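(* Let $\mathcal{H}$ be a Hopf algebra with bijective antipode, and $\mathcal{P}$ a right $\mathcal{H}$-comodule algebra with coaction-invariant subalgebra $\mathcal{B}=\mathcal{P}^{\mathrm{co}\mathcal{H}}$. Then $\mathcal{P}$ is principal if and only if $\mathcal{P}$ is right $\mathcal{H}$-coflat and for all left $\mathcal{H}$-comodules $V$ and $W$ the map $$\beta\colon(\mathcal{P}\Box_{\mathcal{H}}V)\otimes_{\mathcal{B}}(\mathcal{P}\Box_{\mathcal{H}}W)\longrightarrow\mathcal{P}\Box_{\mathcal{H}}(V\otimes W),\qquad \Big(\sum_ia_i\otimes v_i\Big)\otimes\Big(\sum_jb_j\otimes w_j\Big)\longmapsto\sum_{i,j}a_ib_j\otimes(v_i\otimes w_j)$$ is bijective. In other words, $\mathcal{P}$ is principal if and only if the cotensor product functor $\mathcal{P}\Box_{\mathcal{H}}(-)$ is exact and strongly monoidal with respect to the map $\beta$.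
   Context: All algebras and tensor products $\otimes$ are over $\mathbb{C}$; tensor products over algebras are purely algebraic. A right $\mathcal{H}$-comodule algebra is a unital algebra $\mathcal{P}$ with a right coaction $\Delta_{\mathcal{P}}\colon\mathcal{P}\to\mathcal{P}\otimes\mathcal{H}$ that is a unital algebra homomorphism. Put $\mathcal{B}=\mathcal{P}^{\mathrm{co}\mathcal{H}}:=\{p\in\mathcal{P}\mid\Delta_{\mathcal{P}}(p)=p\otimes 1\}$. $\mathcal{P}$ is called principal if (1) the canonical map $\mathcal{P}\otimes_{\mathcal{B}}\mathcal{P}\to\mathcal{P}\otimes\mathcal{H}$, $p\otimes q\mapsto(p\otimes 1)\Delta_{\mathcal{P}}(q)$, is bijective; and (2) there exists a left $\mathcal{B}$-linear right $\mathcal{H}$-colinear splitting of the multiplication map $\mathcal{B}\otimes\mathcal{P}\to\mathcal{P}$. For a right comodule $M$ over a coalgebra $C$ with coaction $\Delta_M\colon M\to M\otimes C$ and a left $C$-comodule $N$ with coaction ${}_N\Delta\colon N\to C\otimes N$, the cotensor product is $M\Box_C N:=\{t\in M\otimes N\mid(\Delta_M\otimes\mathrm{id})(t)=(\mathrm{id}\otimes{}_N\Delta)(t)\}$. A right comodule is coflat if cotensoring it with left comodules preserves exact sequences. $V\otimes W$ carries the diagonal left $\mathcal{H}$-coaction. *)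

theory Defs
  imports "HOL-Algebra.Free_Abelian_Groups" "HOL-Algebra.Module"
    "HOL-Algebra.Generated_Groups" "HOL-Algebra.Algebraic_Closure_Type"
begin

section \<open>Tensor products over a ring\<close>

text \<open>
  The tensor product of a right \<open>R\<close>-module \<open>M\<close> and a left \<open>R\<close>-module \<open>N\<close> is the quotient of the free
  abelian group on \<open>M \<times> N\<close> by the biadditivity and balancing relations; \<open>R\<close> may be noncommutative.
  Both modules are given by \<^type>\<open>module\<close> records. In the right module \<open>M\<close> the term
  \<open>r \<odot>\<^bsub>M\<^esub> m\<close> denotes the right action \<open>m r\<close>. Only the carrier of \<open>R\<close> enters the construction.
\<close>

type_synonym ('a, 'b) tens = "(('a \<times> 'b) \<Rightarrow>\<^sub>0 int) set"

definition tensor_rels ::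
    "'r set \<Rightarrow> ('r, 'a, 'm) module_scheme \<Rightarrow> ('r, 'b, 'n) module_scheme \<Rightarrow> (('a \<times> 'b) \<Rightarrow>\<^sub>0 int) set"
  where "tensor_rels R M N =
    {frag_of (m \<oplus>\<^bsub>M\<^esub> m', n) - frag_of (m, n) - frag_of (m', n) | m m' n.
        m \<in> carrier M \<and> m' \<in> carrier M \<and> n \<in> carrier N} \<union>
    {frag_of (m, n \<oplus>\<^bsub>N\<^esub> n') - frag_of (m, n) - frag_of (m, n') | m n n'.
        m \<in> carrier M \<and> n \<in> carrier N \<and> n' \<in> carrier N} \<union>
    {frag_of (r \<odot>\<^bsub>M\<^esub> m, n) - frag_of (m, r \<odot>\<^bsub>N\<^esub> n) | r m n.
        r \<in> R \<and> m \<in> carrier M \<and> n \<in> carrier N}"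

definition tensor_kernel ::
    "'r set \<Rightarrow> ('r, 'a, 'm) module_scheme \<Rightarrow> ('r, 'b, 'n) module_scheme \<Rightarrow> (('a \<times> 'b) \<Rightarrow>\<^sub>0 int) set"
  where "tensor_kernel R M N =
    generate (free_Abelian_group (carrier M \<times> carrier N)) (tensor_rels R M N)"

definition tensor_group ::
    "'r set \<Rightarrow> ('r, 'a, 'm) module_scheme \<Rightarrow> ('r, 'b, 'n) module_scheme \<Rightarrow> ('a, 'b) tens monoid"
  where "tensor_group R M N =
    free_Abelian_group (carrier M \<times> carrier N) Mod tensor_kernel R M N"

definition tensor_elem ::
    "'r set \<Rightarrow> ('r, 'a, 'm) module_scheme \<Rightarrow> ('r, 'b, 'n) module_scheme \<Rightarrow> 'a \<Rightarrow> 'b \<Rightarrow> ('a, 'b) tens"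
  where "tensor_elem R M N m n =
    tensor_kernel R M N #>\<^bsub>free_Abelian_group (carrier M \<times> carrier N)\<^esub> frag_of (m, n)"

text \<open>
  The additive map on the tensor product that sends \<open>m \<otimes> n\<close> to \<open>h m n\<close>, for a balanced biadditive
  map \<open>h\<close>; see \<open>tensor_lift_unique\<close> below. Abelian groups are written multiplicatively here.
\<close>

definition tensor_lift ::
    "'r set \<Rightarrow> ('r, 'a, 'm) module_scheme \<Rightarrow> ('r, 'b, 'n) module_scheme \<Rightarrow> ('c, 'k) monoid_scheme
      \<Rightarrow> ('a \<Rightarrow> 'b \<Rightarrow> 'c) \<Rightarrow> ('a, 'b) tens \<Rightarrow> 'c"
  where "tensor_lift R M N G h =
    (THE \<phi>. \<phi> \<in> extensional (carrier (tensor_group R M N)) \<and> \<phi> \<in> hom (tensor_group R M N) G \<and>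
      (\<forall>m\<in>carrier M. \<forall>n\<in>carrier N. \<phi> (tensor_elem R M N m n) = h m n))"

lemma tensor_lift_unique:
  fixes M :: "('r, 'a, 'm) module_scheme" and N :: "('r, 'b, 'n) module_scheme"
  assumes M: "abelian_group M" and N: "abelian_group N" and G: "comm_group G"
    and actM: "\<And>r m. r \<in> R \<Longrightarrow> m \<in> carrier M \<Longrightarrow> r \<odot>\<^bsub>M\<^esub> m \<in> carrier M"
    and actN: "\<And>r n. r \<in> R \<Longrightarrow> n \<in> carrier N \<Longrightarrow> r \<odot>\<^bsub>N\<^esub> n \<in> carrier N"
    and closed: "\<And>m n. m \<in> carrier M \<Longrightarrow> n \<in> carrier N \<Longrightarrow> h m n \<in> carrier G"
    and addM: "\<And>m m' n. m \<in> carrier M \<Longrightarrow> m' \<in> carrier M \<Longrightarrow> n \<in> carrier N \<Longrightarrow>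
                 h (m \<oplus>\<^bsub>M\<^esub> m') n = h m n \<otimes>\<^bsub>G\<^esub> h m' n"
    and addN: "\<And>m n n'. m \<in> carrier M \<Longrightarrow> n \<in> carrier N \<Longrightarrow> n' \<in> carrier N \<Longrightarrow>
                 h m (n \<oplus>\<^bsub>N\<^esub> n') = h m n \<otimes>\<^bsub>G\<^esub> h m n'"
    and bal: "\<And>r m n. r \<in> R \<Longrightarrow> m \<in> carrier M \<Longrightarrow> n \<in> carrier N \<Longrightarrow>
                 h (r \<odot>\<^bsub>M\<^esub> m) n = h m (r \<odot>\<^bsub>N\<^esub> n)"
  shows "\<exists>!\<phi>. \<phi> \<in> extensional (carrier (tensor_group R M N)) \<and> \<phi> \<in> hom (tensor_group R M N) G \<and>
      (\<forall>m\<in>carrier M. \<forall>n\<in>carrier N. \<phi> (tensor_elem R M N m n) = h m n)"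
proof -
  let ?S = "carrier M \<times> carrier N"
  let ?F = "free_Abelian_group ?S"
  let ?K = "tensor_kernel R M N"
  interpret M: abelian_group M by (fact M)
  interpret N: abelian_group N by (fact N)
  interpret G: comm_group G by (fact G)
  interpret F: comm_group ?F by (fact abelian_free_Abelian_group)
  have rels: "tensor_rels R M N \<subseteq> carrier ?F"
  proof
    fix t assume t: "t \<in> tensor_rels R M N"
    have two: "frag_of p - frag_of q \<in> carrier ?F" if "p \<in> ?S" "q \<in> ?S" for p q
      using that keys_diff[of "frag_of p" "frag_of q"] by auto
    have three: "frag_of p - frag_of q - frag_of r \<in> carrier ?F"
      if "p \<in> ?S" "q \<in> ?S" "r \<in> ?S" for p q r
      using that keys_diff[of "frag_of p - frag_of q" "frag_of r"] keys_diff[of "frag_of p" "frag_of q"]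
      by auto
    show "t \<in> carrier ?F"
      using t unfolding tensor_rels_def
      by (auto simp del: carrier_free_Abelian_group_iff intro!: two three simp: actM actN)
  qed
  then have sub: "subgroup ?K ?F"
    unfolding tensor_kernel_def by (rule F.generate_is_subgroup)
  then have nrm: "?K \<lhd> ?F"
    by (rule F.subgroup_imp_normal)
  have "(\<lambda>(m, n). h m n) ` ?S \<subseteq> carrier G"
    using closed by auto
  from G.free_Abelian_group_universal[OF this] obtain k
    where k: "k \<in> hom ?F G" and kof: "\<And>p. p \<in> ?S \<Longrightarrow> k (frag_of p) = (\<lambda>(m, n). h m n) p"
    by blast
  interpret k: group_hom ?F G k
    using k by unfold_locales
  have kdiff: "k (a - b) = k a \<otimes>\<^bsub>G\<^esub> inv\<^bsub>G\<^esub> k b" if "a \<in> carrier ?F" "b \<in> carrier ?F" for a b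
    using that k.hom_mult[of a "-b"] k.hom_inv[of b] by (simp add: keys_minus)
  have "tensor_rels R M N \<subseteq> kernel ?F G k"
  proof
    fix t assume t: "t \<in> tensor_rels R M N"
    with rels have tF: "t \<in> carrier ?F" by blast
    have two: "k (frag_of p - frag_of q) = \<one>\<^bsub>G\<^esub>"
      if "p \<in> ?S" "q \<in> ?S" "k (frag_of p) = k (frag_of q)" for p q
      using that by (subst kdiff) (auto simp: kof closed)
    have three: "k (frag_of p - frag_of q - frag_of r) = \<one>\<^bsub>G\<^esub>"
      if "p \<in> ?S" "q \<in> ?S" "r \<in> ?S" "k (frag_of p) = k (frag_of q) \<otimes>\<^bsub>G\<^esub> k (frag_of r)" for p q r
    proof -
      have c: "frag_of p \<in> carrier ?F" "frag_of q \<in> carrier ?F" "frag_of r \<in> carrier ?F"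
        using that by auto
      have d: "frag_of p - frag_of q \<in> carrier ?F"
        using that keys_diff[of "frag_of p" "frag_of q"] by auto
      have e: "k (frag_of q) \<in> carrier G" "k (frag_of r) \<in> carrier G"
        using c k.hom_closed by blast+
      have "k (frag_of p - frag_of q - frag_of r) =
          (k (frag_of q) \<otimes>\<^bsub>G\<^esub> inv\<^bsub>G\<^esub> k (frag_of q)) \<otimes>\<^bsub>G\<^esub> (k (frag_of r) \<otimes>\<^bsub>G\<^esub> inv\<^bsub>G\<^esub> k (frag_of r))"
        using e by (simp only: kdiff[OF d c(3)] kdiff[OF c(1,2)] that(4))
          (simp only: G.m_ac G.m_closed G.inv_closed)
      then show ?thesis
        using e by (simp only: G.r_inv G.r_one G.one_closed)
    qed
    have "k t = \<one>\<^bsub>G\<^esub>"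
      using t unfolding tensor_rels_def
      by (auto intro!: two three simp: kof actM actN addM addN bal)
    with tF show "t \<in> kernel ?F G k"
      by (simp add: kernel_def)
  qed
  then have "?K \<subseteq> kernel ?F G k"
    unfolding tensor_kernel_def by (rule F.generate_subgroup_incl[OF _ k.subgroup_kernel])
  from k.FactGroup_universal_kernel[OF nrm this] obtain g
    where g: "g \<in> hom (?F Mod ?K) G" and gk: "\<And>x. x \<in> carrier ?F \<Longrightarrow> g (?K #>\<^bsub>?F\<^esub> x) = k x"
    by blast
  show ?thesis
  proof (rule ex1I)
    let ?\<phi> = "restrict g (carrier (tensor_group R M N))"
    interpret Q: group "tensor_group R M N"
      unfolding tensor_group_def using nrm by (rule normal.factorgroup_is_group)
    have "tensor_elem R M N m n \<in> carrier (tensor_group R M N)"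
      if "m \<in> carrier M" "n \<in> carrier N" for m n
      using that by (auto simp: tensor_elem_def tensor_group_def carrier_FactGroup)
    moreover have "?\<phi> \<in> hom (tensor_group R M N) G"
      using g by (auto simp: hom_def tensor_group_def[symmetric])
    ultimately show "?\<phi> \<in> extensional (carrier (tensor_group R M N)) \<and> ?\<phi> \<in> hom (tensor_group R M N) G \<and>
        (\<forall>m\<in>carrier M. \<forall>n\<in>carrier N. ?\<phi> (tensor_elem R M N m n) = h m n)"
      by (auto simp: tensor_elem_def gk kof)
  next
    fix \<psi>
    assume \<psi>: "\<psi> \<in> extensional (carrier (tensor_group R M N)) \<and> \<psi> \<in> hom (tensor_group R M N) G \<and>
        (\<forall>m\<in>carrier M. \<forall>n\<in>carrier N. \<psi> (tensor_elem R M N m n) = h m n)"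
    have comp: "(\<lambda>x. \<psi> (?K #>\<^bsub>?F\<^esub> x)) \<in> hom ?F G"
      using hom_compose[OF normal.r_coset_hom_Mod[OF nrm], of \<psi> G] \<psi>
      by (simp add: tensor_group_def comp_def)
    interpret c: group_hom ?F G "\<lambda>x. \<psi> (?K #>\<^bsub>?F\<^esub> x)"
      using comp by unfold_locales
    have cdiff: "\<psi> (?K #>\<^bsub>?F\<^esub> (a - b)) = \<psi> (?K #>\<^bsub>?F\<^esub> a) \<otimes>\<^bsub>G\<^esub> inv\<^bsub>G\<^esub> \<psi> (?K #>\<^bsub>?F\<^esub> b)"
      if "a \<in> carrier ?F" "b \<in> carrier ?F" for a b
      using that c.hom_mult[of a "-b"] c.hom_inv[of b] by (simp add: keys_minus)
    have ext: "\<psi> (?K #>\<^bsub>?F\<^esub> x) = k x" if "Poly_Mapping.keys x \<subseteq> ?S" for x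
      using that
    proof (rule free_Abelian_group_induct)
      show "\<psi> (?K #>\<^bsub>?F\<^esub> 0) = k 0"
        using c.hom_one k.hom_one by simp
    next
      fix x y :: "('a \<times> 'b) \<Rightarrow>\<^sub>0 int"
      assume "Poly_Mapping.keys x \<subseteq> ?S" "Poly_Mapping.keys y \<subseteq> ?S"
        and "\<psi> (?K #>\<^bsub>?F\<^esub> x) = k x" "\<psi> (?K #>\<^bsub>?F\<^esub> y) = k y"
      then show "\<psi> (?K #>\<^bsub>?F\<^esub> (x - y)) = k (x - y)"
        by (simp add: cdiff kdiff)
    next
      fix p assume "p \<in> ?S"
      then show "\<psi> (?K #>\<^bsub>?F\<^esub> frag_of p) = k (frag_of p)"
        using \<psi> by (auto simp: kof tensor_elem_def)
    qed
    show "\<psi> = restrict g (carrier (tensor_group R M N))"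
      using \<psi> gk ext by (intro extensionalityI[of _ "carrier (tensor_group R M N)"])
        (auto simp: tensor_group_def carrier_FactGroup)
  qed
qed

section \<open>Complex vector spaces and algebras\<close>

abbreviation complex_ring :: "complex ring"
  where "complex_ring \<equiv> ring_of_type_algebra"

definition complex_space :: "(complex, complex) module"
  where "complex_space =
    \<lparr>carrier = UNIV, monoid.mult = (*), one = 1, ring.zero = 0, add = (+), module.smult = (*)\<rparr>"

definition linear_maps ::
    "(complex, 'a, 'm) module_scheme \<Rightarrow> (complex, 'b, 'n) module_scheme \<Rightarrow> ('a \<Rightarrow> 'b) set"
  where "linear_maps V W =
    {f \<in> hom (add_monoid V) (add_monoid W).
       \<forall>c. \<forall>v\<in>carrier V. f (c \<odot>\<^bsub>V\<^esub> v) = c \<odot>\<^bsub>W\<^esub> f v}"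

locale complex_algebra = module complex_ring A + ring A for A (structure) +
  assumes smult_mult_left:
      "\<lbrakk>x \<in> carrier A; y \<in> carrier A\<rbrakk> \<Longrightarrow> (c \<odot> x) \<otimes> y = c \<odot> (x \<otimes> y)"
    and smult_mult_right:
      "\<lbrakk>x \<in> carrier A; y \<in> carrier A\<rbrakk> \<Longrightarrow> x \<otimes> (c \<odot> y) = c \<odot> (x \<otimes> y)"

abbreviation pure_tensor ::
    "(complex, 'a, 'm) module_scheme \<Rightarrow> (complex, 'b, 'n) module_scheme \<Rightarrow> 'a \<Rightarrow> 'b \<Rightarrow> ('a, 'b) tens"
  where "pure_tensor \<equiv> tensor_elem UNIV"

text \<open>
  The fields \<^const>\<open>monoid.mult\<close> and \<^const>\<open>monoid.one\<close> are those of the tensor product of algebras. They are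
  meaningless, and not used, if the factors are merely vector spaces.
\<close>

definition tensor ::
    "(complex, 'a, 'm) module_scheme \<Rightarrow> (complex, 'b, 'n) module_scheme \<Rightarrow> (complex, ('a, 'b) tens) module"
    (infixr \<open>\<otimes>\<^sub>\<complex>\<close> 70)
  where "V \<otimes>\<^sub>\<complex> W =
    (let T = tensor_group UNIV V W in
      \<lparr>carrier = carrier T,
       monoid.mult = (\<lambda>s t.
         tensor_lift UNIV V W T (\<lambda>v w.
           tensor_lift UNIV V W T (\<lambda>v' w'. pure_tensor V W (v \<otimes>\<^bsub>V\<^esub> v') (w \<otimes>\<^bsub>W\<^esub> w')) t) s),
       one = pure_tensor V W \<one>\<^bsub>V\<^esub> \<one>\<^bsub>W\<^esub>,
       ring.zero = \<one>\<^bsub>T\<^esub>,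
       add = (\<lambda>s t. s \<otimes>\<^bsub>T\<^esub> t),
       module.smult = (\<lambda>c. tensor_lift UNIV V W T (\<lambda>v w. pure_tensor V W (c \<odot>\<^bsub>V\<^esub> v) w))\<rparr>)"

text \<open>The linear map \<open>V \<otimes> W \<rightarrow> U\<close> induced by a bilinear map \<open>h\<close>.\<close>

definition bilinear_lift ::
    "(complex, 'a, 'm) module_scheme \<Rightarrow> (complex, 'b, 'n) module_scheme \<Rightarrow> (complex, 'c, 'k) module_scheme
      \<Rightarrow> ('a \<Rightarrow> 'b \<Rightarrow> 'c) \<Rightarrow> ('a, 'b) tens \<Rightarrow> 'c"
  where "bilinear_lift V W U h = tensor_lift UNIV V W (add_monoid U) h"

text \<open>The map \<open>f \<otimes> g : V \<otimes> W \<rightarrow> V' \<otimes> W'\<close>.\<close>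

definition tensor_map ::
    "(complex, 'a, 'm) module_scheme \<Rightarrow> (complex, 'b, 'n) module_scheme
      \<Rightarrow> (complex, 'c, 'k) module_scheme \<Rightarrow> (complex, 'd, 'l) module_scheme
      \<Rightarrow> ('a \<Rightarrow> 'c) \<Rightarrow> ('b \<Rightarrow> 'd) \<Rightarrow> ('a, 'b) tens \<Rightarrow> ('c, 'd) tens"
  where "tensor_map V W V' W' f g =
    bilinear_lift V W (V' \<otimes>\<^sub>\<complex> W') (\<lambda>v w. pure_tensor V' W' (f v) (g w))"

text \<open>The associativity isomorphism \<open>(U \<otimes> V) \<otimes> W \<rightarrow> U \<otimes> (V \<otimes> W)\<close>.\<close>

definition tensor_assoc ::
    "(complex, 'a, 'm) module_scheme \<Rightarrow> (complex, 'b, 'n) module_scheme \<Rightarrow> (complex, 'c, 'k) module_scheme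
      \<Rightarrow> (('a, 'b) tens, 'c) tens \<Rightarrow> ('a, ('b, 'c) tens) tens"
  where "tensor_assoc U V W =
    bilinear_lift (U \<otimes>\<^sub>\<complex> V) W (U \<otimes>\<^sub>\<complex> (V \<otimes>\<^sub>\<complex> W)) (\<lambda>t w.
      bilinear_lift U V (U \<otimes>\<^sub>\<complex> (V \<otimes>\<^sub>\<complex> W)) (\<lambda>u v.
        pure_tensor U (V \<otimes>\<^sub>\<complex> W) u (pure_tensor V W v w)) t)"


section \<open>Hopf algebras, comodules and comodule algebras\<close>

record 'h hopf = "(complex, 'h) module" +
  comult :: "'h \<Rightarrow> ('h, 'h) tens"
  counit :: "'h \<Rightarrow> complex"
  antipode :: "'h \<Rightarrow> 'h"

locale hopf_algebra = complex_algebra H for H :: "('h, 'z) hopf_scheme" (structure) +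
  assumes comult_linear: "comult H \<in> linear_maps H (H \<otimes>\<^sub>\<complex> H)"
    and comult_mult: "\<lbrakk>x \<in> carrier H; y \<in> carrier H\<rbrakk> \<Longrightarrow>
      comult H (x \<otimes> y) = comult H x \<otimes>\<^bsub>H \<otimes>\<^sub>\<complex> H\<^esub> comult H y"
    and comult_one: "comult H \<one> = \<one>\<^bsub>H \<otimes>\<^sub>\<complex> H\<^esub>"
    and counit_linear: "counit H \<in> linear_maps H complex_space"
    and counit_mult: "\<lbrakk>x \<in> carrier H; y \<in> carrier H\<rbrakk> \<Longrightarrow>
      counit H (x \<otimes> y) = counit H x * counit H y"
    and counit_one: "counit H \<one> = 1"
    and coassoc: "x \<in> carrier H \<Longrightarrow>
      tensor_assoc H H H (tensor_map H H (H \<otimes>\<^sub>\<complex> H) H (comult H) id (comult H x))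
        = tensor_map H H H (H \<otimes>\<^sub>\<complex> H) id (comult H) (comult H x)"
    and counit_left: "x \<in> carrier H \<Longrightarrow>
      bilinear_lift H H H (\<lambda>y z. counit H y \<odot> z) (comult H x) = x"
    and counit_right: "x \<in> carrier H \<Longrightarrow>
      bilinear_lift H H H (\<lambda>y z. counit H z \<odot> y) (comult H x) = x"
    and antipode_linear: "antipode H \<in> linear_maps H H"
    and antipode_left: "x \<in> carrier H \<Longrightarrow>
      bilinear_lift H H H (\<lambda>y z. antipode H y \<otimes> z) (comult H x) = counit H x \<odot> \<one>"
    and antipode_right: "x \<in> carrier H \<Longrightarrow>
      bilinear_lift H H H (\<lambda>y z. y \<otimes> antipode H z) (comult H x) = counit H x \<odot> \<one>"

record ('h, 'v) lcomod = "(complex, 'v) module" +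
  lcoact :: "'v \<Rightarrow> ('h, 'v) tens"

record ('h, 'p) rcomod = "(complex, 'p) module" +
  rcoact :: "'p \<Rightarrow> ('p, 'h) tens"

locale left_comodule = module complex_ring V
  for H :: "('h, 'z) hopf_scheme" and V :: "('h, 'v, 'y) lcomod_scheme" +
  assumes lcoact_linear: "lcoact V \<in> linear_maps V (H \<otimes>\<^sub>\<complex> V)"
    and lcoact_coassoc: "v \<in> carrier V \<Longrightarrow>
      tensor_assoc H H V (tensor_map H V (H \<otimes>\<^sub>\<complex> H) V (comult H) id (lcoact V v))
        = tensor_map H V H (H \<otimes>\<^sub>\<complex> V) id (lcoact V) (lcoact V v)"
    and lcoact_counit: "v \<in> carrier V \<Longrightarrow>
      bilinear_lift H V V (\<lambda>h w. counit H h \<odot>\<^bsub>V\<^esub> w) (lcoact V v) = v"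

locale right_comodule = module complex_ring M
  for H :: "('h, 'z) hopf_scheme" and M :: "('h, 'p, 'x) rcomod_scheme" +
  assumes rcoact_linear: "rcoact M \<in> linear_maps M (M \<otimes>\<^sub>\<complex> H)"
    and rcoact_coassoc: "m \<in> carrier M \<Longrightarrow>
      tensor_assoc M H H (tensor_map M H (M \<otimes>\<^sub>\<complex> H) H (rcoact M) id (rcoact M m))
        = tensor_map M H M (H \<otimes>\<^sub>\<complex> H) id (comult H) (rcoact M m)"
    and rcoact_counit: "m \<in> carrier M \<Longrightarrow>
      bilinear_lift M H M (\<lambda>n h. counit H h \<odot>\<^bsub>M\<^esub> n) (rcoact M m) = m"

locale comodule_algebra = complex_algebra P + right_comodule H P
  for H :: "('h, 'z) hopf_scheme" and P :: "('h, 'p, 'x) rcomod_scheme" +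
  assumes rcoact_mult: "\<lbrakk>p \<in> carrier P; q \<in> carrier P\<rbrakk> \<Longrightarrow>
      rcoact P (p \<otimes>\<^bsub>P\<^esub> q) = rcoact P p \<otimes>\<^bsub>P \<otimes>\<^sub>\<complex> H\<^esub> rcoact P q"
    and rcoact_one: "rcoact P \<one>\<^bsub>P\<^esub> = \<one>\<^bsub>P \<otimes>\<^sub>\<complex> H\<^esub>"

definition comodule_maps ::
    "('h, 'z) hopf_scheme \<Rightarrow> ('h, 'v, 'y) lcomod_scheme \<Rightarrow> ('h, 'w, 'x) lcomod_scheme \<Rightarrow> ('v \<Rightarrow> 'w) set"
  where "comodule_maps H V W =
    {f \<in> linear_maps V W. \<forall>v\<in>carrier V. lcoact W (f v) = tensor_map H V H W id f (lcoact V v)}"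

text \<open>\<open>V \<otimes> W\<close> with the diagonal coaction \<open>v \<otimes> w \<mapsto> v\<^sub>(\<^sub>-\<^sub>1\<^sub>) w\<^sub>(\<^sub>-\<^sub>1\<^sub>) \<otimes> (v\<^sub>(\<^sub>0\<^sub>) \<otimes> w\<^sub>(\<^sub>0\<^sub>))\<close>.\<close>

definition tensor_comodule ::
    "('h, 'z) hopf_scheme \<Rightarrow> ('h, 'v, 'y) lcomod_scheme \<Rightarrow> ('h, 'w, 'x) lcomod_scheme
      \<Rightarrow> ('h, ('v, 'w) tens) lcomod"
  where "tensor_comodule H V W =
    module.extend (V \<otimes>\<^sub>\<complex> W) (lcomod.fields
      (bilinear_lift V W (H \<otimes>\<^sub>\<complex> (V \<otimes>\<^sub>\<complex> W)) (\<lambda>v w.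
        bilinear_lift H V (H \<otimes>\<^sub>\<complex> (V \<otimes>\<^sub>\<complex> W)) (\<lambda>g v0.
          bilinear_lift H W (H \<otimes>\<^sub>\<complex> (V \<otimes>\<^sub>\<complex> W)) (\<lambda>h w0.
            pure_tensor H (V \<otimes>\<^sub>\<complex> W) (g \<otimes>\<^bsub>H\<^esub> h) (pure_tensor V W v0 w0))
          (lcoact W w))
        (lcoact V v))))"

definition trivial_comodule :: "('h, 'z) hopf_scheme \<Rightarrow> ('h, complex) lcomod"
  where "trivial_comodule H =
    module.extend complex_space (lcomod.fields (\<lambda>c. pure_tensor H complex_space \<one>\<^bsub>H\<^esub> c))"


section \<open>Principal comodule algebras\<close>

definition coinvariants ::
    "('h, 'z) hopf_scheme \<Rightarrow> ('h, 'p, 'x) rcomod_scheme \<Rightarrow> 'p set"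
  where "coinvariants H P = {p \<in> carrier P. rcoact P p = pure_tensor P H p \<one>\<^bsub>H\<^esub>}"

text \<open>The additive group of \<open>M\<close> with a new scalar action.\<close>

definition with_action ::
    "('a, 'm) ring_scheme \<Rightarrow> ('r \<Rightarrow> 'a \<Rightarrow> 'a) \<Rightarrow> ('r, 'a) module"
  where "with_action M act =
    \<lparr>carrier = carrier M, monoid.mult = monoid.mult M, one = monoid.one M, ring.zero = ring.zero M, add = ring.add M,
     module.smult = act\<rparr>"

abbreviation right_regular :: "('a, 'm) ring_scheme \<Rightarrow> ('a, 'a) module"
  where "right_regular A \<equiv> with_action A (\<lambda>b a. a \<otimes>\<^bsub>A\<^esub> b)"

abbreviation left_regular :: "('a, 'm) ring_scheme \<Rightarrow> ('a, 'a) module"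
  where "left_regular A \<equiv> with_action A (\<lambda>b a. b \<otimes>\<^bsub>A\<^esub> a)"

definition canonical_map ::
    "('h, 'z) hopf_scheme \<Rightarrow> ('h, 'p, 'x) rcomod_scheme \<Rightarrow> ('p, 'p) tens \<Rightarrow> ('p, 'h) tens"
  where "canonical_map H P =
    tensor_lift (coinvariants H P) (right_regular P) (left_regular P) (add_monoid (P \<otimes>\<^sub>\<complex> H))
      (\<lambda>p q. pure_tensor P H p \<one>\<^bsub>H\<^esub> \<otimes>\<^bsub>P \<otimes>\<^sub>\<complex> H\<^esub> rcoact P q)"

definition principal_comodule_algebra ::
    "('h, 'z) hopf_scheme \<Rightarrow> ('h, 'p, 'x) rcomod_scheme \<Rightarrow> bool"
  where "principal_comodule_algebra H P \<longleftrightarrow>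
    bij_betw (canonical_map H P)
      (carrier (tensor_group (coinvariants H P) (right_regular P) (left_regular P)))
      (carrier (P \<otimes>\<^sub>\<complex> H)) \<and>
    (let B = P\<lparr>carrier := coinvariants H P\<rparr> in
      \<exists>s \<in> linear_maps P (B \<otimes>\<^sub>\<complex> P).
        (\<forall>b\<in>carrier B. \<forall>p\<in>carrier P.
          s (b \<otimes>\<^bsub>P\<^esub> p) = tensor_map B P B P (\<lambda>a. b \<otimes>\<^bsub>P\<^esub> a) id (s p)) \<and>
        (\<forall>p\<in>carrier P.
          tensor_assoc B P H (tensor_map P H (B \<otimes>\<^sub>\<complex> P) H s id (rcoact P p))
            = tensor_map B P B (P \<otimes>\<^sub>\<complex> H) id (rcoact P) (s p)) \<and>
        (\<forall>p\<in>carrier P. bilinear_lift B P P (\<lambda>b q. b \<otimes>\<^bsub>P\<^esub> q) (s p) = p))"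


section \<open>The cotensor product functor\<close>

definition cotensor ::
    "('h, 'z) hopf_scheme \<Rightarrow> ('h, 'p, 'x) rcomod_scheme \<Rightarrow> ('h, 'v, 'y) lcomod_scheme
      \<Rightarrow> (complex, ('p, 'v) tens) module"
  where "cotensor H P V = (P \<otimes>\<^sub>\<complex> V)\<lparr>carrier :=
    {t \<in> carrier (P \<otimes>\<^sub>\<complex> V).
      tensor_assoc P H V (tensor_map P V (P \<otimes>\<^sub>\<complex> H) V (rcoact P) id t)
        = tensor_map P V P (H \<otimes>\<^sub>\<complex> V) id (lcoact V) t}\<rparr>"

text \<open>
  HOL cannot quantify over types inside a formula, so the left comodules that occur in the
  following properties have carriers that are subsets of one type \<open>'u\<close>, passed as an
  \<^type>\<open>itself\<close> argument. Comodules of all cardinalities are covered since \<open>'u\<close> is arbitrary.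
\<close>

definition coflat ::
    "'u itself \<Rightarrow> ('h, 'z) hopf_scheme \<Rightarrow> ('h, 'p, 'x) rcomod_scheme \<Rightarrow> bool"
  where "coflat (_ :: 'u itself) H P \<longleftrightarrow>
    (\<forall>(U :: ('h, 'u) lcomod) (V :: ('h, 'u) lcomod) (W :: ('h, 'u) lcomod).
      left_comodule H U \<longrightarrow> left_comodule H V \<longrightarrow> left_comodule H W \<longrightarrow>
      (\<forall>f\<in>comodule_maps H U V. \<forall>g\<in>comodule_maps H V W.
        f ` carrier U = {v \<in> carrier V. g v = \<zero>\<^bsub>W\<^esub>} \<longrightarrow>
        tensor_map P U P V id f ` carrier (cotensor H P U)
          = {t \<in> carrier (cotensor H P V). tensor_map P V P W id g t = \<zero>\<^bsub>P \<otimes>\<^sub>\<complex> W\<^esub>}))"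

text \<open>The left and right actions of the coinvariants on \<open>P \<box>\<^sub>H V\<close> by multiplication in \<open>P\<close>.\<close>

definition cotensor_lact ::
    "('h, 'p, 'x) rcomod_scheme \<Rightarrow> ('h, 'v, 'y) lcomod_scheme
      \<Rightarrow> 'p \<Rightarrow> ('p, 'v) tens \<Rightarrow> ('p, 'v) tens"
  where "cotensor_lact P V b = tensor_map P V P V (\<lambda>a. b \<otimes>\<^bsub>P\<^esub> a) id"

definition cotensor_ract ::
    "('h, 'p, 'x) rcomod_scheme \<Rightarrow> ('h, 'v, 'y) lcomod_scheme
      \<Rightarrow> 'p \<Rightarrow> ('p, 'v) tens \<Rightarrow> ('p, 'v) tens"
  where "cotensor_ract P V b = tensor_map P V P V (\<lambda>a. a \<otimes>\<^bsub>P\<^esub> b) id"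

abbreviation cotensor_left ::
    "('h, 'z) hopf_scheme \<Rightarrow> ('h, 'p, 'x) rcomod_scheme \<Rightarrow> ('h, 'v, 'y) lcomod_scheme
      \<Rightarrow> ('p, ('p, 'v) tens) module"
  where "cotensor_left H P V \<equiv> with_action (cotensor H P V) (cotensor_lact P V)"

abbreviation cotensor_right ::
    "('h, 'z) hopf_scheme \<Rightarrow> ('h, 'p, 'x) rcomod_scheme \<Rightarrow> ('h, 'v, 'y) lcomod_scheme
      \<Rightarrow> ('p, ('p, 'v) tens) module"
  where "cotensor_right H P V \<equiv> with_action (cotensor H P V) (cotensor_ract P V)"

definition beta_dom ::
    "('h, 'z) hopf_scheme \<Rightarrow> ('h, 'p, 'x) rcomod_scheme
      \<Rightarrow> ('h, 'v, 'y) lcomod_scheme \<Rightarrow> ('h, 'w, 'k) lcomod_scheme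
      \<Rightarrow> (('p, 'v) tens, ('p, 'w) tens) tens monoid"
  where "beta_dom H P V W =
    tensor_group (coinvariants H P) (cotensor_right H P V) (cotensor_left H P W)"

definition beta_tensor ::
    "('h, 'z) hopf_scheme \<Rightarrow> ('h, 'p, 'x) rcomod_scheme
      \<Rightarrow> ('h, 'v, 'y) lcomod_scheme \<Rightarrow> ('h, 'w, 'k) lcomod_scheme
      \<Rightarrow> ('p, 'v) tens \<Rightarrow> ('p, 'w) tens \<Rightarrow> (('p, 'v) tens, ('p, 'w) tens) tens"
  where "beta_tensor H P V W =
    tensor_elem (coinvariants H P) (cotensor_right H P V) (cotensor_left H P W)"

definition beta ::
    "('h, 'z) hopf_scheme \<Rightarrow> ('h, 'p, 'x) rcomod_scheme
      \<Rightarrow> ('h, 'v, 'y) lcomod_scheme \<Rightarrow> ('h, 'w, 'k) lcomod_scheme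
      \<Rightarrow> (('p, 'v) tens, ('p, 'w) tens) tens \<Rightarrow> ('p, ('v, 'w) tens) tens"
  where "beta H P V W =
    (let VW = tensor_comodule H V W; T = P \<otimes>\<^sub>\<complex> VW in
      tensor_lift (coinvariants H P) (cotensor_right H P V) (cotensor_left H P W) (add_monoid T)
        (\<lambda>x y.
          bilinear_lift P V T (\<lambda>a v.
            bilinear_lift P W T (\<lambda>b w.
              pure_tensor P VW (a \<otimes>\<^bsub>P\<^esub> b) (pure_tensor V W v w)) y) x))"

definition beta_bijective ::
    "('h, 'z) hopf_scheme \<Rightarrow> ('h, 'p, 'x) rcomod_scheme
      \<Rightarrow> ('h, 'v, 'y) lcomod_scheme \<Rightarrow> ('h, 'w, 'k) lcomod_scheme \<Rightarrow> bool"
  where "beta_bijective H P V W \<longleftrightarrow>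
    bij_betw (beta H P V W) (carrier (beta_dom H P V W))
      (carrier (cotensor H P (tensor_comodule H V W)))"

text \<open>
  The functor \<open>P \<box>\<^sub>H (-)\<close> from left \<open>H\<close>-comodules to bimodules over \<open>B = P\<^sup>c\<^sup>o\<^sup>H\<close> is strongly monoidal
  with structure maps \<open>\<beta>\<close> and \<open>B \<rightarrow> P \<box>\<^sub>H \<complex>\<close>, \<open>b \<mapsto> b \<otimes> 1\<close>: in this order, \<open>\<beta>\<close> is bijective and
  \<open>B\<close>-bilinear, \<open>\<beta>\<close> is natural, the associativity square and the two unit triangles commute, and the
  unit map is bijective. The diagrams are stated on the elements \<open>x \<otimes> y\<close> and \<open>(x \<otimes> y) \<otimes> z\<close>, which
  generate the respective sources.
\<close>

definition strongly_monoidal ::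
    "'u itself \<Rightarrow> ('h, 'z) hopf_scheme \<Rightarrow> ('h, 'p, 'x) rcomod_scheme \<Rightarrow> bool"
  where "strongly_monoidal (_ :: 'u itself) H P \<longleftrightarrow>
    (\<forall>(V :: ('h, 'u) lcomod) (W :: ('h, 'u) lcomod).
      left_comodule H V \<longrightarrow> left_comodule H W \<longrightarrow>
      beta_bijective H P V W \<and>
      (\<forall>b\<in>coinvariants H P. \<forall>x\<in>carrier (cotensor H P V). \<forall>y\<in>carrier (cotensor H P W).
        beta H P V W (beta_tensor H P V W (cotensor_lact P V b x) y)
          = cotensor_lact P (tensor_comodule H V W) b (beta H P V W (beta_tensor H P V W x y)) \<and>
        beta H P V W (beta_tensor H P V W x (cotensor_ract P W b y))
          = cotensor_ract P (tensor_comodule H V W) b (beta H P V W (beta_tensor H P V W x y)))) \<and>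
    (\<forall>(V :: ('h, 'u) lcomod) (V' :: ('h, 'u) lcomod) (W :: ('h, 'u) lcomod) (W' :: ('h, 'u) lcomod).
      left_comodule H V \<longrightarrow> left_comodule H V' \<longrightarrow> left_comodule H W \<longrightarrow> left_comodule H W' \<longrightarrow>
      (\<forall>f\<in>comodule_maps H V V'. \<forall>g\<in>comodule_maps H W W'.
       \<forall>x\<in>carrier (cotensor H P V). \<forall>y\<in>carrier (cotensor H P W).
        tensor_map P (tensor_comodule H V W) P (tensor_comodule H V' W') id (tensor_map V W V' W' f g)
            (beta H P V W (beta_tensor H P V W x y))
          = beta H P V' W' (beta_tensor H P V' W'
              (tensor_map P V P V' id f x) (tensor_map P W P W' id g y)))) \<and>
    (\<forall>(U :: ('h, 'u) lcomod) (V :: ('h, 'u) lcomod) (W :: ('h, 'u) lcomod).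
      left_comodule H U \<longrightarrow> left_comodule H V \<longrightarrow> left_comodule H W \<longrightarrow>
      (let UV = tensor_comodule H U V; VW = tensor_comodule H V W in
        \<forall>x\<in>carrier (cotensor H P U). \<forall>y\<in>carrier (cotensor H P V). \<forall>z\<in>carrier (cotensor H P W).
          tensor_map P (tensor_comodule H UV W) P (tensor_comodule H U VW) id (tensor_assoc U V W)
              (beta H P UV W (beta_tensor H P UV W (beta H P U V (beta_tensor H P U V x y)) z))
            = beta H P U VW (beta_tensor H P U VW x (beta H P V W (beta_tensor H P V W y z))))) \<and>
    (let I = trivial_comodule H; \<eta> = (\<lambda>b. pure_tensor P I b 1) in
      (\<forall>V :: ('h, 'u) lcomod. left_comodule H V \<longrightarrow>
        (\<forall>b\<in>coinvariants H P. \<forall>x\<in>carrier (cotensor H P V).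
          tensor_map P (tensor_comodule H I V) P V id (bilinear_lift I V V (\<lambda>c v. c \<odot>\<^bsub>V\<^esub> v))
              (beta H P I V (beta_tensor H P I V (\<eta> b) x))
            = cotensor_lact P V b x \<and>
          tensor_map P (tensor_comodule H V I) P V id (bilinear_lift V I V (\<lambda>v c. c \<odot>\<^bsub>V\<^esub> v))
              (beta H P V I (beta_tensor H P V I x (\<eta> b)))
            = cotensor_ract P V b x)) \<and>
      bij_betw \<eta> (coinvariants H P) (carrier (cotensor H P I)))"

end

theory Submission
  imports Defs
begin

text \<open>
  Both sides of the equivalence amount to the existence of a strong connection: a linear map \<open>\<omega>\<close> from \<open>H\<close> to
  \<open>P \<otimes> P\<close>, written \<open>h \<mapsto> h\<^sup>1 \<otimes> h\<^sup>2\<close>, that is colinear in both legs and satisfies \<open>h\<^sup>1 h\<^sup>2 = \<epsilon>(h)\<close>. It lifts the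
  translation map \<open>h \<mapsto> can\<^sup>-\<^sup>1(1 \<otimes> h)\<close> of a principal comodule algebra from \<open>P \<otimes>\<^sub>B P\<close> to \<open>P \<otimes> P\<close>.

  A strong connection makes everything explicit. The map \<open>p \<mapsto> p\<^sub>0 \<omega>(p\<^sub>1)\<close> splits the multiplication
  \<open>B \<otimes> P \<rightarrow> P\<close>, and \<open>p \<otimes> h \<mapsto> p \<omega>(h)\<close> inverts the canonical map (\<open>strong_connection_principal\<close>). The same
  splitting yields a natural retraction of \<open>P \<otimes> V\<close> onto \<open>P \<box> V\<close>; since \<open>P \<otimes> (-)\<close> is exact over a field, \<open>P\<close> is
  coflat (\<open>strong_connection_coflat\<close>). The inverse of \<open>\<beta>\<close> sends \<open>p \<otimes> (v \<otimes> w)\<close> to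
  \<open>(p w\<^sub>1\<^sup>1 \<otimes> v) \<otimes> (w\<^sub>1\<^sup>2 \<otimes> w\<^sub>0)\<close> (\<open>strong_connection_beta_bijective\<close>). The bilinearity, naturality, associativity
  and unit conditions of a monoidal functor hold for every \<open>P\<close> by direct evaluation (\<open>strongly_monoidalI\<close>), so
  strong monoidality is bijectivity of all the maps \<open>\<beta>\<close>.

  If \<open>P\<close> is principal with splitting \<open>s\<close>, then \<open>\<omega>(h) = x s(y)\<close> for \<open>can(x \<otimes> y) = 1 \<otimes> h\<close> is a strong connection
  (\<open>principal_strong_connection\<close>).

  Conversely, let \<open>P\<close> be coflat with bijective \<open>\<beta>\<close>. For \<open>V = W = H\<close>, the identifications \<open>P \<box> H = P\<close> and
  \<open>P \<box> (H \<otimes> H) = P \<otimes> H\<close> turn \<open>\<beta>\<close> into the canonical map, which is therefore onto (\<open>lcan_onto\<close>). So the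
  translation map has a linear lift, and it remains to make a lift colinear on both sides. This is done by averaging
  with a total integral, a unital colinear map \<open>j\<close> from \<open>H\<close> to \<open>P\<close>; the left-hand average involves the inverse of
  the antipode (\<open>strong_connection_exists\<close>). The total integral comes from coflatness: \<open>P\<close> is injective enough for
  the colinear map \<open>1 \<mapsto> 1\<close> to extend from \<open>\<complex> 1\<close> to \<open>H\<close>. By Zorn's lemma it suffices to extend a colinear map from
  a subcomodule of \<open>H\<close> by one element, and this is exactness of \<open>P \<box> (-)\<close> at a quotient comodule of \<open>H\<close>
  (\<open>colinear_extension_step\<close>, \<open>total_integral\<close>). All comodules that occur here are quotients of \<open>H\<close>, so a type that
  contains a copy of \<open>H\<close> is large enough for the test objects.

  Calculations use Sweedler notation in the following form. An element \<open>t = \<Sum> v \<otimes> w\<close> of a tensor product is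
  determined by the numbers \<open>\<Sum> \<alpha>(v) \<beta>(w)\<close> for linear functionals \<open>\<alpha>\<close> and \<open>\<beta>\<close> (\<open>tensor_eqI\<close>), so every identity
  becomes one between nested finite sums of complex numbers, rewritten by the axioms of Hopf algebras and comodules.
\<close>

section \<open>Linear algebra over the complex numbers\<close>

text \<open>Vector spaces are modules over the complex numbers, with an explicit carrier.\<close>

abbreviation vs :: "(complex, 'a, 'm) module_scheme \<Rightarrow> bool"
  where "vs V \<equiv> module complex_ring V"

lemma complex_ring_simps [simp]:
  "carrier complex_ring = UNIV" "\<one>\<^bsub>complex_ring\<^esub> = 1" "\<zero>\<^bsub>complex_ring\<^esub> = 0"
  "a \<otimes>\<^bsub>complex_ring\<^esub> b = a * b" "a \<oplus>\<^bsub>complex_ring\<^esub> b = a + b"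
  by (auto simp: ring_of_type_algebra_def)

lemma cring_complex: "cring complex_ring"
  by (rule cring_from_type_algebra)

lemma vsI:
  assumes "abelian_group V"
    and "\<And>a x. x \<in> carrier V \<Longrightarrow> a \<odot>\<^bsub>V\<^esub> x \<in> carrier V"
    and "\<And>a b x. x \<in> carrier V \<Longrightarrow> (a + b) \<odot>\<^bsub>V\<^esub> x = a \<odot>\<^bsub>V\<^esub> x \<oplus>\<^bsub>V\<^esub> b \<odot>\<^bsub>V\<^esub> x"
    and "\<And>a x y. x \<in> carrier V \<Longrightarrow> y \<in> carrier V \<Longrightarrow> a \<odot>\<^bsub>V\<^esub> (x \<oplus>\<^bsub>V\<^esub> y) = a \<odot>\<^bsub>V\<^esub> x \<oplus>\<^bsub>V\<^esub> a \<odot>\<^bsub>V\<^esub> y"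
    and "\<And>a b x. x \<in> carrier V \<Longrightarrow> (a * b) \<odot>\<^bsub>V\<^esub> x = a \<odot>\<^bsub>V\<^esub> (b \<odot>\<^bsub>V\<^esub> x)"
    and "\<And>x. x \<in> carrier V \<Longrightarrow> 1 \<odot>\<^bsub>V\<^esub> x = x"
  shows "vs V"
  by (rule moduleI) (use assms cring_complex in auto)

context
  fixes V :: "(complex, 'a, 'm) module_scheme"
  assumes V: "vs V"
begin

interpretation V: module complex_ring V by (fact V)

lemma vs_abelian: "abelian_group V" by (rule V.abelian_group_axioms)

lemma vs_closed [simp]:
  "\<zero>\<^bsub>V\<^esub> \<in> carrier V"
  "x \<in> carrier V \<Longrightarrow> y \<in> carrier V \<Longrightarrow> x \<oplus>\<^bsub>V\<^esub> y \<in> carrier V"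
  "x \<in> carrier V \<Longrightarrow> c \<odot>\<^bsub>V\<^esub> x \<in> carrier V"
  by auto

lemma vs_simps:
  "x \<in> carrier V \<Longrightarrow> \<zero>\<^bsub>V\<^esub> \<oplus>\<^bsub>V\<^esub> x = x"
  "x \<in> carrier V \<Longrightarrow> x \<oplus>\<^bsub>V\<^esub> \<zero>\<^bsub>V\<^esub> = x"
  "x \<in> carrier V \<Longrightarrow> 1 \<odot>\<^bsub>V\<^esub> x = x"
  "c \<odot>\<^bsub>V\<^esub> \<zero>\<^bsub>V\<^esub> = \<zero>\<^bsub>V\<^esub>"
  "x \<in> carrier V \<Longrightarrow> c \<odot>\<^bsub>V\<^esub> (d \<odot>\<^bsub>V\<^esub> x) = (c * d) \<odot>\<^bsub>V\<^esub> x"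
  "x \<in> carrier V \<Longrightarrow> 0 \<odot>\<^bsub>V\<^esub> x = \<zero>\<^bsub>V\<^esub>"
  using V.smult_one V.smult_r_null V.smult_l_null V.smult_assoc1 by auto

lemma vs_distrib:
  "x \<in> carrier V \<Longrightarrow> (c + d) \<odot>\<^bsub>V\<^esub> x = c \<odot>\<^bsub>V\<^esub> x \<oplus>\<^bsub>V\<^esub> d \<odot>\<^bsub>V\<^esub> x"
  "x \<in> carrier V \<Longrightarrow> y \<in> carrier V \<Longrightarrow> c \<odot>\<^bsub>V\<^esub> (x \<oplus>\<^bsub>V\<^esub> y) = c \<odot>\<^bsub>V\<^esub> x \<oplus>\<^bsub>V\<^esub> c \<odot>\<^bsub>V\<^esub> y"
  using V.smult_l_distr V.smult_r_distr by auto

lemma vs_ac: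
  "x \<in> carrier V \<Longrightarrow> y \<in> carrier V \<Longrightarrow> x \<oplus>\<^bsub>V\<^esub> y = y \<oplus>\<^bsub>V\<^esub> x"
  "x \<in> carrier V \<Longrightarrow> y \<in> carrier V \<Longrightarrow> z \<in> carrier V \<Longrightarrow> (x \<oplus>\<^bsub>V\<^esub> y) \<oplus>\<^bsub>V\<^esub> z = x \<oplus>\<^bsub>V\<^esub> (y \<oplus>\<^bsub>V\<^esub> z)"
  "x \<in> carrier V \<Longrightarrow> y \<in> carrier V \<Longrightarrow> z \<in> carrier V \<Longrightarrow> x \<oplus>\<^bsub>V\<^esub> (y \<oplus>\<^bsub>V\<^esub> z) = y \<oplus>\<^bsub>V\<^esub> (x \<oplus>\<^bsub>V\<^esub> z)"
  using V.a_ac by auto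

lemma vs_neg: "x \<in> carrier V \<Longrightarrow> x \<oplus>\<^bsub>V\<^esub> (- 1) \<odot>\<^bsub>V\<^esub> x = \<zero>\<^bsub>V\<^esub>"
  using vs_distrib(1)[of x 1 "- 1"] by (simp add: vs_simps)

lemma vs_eq_diff:
  assumes "x \<in> carrier V" "y \<in> carrier V" "x \<oplus>\<^bsub>V\<^esub> (- 1) \<odot>\<^bsub>V\<^esub> y = \<zero>\<^bsub>V\<^esub>"
  shows "x = y"
proof -
  have "x = (x \<oplus>\<^bsub>V\<^esub> (- 1) \<odot>\<^bsub>V\<^esub> y) \<oplus>\<^bsub>V\<^esub> y"
    using assms(1,2) vs_neg[of y] by (simp add: vs_ac vs_simps)
  then show ?thesis using assms by (simp add: vs_simps)
qed

end

definition lin :: "(complex, 'a, 'm) module_scheme \<Rightarrow> ('a \<Rightarrow> complex) \<Rightarrow> bool"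
  where "lin V f \<longleftrightarrow>
    (\<forall>x\<in>carrier V. \<forall>y\<in>carrier V. f (x \<oplus>\<^bsub>V\<^esub> y) = f x + f y) \<and>
    (\<forall>c. \<forall>x\<in>carrier V. f (c \<odot>\<^bsub>V\<^esub> x) = c * f x)"

lemma lin_apply:
  assumes "lin V f"
  shows "x \<in> carrier V \<Longrightarrow> y \<in> carrier V \<Longrightarrow> f (x \<oplus>\<^bsub>V\<^esub> y) = f x + f y"
    and "x \<in> carrier V \<Longrightarrow> f (c \<odot>\<^bsub>V\<^esub> x) = c * f x"
  using assms by (auto simp: lin_def)

lemma lin_zero: "lin V f \<Longrightarrow> vs V \<Longrightarrow> f \<zero>\<^bsub>V\<^esub> = 0"
  using lin_apply(2)[of V f "\<zero>\<^bsub>V\<^esub>" 0] by (simp add: vs_simps)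

lemma linear_maps_iff:
  "f \<in> linear_maps V W \<longleftrightarrow> (\<forall>x\<in>carrier V. f x \<in> carrier W) \<and>
    (\<forall>x\<in>carrier V. \<forall>y\<in>carrier V. f (x \<oplus>\<^bsub>V\<^esub> y) = f x \<oplus>\<^bsub>W\<^esub> f y) \<and>
    (\<forall>c. \<forall>x\<in>carrier V. f (c \<odot>\<^bsub>V\<^esub> x) = c \<odot>\<^bsub>W\<^esub> f x)"
  by (auto simp: linear_maps_def hom_def)

lemma linear_mapsI:
  assumes "\<And>x. x \<in> carrier V \<Longrightarrow> f x \<in> carrier W"
    and "\<And>x y. x \<in> carrier V \<Longrightarrow> y \<in> carrier V \<Longrightarrow> f (x \<oplus>\<^bsub>V\<^esub> y) = f x \<oplus>\<^bsub>W\<^esub> f y"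
    and "\<And>c x. x \<in> carrier V \<Longrightarrow> f (c \<odot>\<^bsub>V\<^esub> x) = c \<odot>\<^bsub>W\<^esub> f x"
  shows "f \<in> linear_maps V W"
  using assms by (auto simp: linear_maps_iff)

lemma linear_maps_apply:
  assumes "f \<in> linear_maps V W"
  shows "x \<in> carrier V \<Longrightarrow> f x \<in> carrier W"
    and "x \<in> carrier V \<Longrightarrow> y \<in> carrier V \<Longrightarrow> f (x \<oplus>\<^bsub>V\<^esub> y) = f x \<oplus>\<^bsub>W\<^esub> f y"
    and "x \<in> carrier V \<Longrightarrow> f (c \<odot>\<^bsub>V\<^esub> x) = c \<odot>\<^bsub>W\<^esub> f x"
  using assms by (auto simp: linear_maps_iff)

lemma linear_maps_zero: "f \<in> linear_maps V W \<Longrightarrow> vs V \<Longrightarrow> vs W \<Longrightarrow> f \<zero>\<^bsub>V\<^esub> = \<zero>\<^bsub>W\<^esub>"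
  using linear_maps_apply(3)[of f V W "\<zero>\<^bsub>V\<^esub>" 0] linear_maps_apply(1)[of f V W "\<zero>\<^bsub>V\<^esub>"]
  by (simp add: vs_simps)

lemma complex_space_simps [simp]:
  "carrier complex_space = UNIV" "\<zero>\<^bsub>complex_space\<^esub> = 0"
  "a \<oplus>\<^bsub>complex_space\<^esub> b = a + b" "a \<odot>\<^bsub>complex_space\<^esub> b = a * b"
  by (auto simp: complex_space_def)

lemma vs_complex_space [simp]: "vs complex_space"
proof (rule vsI)
  show "abelian_group complex_space"
    by (rule abelian_groupI) (auto simp: algebra_simps intro: exI[of _ "- x" for x])
qed (auto simp: algebra_simps)

lemma lin_iff: "lin V f \<longleftrightarrow> f \<in> linear_maps V complex_space"
  by (auto simp: lin_def linear_maps_iff)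

definition linrel ::
    "(complex, 'a, 'm) module_scheme \<Rightarrow> (complex, 'b, 'n) module_scheme \<Rightarrow> ('a \<times> 'b) set \<Rightarrow> bool"
  where "linrel V W G \<longleftrightarrow> G \<subseteq> carrier V \<times> carrier W \<and> (\<zero>\<^bsub>V\<^esub>, \<zero>\<^bsub>W\<^esub>) \<in> G \<and>
    (\<forall>(v, w)\<in>G. \<forall>(v', w')\<in>G. (v \<oplus>\<^bsub>V\<^esub> v', w \<oplus>\<^bsub>W\<^esub> w') \<in> G) \<and>
    (\<forall>c. \<forall>(v, w)\<in>G. (c \<odot>\<^bsub>V\<^esub> v, c \<odot>\<^bsub>W\<^esub> w) \<in> G)"

text \<open>A linear relation is the graph of a partial linear map iff it relates \<open>0\<close> only to \<open>0\<close>.\<close>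

definition linfun ::
    "(complex, 'a, 'm) module_scheme \<Rightarrow> (complex, 'b, 'n) module_scheme \<Rightarrow> ('a \<times> 'b) set \<Rightarrow> bool"
  where "linfun V W G \<longleftrightarrow> linrel V W G \<and> (\<forall>w. (\<zero>\<^bsub>V\<^esub>, w) \<in> G \<longrightarrow> w = \<zero>\<^bsub>W\<^esub>)"

lemma linrelI:
  assumes "\<And>v w. (v, w) \<in> G \<Longrightarrow> v \<in> carrier V \<and> w \<in> carrier W" "(\<zero>\<^bsub>V\<^esub>, \<zero>\<^bsub>W\<^esub>) \<in> G"
    "\<And>v w v' w'. (v, w) \<in> G \<Longrightarrow> (v', w') \<in> G \<Longrightarrow> (v \<oplus>\<^bsub>V\<^esub> v', w \<oplus>\<^bsub>W\<^esub> w') \<in> G"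
    "\<And>c v w. (v, w) \<in> G \<Longrightarrow> (c \<odot>\<^bsub>V\<^esub> v, c \<odot>\<^bsub>W\<^esub> w) \<in> G"
  shows "linrel V W G"
  using assms by (auto simp: linrel_def)

lemma linrelD:
  assumes "linrel V W G"
  shows "(v, w) \<in> G \<Longrightarrow> v \<in> carrier V" "(v, w) \<in> G \<Longrightarrow> w \<in> carrier W"
    "(\<zero>\<^bsub>V\<^esub>, \<zero>\<^bsub>W\<^esub>) \<in> G"
    "(v, w) \<in> G \<Longrightarrow> (v', w') \<in> G \<Longrightarrow> (v \<oplus>\<^bsub>V\<^esub> v', w \<oplus>\<^bsub>W\<^esub> w') \<in> G"
    "(v, w) \<in> G \<Longrightarrow> (c \<odot>\<^bsub>V\<^esub> v, c \<odot>\<^bsub>W\<^esub> w) \<in> G"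
  using assms by (auto simp: linrel_def)

lemma linfun_unique:
  assumes "vs V" "vs W" and G: "linfun V W G" and 1: "(v, w) \<in> G" "(v, w') \<in> G"
  shows "w = w'"
proof -
  have G': "linrel V W G" using G by (simp add: linfun_def)
  have "(v \<oplus>\<^bsub>V\<^esub> (- 1) \<odot>\<^bsub>V\<^esub> v, w \<oplus>\<^bsub>W\<^esub> (- 1) \<odot>\<^bsub>W\<^esub> w') \<in> G"
    using 1 linrelD[OF G'] by blast
  then have "w \<oplus>\<^bsub>W\<^esub> (- 1) \<odot>\<^bsub>W\<^esub> w' = \<zero>\<^bsub>W\<^esub>"
    using G vs_neg[OF \<open>vs V\<close>] linrelD(1)[OF G' 1(1)] by (auto simp: linfun_def)
  then show ?thesis
    using vs_eq_diff[OF \<open>vs W\<close>] linrelD(2)[OF G'] 1 by blast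
qed

text \<open>Zorn's lemma enters here and nowhere else. It serves to extend functionals, to choose complements and
  sections, and to construct the total integral, for which the operators \<open>\<Theta>\<close> express that a partial map is
  colinear.\<close>

lemma maximal_linfun:
  assumes "linfun V W G0" "G0 \<subseteq> R" "\<And>\<theta>. \<theta> \<in> \<Theta> \<Longrightarrow> \<theta> ` G0 \<subseteq> G0"
  obtains M where "linfun V W M" "G0 \<subseteq> M" "M \<subseteq> R" "\<And>\<theta>. \<theta> \<in> \<Theta> \<Longrightarrow> \<theta> ` M \<subseteq> M"
    "\<And>G. linfun V W G \<Longrightarrow> M \<subseteq> G \<Longrightarrow> G \<subseteq> R \<Longrightarrow> (\<And>\<theta>. \<theta> \<in> \<Theta> \<Longrightarrow> \<theta> ` G \<subseteq> G) \<Longrightarrow> G = M"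
proof -
  define \<A> where "\<A> = {G. linfun V W G \<and> G0 \<subseteq> G \<and> G \<subseteq> R \<and> (\<forall>\<theta>\<in>\<Theta>. \<theta> ` G \<subseteq> G)}"
  have "\<exists>M\<in>\<A>. \<forall>G\<in>\<A>. M \<subseteq> G \<longrightarrow> G = M"
  proof (rule subset_Zorn_nonempty)
    show "\<A> \<noteq> {}" using assms unfolding \<A>_def by blast
  next
    fix \<C> assume ne: "\<C> \<noteq> {}" and ch: "subset.chain \<A> \<C>"
    have sub: "\<C> \<subseteq> \<A>" using ch by (auto simp: subset.chain_def)
    have two: "\<exists>G\<in>\<C>. a \<in> G \<and> b \<in> G" if "a \<in> \<Union>\<C>" "b \<in> \<Union>\<C>" for a b
    proof -
      from that obtain A B where AB: "A \<in> \<C>" "B \<in> \<C>" "a \<in> A" "b \<in> B" by blast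
      then have "A \<subseteq> B \<or> B \<subseteq> A" using ch by (auto simp: subset.chain_def)
      with AB show ?thesis by blast
    qed
    have "linrel V W (\<Union>\<C>)"
      unfolding linrel_def
    proof (intro conjI ballI allI)
      show "\<Union>\<C> \<subseteq> carrier V \<times> carrier W" "(\<zero>\<^bsub>V\<^esub>, \<zero>\<^bsub>W\<^esub>) \<in> \<Union>\<C>"
        using sub ne by (auto simp: \<A>_def linfun_def linrel_def)
      show "case a of (v, w) \<Rightarrow> \<forall>(v', w')\<in>\<Union>\<C>. (v \<oplus>\<^bsub>V\<^esub> v', w \<oplus>\<^bsub>W\<^esub> w') \<in> \<Union>\<C>" if "a \<in> \<Union>\<C>" for a
      proof (clarify)
        fix v w v' w' G' assume a: "a = (v, w)" and b: "(v', w') \<in> G'" "G' \<in> \<C>"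
        obtain G where "G \<in> \<C>" "(v, w) \<in> G" "(v', w') \<in> G"
          using two[of "(v, w)" "(v', w')"] \<open>a \<in> \<Union>\<C>\<close> a b by blast
        then show "(v \<oplus>\<^bsub>V\<^esub> v', w \<oplus>\<^bsub>W\<^esub> w') \<in> \<Union>\<C>"
          using sub linrelD(4)[of V W G v w v' w'] by (auto simp: \<A>_def linfun_def)
      qed
      show "case a of (v, w) \<Rightarrow> (c \<odot>\<^bsub>V\<^esub> v, c \<odot>\<^bsub>W\<^esub> w) \<in> \<Union>\<C>" if aC: "a \<in> \<Union>\<C>" for a c
      proof -
        obtain v w G where a: "a = (v, w)" "G \<in> \<C>" "(v, w) \<in> G"
          using aC by (metis UnionE surj_pair)
        then have "(c \<odot>\<^bsub>V\<^esub> v, c \<odot>\<^bsub>W\<^esub> w) \<in> G"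
          using sub linrelD(5)[of V W G v w c] by (auto simp: \<A>_def linfun_def)
        then show ?thesis using a by auto
      qed
    qed
    then have "linfun V W (\<Union>\<C>)"
      using sub by (auto simp: linfun_def \<A>_def)
    then show "\<Union>\<C> \<in> \<A>"
      using sub ne unfolding \<A>_def by blast
  qed
  then obtain M where M: "M \<in> \<A>" "\<And>G. G \<in> \<A> \<Longrightarrow> M \<subseteq> G \<Longrightarrow> G = M" by blast
  show thesis
  proof (rule that[of M])
    fix G assume "linfun V W G" "M \<subseteq> G" "G \<subseteq> R" "\<And>\<theta>. \<theta> \<in> \<Theta> \<Longrightarrow> \<theta> ` G \<subseteq> G"
    then show "G = M" using M by (intro M(2)) (auto simp: \<A>_def)
  qed (use M in \<open>auto simp: \<A>_def\<close>)
qed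

lemma linfun_total:
  assumes V: "vs V" and W: "vs W" and G: "linfun V W G" and tot: "\<And>v. v \<in> carrier V \<Longrightarrow> v \<in> fst ` G"
  obtains f where "f \<in> linear_maps V W" "\<And>v. v \<in> carrier V \<Longrightarrow> (v, f v) \<in> G" "\<And>v w. (v, w) \<in> G \<Longrightarrow> f v = w"
proof -
  have G': "linrel V W G" using G by (simp add: linfun_def)
  define f where "f v = (SOME w. (v, w) \<in> G)" for v
  have f: "(v, f v) \<in> G" if "v \<in> carrier V" for v
  proof -
    from tot[OF that] have "\<exists>w. (v, w) \<in> G" by fastforce
    then show ?thesis unfolding f_def by (rule someI_ex)
  qed
  have u: "f v = w" if "(v, w) \<in> G" for v w
    using linfun_unique[OF V W G] f linrelD(1)[OF G'] that by blast
  have "f \<in> linear_maps V W"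
  proof (rule linear_mapsI)
    show "f x \<in> carrier W" if "x \<in> carrier V" for x
      using linrelD(2)[OF G' f[OF that]] .
    show "f (x \<oplus>\<^bsub>V\<^esub> y) = f x \<oplus>\<^bsub>W\<^esub> f y" if "x \<in> carrier V" "y \<in> carrier V" for x y
      using u[OF linrelD(4)[OF G' f f]] that .
    show "f (c \<odot>\<^bsub>V\<^esub> x) = c \<odot>\<^bsub>W\<^esub> f x" if "x \<in> carrier V" for x c
      using u[OF linrelD(5)[OF G' f]] that .
  qed
  then show thesis using f u that by blast
qed

text \<open>The sum of two graphs is single-valued because they agree wherever both are defined.\<close>

lemma linfun_extend:
  assumes V: "vs V" and W: "vs W" and M: "linfun V W M" and N: "linrel V W N"
    and agree: "\<And>v w w'. (v, w) \<in> M \<Longrightarrow> (v, w') \<in> N \<Longrightarrow> w = w'"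
  shows "linfun V W ((\<lambda>((v, w), (v', w')). (v \<oplus>\<^bsub>V\<^esub> v', w \<oplus>\<^bsub>W\<^esub> w')) ` (M \<times> N))" (is "linfun V W ?S")
proof -
  have M': "linrel V W M" using M by (simp add: linfun_def)
  note mD = linrelD[OF M'] and nD = linrelD[OF N]
  have add: "(a \<oplus>\<^bsub>V\<^esub> a', b \<oplus>\<^bsub>W\<^esub> b') \<in> ?S" if "(a, b) \<in> M" "(a', b') \<in> N" for a b a' b'
    using that by force
  have S: "\<exists>a b a' b'. (a, b) \<in> M \<and> (a', b') \<in> N \<and> v = a \<oplus>\<^bsub>V\<^esub> a' \<and> w = b \<oplus>\<^bsub>W\<^esub> b'"
    if "(v, w) \<in> ?S" for v w
    using that by auto
  have "linrel V W ?S"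
  proof (rule linrelI)
    show "v \<in> carrier V \<and> w \<in> carrier W" if "(v, w) \<in> ?S" for v w
      using S[OF that] V W mD(1,2) nD(1,2) by auto
    show "(\<zero>\<^bsub>V\<^esub>, \<zero>\<^bsub>W\<^esub>) \<in> ?S"
      using add[OF mD(3) nD(3)] V W by (simp add: vs_simps)
  next
    fix v w v' w'
    assume "(v, w) \<in> ?S" "(v', w') \<in> ?S"
    from S[OF this(1)] S[OF this(2)] obtain a1 b1 a2 b2 a3 b3 a4 b4 where
      1: "(a1, b1) \<in> M" "(a2, b2) \<in> N" "(a3, b3) \<in> M" "(a4, b4) \<in> N" and
      2: "v = a1 \<oplus>\<^bsub>V\<^esub> a2" "w = b1 \<oplus>\<^bsub>W\<^esub> b2" "v' = a3 \<oplus>\<^bsub>V\<^esub> a4" "w' = b3 \<oplus>\<^bsub>W\<^esub> b4"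
      by (elim exE conjE) (rule that)
    have "((a1 \<oplus>\<^bsub>V\<^esub> a3) \<oplus>\<^bsub>V\<^esub> (a2 \<oplus>\<^bsub>V\<^esub> a4), (b1 \<oplus>\<^bsub>W\<^esub> b3) \<oplus>\<^bsub>W\<^esub> (b2 \<oplus>\<^bsub>W\<^esub> b4)) \<in> ?S"
      using add[OF mD(4)[OF 1(1,3)] nD(4)[OF 1(2,4)]] .
    then show "(v \<oplus>\<^bsub>V\<^esub> v', w \<oplus>\<^bsub>W\<^esub> w') \<in> ?S"
      using mD(1,2)[OF 1(1)] mD(1,2)[OF 1(3)] nD(1,2)[OF 1(2)] nD(1,2)[OF 1(4)]
      unfolding 2 by (simp add: vs_ac[OF V] vs_ac[OF W] V W del: image_iff)
  next
    fix c v w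
    assume "(v, w) \<in> ?S"
    from S[OF this] obtain a1 b1 a2 b2 where 1: "(a1, b1) \<in> M" "(a2, b2) \<in> N"
      and 2: "v = a1 \<oplus>\<^bsub>V\<^esub> a2" "w = b1 \<oplus>\<^bsub>W\<^esub> b2" by blast
    show "(c \<odot>\<^bsub>V\<^esub> v, c \<odot>\<^bsub>W\<^esub> w) \<in> ?S"
      using add[OF mD(5)[OF 1(1), of c] nD(5)[OF 1(2), of c]] mD(1,2)[OF 1(1)] nD(1,2)[OF 1(2)]
      unfolding 2 by (simp add: vs_distrib[OF V] vs_distrib[OF W] del: image_iff)
  qed
  moreover have "w = \<zero>\<^bsub>W\<^esub>" if "(\<zero>\<^bsub>V\<^esub>, w) \<in> ?S" for w
  proof -
    from that obtain a b a' b' where 1: "(a, b) \<in> M" "(a', b') \<in> N"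
      and eq: "\<zero>\<^bsub>V\<^esub> = a \<oplus>\<^bsub>V\<^esub> a'" "w = b \<oplus>\<^bsub>W\<^esub> b'" by auto
    have c: "a \<in> carrier V" "a' \<in> carrier V" "b \<in> carrier W" "b' \<in> carrier W"
      using 1 mD nD by auto
    have a: "a = (- 1) \<odot>\<^bsub>V\<^esub> a'"
      by (rule vs_eq_diff[OF V]) (use eq(1)[symmetric] c V in \<open>simp_all add: vs_simps\<close>)
    have "((- 1) \<odot>\<^bsub>V\<^esub> a', (- 1) \<odot>\<^bsub>W\<^esub> b') \<in> N"
      using nD(5) 1 by blast
    then have "b = (- 1) \<odot>\<^bsub>W\<^esub> b'"
      using agree[OF 1(1)] a by blast
    then show ?thesis
      using eq(2) c vs_neg[OF W, of b'] by (simp add: vs_ac[OF W] W)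
  qed
  ultimately show ?thesis by (auto simp: linfun_def)
qed

text \<open>A maximal partial map inside a total linear relation is defined everywhere: at a new vector \<open>v\<close>
  any \<open>w\<close> related to \<open>v\<close> can be chosen as its value. Projections, sections and functionals are all selections
  from suitable relations.\<close>

lemma linear_selection:
  assumes V: "vs V" and W: "vs W" and R: "linrel V W R" and tot: "\<And>v. v \<in> carrier V \<Longrightarrow> v \<in> fst ` R"
    and G0: "linfun V W G0" "G0 \<subseteq> R"
  obtains f where "f \<in> linear_maps V W" "\<And>v. v \<in> carrier V \<Longrightarrow> (v, f v) \<in> R" "\<And>v w. (v, w) \<in> G0 \<Longrightarrow> f v = w"
proof -
  obtain M where M: "linfun V W M" "G0 \<subseteq> M" "M \<subseteq> R"
    and max: "\<And>G. linfun V W G \<Longrightarrow> M \<subseteq> G \<Longrightarrow> G \<subseteq> R \<Longrightarrow> G = M"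
    by (rule maximal_linfun[of V W G0 R "{}"]) (use G0 in auto)
  have M': "linrel V W M" using M by (simp add: linfun_def)
  have "v \<in> fst ` M" if v: "v \<in> carrier V" for v
  proof (rule ccontr)
    assume nv: "v \<notin> fst ` M"
    obtain w where w: "(v, w) \<in> R" using tot[OF v] by auto
    have wc: "w \<in> carrier W" using linrelD(2)[OF R w] .
    let ?N = "range (\<lambda>c. (c \<odot>\<^bsub>V\<^esub> v, c \<odot>\<^bsub>W\<^esub> w))"
    let ?S = "(\<lambda>((v, w), (v', w')). (v \<oplus>\<^bsub>V\<^esub> v', w \<oplus>\<^bsub>W\<^esub> w')) ` (M \<times> ?N)"
    have N: "linrel V W ?N"
    proof (rule linrelI)
      show "(\<zero>\<^bsub>V\<^esub>, \<zero>\<^bsub>W\<^esub>) \<in> ?N"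
        by (rule image_eqI[of _ _ 0]) (simp_all add: vs_simps V W v wc)
      fix x y x' y' b
      assume "(x, y) \<in> ?N"
      then obtain c where c: "x = c \<odot>\<^bsub>V\<^esub> v" "y = c \<odot>\<^bsub>W\<^esub> w" by auto
      show "(b \<odot>\<^bsub>V\<^esub> x, b \<odot>\<^bsub>W\<^esub> y) \<in> ?N"
        by (rule image_eqI[of _ _ "b * c"]) (simp_all add: vs_simps V W v wc c)
      assume "(x', y') \<in> ?N"
      then obtain d where d: "x' = d \<odot>\<^bsub>V\<^esub> v" "y' = d \<odot>\<^bsub>W\<^esub> w" by auto
      show "(x \<oplus>\<^bsub>V\<^esub> x', y \<oplus>\<^bsub>W\<^esub> y') \<in> ?N"
        by (rule image_eqI[of _ _ "c + d"]) (simp_all add: vs_distrib V W v wc c d)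
    qed (use v wc V W in auto)
    have agree: "x = y" if "(u, x) \<in> M" "(u, y) \<in> ?N" for u x y
    proof -
      from that(2) obtain c where c: "u = c \<odot>\<^bsub>V\<^esub> v" "y = c \<odot>\<^bsub>W\<^esub> w" by auto
      show ?thesis
      proof (cases "c = 0")
        case True
        then show ?thesis
          using that(1) c M(1) v wc by (auto simp: vs_simps V W linfun_def)
      next
        case False
        then have "(v, (1 / c) \<odot>\<^bsub>W\<^esub> x) \<in> M"
          using linrelD(5)[OF M' that(1), of "1 / c"] c v by (simp add: vs_simps V)
        with nv show ?thesis by force
      qed
    qed
    have "?S = M"
    proof (rule max)
      show "linfun V W ?S" by (rule linfun_extend[OF V W M(1) N agree])
      have "(\<zero>\<^bsub>V\<^esub>, \<zero>\<^bsub>W\<^esub>) \<in> ?N" using linrelD(3)[OF N] .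
      show "M \<subseteq> ?S"
      proof (clarify)
        fix x y assume xy: "(x, y) \<in> M"
        show "(x, y) \<in> ?S"
          by (rule image_eqI[of _ _ "((x, y), (\<zero>\<^bsub>V\<^esub>, \<zero>\<^bsub>W\<^esub>))"])
            (use xy linrelD(1,2)[OF M' xy] \<open>(\<zero>\<^bsub>V\<^esub>, \<zero>\<^bsub>W\<^esub>) \<in> ?N\<close> in \<open>auto simp: vs_simps V W\<close>)
      qed
      show "?S \<subseteq> R"
        using M(3) linrelD(4,5)[OF R] w by auto
    qed
    moreover have "(v, w) \<in> ?N"
      by (rule image_eqI[of _ _ 1]) (simp_all add: vs_simps V W v wc)
    then have "(v, w) \<in> ?S"
      by (intro image_eqI[of _ _ "((\<zero>\<^bsub>V\<^esub>, \<zero>\<^bsub>W\<^esub>), (v, w))"])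
        (use v wc linrelD(3)[OF M'] in \<open>simp_all add: vs_simps V W\<close>)
    ultimately show False using nv by force
  qed
  then obtain f where "f \<in> linear_maps V W" "\<And>v. v \<in> carrier V \<Longrightarrow> (v, f v) \<in> M" "\<And>v w. (v, w) \<in> M \<Longrightarrow> f v = w"
    by (rule linfun_total[OF V W M(1)]) (assumption, rule that)
  then show thesis using M that by blast
qed

definition subspace :: "(complex, 'a, 'm) module_scheme \<Rightarrow> 'a set \<Rightarrow> bool"
  where "subspace V U \<longleftrightarrow> U \<subseteq> carrier V \<and> \<zero>\<^bsub>V\<^esub> \<in> U \<and> (\<forall>x\<in>U. \<forall>y\<in>U. x \<oplus>\<^bsub>V\<^esub> y \<in> U) \<and>
    (\<forall>c. \<forall>x\<in>U. c \<odot>\<^bsub>V\<^esub> x \<in> U)"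

lemma subspace_projection:
  assumes V: "vs V" and U: "subspace V U"
  obtains \<pi> where "\<pi> \<in> linear_maps V V" "\<And>v. v \<in> carrier V \<Longrightarrow> \<pi> v \<in> U" "\<And>u. u \<in> U \<Longrightarrow> \<pi> u = u"
proof -
  have a: "linrel V V (carrier V \<times> U)"
    using V U by (auto simp: linrel_def subspace_def)
  have b: "linfun V V ((\<lambda>u. (u, u)) ` U)"
    using U by (auto simp: linfun_def linrel_def subspace_def)
  have c: "v \<in> fst ` (carrier V \<times> U)" if "v \<in> carrier V" for v
    using that U by (force simp: subspace_def)
  have d: "(\<lambda>u. (u, u)) ` U \<subseteq> carrier V \<times> U"
    using U by (auto simp: subspace_def)
  obtain f where "f \<in> linear_maps V V" "\<And>v. v \<in> carrier V \<Longrightarrow> (v, f v) \<in> carrier V \<times> U"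
    "\<And>v w. (v, w) \<in> (\<lambda>u. (u, u)) ` U \<Longrightarrow> f v = w"
    by (rule linear_selection[OF V V a c b d]) (assumption, rule that)
  then show thesis by (intro that[of f]) auto
qed

lemma linear_lift:
  assumes U: "vs U" and V: "vs V" and W: "vs W"
    and g: "g \<in> linear_maps V W" and k: "k \<in> linear_maps U W"
    and onto: "\<And>u. u \<in> carrier U \<Longrightarrow> k u \<in> g ` carrier V"
  obtains \<sigma> where "\<sigma> \<in> linear_maps U V" "\<And>u. u \<in> carrier U \<Longrightarrow> g (\<sigma> u) = k u"
proof -
  let ?R = "{(u, v). u \<in> carrier U \<and> v \<in> carrier V \<and> g v = k u}"
  have a: "linrel U V ?R"
    by (rule linrelI)
      (auto simp: U V linear_maps_zero[OF g V W] linear_maps_zero[OF k U W] linear_maps_apply[OF g] linear_maps_apply[OF k])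
  have b: "linfun U V {(\<zero>\<^bsub>U\<^esub>, \<zero>\<^bsub>V\<^esub>)}"
    by (auto simp: linfun_def linrel_def vs_simps U V)
  have d: "{(\<zero>\<^bsub>U\<^esub>, \<zero>\<^bsub>V\<^esub>)} \<subseteq> ?R"
    using linrelD(3)[OF a] by simp
  have c: "u \<in> fst ` ?R" if "u \<in> carrier U" for u
    using that onto[OF that] by force
  obtain f where f: "f \<in> linear_maps U V" "\<And>v. v \<in> carrier U \<Longrightarrow> (v, f v) \<in> ?R"
    by (rule linear_selection[OF U V a c b d]) (assumption, rule that)
  have "g (f u) = k u" if "u \<in> carrier U" for u
    using f(2)[OF that] by auto
  then show thesis using f(1) that by blast
qed

lemma functional_separates:
  assumes V: "vs V" and v: "v \<in> carrier V" "v \<noteq> \<zero>\<^bsub>V\<^esub>"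
  obtains \<phi> where "lin V \<phi>" "\<phi> v = 1"
proof -
  have a: "linrel V complex_space (carrier V \<times> UNIV)"
    using V by (auto simp: linrel_def)
  have b: "linfun V complex_space (range (\<lambda>c. (c \<odot>\<^bsub>V\<^esub> v, c)))"
    unfolding linfun_def
  proof (intro conjI allI impI linrelI)
    show "(\<zero>\<^bsub>V\<^esub>, \<zero>\<^bsub>complex_space\<^esub>) \<in> range (\<lambda>c. (c \<odot>\<^bsub>V\<^esub> v, c))"
      by (rule image_eqI[of _ _ 0]) (simp_all add: vs_simps V v)
    fix w assume "(\<zero>\<^bsub>V\<^esub>, w) \<in> range (\<lambda>c. (c \<odot>\<^bsub>V\<^esub> v, c))"
    then have eq: "\<zero>\<^bsub>V\<^esub> = w \<odot>\<^bsub>V\<^esub> v" by auto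
    show "w = \<zero>\<^bsub>complex_space\<^esub>"
    proof (rule ccontr)
      assume "w \<noteq> \<zero>\<^bsub>complex_space\<^esub>"
      then have "v = (1 / w) \<odot>\<^bsub>V\<^esub> (w \<odot>\<^bsub>V\<^esub> v)" using v V by (simp add: vs_simps)
      also have "\<dots> = \<zero>\<^bsub>V\<^esub>" using V by (simp flip: eq add: vs_simps)
      finally show False using v by simp
    qed
  qed (use V v in \<open>auto simp: vs_distrib(1)[symmetric] vs_simps\<close>)
  have d: "range (\<lambda>c. (c \<odot>\<^bsub>V\<^esub> v, c)) \<subseteq> carrier V \<times> UNIV"
    using V v by auto
  have c: "u \<in> fst ` (carrier V \<times> UNIV)" if "u \<in> carrier V" for u
    using that by force
  obtain f where "f \<in> linear_maps V complex_space" "\<And>u w. (u, w) \<in> range (\<lambda>c. (c \<odot>\<^bsub>V\<^esub> v, c)) \<Longrightarrow> f u = w"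
    by (rule linear_selection[OF V vs_complex_space a c b d]) (assumption, rule that)
  moreover have "(v, 1) \<in> range (\<lambda>c. (c \<odot>\<^bsub>V\<^esub> v, c))"
    by (rule image_eqI[of _ _ 1]) (simp_all add: vs_simps V v)
  ultimately show thesis by (intro that[of f]) (auto simp: lin_iff)
qed

text \<open>Vectors are compared through their values under all functionals. This turns identities in iterated
  tensor products into identities between complex numbers.\<close>

lemma vs_eqI:
  assumes V: "vs V" and "x \<in> carrier V" "y \<in> carrier V"
    and eq: "\<And>\<phi>. lin V \<phi> \<Longrightarrow> \<phi> x = \<phi> y"
  shows "x = y"
proof (rule ccontr)
  assume "x \<noteq> y"
  then have "x \<oplus>\<^bsub>V\<^esub> (- 1) \<odot>\<^bsub>V\<^esub> y \<noteq> \<zero>\<^bsub>V\<^esub>"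
    using vs_eq_diff[OF V] assms by blast
  then obtain \<phi> where \<phi>: "lin V \<phi>" "\<phi> (x \<oplus>\<^bsub>V\<^esub> (- 1) \<odot>\<^bsub>V\<^esub> y) = 1"
    using functional_separates[OF V] assms by (metis vs_closed(2,3))
  then show False
    using eq[OF \<phi>(1)] assms by (simp add: lin_apply[OF \<phi>(1)])
qed

lemma linear_maps_by_functionals:
  assumes V: "vs V" and W: "vs W" and closed: "\<And>v. v \<in> carrier V \<Longrightarrow> f v \<in> carrier W"
    and lin: "\<And>\<phi>. lin W \<phi> \<Longrightarrow> lin V (\<lambda>v. \<phi> (f v))"
  shows "f \<in> linear_maps V W"
proof (rule linear_mapsI[OF closed])
  fix x y assume "x \<in> carrier V" "y \<in> carrier V"
  then show "f (x \<oplus>\<^bsub>V\<^esub> y) = f x \<oplus>\<^bsub>W\<^esub> f y"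
    using V W closed by (intro vs_eqI[OF W]) (simp_all add: lin_apply lin_apply[OF lin])
next
  fix x c assume "x \<in> carrier V"
  then show "f (c \<odot>\<^bsub>V\<^esub> x) = c \<odot>\<^bsub>W\<^esub> f x"
    using V W closed by (intro vs_eqI[OF W]) (simp_all add: lin_apply lin_apply[OF lin])
qed

text \<open>A dual basis for finitely many given vectors: on their span the identity is \<open>\<Sum> \<alpha> \<otimes> e\<close>. A new
  vector contributes the part of it that the previous pairs do not reach, together with a functional that
  vanishes on what they do reach.\<close>

lemma finite_rank_identity:
  assumes V: "vs V" and xs: "set xs \<subseteq> carrier V"
  obtains es where "\<And>e \<alpha>. (e, \<alpha>) \<in> set es \<Longrightarrow> e \<in> carrier V \<and> lin V \<alpha>"
    "\<And>x \<phi>. x \<in> set xs \<Longrightarrow> lin V \<phi> \<Longrightarrow> \<phi> x = (\<Sum>(e, \<alpha>)\<leftarrow>es. \<alpha> x * \<phi> e)"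
proof -
  have "\<exists>es. (\<forall>(e, \<alpha>)\<in>set es. e \<in> carrier V \<and> lin V \<alpha>) \<and>
      (\<forall>x\<in>set xs. \<forall>\<phi>. lin V \<phi> \<longrightarrow> \<phi> x = (\<Sum>(e, \<alpha>)\<leftarrow>es. \<alpha> x * \<phi> e))"
    using xs
  proof (induction xs)
    case Nil
    show ?case by (rule exI[of _ "[]"]) auto
  next
    case (Cons v xs)
    then obtain es where es: "\<And>e \<alpha>. (e, \<alpha>) \<in> set es \<Longrightarrow> e \<in> carrier V \<and> lin V \<alpha>"
      and id: "\<And>x \<phi>. x \<in> set xs \<Longrightarrow> lin V \<phi> \<Longrightarrow> \<phi> x = (\<Sum>(e, \<alpha>)\<leftarrow>es. \<alpha> x * \<phi> e)"
      by fastforce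
    have v: "v \<in> carrier V" using Cons.prems by simp
    define pr where "pr x = foldr (\<lambda>(e, \<alpha>) s. \<alpha> x \<odot>\<^bsub>V\<^esub> e \<oplus>\<^bsub>V\<^esub> s) es \<zero>\<^bsub>V\<^esub>" for x
    have prc: "pr x \<in> carrier V" and pr\<phi>: "lin V \<phi> \<Longrightarrow> \<phi> (pr x) = (\<Sum>(e, \<alpha>)\<leftarrow>es. \<alpha> x * \<phi> e)" for x \<phi>
    proof -
      have "set es' \<subseteq> set es \<Longrightarrow> foldr (\<lambda>(e, \<alpha>) s. \<alpha> x \<odot>\<^bsub>V\<^esub> e \<oplus>\<^bsub>V\<^esub> s) es' \<zero>\<^bsub>V\<^esub> \<in> carrier V \<and>
         (lin V \<phi> \<longrightarrow> \<phi> (foldr (\<lambda>(e, \<alpha>) s. \<alpha> x \<odot>\<^bsub>V\<^esub> e \<oplus>\<^bsub>V\<^esub> s) es' \<zero>\<^bsub>V\<^esub>) = (\<Sum>(e, \<alpha>)\<leftarrow>es'. \<alpha> x * \<phi> e))" for es'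
        by (induction es') (use V es in \<open>auto simp: lin_apply lin_zero\<close>)
      then show "pr x \<in> carrier V" "lin V \<phi> \<Longrightarrow> \<phi> (pr x) = (\<Sum>(e, \<alpha>)\<leftarrow>es. \<alpha> x * \<phi> e)"
        unfolding pr_def by blast+
    qed
    have fixed: "pr x = x" if "x \<in> set xs" for x
      by (rule vs_eqI[OF V prc]) (use that Cons.prems pr\<phi> id[symmetric] in auto)
    show ?case
    proof (cases "pr v = v")
      case True
      then have "\<phi> v = (\<Sum>(e, \<alpha>)\<leftarrow>es. \<alpha> v * \<phi> e)" if "lin V \<phi>" for \<phi>
        using pr\<phi>[OF that, of v] by simp
      then show ?thesis using es id by (intro exI[of _ es]) auto
    next
      case False
      let ?e = "v \<oplus>\<^bsub>V\<^esub> (- 1) \<odot>\<^bsub>V\<^esub> pr v"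
      have e: "?e \<in> carrier V" using V v prc by simp
      have "?e \<noteq> \<zero>\<^bsub>V\<^esub>" using vs_eq_diff[OF V v prc] False by metis
      then obtain \<psi> where \<psi>: "lin V \<psi>" "\<psi> ?e = 1"
        using functional_separates[OF V e] by blast
      define \<beta> where "\<beta> x = \<psi> x - \<psi> (pr x)" for x
      have l: "lin V (\<lambda>x. (\<Sum>(e, \<alpha>)\<leftarrow>es'. \<alpha> x * \<psi> e))" if "set es' \<subseteq> set es" for es'
        using that by (induction es') (auto simp: lin_def algebra_simps dest!: es)
      have "lin V \<beta>"
        unfolding \<beta>_def using l[OF order.refl] \<psi>(1) pr\<phi>[OF \<psi>(1)]
        by (auto simp: lin_def algebra_simps)
      moreover have "\<beta> v = 1"
        using \<psi> v prc V by (simp add: \<beta>_def lin_apply)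
      moreover have "\<beta> x = 0" if "x \<in> set xs" for x
        using fixed[OF that] by (simp add: \<beta>_def)
      moreover have "\<phi> v = \<phi> ?e + (\<Sum>(e, \<alpha>)\<leftarrow>es. \<alpha> v * \<phi> e)" if "lin V \<phi>" for \<phi>
        using that v prc V pr\<phi>[OF that, of v] by (simp add: lin_apply)
      ultimately show ?thesis
        using es id e by (intro exI[of _ "(?e, \<beta>) # es"]) auto
    qed
  qed
  then show thesis using that by fastforce
qed

section \<open>Tensor products\<close>

text \<open>The setting in which the quotient of the free abelian group has the universal property of
  \<open>M \<otimes>\<^sub>R N\<close>. It is used over \<open>\<complex>\<close>, for \<open>P \<otimes>\<^sub>B P\<close>, and for the source of \<open>\<beta>\<close>.\<close>

locale balanced_tensor =
  fixes R :: "'r set" and M :: "('r, 'a, 'm) module_scheme" and N :: "('r, 'b, 'n) module_scheme"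
  assumes M: "abelian_group M" and N: "abelian_group N"
    and actM: "\<And>r m. r \<in> R \<Longrightarrow> m \<in> carrier M \<Longrightarrow> r \<odot>\<^bsub>M\<^esub> m \<in> carrier M"
    and actN: "\<And>r n. r \<in> R \<Longrightarrow> n \<in> carrier N \<Longrightarrow> r \<odot>\<^bsub>N\<^esub> n \<in> carrier N"
begin

interpretation M: abelian_group M by (fact M)
interpretation N: abelian_group N by (fact N)

abbreviation "Fr \<equiv> free_Abelian_group (carrier M \<times> carrier N)"
abbreviation "Kr \<equiv> tensor_kernel R M N"
abbreviation "Tg \<equiv> tensor_group R M N"
abbreviation "te \<equiv> tensor_elem R M N"

interpretation Fr: comm_group Fr by (fact abelian_free_Abelian_group)

lemma frag_of_closed: "p \<in> carrier M \<times> carrier N \<Longrightarrow> frag_of p \<in> carrier Fr"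
  by auto

lemma frag_diff_closed: "a \<in> carrier Fr \<Longrightarrow> b \<in> carrier Fr \<Longrightarrow> a - b \<in> carrier Fr"
  using keys_diff[of a b] by auto

lemma rels_closed: "tensor_rels R M N \<subseteq> carrier Fr"
  unfolding tensor_rels_def
  by (auto simp del: carrier_free_Abelian_group_iff intro!: frag_diff_closed frag_of_closed simp: actM actN)

lemma kernel_subgroup: "subgroup Kr Fr"
  unfolding tensor_kernel_def using rels_closed by (rule Fr.generate_is_subgroup)

lemma kernel_normal: "Kr \<lhd> Fr"
  by (rule Fr.subgroup_imp_normal[OF kernel_subgroup])

lemma tensor_comm_group: "comm_group Tg"
  unfolding tensor_group_def by (rule Fr.abelian_FactGroup[OF kernel_subgroup])

interpretation Tg: comm_group Tg by (fact tensor_comm_group)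

abbreviation "qt \<equiv> (\<lambda>x. Kr #>\<^bsub>Fr\<^esub> x)"

lemma qt_hom: "qt \<in> hom Fr Tg"
  unfolding tensor_group_def by (rule normal.r_coset_hom_Mod[OF kernel_normal])

interpretation qt: group_hom Fr Tg qt
  using qt_hom by unfold_locales

lemma qt_diff: "a \<in> carrier Fr \<Longrightarrow> b \<in> carrier Fr \<Longrightarrow> qt (a - b) = qt a \<otimes>\<^bsub>Tg\<^esub> inv\<^bsub>Tg\<^esub> qt b"
  using qt.hom_mult[of a "-b"] qt.hom_inv[of b] by (simp add: keys_minus)

lemma qt_rel: "x \<in> tensor_rels R M N \<Longrightarrow> qt x = \<one>\<^bsub>Tg\<^esub>"
  using rels_closed generate.incl[of x "tensor_rels R M N" Fr] subgroup.rcos_const[OF kernel_subgroup]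
  by (auto simp: tensor_group_def FactGroup_def tensor_kernel_def Fr.is_group)

lemma te_closed [simp]: "m \<in> carrier M \<Longrightarrow> n \<in> carrier N \<Longrightarrow> te m n \<in> carrier Tg"
  unfolding tensor_elem_def by (rule qt.hom_closed) auto

lemma quotient_add:
  assumes "qt (frag_of a - frag_of b - frag_of c) = \<one>\<^bsub>Tg\<^esub>"
    and s: "a \<in> carrier M \<times> carrier N" "b \<in> carrier M \<times> carrier N" "c \<in> carrier M \<times> carrier N"
  shows "qt (frag_of a) = qt (frag_of b) \<otimes>\<^bsub>Tg\<^esub> qt (frag_of c)"
proof -
  have fc: "frag_of a \<in> carrier Fr" "frag_of b \<in> carrier Fr" "frag_of c \<in> carrier Fr"
    "frag_of a - frag_of b \<in> carrier Fr"
    using s by (auto simp del: carrier_free_Abelian_group_iff intro!: frag_diff_closed frag_of_closed)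
  have c: "qt (frag_of a) \<in> carrier Tg" "qt (frag_of b) \<in> carrier Tg" "qt (frag_of c) \<in> carrier Tg"
    using fc qt.hom_closed by blast+
  have "qt (frag_of a) \<otimes>\<^bsub>Tg\<^esub> inv\<^bsub>Tg\<^esub> qt (frag_of b) \<otimes>\<^bsub>Tg\<^esub> inv\<^bsub>Tg\<^esub> qt (frag_of c) = \<one>\<^bsub>Tg\<^esub>"
    using assms(1) by (simp only: qt_diff[OF fc(4) fc(3)] qt_diff[OF fc(1,2)])
  then have "qt (frag_of a) \<otimes>\<^bsub>Tg\<^esub> inv\<^bsub>Tg\<^esub> qt (frag_of b) = qt (frag_of c)"
    using c by (metis Tg.inv_closed Tg.inv_equality Tg.inv_inv Tg.m_closed)
  then show ?thesis
    using c by (metis Tg.inv_solve_right Tg.m_comm)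
qed

lemma te_add_left:
  assumes "m \<in> carrier M" "m' \<in> carrier M" "n \<in> carrier N"
  shows "te (m \<oplus>\<^bsub>M\<^esub> m') n = te m n \<otimes>\<^bsub>Tg\<^esub> te m' n"
  unfolding tensor_elem_def using assms
  by (intro quotient_add qt_rel) (auto simp: tensor_rels_def)

lemma te_add_right:
  assumes "m \<in> carrier M" "n' \<in> carrier N" "n \<in> carrier N"
  shows "te m (n \<oplus>\<^bsub>N\<^esub> n') = te m n \<otimes>\<^bsub>Tg\<^esub> te m n'"
  unfolding tensor_elem_def using assms
  by (intro quotient_add qt_rel) (auto simp: tensor_rels_def)

lemma te_balanced:
  assumes "r \<in> R" "m \<in> carrier M" "n \<in> carrier N"
  shows "te (r \<odot>\<^bsub>M\<^esub> m) n = te m (r \<odot>\<^bsub>N\<^esub> n)"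
proof -
  have c: "frag_of (r \<odot>\<^bsub>M\<^esub> m, n) \<in> carrier Fr" "frag_of (m, r \<odot>\<^bsub>N\<^esub> n) \<in> carrier Fr"
    using assms actM actN by auto
  have "qt (frag_of (r \<odot>\<^bsub>M\<^esub> m, n) - frag_of (m, r \<odot>\<^bsub>N\<^esub> n)) = \<one>\<^bsub>Tg\<^esub>"
    using assms by (intro qt_rel) (auto simp: tensor_rels_def)
  then show ?thesis
    unfolding tensor_elem_def qt_diff[OF c]
    using c qt.hom_closed by (metis Tg.inv_equality Tg.inv_inv Tg.inv_closed)
qed

lemma te_zero:
  "n \<in> carrier N \<Longrightarrow> te \<zero>\<^bsub>M\<^esub> n = \<one>\<^bsub>Tg\<^esub>" "m \<in> carrier M \<Longrightarrow> te m \<zero>\<^bsub>N\<^esub> = \<one>\<^bsub>Tg\<^esub>"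
  using te_add_left[of "\<zero>\<^bsub>M\<^esub>" "\<zero>\<^bsub>M\<^esub>" n] te_add_right[of m "\<zero>\<^bsub>N\<^esub>" "\<zero>\<^bsub>N\<^esub>"] by auto

lemma te_neg:
  assumes "m \<in> carrier M" "n \<in> carrier N"
  shows "inv\<^bsub>Tg\<^esub> te m n = te (\<ominus>\<^bsub>M\<^esub> m) n"
  using te_add_left[of "\<ominus>\<^bsub>M\<^esub> m" m n] te_zero assms
  by (intro Tg.inv_equality) (auto simp: M.l_neg)

abbreviation "terep xs \<equiv> foldr (\<lambda>p s. te (fst p) (snd p) \<otimes>\<^bsub>Tg\<^esub> s) xs \<one>\<^bsub>Tg\<^esub>"

lemma terep_closed: "set xs \<subseteq> carrier M \<times> carrier N \<Longrightarrow> terep xs \<in> carrier Tg"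
  by (induction xs) auto

lemma terep_append:
  "set xs \<subseteq> carrier M \<times> carrier N \<Longrightarrow> set ys \<subseteq> carrier M \<times> carrier N \<Longrightarrow>
    terep (xs @ ys) = terep xs \<otimes>\<^bsub>Tg\<^esub> terep ys"
  by (induction xs) (auto simp: Tg.m_assoc terep_closed[unfolded case_prod_beta] case_prod_beta)

lemma terep_inv:
  "set xs \<subseteq> carrier M \<times> carrier N \<Longrightarrow> inv\<^bsub>Tg\<^esub> terep xs = terep (map (\<lambda>(m, n). (\<ominus>\<^bsub>M\<^esub> m, n)) xs)"
  by (induction xs) (auto simp: Tg.inv_mult terep_closed[unfolded case_prod_beta] case_prod_beta te_neg)

text \<open>Pure tensors suffice without signs, since \<open>- (m \<otimes> n) = (- m) \<otimes> n\<close>.\<close>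

lemma tensor_rep:
  assumes "t \<in> carrier Tg"
  obtains xs where "set xs \<subseteq> carrier M \<times> carrier N" "t = terep xs"
proof -
  from assms obtain x where x: "x \<in> carrier Fr" "t = qt x"
    by (auto simp: tensor_group_def carrier_FactGroup)
  from x(1) have "Poly_Mapping.keys x \<subseteq> carrier M \<times> carrier N" by simp
  then have "\<exists>xs. set xs \<subseteq> carrier M \<times> carrier N \<and> qt x = terep xs"
  proof (rule free_Abelian_group_induct)
    show "\<exists>xs. set xs \<subseteq> carrier M \<times> carrier N \<and> qt 0 = terep xs"
      using qt.hom_one by (intro exI[of _ "[]"]) simp
  next
    fix x y :: "('a \<times> 'b) \<Rightarrow>\<^sub>0 int"
    assume k: "Poly_Mapping.keys x \<subseteq> carrier M \<times> carrier N" "Poly_Mapping.keys y \<subseteq> carrier M \<times> carrier N"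
      and "\<exists>xs. set xs \<subseteq> carrier M \<times> carrier N \<and> qt x = terep xs" "\<exists>xs. set xs \<subseteq> carrier M \<times> carrier N \<and> qt y = terep xs"
    then obtain xs ys where "set xs \<subseteq> carrier M \<times> carrier N" "qt x = terep xs"
      "set ys \<subseteq> carrier M \<times> carrier N" "qt y = terep ys" by blast
    then have "qt (x - y) = terep (xs @ map (\<lambda>(m, n). (\<ominus>\<^bsub>M\<^esub> m, n)) ys)"
      using k qt_diff[of x y] terep_inv[of ys] by (subst terep_append) auto
    moreover have "set (xs @ map (\<lambda>(m, n). (\<ominus>\<^bsub>M\<^esub> m, n)) ys) \<subseteq> carrier M \<times> carrier N"
      using \<open>set xs \<subseteq> _\<close> \<open>set ys \<subseteq> _\<close> by auto
    ultimately show "\<exists>xs. set xs \<subseteq> carrier M \<times> carrier N \<and> qt (x - y) = terep xs"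
      by blast
  next
    fix p assume p: "p \<in> carrier M \<times> carrier N"
    then have "te (fst p) (snd p) \<in> carrier Tg" by auto
    with p show "\<exists>xs. set xs \<subseteq> carrier M \<times> carrier N \<and> qt (frag_of p) = terep xs"
      by (intro exI[of _ "[p]"]) (auto simp: tensor_elem_def)
  qed
  then show thesis using x that by blast
qed

lemma tensor_induct [consumes 1, case_names one mult]:
  assumes "t \<in> carrier Tg" and "Q \<one>\<^bsub>Tg\<^esub>"
    and "\<And>m n s. m \<in> carrier M \<Longrightarrow> n \<in> carrier N \<Longrightarrow> s \<in> carrier Tg \<Longrightarrow> Q s \<Longrightarrow> Q (te m n \<otimes>\<^bsub>Tg\<^esub> s)"
  shows "Q t"
proof -
  obtain xs where xs: "set xs \<subseteq> carrier M \<times> carrier N" "t = terep xs" by (rule tensor_rep[OF assms(1)])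
  from xs(1) have "Q (terep xs)"
  proof (induction xs)
    case (Cons a xs)
    then show ?case using terep_closed[of xs] assms(3) by (cases a) auto
  qed (simp add: assms(2))
  then show ?thesis using xs by simp
qed

lemma tensor_lift:
  fixes h :: "'a \<Rightarrow> 'b \<Rightarrow> 'c" and G :: "('c, 'k) monoid_scheme"
  assumes G: "comm_group G"
    and "\<And>m n. m \<in> carrier M \<Longrightarrow> n \<in> carrier N \<Longrightarrow> h m n \<in> carrier G"
    and "\<And>m m' n. m \<in> carrier M \<Longrightarrow> m' \<in> carrier M \<Longrightarrow> n \<in> carrier N \<Longrightarrow>
                 h (m \<oplus>\<^bsub>M\<^esub> m') n = h m n \<otimes>\<^bsub>G\<^esub> h m' n"
    and "\<And>m n n'. m \<in> carrier M \<Longrightarrow> n \<in> carrier N \<Longrightarrow> n' \<in> carrier N \<Longrightarrow>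
                 h m (n \<oplus>\<^bsub>N\<^esub> n') = h m n \<otimes>\<^bsub>G\<^esub> h m n'"
    and "\<And>r m n. r \<in> R \<Longrightarrow> m \<in> carrier M \<Longrightarrow> n \<in> carrier N \<Longrightarrow>
                 h (r \<odot>\<^bsub>M\<^esub> m) n = h m (r \<odot>\<^bsub>N\<^esub> n)"
  shows "tensor_lift R M N G h \<in> hom Tg G"
    and "m \<in> carrier M \<Longrightarrow> n \<in> carrier N \<Longrightarrow> tensor_lift R M N G h (te m n) = h m n"
  using theI'[OF tensor_lift_unique[OF M N G actM actN assms(2-5)], folded tensor_lift_def] by auto

end

lemma comm_group_add_monoid: "abelian_group U \<Longrightarrow> comm_group (add_monoid U)"
  by (rule abelian_group.a_comm_group)

definition bil ::
    "(complex, 'a, 'm) module_scheme \<Rightarrow> (complex, 'b, 'n) module_scheme \<Rightarrow> ('a \<Rightarrow> 'b \<Rightarrow> complex) \<Rightarrow> bool"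
  where "bil V W F \<longleftrightarrow> (\<forall>v\<in>carrier V. lin W (\<lambda>w. F v w)) \<and> (\<forall>w\<in>carrier W. lin V (\<lambda>v. F v w))"

lemma balanced_tensor_vs: "vs V \<Longrightarrow> vs W \<Longrightarrow> balanced_tensor UNIV V W"
  by (rule balanced_tensor.intro) (auto intro: vs_abelian)

lemma tensor_simps:
  "carrier (V \<otimes>\<^sub>\<complex> W) = carrier (tensor_group UNIV V W)"
  "s \<oplus>\<^bsub>V \<otimes>\<^sub>\<complex> W\<^esub> t = s \<otimes>\<^bsub>tensor_group UNIV V W\<^esub> t"
  "\<zero>\<^bsub>V \<otimes>\<^sub>\<complex> W\<^esub> = \<one>\<^bsub>tensor_group UNIV V W\<^esub>"
  "c \<odot>\<^bsub>V \<otimes>\<^sub>\<complex> W\<^esub> t = tensor_lift UNIV V W (tensor_group UNIV V W) (\<lambda>v w. pure_tensor V W (c \<odot>\<^bsub>V\<^esub> v) w) t"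
  by (simp_all add: tensor_def Let_def)

context
  fixes V :: "(complex, 'a, 'm) module_scheme" and W :: "(complex, 'b, 'n) module_scheme"
  assumes V: "vs V" and W: "vs W"
begin

interpretation balanced_tensor UNIV V W by (rule balanced_tensor_vs[OF V W])
interpretation Tg: comm_group Tg by (rule tensor_comm_group)

lemma smult_hom: "(\<lambda>t. c \<odot>\<^bsub>V \<otimes>\<^sub>\<complex> W\<^esub> t) \<in> hom Tg Tg"
  and smult_pure: "v \<in> carrier V \<Longrightarrow> w \<in> carrier W \<Longrightarrow>
    c \<odot>\<^bsub>V \<otimes>\<^sub>\<complex> W\<^esub> pure_tensor V W v w = pure_tensor V W (c \<odot>\<^bsub>V\<^esub> v) w"
proof -
  have "(c \<odot>\<^bsub>V\<^esub> (r \<odot>\<^bsub>V\<^esub> m)) = r \<odot>\<^bsub>V\<^esub> (c \<odot>\<^bsub>V\<^esub> m)" if "m \<in> carrier V" for r m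
    using that V by (simp add: vs_simps mult.commute)
  then have b: "te (c \<odot>\<^bsub>V\<^esub> (r \<odot>\<^bsub>V\<^esub> m)) n = te (c \<odot>\<^bsub>V\<^esub> m) (r \<odot>\<^bsub>W\<^esub> n)"
    if "m \<in> carrier V" "n \<in> carrier W" for r m n
    using that te_balanced[of r "c \<odot>\<^bsub>V\<^esub> m" n] V by simp
  note l = tensor_lift[OF Tg.comm_group_axioms, where h = "\<lambda>v w. te (c \<odot>\<^bsub>V\<^esub> v) w"]
  show "(\<lambda>t. c \<odot>\<^bsub>V \<otimes>\<^sub>\<complex> W\<^esub> t) \<in> hom Tg Tg"
    unfolding tensor_simps by (rule l(1)) (simp_all add: V W vs_distrib te_add_left te_add_right b)
  show "c \<odot>\<^bsub>V \<otimes>\<^sub>\<complex> W\<^esub> pure_tensor V W v w = pure_tensor V W (c \<odot>\<^bsub>V\<^esub> v) w"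
    if "v \<in> carrier V" "w \<in> carrier W"
    unfolding tensor_simps by (rule l(2)) (simp_all add: V W vs_distrib te_add_left te_add_right b that)
qed

lemma vs_tensor: "vs (V \<otimes>\<^sub>\<complex> W)"
proof -
  interpret s: group_hom Tg Tg "\<lambda>t. c \<odot>\<^bsub>V \<otimes>\<^sub>\<complex> W\<^esub> t" for c
    using smult_hom by unfold_locales
  show ?thesis
  proof (rule vsI)
    show "abelian_group (V \<otimes>\<^sub>\<complex> W)"
      by (rule abelian_groupI)
        (auto simp: tensor_simps(1-3) Tg.m_ac intro: bexI[of _ "inv\<^bsub>Tg\<^esub> x" for x])
  next
    fix a x assume "x \<in> carrier (V \<otimes>\<^sub>\<complex> W)"
    then show "a \<odot>\<^bsub>V \<otimes>\<^sub>\<complex> W\<^esub> x \<in> carrier (V \<otimes>\<^sub>\<complex> W)"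
      using s.hom_closed by (simp add: tensor_simps(1))
  next
    fix a x y assume "x \<in> carrier (V \<otimes>\<^sub>\<complex> W)" "y \<in> carrier (V \<otimes>\<^sub>\<complex> W)"
    then show "a \<odot>\<^bsub>V \<otimes>\<^sub>\<complex> W\<^esub> (x \<oplus>\<^bsub>V \<otimes>\<^sub>\<complex> W\<^esub> y) = a \<odot>\<^bsub>V \<otimes>\<^sub>\<complex> W\<^esub> x \<oplus>\<^bsub>V \<otimes>\<^sub>\<complex> W\<^esub> a \<odot>\<^bsub>V \<otimes>\<^sub>\<complex> W\<^esub> y"
      using s.hom_mult by (simp add: tensor_simps(1,2))
  next
    fix a b x assume "x \<in> carrier (V \<otimes>\<^sub>\<complex> W)"
    then have x: "x \<in> carrier Tg" by (simp add: tensor_simps)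
    have c: "c \<odot>\<^bsub>V \<otimes>\<^sub>\<complex> W\<^esub> s \<in> carrier Tg" if "s \<in> carrier Tg" for c s
      using s.hom_closed that .
    from x show "(a + b) \<odot>\<^bsub>V \<otimes>\<^sub>\<complex> W\<^esub> x = a \<odot>\<^bsub>V \<otimes>\<^sub>\<complex> W\<^esub> x \<oplus>\<^bsub>V \<otimes>\<^sub>\<complex> W\<^esub> b \<odot>\<^bsub>V \<otimes>\<^sub>\<complex> W\<^esub> x"
      unfolding tensor_simps(2)
    proof (induction rule: tensor_induct)
      case (mult m n s)
      then show ?case
        by (simp add: s.hom_mult smult_pure vs_distrib V te_add_left c Tg.m_ac)
    qed simp
    from x show "(a * b) \<odot>\<^bsub>V \<otimes>\<^sub>\<complex> W\<^esub> x = a \<odot>\<^bsub>V \<otimes>\<^sub>\<complex> W\<^esub> (b \<odot>\<^bsub>V \<otimes>\<^sub>\<complex> W\<^esub> x)"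
    proof (induction rule: tensor_induct)
      case (mult m n s)
      then show ?case
        by (simp add: s.hom_mult smult_pure vs_simps V c)
    qed simp
  next
    fix x assume "x \<in> carrier (V \<otimes>\<^sub>\<complex> W)"
    then have "x \<in> carrier Tg" by (simp add: tensor_simps)
    then show "1 \<odot>\<^bsub>V \<otimes>\<^sub>\<complex> W\<^esub> x = x"
    proof (induction rule: tensor_induct)
      case (mult m n s)
      then show ?case
        by (simp add: s.hom_mult smult_pure vs_simps V)
    qed simp
  qed
qed

lemma pure_closed: "v \<in> carrier V \<Longrightarrow> w \<in> carrier W \<Longrightarrow> pure_tensor V W v w \<in> carrier (V \<otimes>\<^sub>\<complex> W)"
  by (simp add: tensor_simps)

lemma pure_linear_left: "w \<in> carrier W \<Longrightarrow> (\<lambda>v. pure_tensor V W v w) \<in> linear_maps V (V \<otimes>\<^sub>\<complex> W)"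
  by (rule linear_mapsI) (auto simp: pure_closed tensor_simps(2) te_add_left smult_pure)

lemma pure_linear_right: "v \<in> carrier V \<Longrightarrow> (\<lambda>w. pure_tensor V W v w) \<in> linear_maps W (V \<otimes>\<^sub>\<complex> W)"
  by (rule linear_mapsI) (auto simp: pure_closed tensor_simps(2) te_add_right smult_pure te_balanced)

lemma tensor_presentation:
  assumes "t \<in> carrier (V \<otimes>\<^sub>\<complex> W)"
  shows "\<exists>xs. set xs \<subseteq> carrier V \<times> carrier W \<and>
    t = foldr (\<lambda>p s. pure_tensor V W (fst p) (snd p) \<oplus>\<^bsub>V \<otimes>\<^sub>\<complex> W\<^esub> s) xs \<zero>\<^bsub>V \<otimes>\<^sub>\<complex> W\<^esub>"
proof -
  obtain xs where "set xs \<subseteq> carrier V \<times> carrier W" "t = terep xs"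
    by (rule tensor_rep[OF assms[unfolded tensor_simps(1)]])
  then show ?thesis unfolding tensor_simps by (intro exI[of _ xs]) simp
qed

lemma bilinear_lift_props:
  fixes U :: "(complex, 'c, 'k) module_scheme"
  assumes U: "vs U"
    and r: "\<And>v. v \<in> carrier V \<Longrightarrow> (\<lambda>w. h v w) \<in> linear_maps W U"
    and l: "\<And>w. w \<in> carrier W \<Longrightarrow> (\<lambda>v. h v w) \<in> linear_maps V U"
  shows "bilinear_lift V W U h \<in> linear_maps (V \<otimes>\<^sub>\<complex> W) U"
    and "\<And>v w. v \<in> carrier V \<Longrightarrow> w \<in> carrier W \<Longrightarrow> bilinear_lift V W U h (pure_tensor V W v w) = h v w"
proof -
  note ll = linear_maps_apply[OF l] and rr = linear_maps_apply[OF r]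
  have G: "comm_group (add_monoid U)"
    by (rule comm_group_add_monoid[OF vs_abelian[OF U]])
  note L = tensor_lift[OF G, where h = h, folded bilinear_lift_def]
  have hom: "bilinear_lift V W U h \<in> hom Tg (add_monoid U)"
    by (rule L(1)) (simp_all add: ll rr)
  show pure: "\<And>v w. v \<in> carrier V \<Longrightarrow> w \<in> carrier W \<Longrightarrow> bilinear_lift V W U h (pure_tensor V W v w) = h v w"
    by (rule L(2)) (simp_all add: ll rr)
  interpret s: group_hom Tg Tg "\<lambda>t. c \<odot>\<^bsub>V \<otimes>\<^sub>\<complex> W\<^esub> t" for c
    using smult_hom by unfold_locales
  interpret h: group_hom Tg "add_monoid U" "bilinear_lift V W U h"
    using hom comm_group.axioms(2)[OF G]
    by (auto simp: group_hom_def group_hom_axioms_def Tg.is_group)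
  note hm = h.hom_mult[simplified] and hc = h.hom_closed[simplified]
  show "bilinear_lift V W U h \<in> linear_maps (V \<otimes>\<^sub>\<complex> W) U"
  proof (rule linear_mapsI)
    fix c x assume "x \<in> carrier (V \<otimes>\<^sub>\<complex> W)"
    then have "x \<in> carrier Tg" by (simp add: tensor_simps)
    then show "bilinear_lift V W U h (c \<odot>\<^bsub>V \<otimes>\<^sub>\<complex> W\<^esub> x) = c \<odot>\<^bsub>U\<^esub> bilinear_lift V W U h x"
    proof (induction rule: tensor_induct)
      case one
      then show ?case using h.hom_one U by (simp add: vs_simps)
    next
      case (mult m n s)
      then show ?case
        by (simp add: s.hom_mult smult_pure V hm s.hom_closed pure ll vs_distrib U hc)
    qed
  qed (use hm hc in \<open>auto simp: tensor_simps\<close>)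
qed

end

text \<open>Sweedler notation: \<open>tsum V W t F\<close> is \<open>\<Sum> F(v, w)\<close> for \<open>t = \<Sum> v \<otimes> w\<close>, and \<open>tvec\<close> is the
  same sum with values in a module. The sums run over one chosen presentation of \<open>t\<close>. Hence they are finite sums
  for every \<open>F\<close>, which may be exchanged freely, and they are independent of the presentation whenever \<open>F\<close> is
  bilinear. The guards on the carriers make it possible to rewrite under the sum with membership facts.\<close>

definition presentation ::
    "(complex, 'a, 'm) module_scheme \<Rightarrow> (complex, 'b, 'n) module_scheme \<Rightarrow> ('a, 'b) tens \<Rightarrow> ('a \<times> 'b) list"
  where "presentation V W t = (SOME xs. set xs \<subseteq> carrier V \<times> carrier W \<and>
    t = foldr (\<lambda>p s. pure_tensor V W (fst p) (snd p) \<oplus>\<^bsub>V \<otimes>\<^sub>\<complex> W\<^esub> s) xs \<zero>\<^bsub>V \<otimes>\<^sub>\<complex> W\<^esub>)"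

definition tsum ::
    "(complex, 'a, 'm) module_scheme \<Rightarrow> (complex, 'b, 'n) module_scheme \<Rightarrow> ('a, 'b) tens \<Rightarrow>
      ('a \<Rightarrow> 'b \<Rightarrow> complex) \<Rightarrow> complex"
  where "tsum V W t F = (\<Sum>(v, w)\<leftarrow>presentation V W t. if v \<in> carrier V \<and> w \<in> carrier W then F v w else 0)"

definition tvec ::
    "(complex, 'a, 'm) module_scheme \<Rightarrow> (complex, 'b, 'n) module_scheme \<Rightarrow> (complex, 'c, 'k) module_scheme
      \<Rightarrow> ('a, 'b) tens \<Rightarrow> ('a \<Rightarrow> 'b \<Rightarrow> 'c) \<Rightarrow> 'c"
  where "tvec V W U t h =
    foldr (\<lambda>(v, w) s. if v \<in> carrier V \<and> w \<in> carrier W then h v w \<oplus>\<^bsub>U\<^esub> s else s) (presentation V W t) \<zero>\<^bsub>U\<^esub>"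

lemma tsum_cong [cong]:
  "V = V' \<Longrightarrow> W = W' \<Longrightarrow> t = t' \<Longrightarrow> (\<And>v w. v \<in> carrier V' \<Longrightarrow> w \<in> carrier W' \<Longrightarrow> F v w = G v w) \<Longrightarrow>
    tsum V W t F = tsum V' W' t' G"
  unfolding tsum_def by (intro arg_cong[of _ _ sum_list] map_cong) auto

lemmas tsum_body = tsum_cong[OF refl refl refl]

lemma sum_list_linear:
  "(\<Sum>x\<leftarrow>xs. c * f x) = c * (\<Sum>x\<leftarrow>xs. f x :: complex)"
  by (induction xs) (auto simp: algebra_simps)

lemma tsum_add: "tsum V W t (\<lambda>v w. F v w + G v w) = tsum V W t F + tsum V W t G"
  unfolding tsum_def sum_list_addf[symmetric] by (intro arg_cong[of _ _ sum_list] map_cong) auto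

lemma tsum_cmult: "tsum V W t (\<lambda>v w. c * F v w) = c * tsum V W t F"
  unfolding tsum_def sum_list_linear[symmetric] by (intro arg_cong[of _ _ sum_list] map_cong) auto

lemma tsum_multc: "tsum V W t (\<lambda>v w. F v w * c) = tsum V W t F * c"
  using tsum_cmult[of V W t c F] by (simp add: mult.commute)

lemma tsum_diff: "tsum V W t (\<lambda>v w. F v w - G v w) = tsum V W t F - tsum V W t G"
  using tsum_add[of V W t F "\<lambda>v w. - 1 * G v w"] tsum_cmult[of V W t "- 1" G] by simp

lemma tsum_swap:
  "tsum V W t (\<lambda>v w. tsum V' W' t' (\<lambda>v' w'. F v w v' w')) =
    tsum V' W' t' (\<lambda>v' w'. tsum V W t (\<lambda>v w. F v w v' w'))"
proof -
  have "(\<Sum>x\<leftarrow>xs. \<Sum>y\<leftarrow>ys. f x y) = (\<Sum>y\<leftarrow>ys. \<Sum>x\<leftarrow>xs. f x y :: complex)" for xs ys f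
    by (induction xs) (auto simp: sum_list_addf sum_list_0)
  note s = this
  have i: "(if P then sum_list (map g ys) else 0) = (\<Sum>y\<leftarrow>ys. if P then g y else (0::complex))" for P g ys
    by (cases P) (auto simp: sum_list_0)
  show ?thesis
    unfolding tsum_def case_prod_beta i
    by (subst s) (intro arg_cong[of _ _ sum_list] map_cong refl, auto)
qed

context
  fixes V :: "(complex, 'a, 'm) module_scheme" and W :: "(complex, 'b, 'n) module_scheme"
  assumes V: "vs V" and W: "vs W"
begin

interpretation balanced_tensor UNIV V W by (rule balanced_tensor_vs[OF V W])

lemma presentation:
  assumes "t \<in> carrier (V \<otimes>\<^sub>\<complex> W)"
  shows "set (presentation V W t) \<subseteq> carrier V \<times> carrier W"
    and "t = foldr (\<lambda>p s. pure_tensor V W (fst p) (snd p) \<oplus>\<^bsub>V \<otimes>\<^sub>\<complex> W\<^esub> s) (presentation V W t) \<zero>\<^bsub>V \<otimes>\<^sub>\<complex> W\<^esub>"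
  using someI_ex[OF tensor_presentation[OF V W assms]] unfolding presentation_def by blast+

text \<open>The origin of all rules for \<open>tsum\<close>: a functional on \<open>V \<otimes> W\<close> is summed over the presentation.\<close>

lemma lin_presentation:
  assumes t: "t \<in> carrier (V \<otimes>\<^sub>\<complex> W)" and \<Phi>: "lin (V \<otimes>\<^sub>\<complex> W) \<Phi>"
  shows "\<Phi> t = tsum V W t (\<lambda>v w. \<Phi> (pure_tensor V W v w))"
proof -
  have "set xs \<subseteq> carrier V \<times> carrier W \<Longrightarrow>
      foldr (\<lambda>p s. pure_tensor V W (fst p) (snd p) \<oplus>\<^bsub>V \<otimes>\<^sub>\<complex> W\<^esub> s) xs \<zero>\<^bsub>V \<otimes>\<^sub>\<complex> W\<^esub> \<in> carrier (V \<otimes>\<^sub>\<complex> W) \<and>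
      \<Phi> (foldr (\<lambda>p s. pure_tensor V W (fst p) (snd p) \<oplus>\<^bsub>V \<otimes>\<^sub>\<complex> W\<^esub> s) xs \<zero>\<^bsub>V \<otimes>\<^sub>\<complex> W\<^esub>) =
      (\<Sum>(v, w)\<leftarrow>xs. if v \<in> carrier V \<and> w \<in> carrier W then \<Phi> (pure_tensor V W v w) else 0)" for xs
    by (induction xs) (use vs_tensor[OF V W] in \<open>auto simp: lin_zero[OF \<Phi>] lin_apply[OF \<Phi>] pure_closed[OF V W]\<close>)
  from this[OF presentation(1)[OF t]] show ?thesis
    using presentation(2)[OF t] by (simp add: tsum_def)
qed

lemma bil_lift:
  assumes F: "bil V W F"
  shows "lin (V \<otimes>\<^sub>\<complex> W) (bilinear_lift V W complex_space F)"
    and "\<And>v w. v \<in> carrier V \<Longrightarrow> w \<in> carrier W \<Longrightarrow> bilinear_lift V W complex_space F (pure_tensor V W v w) = F v w"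
  using bilinear_lift_props[OF V W vs_complex_space, of F] F by (simp_all add: bil_def lin_iff)

lemma bil_lift_tsum:
  assumes F: "bil V W F" and t: "t \<in> carrier (V \<otimes>\<^sub>\<complex> W)"
  shows "bilinear_lift V W complex_space F t = tsum V W t F"
  using lin_presentation[OF t bil_lift(1)[OF F]] by (simp add: bil_lift(2)[OF F])

lemma lin_tsum:
  assumes F: "bil V W F"
  shows "lin (V \<otimes>\<^sub>\<complex> W) (\<lambda>t. tsum V W t F)"
  using bil_lift(1)[OF F] vs_tensor[OF V W] by (simp add: lin_def bil_lift_tsum[OF F])

lemma tsum_pure:
  assumes "bil V W F" "v \<in> carrier V" "w \<in> carrier W"
  shows "tsum V W (pure_tensor V W v w) F = F v w"
  using bil_lift(2)[OF assms] bil_lift_tsum[OF assms(1)] pure_closed[OF V W] assms by metis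

lemma lin_bilinear_lift:
  assumes U: "vs U"
    and r: "\<And>v. v \<in> carrier V \<Longrightarrow> (\<lambda>w. h v w) \<in> linear_maps W U"
    and l: "\<And>w. w \<in> carrier W \<Longrightarrow> (\<lambda>v. h v w) \<in> linear_maps V U"
    and t: "t \<in> carrier (V \<otimes>\<^sub>\<complex> W)" and \<phi>: "lin U \<phi>"
  shows "\<phi> (bilinear_lift V W U h t) = tsum V W t (\<lambda>v w. \<phi> (h v w))"
proof -
  note L = bilinear_lift_props[OF V W U r l]
  have "lin (V \<otimes>\<^sub>\<complex> W) (\<lambda>t. \<phi> (bilinear_lift V W U h t))"
    using linear_maps_apply[OF L(1)] lin_apply[OF \<phi>] by (simp add: lin_def)
  from lin_presentation[OF t this] show ?thesis by (simp add: L(2))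
qed

lemma tvec_closed:
  assumes "vs U" "\<And>v w. v \<in> carrier V \<Longrightarrow> w \<in> carrier W \<Longrightarrow> h v w \<in> carrier U"
  shows "tvec V W U t h \<in> carrier U"
proof -
  have "foldr (\<lambda>(v, w) s. if v \<in> carrier V \<and> w \<in> carrier W then h v w \<oplus>\<^bsub>U\<^esub> s else s) xs \<zero>\<^bsub>U\<^esub> \<in> carrier U" for xs
    by (induction xs) (use assms in auto)
  then show ?thesis by (simp add: tvec_def)
qed

lemma lin_tvec:
  assumes U: "vs U" and h: "\<And>v w. v \<in> carrier V \<Longrightarrow> w \<in> carrier W \<Longrightarrow> h v w \<in> carrier U" and \<phi>: "lin U \<phi>"
  shows "\<phi> (tvec V W U t h) = tsum V W t (\<lambda>v w. \<phi> (h v w))"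
proof -
  have "foldr (\<lambda>(v, w) s. if v \<in> carrier V \<and> w \<in> carrier W then h v w \<oplus>\<^bsub>U\<^esub> s else s) xs \<zero>\<^bsub>U\<^esub> \<in> carrier U \<and>
    \<phi> (foldr (\<lambda>(v, w) s. if v \<in> carrier V \<and> w \<in> carrier W then h v w \<oplus>\<^bsub>U\<^esub> s else s) xs \<zero>\<^bsub>U\<^esub>)
     = (\<Sum>(v, w)\<leftarrow>xs. if v \<in> carrier V \<and> w \<in> carrier W then \<phi> (h v w) else 0)" for xs
    by (induction xs) (use U h lin_apply[OF \<phi>] lin_zero[OF \<phi> U] in auto)
  then show ?thesis by (simp add: tvec_def tsum_def)
qed

text \<open>Products of functionals separate the points of a tensor product: on the finitely many vectors that
  occur in a presentation, an arbitrary bilinear form agrees with a sum of products.\<close>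

lemma tensor_eqI:
  assumes s: "s \<in> carrier (V \<otimes>\<^sub>\<complex> W)" and t: "t \<in> carrier (V \<otimes>\<^sub>\<complex> W)"
    and eq: "\<And>\<alpha> \<beta>. lin V \<alpha> \<Longrightarrow> lin W \<beta> \<Longrightarrow> tsum V W s (\<lambda>v w. \<alpha> v * \<beta> w) = tsum V W t (\<lambda>v w. \<alpha> v * \<beta> w)"
  shows "s = t"
proof (rule vs_eqI[OF vs_tensor[OF V W] s t])
  fix \<Phi> assume \<Phi>: "lin (V \<otimes>\<^sub>\<complex> W) \<Phi>"
  define F where "F v w = \<Phi> (pure_tensor V W v w)" for v w
  have F: "lin W (\<lambda>w. F v w)" if "v \<in> carrier V" for v
    unfolding F_def
    using linear_maps_apply[OF pure_linear_right[OF V W that]] lin_apply[OF \<Phi>] by (simp add: lin_def)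
  have F': "lin V (\<lambda>v. F v w)" if "w \<in> carrier W" for w
    unfolding F_def
    using linear_maps_apply[OF pure_linear_left[OF V W that]] lin_apply[OF \<Phi>] by (simp add: lin_def)
  let ?xs = "map fst (presentation V W s @ presentation V W t)"
  have "set ?xs \<subseteq> carrier V" using presentation(1)[OF s] presentation(1)[OF t] by auto
  from finite_rank_identity[OF V this] obtain es where
    es: "\<And>e \<alpha>. (e, \<alpha>) \<in> set es \<Longrightarrow> e \<in> carrier V \<and> lin V \<alpha>"
    and id: "\<And>x \<phi>. x \<in> set ?xs \<Longrightarrow> lin V \<phi> \<Longrightarrow> \<phi> x = (\<Sum>(e, \<alpha>)\<leftarrow>es. \<alpha> x * \<phi> e)" by blast
  have *: "tsum V W u F = (\<Sum>(e, \<alpha>)\<leftarrow>es. tsum V W u (\<lambda>v w. \<alpha> v * F e w))"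
    if "set (map fst (presentation V W u)) \<subseteq> set ?xs" for u
  proof -
    have "tsum V W u F = (\<Sum>(v, w)\<leftarrow>presentation V W u.
        if v \<in> carrier V \<and> w \<in> carrier W then (\<Sum>(e, \<alpha>)\<leftarrow>es. \<alpha> v * F e w) else 0)"
      unfolding tsum_def
    proof (intro arg_cong[of _ _ sum_list] map_cong refl, clarify)
      fix v w assume vw: "(v, w) \<in> set (presentation V W u)"
      have "v \<in> set ?xs" using that vw by force
      then show "(if v \<in> carrier V \<and> w \<in> carrier W then F v w else 0) =
          (if v \<in> carrier V \<and> w \<in> carrier W then \<Sum>(e, \<alpha>)\<leftarrow>es. \<alpha> v * F e w else 0)"
        using id[OF _ F'] by auto
    qed
    also have "\<dots> = (\<Sum>(e, \<alpha>)\<leftarrow>es. tsum V W u (\<lambda>v w. \<alpha> v * F e w))"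
    proof -
      have "(\<Sum>(v, w)\<leftarrow>xs. if v \<in> carrier V \<and> w \<in> carrier W then (\<Sum>(e, \<alpha>)\<leftarrow>es. \<alpha> v * F e w) else 0) =
        (\<Sum>(e, \<alpha>)\<leftarrow>es. \<Sum>(v, w)\<leftarrow>xs. if v \<in> carrier V \<and> w \<in> carrier W then \<alpha> v * F e w else 0)" for xs
        by (induction xs) (auto simp: sum_list_addf[symmetric] case_prod_beta sum_list_0)
      then show ?thesis unfolding tsum_def .
    qed
    finally show ?thesis .
  qed
  have "\<Phi> s = tsum V W s F" "\<Phi> t = tsum V W t F"
    using lin_presentation[OF s \<Phi>] lin_presentation[OF t \<Phi>] by (simp_all add: F_def)
  moreover have "tsum V W s F = tsum V W t F"
    by (subst (1 2) *) (auto intro!: arg_cong[of _ _ sum_list] eq dest!: es intro: F)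
  ultimately show "\<Phi> s = \<Phi> t" by simp
qed

end

section \<open>Sweedler sums\<close>

text \<open>The simplifier has to discharge many linearity conditions on nested sums. The closure rules below are
  stated with an inner linear map, so that they apply to every argument position of such a sum.\<close>

declare vs_tensor [simp] pure_closed [simp]

definition tril ::
    "(complex, 'a, 'm) module_scheme \<Rightarrow> (complex, 'b, 'n) module_scheme \<Rightarrow> (complex, 'c, 'k) module_scheme
      \<Rightarrow> ('a \<Rightarrow> 'b \<Rightarrow> 'c \<Rightarrow> complex) \<Rightarrow> bool"
  where "tril U V W F \<longleftrightarrow>
    (\<forall>u\<in>carrier U. \<forall>v\<in>carrier V. lin W (\<lambda>w. F u v w)) \<and>
    (\<forall>u\<in>carrier U. \<forall>w\<in>carrier W. lin V (\<lambda>v. F u v w)) \<and>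
    (\<forall>v\<in>carrier V. \<forall>w\<in>carrier W. lin U (\<lambda>u. F u v w))"

lemma lin_comp: "lin W \<alpha> \<Longrightarrow> f \<in> linear_maps V W \<Longrightarrow> lin V (\<lambda>v. \<alpha> (f v))"
  using linear_maps_apply[of f V W] lin_apply[of W \<alpha>] by (simp add: lin_def)

lemma tril_comp:
  assumes "tril A B C F"
  shows "f \<in> linear_maps V A \<Longrightarrow> b \<in> carrier B \<Longrightarrow> c \<in> carrier C \<Longrightarrow> lin V (\<lambda>v. F (f v) b c)"
    and "g \<in> linear_maps V B \<Longrightarrow> a \<in> carrier A \<Longrightarrow> c \<in> carrier C \<Longrightarrow> lin V (\<lambda>v. F a (g v) c)"
    and "h \<in> linear_maps V C \<Longrightarrow> a \<in> carrier A \<Longrightarrow> b \<in> carrier B \<Longrightarrow> lin V (\<lambda>v. F a b (h v))"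
  using assms lin_comp[of A "\<lambda>a. F a b c" f V] lin_comp[of B "\<lambda>b. F a b c" g V] lin_comp[of C "F a b" h V]
  unfolding tril_def by blast+

lemma bil_comp:
  assumes "bil A B F"
  shows "f \<in> linear_maps V A \<Longrightarrow> b \<in> carrier B \<Longrightarrow> lin V (\<lambda>v. F (f v) b)"
    and "g \<in> linear_maps V B \<Longrightarrow> a \<in> carrier A \<Longrightarrow> lin V (\<lambda>v. F a (g v))"
  using assms lin_comp[of A "\<lambda>a. F a b" f V] lin_comp[of B "F a" g V]
  unfolding bil_def by blast+

lemma lin_closure [simp]:
  "lin V (\<lambda>v. 0)"
  "lin V f \<Longrightarrow> lin V (\<lambda>v. c * f v)"
  "lin V f \<Longrightarrow> lin V (\<lambda>v. f v * c)"
  "lin V f \<Longrightarrow> lin V g \<Longrightarrow> lin V (\<lambda>v. f v + g v)"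
  by (auto simp: lin_def algebra_simps)

lemma lin_tsum_body [simp]:
  assumes "\<And>x y. x \<in> carrier A \<Longrightarrow> y \<in> carrier B \<Longrightarrow> lin V (\<lambda>v. G v x y)"
  shows "lin V (\<lambda>v. tsum A B t (\<lambda>x y. G v x y))"
proof -
  have "tsum A B t (\<lambda>x y. G (v \<oplus>\<^bsub>V\<^esub> v') x y) = tsum A B t (\<lambda>x y. G v x y) + tsum A B t (\<lambda>x y. G v' x y)"
    if "v \<in> carrier V" "v' \<in> carrier V" for v v'
    unfolding tsum_add[symmetric] by (rule tsum_cong) (use assms that in \<open>auto simp: lin_def\<close>)
  moreover have "tsum A B t (\<lambda>x y. G (c \<odot>\<^bsub>V\<^esub> v) x y) = c * tsum A B t (\<lambda>x y. G v x y)"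
    if "v \<in> carrier V" for v c
    unfolding tsum_cmult[symmetric] by (rule tsum_cong) (use assms that in \<open>auto simp: lin_def\<close>)
  ultimately show ?thesis by (simp add: lin_def)
qed

lemma lin_tsum_arg [simp]:
  assumes "vs A" "vs B" "bil A B G" "f \<in> linear_maps V (A \<otimes>\<^sub>\<complex> B)"
  shows "lin V (\<lambda>v. tsum A B (f v) G)"
  using lin_comp[OF lin_tsum[OF assms(1-3)] assms(4)] .

lemma linear_maps_id [simp]: "(\<lambda>v. v) \<in> linear_maps V V" "id \<in> linear_maps V V"
  by (auto simp: linear_maps_iff)

lemma linear_maps_comp: "g \<in> linear_maps V W \<Longrightarrow> f \<in> linear_maps U V \<Longrightarrow> (\<lambda>u. g (f u)) \<in> linear_maps U W"
  by (auto simp: linear_maps_iff)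

lemma linear_maps_pure [simp]:
  "vs V \<Longrightarrow> vs W \<Longrightarrow> f \<in> linear_maps U V \<Longrightarrow> w \<in> carrier W \<Longrightarrow>
    (\<lambda>u. pure_tensor V W (f u) w) \<in> linear_maps U (V \<otimes>\<^sub>\<complex> W)"
  "vs V \<Longrightarrow> vs W \<Longrightarrow> g \<in> linear_maps U W \<Longrightarrow> v \<in> carrier V \<Longrightarrow>
    (\<lambda>u. pure_tensor V W v (g u)) \<in> linear_maps U (V \<otimes>\<^sub>\<complex> W)"
  by (rule linear_maps_comp[OF pure_linear_left] linear_maps_comp[OF pure_linear_right]; assumption)+

lemma linear_maps_smult [simp]:
  "vs V \<Longrightarrow> f \<in> linear_maps U V \<Longrightarrow> (\<lambda>u. c \<odot>\<^bsub>V\<^esub> f u) \<in> linear_maps U V"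
  "vs V \<Longrightarrow> lin U \<alpha> \<Longrightarrow> v \<in> carrier V \<Longrightarrow> (\<lambda>u. \<alpha> u \<odot>\<^bsub>V\<^esub> v) \<in> linear_maps U V"
  by (auto simp: linear_maps_iff lin_def vs_distrib vs_simps mult.commute)

lemma bilI:
  "(\<And>v. v \<in> carrier V \<Longrightarrow> lin W (\<lambda>w. F v w)) \<Longrightarrow> (\<And>w. w \<in> carrier W \<Longrightarrow> lin V (\<lambda>v. F v w)) \<Longrightarrow> bil V W F"
  by (auto simp: bil_def)

lemma trilI:
  "(\<And>u v. u \<in> carrier U \<Longrightarrow> v \<in> carrier V \<Longrightarrow> lin W (\<lambda>w. F u v w)) \<Longrightarrow>
   (\<And>u w. u \<in> carrier U \<Longrightarrow> w \<in> carrier W \<Longrightarrow> lin V (\<lambda>v. F u v w)) \<Longrightarrow>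
   (\<And>v w. v \<in> carrier V \<Longrightarrow> w \<in> carrier W \<Longrightarrow> lin U (\<lambda>u. F u v w)) \<Longrightarrow> tril U V W F"
  by (auto simp: tril_def)

declare bilI [simp] trilI [simp]

lemma tvec_closed' [simp]:
  "vs V \<Longrightarrow> vs W \<Longrightarrow> vs U \<Longrightarrow> (\<And>v w. v \<in> carrier V \<Longrightarrow> w \<in> carrier W \<Longrightarrow> h v w \<in> carrier U) \<Longrightarrow>
    tvec V W U t h \<in> carrier U"
  by (rule tvec_closed)

lemma tsum_tvec:
  assumes "vs V" "vs W" "vs A" "vs B" "\<And>v w. v \<in> carrier V \<Longrightarrow> w \<in> carrier W \<Longrightarrow> h v w \<in> carrier (A \<otimes>\<^sub>\<complex> B)" "bil A B F"
  shows "tsum A B (tvec V W (A \<otimes>\<^sub>\<complex> B) t h) F = tsum V W t (\<lambda>v w. tsum A B (h v w) F)"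
  by (rule lin_tvec[OF assms(1,2) _ assms(5) lin_tsum[OF assms(3,4,6)]]) (use assms in auto)

lemma tsum_bilinear_lift:
  assumes "vs V" "vs W" "vs A" "vs B" "t \<in> carrier (V \<otimes>\<^sub>\<complex> W)" "bil A B F"
    and "\<And>v. v \<in> carrier V \<Longrightarrow> (\<lambda>w. h v w) \<in> linear_maps W (A \<otimes>\<^sub>\<complex> B)"
    and "\<And>w. w \<in> carrier W \<Longrightarrow> (\<lambda>v. h v w) \<in> linear_maps V (A \<otimes>\<^sub>\<complex> B)"
  shows "tsum A B (bilinear_lift V W (A \<otimes>\<^sub>\<complex> B) h t) F = tsum V W t (\<lambda>v w. tsum A B (h v w) F)"
  by (rule lin_bilinear_lift[OF assms(1,2) _ assms(7,8,5) lin_tsum[OF assms(3,4,6)]]) (use assms in auto)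

lemma bilinear_lift_linear_left:
  assumes V: "vs V" and W: "vs W" and A: "vs A"
    and "\<And>v w. v \<in> carrier V \<Longrightarrow> w \<in> carrier W \<Longrightarrow> (\<lambda>u. h u v w) \<in> linear_maps U A"
    and "\<And>u v. u \<in> carrier U \<Longrightarrow> v \<in> carrier V \<Longrightarrow> (\<lambda>w. h u v w) \<in> linear_maps W A"
    and "\<And>u w. u \<in> carrier U \<Longrightarrow> w \<in> carrier W \<Longrightarrow> (\<lambda>v. h u v w) \<in> linear_maps V A"
    and U: "vs U" and t: "t \<in> carrier (V \<otimes>\<^sub>\<complex> W)"
  shows "(\<lambda>u. bilinear_lift V W A (h u) t) \<in> linear_maps U A"
proof (rule linear_maps_by_functionals[OF U A])
  fix u assume "u \<in> carrier U"
  then show "bilinear_lift V W A (h u) t \<in> carrier A"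
    using linear_maps_apply(1)[OF bilinear_lift_props(1)[OF V W A]] assms(5,6) t by blast
next
  fix \<phi> assume \<phi>: "lin A \<phi>"
  have eq: "\<phi> (bilinear_lift V W A (h u) t) = tsum V W t (\<lambda>v w. \<phi> (h u v w))" if "u \<in> carrier U" for u
    by (rule lin_bilinear_lift[OF V W A _ _ t \<phi>]) (use assms that in auto)
  have "lin U (\<lambda>u. tsum V W t (\<lambda>v w. \<phi> (h u v w)))"
    by (rule lin_tsum_body) (rule lin_comp[OF \<phi> assms(4)])
  then show "lin U (\<lambda>u. \<phi> (bilinear_lift V W A (h u) t))"
    using U by (simp add: lin_def eq)
qed

lemma bilinear_lift_linear_arg:
  assumes "vs V" "vs W" "vs A"
    and "\<And>v. v \<in> carrier V \<Longrightarrow> (\<lambda>w. h v w) \<in> linear_maps W A"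
    and "\<And>w. w \<in> carrier W \<Longrightarrow> (\<lambda>v. h v w) \<in> linear_maps V A"
    and "f \<in> linear_maps U (V \<otimes>\<^sub>\<complex> W)"
  shows "(\<lambda>u. bilinear_lift V W A h (f u)) \<in> linear_maps U A"
  using linear_maps_comp[OF bilinear_lift_props(1)[OF assms(1-5)] assms(6)] .

lemma tensor_map_linear:
  assumes "vs V" "vs W" "vs V'" "vs W'" "f \<in> linear_maps V V'" "g \<in> linear_maps W W'"
  shows "tensor_map V W V' W' f g \<in> linear_maps (V \<otimes>\<^sub>\<complex> W) (V' \<otimes>\<^sub>\<complex> W')"
  unfolding tensor_map_def using assms linear_maps_apply(1)[OF assms(5)] linear_maps_apply(1)[OF assms(6)]
  by (intro bilinear_lift_props(1)) auto

lemma tensor_map_pure: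
  assumes "vs V" "vs W" "vs V'" "vs W'" "f \<in> linear_maps V V'" "g \<in> linear_maps W W'" "v \<in> carrier V" "w \<in> carrier W"
  shows "tensor_map V W V' W' f g (pure_tensor V W v w) = pure_tensor V' W' (f v) (g w)"
  unfolding tensor_map_def using assms linear_maps_apply(1)[OF assms(5)] linear_maps_apply(1)[OF assms(6)]
  by (intro bilinear_lift_props(2)) auto

lemma tensor_map_closed [simp]:
  "vs V \<Longrightarrow> vs W \<Longrightarrow> vs V' \<Longrightarrow> vs W' \<Longrightarrow> f \<in> linear_maps V V' \<Longrightarrow> g \<in> linear_maps W W' \<Longrightarrow>
    t \<in> carrier (V \<otimes>\<^sub>\<complex> W) \<Longrightarrow> tensor_map V W V' W' f g t \<in> carrier (V' \<otimes>\<^sub>\<complex> W')"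
  using tensor_map_linear linear_maps_apply(1) by metis

lemma tsum_tensor_map:
  assumes "vs V" "vs W" "vs V'" "vs W'" "f \<in> linear_maps V V'" "g \<in> linear_maps W W'"
    and "t \<in> carrier (V \<otimes>\<^sub>\<complex> W)" and F: "bil V' W' F"
  shows "tsum V' W' (tensor_map V W V' W' f g t) F = tsum V W t (\<lambda>v w. F (f v) (g w))"
proof -
  note fg = linear_maps_apply(1)[OF assms(5)] linear_maps_apply(1)[OF assms(6)]
  have "tsum V' W' (tensor_map V W V' W' f g t) F =
      tsum V W t (\<lambda>v w. tsum V' W' (pure_tensor V' W' (f v) (g w)) F)"
    unfolding tensor_map_def by (rule tsum_bilinear_lift) (use assms fg in auto)
  also have "\<dots> = tsum V W t (\<lambda>v w. F (f v) (g w))"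
    by (rule tsum_cong) (use assms fg in \<open>auto intro: tsum_pure\<close>)
  finally show ?thesis .
qed

context
  fixes U :: "(complex, 'a, 'm) module_scheme" and V :: "(complex, 'b, 'n) module_scheme"
    and W :: "(complex, 'c, 'k) module_scheme"
  assumes U: "vs U" and V: "vs V" and W: "vs W"
begin

lemma tensor_assoc_inner:
  assumes "w \<in> carrier W"
  shows "bilinear_lift U V (U \<otimes>\<^sub>\<complex> (V \<otimes>\<^sub>\<complex> W)) (\<lambda>u v. pure_tensor U (V \<otimes>\<^sub>\<complex> W) u (pure_tensor V W v w))
    \<in> linear_maps (U \<otimes>\<^sub>\<complex> V) (U \<otimes>\<^sub>\<complex> (V \<otimes>\<^sub>\<complex> W))"
  by (rule bilinear_lift_props(1)) (use U V W assms in auto)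

lemma tensor_assoc_outer:
  assumes "t \<in> carrier (U \<otimes>\<^sub>\<complex> V)"
  shows "(\<lambda>w. bilinear_lift U V (U \<otimes>\<^sub>\<complex> (V \<otimes>\<^sub>\<complex> W)) (\<lambda>u v. pure_tensor U (V \<otimes>\<^sub>\<complex> W) u (pure_tensor V W v w)) t)
    \<in> linear_maps W (U \<otimes>\<^sub>\<complex> (V \<otimes>\<^sub>\<complex> W))"
  by (rule bilinear_lift_linear_left) (use U V W assms in auto)

lemma tensor_assoc_linear: "tensor_assoc U V W \<in> linear_maps ((U \<otimes>\<^sub>\<complex> V) \<otimes>\<^sub>\<complex> W) (U \<otimes>\<^sub>\<complex> (V \<otimes>\<^sub>\<complex> W))"
  unfolding tensor_assoc_def
  by (rule bilinear_lift_props(1)) (use U V W tensor_assoc_inner tensor_assoc_outer in auto)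

lemma tensor_assoc_closed [simp]:
  "t \<in> carrier ((U \<otimes>\<^sub>\<complex> V) \<otimes>\<^sub>\<complex> W) \<Longrightarrow> tensor_assoc U V W t \<in> carrier (U \<otimes>\<^sub>\<complex> (V \<otimes>\<^sub>\<complex> W))"
  by (rule linear_maps_apply(1)[OF tensor_assoc_linear])

lemma tsum_tensor_assoc:
  assumes t: "t \<in> carrier ((U \<otimes>\<^sub>\<complex> V) \<otimes>\<^sub>\<complex> W)" and F: "bil U (V \<otimes>\<^sub>\<complex> W) F"
  shows "tsum U (V \<otimes>\<^sub>\<complex> W) (tensor_assoc U V W t) F =
    tsum (U \<otimes>\<^sub>\<complex> V) W t (\<lambda>s w. tsum U V s (\<lambda>u v. F u (pure_tensor V W v w)))"
proof -
  have "tsum U (V \<otimes>\<^sub>\<complex> W) (tensor_assoc U V W t) F =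
    tsum (U \<otimes>\<^sub>\<complex> V) W t (\<lambda>s w. tsum U (V \<otimes>\<^sub>\<complex> W)
      (bilinear_lift U V (U \<otimes>\<^sub>\<complex> (V \<otimes>\<^sub>\<complex> W)) (\<lambda>u v. pure_tensor U (V \<otimes>\<^sub>\<complex> W) u (pure_tensor V W v w)) s) F)"
    unfolding tensor_assoc_def
    by (rule tsum_bilinear_lift) (use U V W t F tensor_assoc_inner tensor_assoc_outer in auto)
  also have "\<dots> = tsum (U \<otimes>\<^sub>\<complex> V) W t (\<lambda>s w. tsum U V s (\<lambda>u v. tsum U (V \<otimes>\<^sub>\<complex> W) (pure_tensor U (V \<otimes>\<^sub>\<complex> W) u (pure_tensor V W v w)) F))"
    by (rule tsum_body, rule tsum_bilinear_lift) (use U V W F in auto)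
  also have "\<dots> = tsum (U \<otimes>\<^sub>\<complex> V) W t (\<lambda>s w. tsum U V s (\<lambda>u v. F u (pure_tensor V W v w)))"
    by (intro tsum_body tsum_pure) (use U V W F in auto)
  finally show ?thesis .
qed

lemma tensor_eqI3:
  assumes "s \<in> carrier (U \<otimes>\<^sub>\<complex> (V \<otimes>\<^sub>\<complex> W))" and t: "t \<in> carrier (U \<otimes>\<^sub>\<complex> (V \<otimes>\<^sub>\<complex> W))"
    and eq: "\<And>\<alpha> \<beta> \<gamma>. lin U \<alpha> \<Longrightarrow> lin V \<beta> \<Longrightarrow> lin W \<gamma> \<Longrightarrow>
      tsum U (V \<otimes>\<^sub>\<complex> W) s (\<lambda>u r. \<alpha> u * tsum V W r (\<lambda>v w. \<beta> v * \<gamma> w)) =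
      tsum U (V \<otimes>\<^sub>\<complex> W) t (\<lambda>u r. \<alpha> u * tsum V W r (\<lambda>v w. \<beta> v * \<gamma> w))"
  shows "s = t"
proof (rule tensor_eqI)
  fix \<alpha> \<Phi> assume \<alpha>: "lin U \<alpha>" and \<Phi>: "lin (V \<otimes>\<^sub>\<complex> W) \<Phi>"
  define \<Psi> where "\<Psi> r = tvec U (V \<otimes>\<^sub>\<complex> W) (V \<otimes>\<^sub>\<complex> W) r (\<lambda>u x. \<alpha> u \<odot>\<^bsub>V \<otimes>\<^sub>\<complex> W\<^esub> x)" for r
  have c: "\<Psi> r \<in> carrier (V \<otimes>\<^sub>\<complex> W)" for r
    unfolding \<Psi>_def using U V W by simp
  have ev: "\<phi> (\<Psi> r) = tsum U (V \<otimes>\<^sub>\<complex> W) r (\<lambda>u x. \<alpha> u * \<phi> x)" if \<phi>: "lin (V \<otimes>\<^sub>\<complex> W) \<phi>" for \<phi> r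
  proof -
    have "\<phi> (\<Psi> r) = tsum U (V \<otimes>\<^sub>\<complex> W) r (\<lambda>u x. \<phi> (\<alpha> u \<odot>\<^bsub>V \<otimes>\<^sub>\<complex> W\<^esub> x))"
      unfolding \<Psi>_def by (rule lin_tvec[OF U _ _ _ \<phi>]) (use V W in auto)
    then show ?thesis using lin_apply(2)[OF \<phi>] by simp
  qed
  have "\<Psi> s = \<Psi> t"
  proof (rule tensor_eqI[OF V W c c])
    fix \<beta> \<gamma> assume bg: "lin V \<beta>" "lin W \<gamma>"
    have "lin (V \<otimes>\<^sub>\<complex> W) (\<lambda>r. tsum V W r (\<lambda>v w. \<beta> v * \<gamma> w))"
      using bg by (intro lin_tsum V W bilI) auto
    from ev[OF this] show "tsum V W (\<Psi> s) (\<lambda>v w. \<beta> v * \<gamma> w) = tsum V W (\<Psi> t) (\<lambda>v w. \<beta> v * \<gamma> w)"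
      using eq[OF \<alpha> bg] by simp
  qed
  then show "tsum U (V \<otimes>\<^sub>\<complex> W) s (\<lambda>v w. \<alpha> v * \<Phi> w) = tsum U (V \<otimes>\<^sub>\<complex> W) t (\<lambda>v w. \<alpha> v * \<Phi> w)"
    using ev[OF \<Phi>] by metis
qed (use assms U V W in auto)

end

text \<open>A tensor lies in \<open>A \<otimes> V\<close> as soon as all its contractions against functionals on \<open>V\<close> lie in \<open>A\<close>.
  The conclusion says this without a change of carrier, by a projection that fixes \<open>A\<close>.\<close>

lemma left_leg_projection:
  fixes U :: "(complex, 'a, 'm) module_scheme" and V :: "(complex, 'b, 'n) module_scheme"
  assumes U: "vs U" and V: "vs V" and t: "t \<in> carrier (U \<otimes>\<^sub>\<complex> V)"
    and leg: "\<And>\<psi>. lin V \<psi> \<Longrightarrow> tvec U V U t (\<lambda>u v. \<psi> v \<odot>\<^bsub>U\<^esub> u) \<in> A"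
    and \<pi>: "\<pi> \<in> linear_maps U U" "\<And>u. u \<in> A \<Longrightarrow> \<pi> u = u"
  shows "tensor_map U V U V \<pi> id t = t"
    and "bil U V F \<Longrightarrow> tsum U V t (\<lambda>u v. F (\<pi> u) v) = tsum U V t F"
proof -
  show e: "tensor_map U V U V \<pi> id t = t"
  proof (rule tensor_eqI[OF U V _ t])
    fix \<alpha> \<beta> assume \<alpha>: "lin U \<alpha>" and \<beta>: "lin V \<beta>"
    have l: "\<phi> (tvec U V U t (\<lambda>u v. \<beta> v \<odot>\<^bsub>U\<^esub> u)) = tsum U V t (\<lambda>u v. \<phi> u * \<beta> v)" if "lin U \<phi>" for \<phi>
    proof -
      have "\<phi> (tvec U V U t (\<lambda>u v. \<beta> v \<odot>\<^bsub>U\<^esub> u)) = tsum U V t (\<lambda>u v. \<phi> (\<beta> v \<odot>\<^bsub>U\<^esub> u))"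
        by (rule lin_tvec[OF U V U _ that]) (use U in auto)
      then show ?thesis using lin_apply(2)[OF that] by (simp add: mult.commute)
    qed
    have "tsum U V (tensor_map U V U V \<pi> id t) (\<lambda>u v. \<alpha> u * \<beta> v) = tsum U V t (\<lambda>u v. \<alpha> (\<pi> u) * \<beta> v)"
      by (subst tsum_tensor_map) (use U V \<pi>(1) t \<alpha> \<beta> in auto)
    also have "\<dots> = \<alpha> (\<pi> (tvec U V U t (\<lambda>u v. \<beta> v \<odot>\<^bsub>U\<^esub> u)))"
      using l[OF lin_comp[OF \<alpha> \<pi>(1)]] by simp
    finally show "tsum U V (tensor_map U V U V \<pi> id t) (\<lambda>u v. \<alpha> u * \<beta> v) = tsum U V t (\<lambda>u v. \<alpha> u * \<beta> v)"
      using l[OF \<alpha>] \<pi>(2)[OF leg[OF \<beta>]] by simp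
  qed (use U V \<pi>(1) t in auto)
  assume "bil U V F"
  then show "tsum U V t (\<lambda>u v. F (\<pi> u) v) = tsum U V t F"
    using tsum_tensor_map[OF U V U V \<pi>(1) linear_maps_id(2) t] e by simp
qed

lemma right_leg_projection:
  fixes U :: "(complex, 'a, 'm) module_scheme" and V :: "(complex, 'b, 'n) module_scheme"
  assumes U: "vs U" and V: "vs V" and t: "t \<in> carrier (U \<otimes>\<^sub>\<complex> V)"
    and leg: "\<And>\<phi>. lin U \<phi> \<Longrightarrow> tvec U V V t (\<lambda>u v. \<phi> u \<odot>\<^bsub>V\<^esub> v) \<in> C"
    and \<kappa>: "\<kappa> \<in> linear_maps V V" "\<And>v. v \<in> C \<Longrightarrow> \<kappa> v = v"
  shows "tensor_map U V U V id \<kappa> t = t"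
    and "bil U V F \<Longrightarrow> tsum U V t (\<lambda>u v. F u (\<kappa> v)) = tsum U V t F"
proof -
  show e: "tensor_map U V U V id \<kappa> t = t"
  proof (rule tensor_eqI[OF U V _ t])
    fix \<alpha> \<beta> assume \<alpha>: "lin U \<alpha>" and \<beta>: "lin V \<beta>"
    have l: "\<phi> (tvec U V V t (\<lambda>u v. \<alpha> u \<odot>\<^bsub>V\<^esub> v)) = tsum U V t (\<lambda>u v. \<alpha> u * \<phi> v)" if "lin V \<phi>" for \<phi>
    proof -
      have "\<phi> (tvec U V V t (\<lambda>u v. \<alpha> u \<odot>\<^bsub>V\<^esub> v)) = tsum U V t (\<lambda>u v. \<phi> (\<alpha> u \<odot>\<^bsub>V\<^esub> v))"
        by (rule lin_tvec[OF U V V _ that]) (use V in auto)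
      then show ?thesis using lin_apply(2)[OF that] by simp
    qed
    have "tsum U V (tensor_map U V U V id \<kappa> t) (\<lambda>u v. \<alpha> u * \<beta> v) = tsum U V t (\<lambda>u v. \<alpha> u * \<beta> (\<kappa> v))"
      by (subst tsum_tensor_map) (use U V \<kappa>(1) t \<alpha> \<beta> in auto)
    also have "\<dots> = \<beta> (\<kappa> (tvec U V V t (\<lambda>u v. \<alpha> u \<odot>\<^bsub>V\<^esub> v)))"
      using l[OF lin_comp[OF \<beta> \<kappa>(1)]] by simp
    finally show "tsum U V (tensor_map U V U V id \<kappa> t) (\<lambda>u v. \<alpha> u * \<beta> v) = tsum U V t (\<lambda>u v. \<alpha> u * \<beta> v)"
      using l[OF \<beta>] \<kappa>(2)[OF leg[OF \<alpha>]] by simp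
  qed (use U V \<kappa>(1) t in auto)
  assume "bil U V F"
  then show "tsum U V t (\<lambda>u v. F u (\<kappa> v)) = tsum U V t F"
    using tsum_tensor_map[OF U V U V linear_maps_id(2) \<kappa>(1) t] e by simp
qed

lemma complex_algebraD:
  assumes "complex_algebra A"
  shows "vs A" "ring A"
    "x \<in> carrier A \<Longrightarrow> y \<in> carrier A \<Longrightarrow> (c \<odot>\<^bsub>A\<^esub> x) \<otimes>\<^bsub>A\<^esub> y = c \<odot>\<^bsub>A\<^esub> (x \<otimes>\<^bsub>A\<^esub> y)"
    "x \<in> carrier A \<Longrightarrow> y \<in> carrier A \<Longrightarrow> x \<otimes>\<^bsub>A\<^esub> (c \<odot>\<^bsub>A\<^esub> y) = c \<odot>\<^bsub>A\<^esub> (x \<otimes>\<^bsub>A\<^esub> y)"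
  using complex_algebra.axioms(1,2)[OF assms] complex_algebra.smult_mult_left[OF assms] complex_algebra.smult_mult_right[OF assms] by auto

lemma linear_maps_mult:
  assumes A: "complex_algebra A"
  shows "f \<in> linear_maps V A \<Longrightarrow> b \<in> carrier A \<Longrightarrow> (\<lambda>v. f v \<otimes>\<^bsub>A\<^esub> b) \<in> linear_maps V A"
    and "f \<in> linear_maps V A \<Longrightarrow> b \<in> carrier A \<Longrightarrow> (\<lambda>v. b \<otimes>\<^bsub>A\<^esub> f v) \<in> linear_maps V A"
proof -
  interpret ring A by (rule complex_algebraD(2)[OF A])
  show "f \<in> linear_maps V A \<Longrightarrow> b \<in> carrier A \<Longrightarrow> (\<lambda>v. f v \<otimes>\<^bsub>A\<^esub> b) \<in> linear_maps V A"
    "f \<in> linear_maps V A \<Longrightarrow> b \<in> carrier A \<Longrightarrow> (\<lambda>v. b \<otimes>\<^bsub>A\<^esub> f v) \<in> linear_maps V A"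
    by (simp_all add: linear_maps_iff complex_algebraD(3,4)[OF A] l_distr r_distr)
qed

lemma tensor_mult:
  "s \<otimes>\<^bsub>V \<otimes>\<^sub>\<complex> W\<^esub> t = bilinear_lift V W (V \<otimes>\<^sub>\<complex> W) (\<lambda>v w.
      bilinear_lift V W (V \<otimes>\<^sub>\<complex> W) (\<lambda>v' w'. pure_tensor V W (v \<otimes>\<^bsub>V\<^esub> v') (w \<otimes>\<^bsub>W\<^esub> w')) t) s"
proof -
  have "tensor_lift UNIV V W (add_monoid (V \<otimes>\<^sub>\<complex> W)) h = tensor_lift UNIV V W (tensor_group UNIV V W) h" for h
    by (simp add: tensor_lift_def tensor_simps hom_def)
  then show ?thesis
    by (simp add: tensor_def Let_def bilinear_lift_def)
qed

lemma
  assumes V: "complex_algebra V" and W: "complex_algebra W"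
    and s: "s \<in> carrier (V \<otimes>\<^sub>\<complex> W)" and t: "t \<in> carrier (V \<otimes>\<^sub>\<complex> W)"
  shows tensor_mult_closed: "s \<otimes>\<^bsub>V \<otimes>\<^sub>\<complex> W\<^esub> t \<in> carrier (V \<otimes>\<^sub>\<complex> W)"
    and tsum_tensor_mult: "bil V W F \<Longrightarrow> tsum V W (s \<otimes>\<^bsub>V \<otimes>\<^sub>\<complex> W\<^esub> t) F =
      tsum V W s (\<lambda>v w. tsum V W t (\<lambda>v' w'. F (v \<otimes>\<^bsub>V\<^esub> v') (w \<otimes>\<^bsub>W\<^esub> w')))"
    and tensor_mult_linear_right: "(\<lambda>t. s \<otimes>\<^bsub>V \<otimes>\<^sub>\<complex> W\<^esub> t) \<in> linear_maps (V \<otimes>\<^sub>\<complex> W) (V \<otimes>\<^sub>\<complex> W)"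
    and tensor_mult_linear_left: "(\<lambda>s. s \<otimes>\<^bsub>V \<otimes>\<^sub>\<complex> W\<^esub> t) \<in> linear_maps (V \<otimes>\<^sub>\<complex> W) (V \<otimes>\<^sub>\<complex> W)"
proof -
  have vs: "vs V" "vs W" using complex_algebraD(1) V W by auto
  interpret V: ring V by (rule complex_algebraD(2)[OF V])
  interpret W: ring W by (rule complex_algebraD(2)[OF W])
  note lm = linear_maps_mult[OF V] linear_maps_mult[OF W]
  let ?g = "\<lambda>v w. bilinear_lift V W (V \<otimes>\<^sub>\<complex> W) (\<lambda>v' w'. pure_tensor V W (v \<otimes>\<^bsub>V\<^esub> v') (w \<otimes>\<^bsub>W\<^esub> w'))"
  have g0: "?g v w \<in> linear_maps (V \<otimes>\<^sub>\<complex> W) (V \<otimes>\<^sub>\<complex> W)" if "v \<in> carrier V" "w \<in> carrier W" for v w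
    by (rule bilinear_lift_props(1)) (use vs that in \<open>auto simp: lm\<close>)
  have g1: "(\<lambda>v. ?g v w t) \<in> linear_maps V (V \<otimes>\<^sub>\<complex> W)" if "w \<in> carrier W" "t \<in> carrier (V \<otimes>\<^sub>\<complex> W)" for w t
    by (rule bilinear_lift_linear_left) (use vs that in \<open>auto simp: lm\<close>)
  have g2: "(\<lambda>w. ?g v w t) \<in> linear_maps W (V \<otimes>\<^sub>\<complex> W)" if "v \<in> carrier V" "t \<in> carrier (V \<otimes>\<^sub>\<complex> W)" for v t
    by (rule bilinear_lift_linear_left) (use vs that in \<open>auto simp: lm\<close>)
  have left: "(\<lambda>s. s \<otimes>\<^bsub>V \<otimes>\<^sub>\<complex> W\<^esub> t) \<in> linear_maps (V \<otimes>\<^sub>\<complex> W) (V \<otimes>\<^sub>\<complex> W)" if "t \<in> carrier (V \<otimes>\<^sub>\<complex> W)" for t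
    unfolding tensor_mult by (rule bilinear_lift_props(1)) (use vs g1 g2 that in auto)
  show "(\<lambda>s. s \<otimes>\<^bsub>V \<otimes>\<^sub>\<complex> W\<^esub> t) \<in> linear_maps (V \<otimes>\<^sub>\<complex> W) (V \<otimes>\<^sub>\<complex> W)" by (rule left[OF t])
  show "(\<lambda>t. s \<otimes>\<^bsub>V \<otimes>\<^sub>\<complex> W\<^esub> t) \<in> linear_maps (V \<otimes>\<^sub>\<complex> W) (V \<otimes>\<^sub>\<complex> W)"
    unfolding tensor_mult
    by (rule bilinear_lift_linear_left) (use vs g0 g1 g2 s in auto)
  show "s \<otimes>\<^bsub>V \<otimes>\<^sub>\<complex> W\<^esub> t \<in> carrier (V \<otimes>\<^sub>\<complex> W)"
    using linear_maps_apply(1)[OF left[OF t] s] .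
  assume F: "bil V W F"
  have "tsum V W (s \<otimes>\<^bsub>V \<otimes>\<^sub>\<complex> W\<^esub> t) F = tsum V W s (\<lambda>v w. tsum V W (?g v w t) F)"
    unfolding tensor_mult by (rule tsum_bilinear_lift) (use vs s t F g1 g2 in auto)
  also have "\<dots> = tsum V W s (\<lambda>v w. tsum V W t (\<lambda>v' w'. tsum V W (pure_tensor V W (v \<otimes>\<^bsub>V\<^esub> v') (w \<otimes>\<^bsub>W\<^esub> w')) F))"
    by (rule tsum_body, rule tsum_bilinear_lift) (use vs t F in \<open>auto simp: lm\<close>)
  also have "\<dots> = tsum V W s (\<lambda>v w. tsum V W t (\<lambda>v' w'. F (v \<otimes>\<^bsub>V\<^esub> v') (w \<otimes>\<^bsub>W\<^esub> w')))"
    by (intro tsum_body tsum_pure) (use vs F in auto)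
  finally show "tsum V W (s \<otimes>\<^bsub>V \<otimes>\<^sub>\<complex> W\<^esub> t) F = tsum V W s (\<lambda>v w. tsum V W t (\<lambda>v' w'. F (v \<otimes>\<^bsub>V\<^esub> v') (w \<otimes>\<^bsub>W\<^esub> w')))" .
qed

lemma tensor_one: "\<one>\<^bsub>V \<otimes>\<^sub>\<complex> W\<^esub> = pure_tensor V W \<one>\<^bsub>V\<^esub> \<one>\<^bsub>W\<^esub>"
  by (simp add: tensor_def Let_def)

lemma bil_tsum_right:
  assumes "vs U" "vs C" "vs A" "tril U C A F"
  shows "bil U (C \<otimes>\<^sub>\<complex> A) (\<lambda>u r. tsum C A r (F u))"
proof -
  note [simp] = tril_comp[OF assms(4)]
  show ?thesis
    using assms(1-3) by (intro bilI lin_tsum) (auto intro!: bilI)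
qed

text \<open>Coassociativity, the comodule axioms and the equation that defines the cotensor product all compare two
  tensors in \<open>M \<otimes> (C \<otimes> A)\<close>, one of them reassociated. The following two rules translate between such an
  equation and an equation of nested sums.\<close>

context
  fixes M1 :: "(complex, 'a, 'm) module_scheme" and M :: "(complex, 'b, 'n) module_scheme"
    and C :: "(complex, 'c, 'k) module_scheme" and A :: "(complex, 'd, 'l) module_scheme"
    and A2 :: "(complex, 'e, 'i) module_scheme"
  assumes vs: "vs M1" "vs M" "vs C" "vs A" "vs A2"
begin

lemma tsum_coassoc_left:
  assumes "f \<in> linear_maps M1 (M \<otimes>\<^sub>\<complex> C)" "t1 \<in> carrier (M1 \<otimes>\<^sub>\<complex> A)" and F: "tril M C A F"
  shows "tsum M (C \<otimes>\<^sub>\<complex> A) (tensor_assoc M C A (tensor_map M1 A (M \<otimes>\<^sub>\<complex> C) A f id t1)) (\<lambda>m r. tsum C A r (F m))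
    = tsum M1 A t1 (\<lambda>x a. tsum M C (f x) (\<lambda>m c. F m c a))"
proof -
  have b: "bil M C (\<lambda>m c. F m c a)" if "a \<in> carrier A" for a
    using F that by (auto simp: tril_def bil_def)
  have "tsum M (C \<otimes>\<^sub>\<complex> A) (tensor_assoc M C A (tensor_map M1 A (M \<otimes>\<^sub>\<complex> C) A f id t1)) (\<lambda>m r. tsum C A r (F m))
    = tsum (M \<otimes>\<^sub>\<complex> C) A (tensor_map M1 A (M \<otimes>\<^sub>\<complex> C) A f id t1)
        (\<lambda>s a. tsum M C s (\<lambda>m c. tsum C A (pure_tensor C A c a) (F m)))"
    by (rule tsum_tensor_assoc) (use vs assms in \<open>auto intro: bil_tsum_right\<close>)
  also have "\<dots> = tsum (M \<otimes>\<^sub>\<complex> C) A (tensor_map M1 A (M \<otimes>\<^sub>\<complex> C) A f id t1) (\<lambda>s a. tsum M C s (\<lambda>m c. F m c a))"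
    using F by (intro tsum_body tsum_pure) (auto simp: vs tril_def bil_def)
  also have "\<dots> = tsum M1 A t1 (\<lambda>x a. tsum M C (f x) (\<lambda>m c. F m c (id a)))"
    by (rule tsum_tensor_map) (use vs assms b in \<open>auto intro!: bilI lin_tsum lin_tsum_body simp: tril_comp[OF F]\<close>)
  finally show ?thesis by simp
qed

lemma tsum_coassoc_right:
  assumes "g \<in> linear_maps A2 (C \<otimes>\<^sub>\<complex> A)" "t2 \<in> carrier (M \<otimes>\<^sub>\<complex> A2)" and F: "tril M C A F"
  shows "tsum M (C \<otimes>\<^sub>\<complex> A) (tensor_map M A2 M (C \<otimes>\<^sub>\<complex> A) id g t2) (\<lambda>m r. tsum C A r (F m))
    = tsum M A2 t2 (\<lambda>m y. tsum C A (g y) (F m))"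
  by (subst tsum_tensor_map) (use vs assms in \<open>auto intro: bil_tsum_right\<close>)

lemma coassocD:
  assumes "f \<in> linear_maps M1 (M \<otimes>\<^sub>\<complex> C)" "t1 \<in> carrier (M1 \<otimes>\<^sub>\<complex> A)"
    and "g \<in> linear_maps A2 (C \<otimes>\<^sub>\<complex> A)" "t2 \<in> carrier (M \<otimes>\<^sub>\<complex> A2)"
    and "tensor_assoc M C A (tensor_map M1 A (M \<otimes>\<^sub>\<complex> C) A f id t1) = tensor_map M A2 M (C \<otimes>\<^sub>\<complex> A) id g t2"
    and "tril M C A F"
  shows "tsum M1 A t1 (\<lambda>x a. tsum M C (f x) (\<lambda>m c. F m c a)) = tsum M A2 t2 (\<lambda>m y. tsum C A (g y) (F m))"
  using tsum_coassoc_left[OF assms(1,2,6)] tsum_coassoc_right[OF assms(3,4,6)] assms(5) by simp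

lemma coassocI:
  assumes f: "f \<in> linear_maps M1 (M \<otimes>\<^sub>\<complex> C)" and t1: "t1 \<in> carrier (M1 \<otimes>\<^sub>\<complex> A)"
    and g: "g \<in> linear_maps A2 (C \<otimes>\<^sub>\<complex> A)" and t2: "t2 \<in> carrier (M \<otimes>\<^sub>\<complex> A2)"
    and eq: "\<And>\<alpha> \<beta> \<gamma>. lin M \<alpha> \<Longrightarrow> lin C \<beta> \<Longrightarrow> lin A \<gamma> \<Longrightarrow>
      tsum M1 A t1 (\<lambda>x a. tsum M C (f x) (\<lambda>m c. \<alpha> m * (\<beta> c * \<gamma> a))) =
      tsum M A2 t2 (\<lambda>m y. tsum C A (g y) (\<lambda>c a. \<alpha> m * (\<beta> c * \<gamma> a)))"
  shows "tensor_assoc M C A (tensor_map M1 A (M \<otimes>\<^sub>\<complex> C) A f id t1) = tensor_map M A2 M (C \<otimes>\<^sub>\<complex> A) id g t2"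
proof (rule tensor_eqI3[OF vs(2-4)])
  fix \<alpha> \<beta> \<gamma> assume l: "lin M \<alpha>" "lin C \<beta>" "lin A \<gamma>"
  have F: "tril M C A (\<lambda>m c a. \<alpha> m * (\<beta> c * \<gamma> a))" by (intro trilI) (use l in auto)
  show "tsum M (C \<otimes>\<^sub>\<complex> A) (tensor_assoc M C A (tensor_map M1 A (M \<otimes>\<^sub>\<complex> C) A f id t1))
      (\<lambda>u r. \<alpha> u * tsum C A r (\<lambda>v w. \<beta> v * \<gamma> w)) =
    tsum M (C \<otimes>\<^sub>\<complex> A) (tensor_map M A2 M (C \<otimes>\<^sub>\<complex> A) id g t2) (\<lambda>u r. \<alpha> u * tsum C A r (\<lambda>v w. \<beta> v * \<gamma> w))"
    using tsum_coassoc_left[OF f t1 F] tsum_coassoc_right[OF g t2 F] eq[OF l] by (simp add: tsum_cmult)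
qed (use vs f g t1 t2 in auto)

end

section \<open>Hopf algebras and comodule algebras in Sweedler notation\<close>

locale hopf_coaction =
  fixes H :: "'h hopf" and P :: "('h, 'p) rcomod"
  assumes hopf: "hopf_algebra H" and coaction: "comodule_algebra H P"
begin

text \<open>\<open>\<Delta> x F\<close> and \<open>\<rho> p F\<close> stand for \<open>\<Sum> F(x\<^sub>1, x\<^sub>2)\<close> and \<open>\<Sum> F(p\<^sub>0, p\<^sub>1)\<close>.\<close>

abbreviation hmul (infixl \<open>\<cdot>\<close> 70) where "x \<cdot> y \<equiv> x \<otimes>\<^bsub>H\<^esub> y"
abbreviation pmul (infixl \<open>\<star>\<close> 70) where "p \<star> q \<equiv> p \<otimes>\<^bsub>P\<^esub> q"
abbreviation hone (\<open>1\<^sub>H\<close>) where "1\<^sub>H \<equiv> \<one>\<^bsub>H\<^esub>"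
abbreviation pone (\<open>1\<^sub>P\<close>) where "1\<^sub>P \<equiv> \<one>\<^bsub>P\<^esub>"
abbreviation "S \<equiv> antipode H"
abbreviation "\<epsilon> \<equiv> counit H"
abbreviation "\<Delta> x F \<equiv> tsum H H (comult H x) F"
abbreviation "\<rho> p F \<equiv> tsum P H (rcoact P p) F"
abbreviation "B \<equiv> coinvariants H P"

lemma algebra_H: "complex_algebra H" using hopf by (simp add: hopf_algebra_def)
lemma algebra_P: "complex_algebra P" using coaction by (simp add: comodule_algebra_def)
lemma comodule_P: "right_comodule H P" using coaction by (simp add: comodule_algebra_def)
lemma ring_H: "ring H" and vs_H [simp]: "vs H" using complex_algebraD algebra_H by auto
lemma ring_P: "ring P" and vs_P [simp]: "vs P" using complex_algebraD algebra_P by auto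

lemma mult_closed [simp]:
  "x \<in> carrier H \<Longrightarrow> y \<in> carrier H \<Longrightarrow> x \<cdot> y \<in> carrier H" "1\<^sub>H \<in> carrier H"
  "p \<in> carrier P \<Longrightarrow> q \<in> carrier P \<Longrightarrow> p \<star> q \<in> carrier P" "1\<^sub>P \<in> carrier P"
  using ring_H ring_P by (auto simp: ring_def intro: monoid.m_closed monoid.one_closed)

lemma mult_one [simp]:
  "x \<in> carrier H \<Longrightarrow> x \<cdot> 1\<^sub>H = x" "x \<in> carrier H \<Longrightarrow> 1\<^sub>H \<cdot> x = x"
  "p \<in> carrier P \<Longrightarrow> p \<star> 1\<^sub>P = p" "p \<in> carrier P \<Longrightarrow> 1\<^sub>P \<star> p = p"
  using ring_H ring_P by (auto simp: ring_def monoid.l_one monoid.r_one)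

lemma mult_assoc:
  "x \<in> carrier H \<Longrightarrow> y \<in> carrier H \<Longrightarrow> z \<in> carrier H \<Longrightarrow> x \<cdot> y \<cdot> z = x \<cdot> (y \<cdot> z)"
  "p \<in> carrier P \<Longrightarrow> q \<in> carrier P \<Longrightarrow> r \<in> carrier P \<Longrightarrow> p \<star> q \<star> r = p \<star> (q \<star> r)"
  using ring_H ring_P by (auto simp: ring_def monoid.m_assoc)

lemmas linear_mult [simp] = linear_maps_mult[OF algebra_H] linear_maps_mult[OF algebra_P]

lemma structure_linear [simp]:
  "comult H \<in> linear_maps H (H \<otimes>\<^sub>\<complex> H)" "S \<in> linear_maps H H" "lin H \<epsilon>"
  "rcoact P \<in> linear_maps P (P \<otimes>\<^sub>\<complex> H)"
  using hopf_algebra.comult_linear[OF hopf] hopf_algebra.antipode_linear[OF hopf] hopf_algebra.counit_linear[OF hopf]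
    right_comodule.rcoact_linear[OF comodule_P] by (auto simp: lin_iff)

lemma structure_linear_comp [simp]:
  "f \<in> linear_maps V H \<Longrightarrow> (\<lambda>v. comult H (f v)) \<in> linear_maps V (H \<otimes>\<^sub>\<complex> H)"
  "f \<in> linear_maps V H \<Longrightarrow> (\<lambda>v. S (f v)) \<in> linear_maps V H"
  "f \<in> linear_maps V H \<Longrightarrow> lin V (\<lambda>v. \<epsilon> (f v))"
  "g \<in> linear_maps V P \<Longrightarrow> (\<lambda>v. rcoact P (g v)) \<in> linear_maps V (P \<otimes>\<^sub>\<complex> H)"
  using linear_maps_comp structure_linear lin_comp by metis+

lemma structure_closed [simp]:
  "x \<in> carrier H \<Longrightarrow> comult H x \<in> carrier (H \<otimes>\<^sub>\<complex> H)"
  "x \<in> carrier H \<Longrightarrow> S x \<in> carrier H"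
  "p \<in> carrier P \<Longrightarrow> rcoact P p \<in> carrier (P \<otimes>\<^sub>\<complex> H)"
  using structure_linear linear_maps_apply(1) by metis+

lemma comult_coassoc:
  assumes "x \<in> carrier H" "tril H H H F"
  shows "\<Delta> x (\<lambda>a b. \<Delta> a (\<lambda>c d. F c d b)) = \<Delta> x (\<lambda>a b. \<Delta> b (\<lambda>c d. F a c d))"
  by (rule coassocD) (use assms hopf_algebra.coassoc[OF hopf] in auto)

lemma coact_coassoc:
  assumes "p \<in> carrier P" "tril P H H F"
  shows "\<rho> p (\<lambda>a b. \<rho> a (\<lambda>c d. F c d b)) = \<rho> p (\<lambda>a b. \<Delta> b (\<lambda>c d. F a c d))"
  by (rule coassocD) (use assms right_comodule.rcoact_coassoc[OF comodule_P] in auto)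

lemma comult_counit:
  assumes x: "x \<in> carrier H" and \<alpha>: "lin H \<alpha>"
  shows "\<Delta> x (\<lambda>a b. \<epsilon> a * \<alpha> b) = \<alpha> x" "\<Delta> x (\<lambda>a b. \<epsilon> b * \<alpha> a) = \<alpha> x"
    "\<Delta> x (\<lambda>a b. \<alpha> b * \<epsilon> a) = \<alpha> x" "\<Delta> x (\<lambda>a b. \<alpha> a * \<epsilon> b) = \<alpha> x"
proof -
  have "\<alpha> (bilinear_lift H H H (\<lambda>y z. \<epsilon> y \<odot>\<^bsub>H\<^esub> z) (comult H x)) = \<Delta> x (\<lambda>a b. \<alpha> (\<epsilon> a \<odot>\<^bsub>H\<^esub> b))"
    by (rule lin_bilinear_lift) (use x \<alpha> in auto)
  then show 1: "\<Delta> x (\<lambda>a b. \<epsilon> a * \<alpha> b) = \<alpha> x"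
    using hopf_algebra.counit_left[OF hopf x] lin_apply(2)[OF \<alpha>] by simp
  have "\<alpha> (bilinear_lift H H H (\<lambda>y z. \<epsilon> z \<odot>\<^bsub>H\<^esub> y) (comult H x)) = \<Delta> x (\<lambda>a b. \<alpha> (\<epsilon> b \<odot>\<^bsub>H\<^esub> a))"
    by (rule lin_bilinear_lift) (use x \<alpha> in auto)
  then show 2: "\<Delta> x (\<lambda>a b. \<epsilon> b * \<alpha> a) = \<alpha> x"
    using hopf_algebra.counit_right[OF hopf x] lin_apply(2)[OF \<alpha>] by simp
  show "\<Delta> x (\<lambda>a b. \<alpha> b * \<epsilon> a) = \<alpha> x" "\<Delta> x (\<lambda>a b. \<alpha> a * \<epsilon> b) = \<alpha> x"
    using 1 2 by (simp_all add: mult.commute)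
qed

lemma coact_counit:
  assumes p: "p \<in> carrier P" and \<alpha>: "lin P \<alpha>"
  shows "\<rho> p (\<lambda>a b. \<epsilon> b * \<alpha> a) = \<alpha> p" "\<rho> p (\<lambda>a b. \<alpha> a * \<epsilon> b) = \<alpha> p"
proof -
  have "\<alpha> (bilinear_lift P H P (\<lambda>y z. \<epsilon> z \<odot>\<^bsub>P\<^esub> y) (rcoact P p)) = \<rho> p (\<lambda>a b. \<alpha> (\<epsilon> b \<odot>\<^bsub>P\<^esub> a))"
    by (rule lin_bilinear_lift) (use p \<alpha> in auto)
  then show "\<rho> p (\<lambda>a b. \<epsilon> b * \<alpha> a) = \<alpha> p"
    using right_comodule.rcoact_counit[OF comodule_P p] lin_apply(2)[OF \<alpha>] by simp
  then show "\<rho> p (\<lambda>a b. \<alpha> a * \<epsilon> b) = \<alpha> p"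
    by (simp add: mult.commute)
qed

lemma antipode_sum:
  assumes x: "x \<in> carrier H" and \<alpha>: "lin H \<alpha>"
  shows "\<Delta> x (\<lambda>a b. \<alpha> (S a \<cdot> b)) = \<epsilon> x * \<alpha> 1\<^sub>H" "\<Delta> x (\<lambda>a b. \<alpha> (a \<cdot> S b)) = \<epsilon> x * \<alpha> 1\<^sub>H"
proof -
  have "\<alpha> (bilinear_lift H H H (\<lambda>y z. S y \<cdot> z) (comult H x)) = \<Delta> x (\<lambda>a b. \<alpha> (S a \<cdot> b))"
    by (rule lin_bilinear_lift) (use x \<alpha> in auto)
  then show "\<Delta> x (\<lambda>a b. \<alpha> (S a \<cdot> b)) = \<epsilon> x * \<alpha> 1\<^sub>H"
    using hopf_algebra.antipode_left[OF hopf x] lin_apply(2)[OF \<alpha>] by simp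
  have "\<alpha> (bilinear_lift H H H (\<lambda>y z. y \<cdot> S z) (comult H x)) = \<Delta> x (\<lambda>a b. \<alpha> (a \<cdot> S b))"
    by (rule lin_bilinear_lift) (use x \<alpha> in auto)
  then show "\<Delta> x (\<lambda>a b. \<alpha> (a \<cdot> S b)) = \<epsilon> x * \<alpha> 1\<^sub>H"
    using hopf_algebra.antipode_right[OF hopf x] lin_apply(2)[OF \<alpha>] by simp
qed

lemma comult_mult:
  assumes "x \<in> carrier H" "y \<in> carrier H" "bil H H F"
  shows "\<Delta> (x \<cdot> y) F = \<Delta> x (\<lambda>a b. \<Delta> y (\<lambda>c d. F (a \<cdot> c) (b \<cdot> d)))"
  using hopf_algebra.comult_mult[OF hopf] tsum_tensor_mult[OF algebra_H algebra_H] assms by simp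

lemma comult_one: "bil H H F \<Longrightarrow> \<Delta> 1\<^sub>H F = F 1\<^sub>H 1\<^sub>H"
  using hopf_algebra.comult_one[OF hopf] by (simp add: tensor_one tsum_pure)

lemma coact_mult:
  assumes "p \<in> carrier P" "q \<in> carrier P" "bil P H F"
  shows "\<rho> (p \<star> q) F = \<rho> p (\<lambda>a b. \<rho> q (\<lambda>c d. F (a \<star> c) (b \<cdot> d)))"
  using comodule_algebra.rcoact_mult[OF coaction] tsum_tensor_mult[OF algebra_P algebra_H] assms by simp

lemma coact_one: "bil P H F \<Longrightarrow> \<rho> 1\<^sub>P F = F 1\<^sub>P 1\<^sub>H"
  using comodule_algebra.rcoact_one[OF coaction] by (simp add: tensor_one tsum_pure)

lemma counit_mult [simp]: "x \<in> carrier H \<Longrightarrow> y \<in> carrier H \<Longrightarrow> \<epsilon> (x \<cdot> y) = \<epsilon> x * \<epsilon> y" "\<epsilon> 1\<^sub>H = 1"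
  using hopf_algebra.counit_mult[OF hopf] hopf_algebra.counit_one[OF hopf] by auto

lemma counit_antipode [simp]:
  assumes x: "x \<in> carrier H" shows "\<epsilon> (S x) = \<epsilon> x"
proof -
  have "\<epsilon> (S x) = \<Delta> x (\<lambda>a b. \<epsilon> (S a) * \<epsilon> b)"
    using comult_counit(4)[OF x, of "\<lambda>a. \<epsilon> (S a)"] by simp
  also have "\<dots> = \<Delta> x (\<lambda>a b. \<epsilon> (S a \<cdot> b))" by simp
  also have "\<dots> = \<epsilon> x" using antipode_sum(1)[OF x, of \<epsilon>] by (simp del: counit_mult(1))
  finally show ?thesis .
qed

text \<open>The antipode reverses the comultiplication: both sides are convolution inverses of \<open>\<Delta>\<close>, so the sum of
  \<open>\<Delta>(S x\<^sub>1) \<Delta>(x\<^sub>2) (S x\<^sub>4 \<otimes> S x\<^sub>3)\<close> can be collapsed from either end.\<close>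

lemma comult_antipode:
  assumes x: "x \<in> carrier H" and F: "bil H H F"
  shows "\<Delta> (S x) F = \<Delta> x (\<lambda>a b. F (S b) (S a))"
proof -
  note [simp] = bil_comp[OF F] F
  let ?K = "\<lambda>x1 x2 x3 w. \<Delta> w (\<lambda>x4 x5. \<Delta> (S x1) (\<lambda>u v. F (u \<cdot> (x2 \<cdot> S x5)) (v \<cdot> (x3 \<cdot> S x4))))"
  let ?G = "\<Delta> x (\<lambda>x1 x'. \<Delta> x' (\<lambda>x2 x''. \<Delta> x'' (\<lambda>x3 w. ?K x1 x2 x3 w)))"
  have "?G = \<Delta> x (\<lambda>x1 x'. \<Delta> x' (\<lambda>x2 x''. \<Delta> x'' (\<lambda>z x5. \<Delta> z (\<lambda>x3 x4.
      \<Delta> (S x1) (\<lambda>u v. F (u \<cdot> (x2 \<cdot> S x5)) (v \<cdot> (x3 \<cdot> S x4)))))))"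
    using x by (simp add: comult_coassoc trilI bilI)
  also have "\<dots> = \<Delta> x (\<lambda>x1 x'. \<Delta> x' (\<lambda>x2 x''. \<Delta> x'' (\<lambda>z x5. \<epsilon> z *
      \<Delta> (S x1) (\<lambda>u v. F (u \<cdot> (x2 \<cdot> S x5)) v))))"
  proof (intro tsum_body)
    fix x1 x2 x5 z assume c: "x1 \<in> carrier H" "x2 \<in> carrier H" "x5 \<in> carrier H" "z \<in> carrier H"
    show "\<Delta> z (\<lambda>x3 x4. \<Delta> (S x1) (\<lambda>u v. F (u \<cdot> (x2 \<cdot> S x5)) (v \<cdot> (x3 \<cdot> S x4)))) =
        \<epsilon> z * \<Delta> (S x1) (\<lambda>u v. F (u \<cdot> (x2 \<cdot> S x5)) v)"
      by (subst antipode_sum(2)[where \<alpha> = "\<lambda>r. \<Delta> (S x1) (\<lambda>u v. F (u \<cdot> (x2 \<cdot> S x5)) (v \<cdot> r))"]) (use c in auto)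
  qed
  also have "\<dots> = \<Delta> x (\<lambda>x1 x'. \<Delta> x' (\<lambda>x2 x''. \<Delta> (S x1) (\<lambda>u v. F (u \<cdot> (x2 \<cdot> S x'')) v)))"
    by (intro tsum_body comult_counit(1)) auto
  also have "\<dots> = \<Delta> x (\<lambda>x1 x'. \<epsilon> x' * \<Delta> (S x1) F)"
  proof (intro tsum_body)
    fix x1 x' assume c: "x1 \<in> carrier H" "x' \<in> carrier H"
    show "\<Delta> x' (\<lambda>x2 x''. \<Delta> (S x1) (\<lambda>u v. F (u \<cdot> (x2 \<cdot> S x'')) v)) = \<epsilon> x' * \<Delta> (S x1) F"
      by (subst antipode_sum(2)[where \<alpha> = "\<lambda>r. \<Delta> (S x1) (\<lambda>u v. F (u \<cdot> r) v)"]) (use c in auto)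
  qed
  also have "\<dots> = \<Delta> (S x) F"
    by (rule comult_counit(2)) (use x in auto)
  finally have 1: "?G = \<Delta> (S x) F" .
  have "?G = \<Delta> x (\<lambda>y w. \<Delta> y (\<lambda>x1 y'. \<Delta> y' (\<lambda>x2 x3. ?K x1 x2 x3 w)))"
    using x by (simp add: comult_coassoc trilI bilI)
  also have "\<dots> = \<Delta> x (\<lambda>y w. \<Delta> y (\<lambda>x1 y'. \<Delta> (S x1 \<cdot> y') (\<lambda>u v. \<Delta> w (\<lambda>x4 x5. F (u \<cdot> S x5) (v \<cdot> S x4)))))"
  proof (intro tsum_body)
    fix y w x1 y' assume c: "y \<in> carrier H" "w \<in> carrier H" "x1 \<in> carrier H" "y' \<in> carrier H"
    have "\<Delta> (S x1 \<cdot> y') (\<lambda>u v. \<Delta> w (\<lambda>x4 x5. F (u \<cdot> S x5) (v \<cdot> S x4))) =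
      \<Delta> (S x1) (\<lambda>u v. \<Delta> y' (\<lambda>x2 x3. \<Delta> w (\<lambda>x4 x5. F (u \<cdot> (x2 \<cdot> S x5)) (v \<cdot> (x3 \<cdot> S x4)))))"
      using c by (simp add: comult_mult bilI mult_assoc)
    also have "\<dots> = \<Delta> y' (\<lambda>x2 x3. ?K x1 x2 x3 w)"
      by (subst tsum_swap) (intro tsum_body tsum_swap)
    finally show "\<Delta> y' (\<lambda>x2 x3. ?K x1 x2 x3 w) = \<Delta> (S x1 \<cdot> y') (\<lambda>u v. \<Delta> w (\<lambda>x4 x5. F (u \<cdot> S x5) (v \<cdot> S x4)))" ..
  qed
  also have "\<dots> = \<Delta> x (\<lambda>y w. \<epsilon> y * \<Delta> w (\<lambda>x4 x5. F (S x5) (S x4)))"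
  proof (intro tsum_body)
    fix y w assume c: "y \<in> carrier H" "w \<in> carrier H"
    show "\<Delta> y (\<lambda>x1 y'. \<Delta> (S x1 \<cdot> y') (\<lambda>u v. \<Delta> w (\<lambda>x4 x5. F (u \<cdot> S x5) (v \<cdot> S x4)))) =
      \<epsilon> y * \<Delta> w (\<lambda>x4 x5. F (S x5) (S x4))"
      by (subst antipode_sum(1)[where \<alpha> = "\<lambda>r. \<Delta> r (\<lambda>u v. \<Delta> w (\<lambda>x4 x5. F (u \<cdot> S x5) (v \<cdot> S x4)))"])
        (use c in \<open>auto intro!: bilI simp: comult_one\<close>)
  qed
  also have "\<dots> = \<Delta> x (\<lambda>a b. F (S b) (S a))"
    by (rule comult_counit(1)) (use x in \<open>auto intro!: bilI\<close>)
  finally show ?thesis using 1 by simp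
qed

subsection \<open>Left comodules and cotensor products\<close>

text \<open>The linear part of a comodule structure. It is all that enters the construction of \<open>P \<box> V\<close> and of
  \<open>\<beta>\<close>, and it passes to \<open>V \<otimes> W\<close> directly.\<close>

definition lcoaction :: "('h, 'v) lcomod \<Rightarrow> bool"
  where "lcoaction V \<longleftrightarrow> vs V \<and> lcoact V \<in> linear_maps V (H \<otimes>\<^sub>\<complex> V)"

lemma lcoactionD:
  assumes "lcoaction V"
  shows "vs V" "lcoact V \<in> linear_maps V (H \<otimes>\<^sub>\<complex> V)"
    "v \<in> carrier V \<Longrightarrow> lcoact V v \<in> carrier (H \<otimes>\<^sub>\<complex> V)"
    "f \<in> linear_maps U V \<Longrightarrow> (\<lambda>u. lcoact V (f u)) \<in> linear_maps U (H \<otimes>\<^sub>\<complex> V)"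
  using assms linear_maps_comp[of "lcoact V" V] linear_maps_apply(1)[of "lcoact V" V]
  by (auto simp: lcoaction_def)

lemma left_comodule_lcoaction: "left_comodule H V \<Longrightarrow> lcoaction V"
  by (auto simp: left_comodule_def left_comodule_axioms_def lcoaction_def)

lemma lcoact_coassoc_sum:
  fixes V :: "('h, 'v) lcomod"
  assumes V: "left_comodule H V" and "v \<in> carrier V" "tril H H V F"
  shows "tsum H V (lcoact V v) (\<lambda>a w. \<Delta> a (\<lambda>c d. F c d w)) =
    tsum H V (lcoact V v) (\<lambda>a w. tsum H V (lcoact V w) (F a))"
  by (rule coassocD)
    (use assms lcoactionD[OF left_comodule_lcoaction[OF V]] left_comodule.lcoact_coassoc[OF V] in auto)

lemma lcoact_counit_sum:
  fixes V :: "('h, 'v) lcomod"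
  assumes V: "left_comodule H V" and v: "v \<in> carrier V" and \<alpha>: "lin V \<alpha>"
  shows "tsum H V (lcoact V v) (\<lambda>a w. \<epsilon> a * \<alpha> w) = \<alpha> v"
proof -
  note V' = lcoactionD[OF left_comodule_lcoaction[OF V]]
  have "\<alpha> (bilinear_lift H V V (\<lambda>h w. \<epsilon> h \<odot>\<^bsub>V\<^esub> w) (lcoact V v)) = tsum H V (lcoact V v) (\<lambda>a b. \<alpha> (\<epsilon> a \<odot>\<^bsub>V\<^esub> b))"
    by (rule lin_bilinear_lift) (use v \<alpha> V' in auto)
  then show ?thesis
    using left_comodule.lcoact_counit[OF V v] lin_apply(2)[OF \<alpha>] by simp
qed

lemma left_comoduleI:
  fixes V :: "('h, 'v) lcomod"
  assumes V: "lcoaction V"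
    and coassoc: "\<And>v \<alpha> \<beta> \<gamma>. v \<in> carrier V \<Longrightarrow> lin H \<alpha> \<Longrightarrow> lin H \<beta> \<Longrightarrow> lin V \<gamma> \<Longrightarrow>
      tsum H V (lcoact V v) (\<lambda>a w. \<Delta> a (\<lambda>c d. \<alpha> c * (\<beta> d * \<gamma> w))) =
      tsum H V (lcoact V v) (\<lambda>a w. tsum H V (lcoact V w) (\<lambda>d u. \<alpha> a * (\<beta> d * \<gamma> u)))"
    and counit: "\<And>v \<gamma>. v \<in> carrier V \<Longrightarrow> lin V \<gamma> \<Longrightarrow> tsum H V (lcoact V v) (\<lambda>a w. \<epsilon> a * \<gamma> w) = \<gamma> v"
  shows "left_comodule H V"
proof (rule left_comodule.intro[OF lcoactionD(1)[OF V]], rule left_comodule_axioms.intro)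
  note V' = lcoactionD[OF V]
  show "lcoact V \<in> linear_maps V (H \<otimes>\<^sub>\<complex> V)" by (fact V'(2))
  show "tensor_assoc H H V (tensor_map H V (H \<otimes>\<^sub>\<complex> H) V (comult H) id (lcoact V v)) =
      tensor_map H V H (H \<otimes>\<^sub>\<complex> V) id (lcoact V) (lcoact V v)" if "v \<in> carrier V" for v
    by (rule coassocI) (use V' that coassoc in auto)
  show "bilinear_lift H V V (\<lambda>h w. \<epsilon> h \<odot>\<^bsub>V\<^esub> w) (lcoact V v) = v" if v: "v \<in> carrier V" for v
  proof (rule vs_eqI[OF V'(1)])
    show "bilinear_lift H V V (\<lambda>h w. \<epsilon> h \<odot>\<^bsub>V\<^esub> w) (lcoact V v) \<in> carrier V"
      by (rule linear_maps_apply(1)[OF bilinear_lift_props(1)]) (use V' v in auto)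
    fix \<phi> assume \<phi>: "lin V \<phi>"
    have "\<phi> (bilinear_lift H V V (\<lambda>h w. \<epsilon> h \<odot>\<^bsub>V\<^esub> w) (lcoact V v)) = tsum H V (lcoact V v) (\<lambda>a b. \<phi> (\<epsilon> a \<odot>\<^bsub>V\<^esub> b))"
      by (rule lin_bilinear_lift) (use v \<phi> V' in auto)
    then show "\<phi> (bilinear_lift H V V (\<lambda>h w. \<epsilon> h \<odot>\<^bsub>V\<^esub> w) (lcoact V v)) = \<phi> v"
      using counit[OF v \<phi>] lin_apply(2)[OF \<phi>] by simp
  qed (fact v)
qed

lemma cotensor_carrier: "t \<in> carrier (cotensor H P V) \<Longrightarrow> t \<in> carrier (P \<otimes>\<^sub>\<complex> V)"
  by (simp add: cotensor_def)

text \<open>Membership in \<open>P \<box> V\<close> in Sweedler notation: \<open>p\<^sub>0 \<otimes> p\<^sub>1 \<otimes> v = p \<otimes> v\<^sub>1 \<otimes> v\<^sub>0\<close>.\<close>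

lemma cotensor_sum:
  assumes V: "lcoaction V" and t: "t \<in> carrier (cotensor H P V)" and F: "tril P H V F"
  shows "tsum P V t (\<lambda>p v. \<rho> p (\<lambda>a b. F a b v)) = tsum P V t (\<lambda>p v. tsum H V (lcoact V v) (F p))"
  by (rule coassocD) (use lcoactionD[OF V] t F in \<open>auto simp: cotensor_def\<close>)

lemma cotensorI:
  assumes V: "lcoaction V" and t: "t \<in> carrier (P \<otimes>\<^sub>\<complex> V)"
    and "\<And>\<alpha> \<beta> \<gamma>. lin P \<alpha> \<Longrightarrow> lin H \<beta> \<Longrightarrow> lin V \<gamma> \<Longrightarrow>
      tsum P V t (\<lambda>p v. \<rho> p (\<lambda>a b. \<alpha> a * (\<beta> b * \<gamma> v))) =
      tsum P V t (\<lambda>p v. tsum H V (lcoact V v) (\<lambda>b w. \<alpha> p * (\<beta> b * \<gamma> w)))"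
  shows "t \<in> carrier (cotensor H P V)"
proof -
  have "tensor_assoc P H V (tensor_map P V (P \<otimes>\<^sub>\<complex> H) V (rcoact P) id t)
        = tensor_map P V P (H \<otimes>\<^sub>\<complex> V) id (lcoact V) t"
    by (rule coassocI) (use lcoactionD[OF V] assms in auto)
  with t show ?thesis by (simp add: cotensor_def)
qed

lemma cotensor_subspace:
  assumes V: "lcoaction V"
  shows "subspace (P \<otimes>\<^sub>\<complex> V) (carrier (cotensor H P V))"
proof -
  note V' [simp] = lcoactionD[OF V]
  let ?l = "\<lambda>\<alpha> \<beta> \<gamma> t. tsum P V t (\<lambda>p v. \<rho> p (\<lambda>a b. \<alpha> a * (\<beta> b * \<gamma> v)))"
  let ?r = "\<lambda>\<alpha> \<beta> \<gamma> t. tsum P V t (\<lambda>p v. tsum H V (lcoact V v) (\<lambda>b w. \<alpha> p * (\<beta> b * \<gamma> w)))"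
  have l: "lin (P \<otimes>\<^sub>\<complex> V) (?l \<alpha> \<beta> \<gamma>)" and r: "lin (P \<otimes>\<^sub>\<complex> V) (?r \<alpha> \<beta> \<gamma>)"
    if "lin P \<alpha>" "lin H \<beta>" "lin V \<gamma>" for \<alpha> \<beta> \<gamma>
    using that by (auto intro!: lin_tsum)
  have eq: "?l \<alpha> \<beta> \<gamma> t = ?r \<alpha> \<beta> \<gamma> t" if "t \<in> carrier (cotensor H P V)" "lin P \<alpha>" "lin H \<beta>" "lin V \<gamma>" for t \<alpha> \<beta> \<gamma>
    by (rule cotensor_sum[OF V that(1)]) (use that in auto)
  have c: "t \<in> carrier (P \<otimes>\<^sub>\<complex> V)" if "t \<in> carrier (cotensor H P V)" for t
    using that by (rule cotensor_carrier)
  have v: "vs (P \<otimes>\<^sub>\<complex> V)" by simp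
  show ?thesis
    unfolding subspace_def
  proof (intro conjI ballI allI subsetI)
    show "\<zero>\<^bsub>P \<otimes>\<^sub>\<complex> V\<^esub> \<in> carrier (cotensor H P V)"
      by (rule cotensorI[OF V]) (simp_all add: lin_zero[OF l v] lin_zero[OF r v])
  qed (auto intro!: cotensorI[OF V] simp: c lin_apply[OF l] lin_apply[OF r] eq)
qed

lemma cotensor_simps [simp]:
  "x \<oplus>\<^bsub>cotensor H P V\<^esub> y = x \<oplus>\<^bsub>P \<otimes>\<^sub>\<complex> V\<^esub> y" "\<zero>\<^bsub>cotensor H P V\<^esub> = \<zero>\<^bsub>P \<otimes>\<^sub>\<complex> V\<^esub>"
  "c \<odot>\<^bsub>cotensor H P V\<^esub> x = c \<odot>\<^bsub>P \<otimes>\<^sub>\<complex> V\<^esub> x"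
  by (simp_all add: cotensor_def)

lemma coinvariants_iff:
  "b \<in> B \<longleftrightarrow> b \<in> carrier P \<and> (\<forall>\<alpha> \<beta>. lin P \<alpha> \<longrightarrow> lin H \<beta> \<longrightarrow> \<rho> b (\<lambda>x h. \<alpha> x * \<beta> h) = \<alpha> b * \<beta> 1\<^sub>H)"
proof -
  have "rcoact P b = pure_tensor P H b 1\<^sub>H \<longleftrightarrow>
      (\<forall>\<alpha> \<beta>. lin P \<alpha> \<longrightarrow> lin H \<beta> \<longrightarrow> \<rho> b (\<lambda>x h. \<alpha> x * \<beta> h) = \<alpha> b * \<beta> 1\<^sub>H)" if "b \<in> carrier P"
  proof
    assume "\<forall>\<alpha> \<beta>. lin P \<alpha> \<longrightarrow> lin H \<beta> \<longrightarrow> \<rho> b (\<lambda>x h. \<alpha> x * \<beta> h) = \<alpha> b * \<beta> 1\<^sub>H"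
    then show "rcoact P b = pure_tensor P H b 1\<^sub>H"
      using that by (intro tensor_eqI[of P H]) (auto simp: tsum_pure)
  qed (use that in \<open>auto simp: tsum_pure\<close>)
  then show ?thesis by (auto simp: coinvariants_def)
qed

lemma coinvariants_carrier [simp]: "b \<in> B \<Longrightarrow> b \<in> carrier P"
  by (simp add: coinvariants_def)

lemma coinvariants_sum: "b \<in> B \<Longrightarrow> bil P H F \<Longrightarrow> \<rho> b F = F b 1\<^sub>H"
  by (simp add: coinvariants_def tsum_pure del: coinvariants_carrier)

lemma coinvariants_subspace: "subspace P B"
proof -
  have l: "lin P (\<lambda>p. \<rho> p (\<lambda>x h. \<alpha> x * \<beta> h))" if "lin P \<alpha>" "lin H \<beta>" for \<alpha> \<beta>
    using that by auto
  show ?thesis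
    unfolding subspace_def
    by (auto simp: coinvariants_iff lin_zero[OF l] lin_apply[OF l] lin_zero lin_apply algebra_simps)
qed

lemma coinvariants_one [simp]: "1\<^sub>P \<in> B"
  by (auto simp: coinvariants_iff coact_one)

lemma coinvariants_mult [simp]: "a \<in> B \<Longrightarrow> b \<in> B \<Longrightarrow> a \<star> b \<in> B"
  unfolding coinvariants_iff[of "a \<star> b"]
proof (intro conjI allI impI)
  fix \<alpha> \<beta> assume b: "a \<in> B" "b \<in> B" and l [simp]: "lin P \<alpha>" "lin H \<beta>"
  note [simp] = lin_comp[OF l(1)] lin_comp[OF l(2)]
  show "\<rho> (a \<star> b) (\<lambda>x h. \<alpha> x * \<beta> h) = \<alpha> (a \<star> b) * \<beta> 1\<^sub>H"
    using b by (simp add: coact_mult coinvariants_sum)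
qed auto

subsection \<open>Quotient comodules of the Hopf algebra\<close>

text \<open>
  A left coideal \<open>L\<close> of \<open>H\<close> with a linear complement is encoded by the projection \<open>\<pi>\<close> with kernel \<open>L\<close>; the
  quotient comodule \<open>H / L\<close> is realised on the complement \<open>\<pi> H\<close>, copied into the type \<open>'u\<close> by \<open>\<iota>\<close>.
\<close>

definition quotient_comodule :: "('h \<Rightarrow> 'u) \<Rightarrow> ('h \<Rightarrow> 'h) \<Rightarrow> ('h, 'u) lcomod"
  where "quotient_comodule \<iota> \<pi> = (let \<kappa> = inv_into (carrier H) \<iota>;
    M = \<lparr>carrier = \<iota> ` \<pi> ` carrier H, monoid.mult = (\<lambda>x y. x), one = \<iota> \<zero>\<^bsub>H\<^esub>, ring.zero = \<iota> \<zero>\<^bsub>H\<^esub>,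
      add = (\<lambda>x y. \<iota> (\<kappa> x \<oplus>\<^bsub>H\<^esub> \<kappa> y)), module.smult = (\<lambda>c x. \<iota> (c \<odot>\<^bsub>H\<^esub> \<kappa> x))\<rparr>
    in module.extend M (lcomod.fields (\<lambda>x. tensor_map H H H M id (\<lambda>h. \<iota> (\<pi> h)) (comult H (\<kappa> x)))))"

lemma tensor_map_cong:
  assumes "carrier M = carrier M'" "\<And>x y. x \<oplus>\<^bsub>M\<^esub> y = x \<oplus>\<^bsub>M'\<^esub> y" "\<And>c x. c \<odot>\<^bsub>M\<^esub> x = c \<odot>\<^bsub>M'\<^esub> x"
  shows "tensor_map A C A M f g = tensor_map A C A M' f g"
proof -
  have *: "tensor_rels UNIV A M = tensor_rels UNIV A M'"
    unfolding tensor_rels_def by (simp add: assms)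
  have k: "tensor_kernel UNIV A M = tensor_kernel UNIV A M'"
    unfolding tensor_kernel_def by (simp add: assms *)
  have g: "tensor_group UNIV A M = tensor_group UNIV A M'"
    unfolding tensor_group_def by (simp add: assms k)
  have e: "pure_tensor A M x y = pure_tensor A M' x y" for x y
    unfolding tensor_elem_def by (simp add: assms k)
  have "add_monoid (A \<otimes>\<^sub>\<complex> M) = add_monoid (A \<otimes>\<^sub>\<complex> M')"
    by (simp add: tensor_simps g fun_eq_iff)
  then show ?thesis
    unfolding tensor_map_def bilinear_lift_def e by simp
qed

context
  fixes \<iota> :: "'h \<Rightarrow> 'u" and \<pi> :: "'h \<Rightarrow> 'h"
  assumes \<iota>: "inj_on \<iota> (carrier H)" and \<pi>: "\<pi> \<in> linear_maps H H" and idem: "\<And>x. x \<in> carrier H \<Longrightarrow> \<pi> (\<pi> x) = \<pi> x"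
    and coideal: "\<And>x \<phi> \<psi>. x \<in> carrier H \<Longrightarrow> lin H \<phi> \<Longrightarrow> lin H \<psi> \<Longrightarrow>
      \<Delta> (\<pi> x) (\<lambda>a b. \<phi> a * \<psi> (\<pi> b)) = \<Delta> x (\<lambda>a b. \<phi> a * \<psi> (\<pi> b))"
begin

abbreviation (input) "Q \<equiv> quotient_comodule \<iota> \<pi>"
abbreviation (input) "\<kappa> \<equiv> inv_into (carrier H) \<iota>"
abbreviation (input) "proj \<equiv> \<lambda>h. \<iota> (\<pi> h)"

lemma quotient_simps:
  "carrier Q = \<iota> ` \<pi> ` carrier H" "\<zero>\<^bsub>Q\<^esub> = \<iota> \<zero>\<^bsub>H\<^esub>" "x \<oplus>\<^bsub>Q\<^esub> y = \<iota> (\<kappa> x \<oplus>\<^bsub>H\<^esub> \<kappa> y)" "c \<odot>\<^bsub>Q\<^esub> x = \<iota> (c \<odot>\<^bsub>H\<^esub> \<kappa> x)"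
  by (simp_all add: quotient_comodule_def Let_def module.extend_def lcomod.fields_def)

lemma quotient_coact: "lcoact Q x = tensor_map H H H Q id proj (comult H (\<kappa> x))"
proof -
  let ?M = "\<lparr>carrier = \<iota> ` \<pi> ` carrier H, monoid.mult = (\<lambda>x y. x), one = \<iota> \<zero>\<^bsub>H\<^esub>, ring.zero = \<iota> \<zero>\<^bsub>H\<^esub>,
      add = (\<lambda>x y. \<iota> (\<kappa> x \<oplus>\<^bsub>H\<^esub> \<kappa> y)), module.smult = (\<lambda>c x. \<iota> (c \<odot>\<^bsub>H\<^esub> \<kappa> x))\<rparr>"
  have "lcoact Q x = tensor_map H H H ?M id proj (comult H (\<kappa> x))"
    by (simp add: quotient_comodule_def Let_def module.extend_def lcomod.fields_def)
  moreover have "tensor_map H H H ?M id proj = tensor_map H H H Q id proj"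
    by (rule tensor_map_cong) (simp_all add: quotient_simps)
  ultimately show ?thesis by simp
qed

lemma \<pi>_closed [simp]: "x \<in> carrier H \<Longrightarrow> \<pi> x \<in> carrier H"
  using linear_maps_apply(1)[OF \<pi>] .

lemma \<kappa>_\<iota> [simp]: "x \<in> carrier H \<Longrightarrow> \<kappa> (\<iota> x) = x"
  using \<iota> by simp

lemma quotient_elem:
  assumes "x \<in> carrier Q"
  shows "\<kappa> x \<in> carrier H" "\<pi> (\<kappa> x) = \<kappa> x" "proj (\<kappa> x) = x"
  using assms by (auto simp: quotient_simps idem)

lemma proj_closed [simp]: "x \<in> carrier H \<Longrightarrow> proj x \<in> carrier Q"
  by (auto simp: quotient_simps)

lemma quotient_vs [simp]: "vs Q"
proof -
  note h = linear_maps_apply(2,3)[OF \<pi>]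
  have e: "\<exists>k. k \<in> carrier H \<and> \<pi> k = k \<and> x = \<iota> k" if "x \<in> carrier Q" for x
    using quotient_elem[OF that] by metis
  have c: "\<iota> k \<in> carrier Q" if "k \<in> carrier H" "\<pi> k = k" for k
    using proj_closed[OF that(1)] that(2) by simp
  have z: "\<pi> \<zero>\<^bsub>H\<^esub> = \<zero>\<^bsub>H\<^esub>" using linear_maps_zero[OF \<pi>] by simp
  show ?thesis
  proof (rule vsI)
    show "abelian_group Q"
    proof (rule abelian_groupI)
      fix x assume "x \<in> carrier Q"
      then obtain k where k: "k \<in> carrier H" "\<pi> k = k" "x = \<iota> k" using e by blast
      show "\<exists>y\<in>carrier Q. y \<oplus>\<^bsub>Q\<^esub> x = \<zero>\<^bsub>Q\<^esub>"
        using k vs_neg[of H k] by (intro bexI[of _ "\<iota> ((- 1) \<odot>\<^bsub>H\<^esub> k)"]) (auto simp: quotient_simps(2,3) h vs_ac intro!: c)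
    qed (auto dest!: e simp: quotient_simps(2,3) vs_ac vs_simps h z intro!: c)
  qed (auto dest!: e simp: quotient_simps(3,4) vs_simps vs_distrib h intro!: c)
qed

lemma proj_linear [simp]: "proj \<in> linear_maps H Q"
  by (rule linear_mapsI) (auto simp: quotient_simps(3,4) linear_maps_apply[OF \<pi>])

lemma \<kappa>_linear [simp]: "\<kappa> \<in> linear_maps Q H"
  by (rule linear_mapsI) (auto simp: quotient_simps(3,4) quotient_elem)

lemma quotient_lcoaction: "lcoaction Q"
  unfolding lcoaction_def
proof
  have "tensor_map H H H Q id proj \<in> linear_maps (H \<otimes>\<^sub>\<complex> H) (H \<otimes>\<^sub>\<complex> Q)"
    by (rule tensor_map_linear) auto
  from linear_maps_comp[OF this linear_maps_comp[OF structure_linear(1) \<kappa>_linear]]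
  show "lcoact Q \<in> linear_maps Q (H \<otimes>\<^sub>\<complex> Q)"
    using quotient_coact by (simp add: linear_maps_iff)
qed simp

lemma quotient_coact_sum:
  assumes x: "x \<in> carrier H" and l: "lin H \<phi>" "lin Q \<psi>"
  shows "tsum H Q (lcoact Q (proj x)) (\<lambda>a w. \<phi> a * \<psi> w) = \<Delta> x (\<lambda>a b. \<phi> a * \<psi> (proj b))"
proof -
  have "tsum H Q (lcoact Q (proj x)) (\<lambda>a w. \<phi> a * \<psi> w) = \<Delta> (\<pi> x) (\<lambda>a b. \<phi> (id a) * \<psi> (proj b))"
    unfolding quotient_coact using x by (subst tsum_tensor_map) (use l in auto)
  also have "\<dots> = \<Delta> (\<pi> x) (\<lambda>a b. \<phi> a * \<psi> (proj (\<pi> b)))" by (simp add: idem)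
  also have "\<dots> = \<Delta> x (\<lambda>a b. \<phi> a * \<psi> (proj b))"
    using coideal[OF x l(1) lin_comp[OF l(2) proj_linear]] by (simp add: idem)
  finally show ?thesis .
qed

lemma quotient_coact_\<kappa>:
  assumes "x \<in> carrier Q" "lin H \<phi>" "lin Q \<psi>"
  shows "tsum H Q (lcoact Q x) (\<lambda>a w. \<phi> a * \<psi> w) = \<Delta> (\<kappa> x) (\<lambda>a b. \<phi> a * \<psi> (proj b))"
  using quotient_coact_sum[of "\<kappa> x"] quotient_elem[OF assms(1)] assms by simp

lemma quotient_left_comodule: "left_comodule H Q"
proof (rule left_comoduleI[OF quotient_lcoaction])
  fix v \<alpha> \<beta> \<gamma> assume v: "v \<in> carrier Q" and l [simp]: "lin H \<alpha>" "lin H \<beta>" "lin Q \<gamma>"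
  note k = quotient_elem[OF v]
  have "tsum H Q (lcoact Q v) (\<lambda>a w. \<Delta> a (\<lambda>c d. \<alpha> c * (\<beta> d * \<gamma> w))) =
      tsum H Q (lcoact Q v) (\<lambda>a w. \<Delta> a (\<lambda>c d. \<alpha> c * \<beta> d) * \<gamma> w)"
    by (simp add: tsum_multc[symmetric] mult.assoc)
  also have "\<dots> = \<Delta> (\<kappa> v) (\<lambda>a b. \<Delta> a (\<lambda>c d. \<alpha> c * \<beta> d) * \<gamma> (proj b))"
    by (rule quotient_coact_\<kappa>[OF v]) auto
  also have "\<dots> = \<Delta> (\<kappa> v) (\<lambda>a b. \<Delta> b (\<lambda>d e. \<alpha> a * (\<beta> d * \<gamma> (proj e))))"
    using k by (simp add: tsum_multc[symmetric] comult_coassoc mult.assoc lin_comp[OF l(3)])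
  also have "\<dots> = \<Delta> (\<kappa> v) (\<lambda>a b. \<alpha> a * tsum H Q (lcoact Q (proj b)) (\<lambda>d u. \<beta> d * \<gamma> u))"
    by (simp add: quotient_coact_sum tsum_cmult)
  also have "\<dots> = tsum H Q (lcoact Q v) (\<lambda>a w. \<alpha> a * tsum H Q (lcoact Q w) (\<lambda>d u. \<beta> d * \<gamma> u))"
    using lcoactionD[OF quotient_lcoaction]
    by (intro quotient_coact_\<kappa>[OF v, symmetric]) auto
  finally show "tsum H Q (lcoact Q v) (\<lambda>a w. \<Delta> a (\<lambda>c d. \<alpha> c * (\<beta> d * \<gamma> w))) =
      tsum H Q (lcoact Q v) (\<lambda>a w. tsum H Q (lcoact Q w) (\<lambda>d u. \<alpha> a * (\<beta> d * \<gamma> u)))"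
    by (simp add: tsum_cmult)
next
  fix v \<gamma> assume v: "v \<in> carrier Q" and l: "lin Q \<gamma>"
  show "tsum H Q (lcoact Q v) (\<lambda>a w. \<epsilon> a * \<gamma> w) = \<gamma> v"
    using quotient_elem[OF v] comult_counit(1)[of "\<kappa> v", OF _ lin_comp[OF l proj_linear]]
    by (simp add: quotient_coact_\<kappa>[OF v _ l])
qed

end

text \<open>The regular comodule \<open>H\<close> itself, copied into \<open>'u\<close>. Cotensoring with it is the identity.\<close>

abbreviation regular :: "('h \<Rightarrow> 'u) \<Rightarrow> ('h, 'u) lcomod"
  where "regular \<iota> \<equiv> quotient_comodule \<iota> (\<lambda>x. x)"

lemma cotensor_regular:
  fixes \<iota> :: "'h \<Rightarrow> 'u"
  assumes \<iota>: "inj_on \<iota> (carrier H)" and u: "u \<in> carrier (cotensor H P (regular \<iota>))"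
  obtains q where "q \<in> carrier P" "\<And>F. bil P H F \<Longrightarrow>
    tsum P (regular \<iota>) u (\<lambda>p x. F p (inv_into (carrier H) \<iota> x)) = \<rho> q F"
    "\<And>\<alpha>. lin P \<alpha> \<Longrightarrow> \<alpha> q = tsum P (regular \<iota>) u (\<lambda>p x. \<alpha> p * \<epsilon> (inv_into (carrier H) \<iota> x))"
proof -
  let ?\<kappa> = "inv_into (carrier H) \<iota>"
  have *: "(\<lambda>x. x) \<in> linear_maps H H" "\<And>x. x \<in> carrier H \<Longrightarrow> (\<lambda>x. x) ((\<lambda>x. x) x) = x"
    "\<And>x \<phi> \<psi>. x \<in> carrier H \<Longrightarrow> lin H \<phi> \<Longrightarrow> lin H \<psi> \<Longrightarrow>
      \<Delta> ((\<lambda>x. x) x) (\<lambda>a b. \<phi> a * \<psi> ((\<lambda>x. x) b)) = \<Delta> x (\<lambda>a b. \<phi> a * \<psi> ((\<lambda>x. x) b))"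
    by auto
  note reg = quotient_vs[OF \<iota> *] quotient_elem[OF \<iota> *] quotient_lcoaction[OF \<iota> *] \<kappa>_linear[OF \<iota> *]
    proj_linear[OF \<iota> *] quotient_coact_\<kappa>[OF \<iota> *]
  note [simp] = reg(1)
  have \<epsilon>\<kappa>: "lin (regular \<iota>) (\<lambda>x. \<epsilon> (?\<kappa> x))"
    by (rule structure_linear_comp(3)) (rule reg)
  have \<epsilon>\<iota>: "\<epsilon> (?\<kappa> (\<iota> x)) = \<epsilon> x" if "x \<in> carrier H" for x
    using that \<iota> by simp
  have uc: "u \<in> carrier (P \<otimes>\<^sub>\<complex> regular \<iota>)" using u by (rule cotensor_carrier)
  define q where "q = tvec P (regular \<iota>) P u (\<lambda>p x. \<epsilon> (?\<kappa> x) \<odot>\<^bsub>P\<^esub> p)"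
  have q: "q \<in> carrier P" unfolding q_def by simp
  have \<alpha>q: "\<alpha> q = tsum P (regular \<iota>) u (\<lambda>p x. \<epsilon> (?\<kappa> x) * \<alpha> p)" if "lin P \<alpha>" for \<alpha>
  proof -
    have "\<alpha> q = tsum P (regular \<iota>) u (\<lambda>p x. \<alpha> (\<epsilon> (?\<kappa> x) \<odot>\<^bsub>P\<^esub> p))"
      unfolding q_def by (rule lin_tvec[OF _ _ _ _ that]) auto
    then show ?thesis using lin_apply(2)[OF that] by simp
  qed
  have \<rho>q: "\<rho> q (\<lambda>a b. \<alpha> a * \<beta> b) = tsum P (regular \<iota>) u (\<lambda>p x. \<alpha> p * \<beta> (?\<kappa> x))"
    if l [simp]: "lin P \<alpha>" "lin H \<beta>" for \<alpha> \<beta>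
  proof -
    have "\<rho> q (\<lambda>a b. \<alpha> a * \<beta> b) = tsum P (regular \<iota>) u (\<lambda>p x. \<rho> p (\<lambda>a b. \<alpha> a * (\<beta> b * \<epsilon> (?\<kappa> x))))"
      by (subst \<alpha>q) (auto simp: tsum_cmult[symmetric] mult_ac)
    also have "\<dots> = tsum P (regular \<iota>) u (\<lambda>p x. tsum H (regular \<iota>) (lcoact (regular \<iota>) x) (\<lambda>b w. \<alpha> p * (\<beta> b * \<epsilon> (?\<kappa> w))))"
      by (rule cotensor_sum[OF reg(5) u]) (use \<epsilon>\<kappa> in auto)
    also have "\<dots> = tsum P (regular \<iota>) u (\<lambda>p x. \<alpha> p * \<beta> (?\<kappa> x))"
      using \<epsilon>\<kappa> by (simp add: tsum_cmult reg(8) \<epsilon>\<iota> comult_counit reg(2))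
    finally show ?thesis .
  qed
  have e: "rcoact P q = tensor_map P (regular \<iota>) P H id ?\<kappa> u"
  proof (rule tensor_eqI[of P H])
    fix \<alpha> \<beta> assume l: "lin P \<alpha>" "lin H \<beta>"
    show "\<rho> q (\<lambda>v w. \<alpha> v * \<beta> w) = tsum P H (tensor_map P (regular \<iota>) P H id ?\<kappa> u) (\<lambda>v w. \<alpha> v * \<beta> w)"
      by (subst tsum_tensor_map) (simp_all add: uc reg(6) l \<rho>q)
  qed (simp_all add: q uc reg(6))
  have "tsum P (regular \<iota>) u (\<lambda>p x. F p (?\<kappa> x)) = \<rho> q F" if "bil P H F" for F
    unfolding e by (subst tsum_tensor_map) (simp_all add: that uc reg(6))
  then show thesis using q \<alpha>q by (intro that[of q]) (simp_all add: mult.commute)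
qed

subsection \<open>Coflatness yields a total integral\<close>

text \<open>The dual of \<open>H\<close> acts by \<open>\<phi> \<cdot> p = p\<^sub>0 \<phi>(p\<^sub>1)\<close> on every right comodule. A subspace is a subcomodule iff
  it is stable under this action, and a linear map is colinear iff it commutes with it. In this form both notions
  make sense for a partial map and survive unions of chains.\<close>

definition dual_H :: "('h \<Rightarrow> complex) \<Rightarrow> 'h \<Rightarrow> 'h"
  where "dual_H \<phi> h = tvec H H H (comult H h) (\<lambda>a b. \<phi> b \<odot>\<^bsub>H\<^esub> a)"

definition dual_P :: "('h \<Rightarrow> complex) \<Rightarrow> 'p \<Rightarrow> 'p"
  where "dual_P \<phi> p = tvec P H P (rcoact P p) (\<lambda>a b. \<phi> b \<odot>\<^bsub>P\<^esub> a)"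

lemma dual_closed [simp]: "dual_H \<phi> h \<in> carrier H" "dual_P \<phi> p \<in> carrier P"
  by (simp_all add: dual_H_def dual_P_def)

lemma lin_dual_H: "lin H \<alpha> \<Longrightarrow> \<alpha> (dual_H \<phi> h) = \<Delta> h (\<lambda>a b. \<alpha> a * \<phi> b)"
  unfolding dual_H_def by (subst lin_tvec[of H H H]) (auto simp: lin_apply mult.commute)

lemma lin_dual_P: "lin P \<alpha> \<Longrightarrow> \<alpha> (dual_P \<phi> p) = \<rho> p (\<lambda>a b. \<alpha> a * \<phi> b)"
  unfolding dual_P_def by (subst lin_tvec[of P H P]) (auto simp: lin_apply mult.commute)

lemma dual_linear [simp]:
  "lin H \<phi> \<Longrightarrow> dual_H \<phi> \<in> linear_maps H H" "lin H \<phi> \<Longrightarrow> dual_P \<phi> \<in> linear_maps P P"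
  by (rule linear_maps_by_functionals; simp add: lin_dual_H lin_dual_P)+

lemma dual_linear_functional:
  "lin H \<phi> \<Longrightarrow> lin H \<psi> \<Longrightarrow> dual_H (\<lambda>x. \<phi> x + \<psi> x) h = dual_H \<phi> h \<oplus>\<^bsub>H\<^esub> dual_H \<psi> h"
  "lin H \<phi> \<Longrightarrow> lin H \<psi> \<Longrightarrow> dual_P (\<lambda>x. \<phi> x + \<psi> x) p = dual_P \<phi> p \<oplus>\<^bsub>P\<^esub> dual_P \<psi> p"
  "lin H \<phi> \<Longrightarrow> dual_H (\<lambda>x. c * \<phi> x) h = c \<odot>\<^bsub>H\<^esub> dual_H \<phi> h"
  "lin H \<phi> \<Longrightarrow> dual_P (\<lambda>x. c * \<phi> x) p = c \<odot>\<^bsub>P\<^esub> dual_P \<phi> p"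
  "dual_H (\<lambda>x. 0) h = \<zero>\<^bsub>H\<^esub>" "dual_P (\<lambda>x. 0) p = \<zero>\<^bsub>P\<^esub>"
  by (rule vs_eqI[of H] vs_eqI[of P];
      simp add: lin_apply lin_dual_H lin_dual_P lin_zero tsum_add algebra_simps tsum_cmult[symmetric] tsum_cmult[of _ _ _ 0, simplified])+

definition convolution :: "('h \<Rightarrow> complex) \<Rightarrow> ('h \<Rightarrow> complex) \<Rightarrow> 'h \<Rightarrow> complex"
  where "convolution \<phi> \<psi> h = \<Delta> h (\<lambda>a b. \<phi> a * \<psi> b)"

lemma convolution_lin [simp]: "lin H \<phi> \<Longrightarrow> lin H \<psi> \<Longrightarrow> lin H (convolution \<phi> \<psi>)"
  unfolding convolution_def by simp

lemma dual_dual: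
  assumes [simp]: "lin H \<phi>" "lin H \<psi>"
  shows "h \<in> carrier H \<Longrightarrow> dual_H \<phi> (dual_H \<psi> h) = dual_H (convolution \<phi> \<psi>) h"
    and "p \<in> carrier P \<Longrightarrow> dual_P \<phi> (dual_P \<psi> p) = dual_P (convolution \<phi> \<psi>) p"
proof -
  assume [simp]: "h \<in> carrier H"
  show "dual_H \<phi> (dual_H \<psi> h) = dual_H (convolution \<phi> \<psi>) h"
  proof (rule vs_eqI[OF vs_H])
    fix \<alpha> assume [simp]: "lin H \<alpha>"
    have "\<alpha> (dual_H \<phi> (dual_H \<psi> h)) = \<Delta> h (\<lambda>a b. \<Delta> a (\<lambda>c d. \<alpha> c * \<phi> d * \<psi> b))"
      by (simp add: lin_dual_H lin_dual_H[of "\<lambda>x. \<Delta> x (\<lambda>a b. \<alpha> a * \<phi> b)"] tsum_multc)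
    also have "\<dots> = \<alpha> (dual_H (convolution \<phi> \<psi>) h)"
      by (simp add: comult_coassoc lin_dual_H convolution_def tsum_cmult[symmetric] mult.assoc)
    finally show "\<alpha> (dual_H \<phi> (dual_H \<psi> h)) = \<alpha> (dual_H (convolution \<phi> \<psi>) h)" .
  qed auto
next
  assume [simp]: "p \<in> carrier P"
  show "dual_P \<phi> (dual_P \<psi> p) = dual_P (convolution \<phi> \<psi>) p"
  proof (rule vs_eqI[OF vs_P])
    fix \<alpha> assume [simp]: "lin P \<alpha>"
    have "\<alpha> (dual_P \<phi> (dual_P \<psi> p)) = \<rho> p (\<lambda>a b. \<rho> a (\<lambda>c d. \<alpha> c * \<phi> d * \<psi> b))"
      by (simp add: lin_dual_P lin_dual_P[of "\<lambda>x. \<rho> x (\<lambda>a b. \<alpha> a * \<phi> b)"] tsum_multc)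
    also have "\<dots> = \<alpha> (dual_P (convolution \<phi> \<psi>) p)"
      by (simp add: coact_coassoc lin_dual_P convolution_def tsum_cmult[symmetric] mult.assoc)
    finally show "\<alpha> (dual_P \<phi> (dual_P \<psi> p)) = \<alpha> (dual_P (convolution \<phi> \<psi>) p)" .
  qed auto
qed

lemma dual_counit: "h \<in> carrier H \<Longrightarrow> dual_H \<epsilon> h = h" "p \<in> carrier P \<Longrightarrow> dual_P \<epsilon> p = p"
  by (rule vs_eqI[of H] vs_eqI[of P]; simp add: lin_dual_H lin_dual_P comult_counit coact_counit)+

lemma dual_one: "lin H \<phi> \<Longrightarrow> dual_H \<phi> 1\<^sub>H = \<phi> 1\<^sub>H \<odot>\<^bsub>H\<^esub> 1\<^sub>H" "lin H \<phi> \<Longrightarrow> dual_P \<phi> 1\<^sub>P = \<phi> 1\<^sub>H \<odot>\<^bsub>P\<^esub> 1\<^sub>P"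
  by (rule vs_eqI[of H] vs_eqI[of P];
      simp add: lin_dual_H lin_dual_P comult_one coact_one lin_apply mult.commute)+

text \<open>
  A colinear map \<open>f\<close> on a subcomodule \<open>D\<close> of \<open>H\<close> extends to the subcomodule generated by one more element \<open>h\<close>.
  Let \<open>L\<close> consist of all \<open>\<xi>(h\<^sub>1) h\<^sub>2\<close> with \<open>\<xi>\<close> vanishing on \<open>D\<close>. Modulo \<open>L\<close> the left leg of \<open>\<Delta> h\<close> lies in \<open>D\<close>, so
  \<open>z = \<Sum> f(h\<^sub>1) \<otimes> [h\<^sub>2]\<close> makes sense in \<open>P \<otimes> (H / L)\<close>, and it lies in \<open>P \<box> (H / L)\<close> because \<open>f\<close> is colinear.
  Coflatness for the surjection from \<open>H\<close> onto \<open>H / L\<close> lifts \<open>z\<close> to \<open>P \<box> H\<close>, that is, to an element \<open>q\<close> of \<open>P\<close>.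
  This \<open>q\<close> is the value at \<open>h\<close>: the conclusion says that it is compatible with the values of \<open>f\<close> at those
  elements \<open>\<phi> \<cdot> h\<close> that are already in \<open>D\<close>.
\<close>

lemma colinear_extension_step:
  fixes \<iota> :: "'h \<Rightarrow> 'u"
  assumes \<iota>: "inj_on \<iota> (carrier H)" and flat: "coflat TYPE('u) H P"
    and D: "subspace H D" and Dinv: "\<And>d \<phi>. d \<in> D \<Longrightarrow> lin H \<phi> \<Longrightarrow> dual_H \<phi> d \<in> D"
    and f: "f \<in> linear_maps H P"
    and fcol: "\<And>d \<phi>. d \<in> D \<Longrightarrow> lin H \<phi> \<Longrightarrow> dual_P \<phi> (f d) = f (dual_H \<phi> d)"
    and h0: "h0 \<in> carrier H"
  obtains q where "q \<in> carrier P"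
    "\<And>\<phi>. lin H \<phi> \<Longrightarrow> dual_H \<phi> h0 \<in> D \<Longrightarrow> dual_P \<phi> q = f (dual_H \<phi> h0)"
proof -
  obtain \<pi>D where \<pi>D: "\<pi>D \<in> linear_maps H H" "\<And>x. x \<in> carrier H \<Longrightarrow> \<pi>D x \<in> D" "\<And>x. x \<in> D \<Longrightarrow> \<pi>D x = x"
    using subspace_projection[OF vs_H D] by blast
  note [simp] = h0 f linear_maps_apply(1)[OF f] \<pi>D linear_maps_apply(1)[OF \<pi>D(1)]
  define fD where "fD x = f (\<pi>D x)" for x
  have fD [simp]: "fD \<in> linear_maps H P" unfolding fD_def by (rule linear_maps_comp[OF f \<pi>D(1)])
  have fDc [simp]: "x \<in> carrier H \<Longrightarrow> fD x \<in> carrier P" for x by (simp add: fD_def)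
  \<comment> \<open>The left coideal of all \<open>\<xi>(h\<^sub>1) h\<^sub>2\<close> with \<open>\<xi>\<close> vanishing on \<open>D\<close>; modulo it the left legs of \<open>\<Delta> h\<close> lie in \<open>D\<close>.\<close>
  define lact where "lact \<xi> = tvec H H H (comult H h0) (\<lambda>a b. \<xi> a \<odot>\<^bsub>H\<^esub> b)" for \<xi>
  define L where "L = lact ` {\<xi>. lin H \<xi> \<and> (\<forall>d\<in>D. \<xi> d = 0)}"
  have lactc [simp]: "lact \<xi> \<in> carrier H" for \<xi> by (simp add: lact_def)
  have lact: "\<alpha> (lact \<xi>) = \<Delta> h0 (\<lambda>a b. \<xi> a * \<alpha> b)" if "lin H \<alpha>" for \<alpha> \<xi>
    unfolding lact_def using that by (subst lin_tvec[of H H H]) (auto simp: lin_apply)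
  have "subspace H L"
    unfolding subspace_def
  proof (intro conjI ballI allI)
    show "L \<subseteq> carrier H" by (auto simp: L_def)
    have "lact (\<lambda>x. 0) = \<zero>\<^bsub>H\<^esub>"
      by (rule vs_eqI[OF vs_H]) (simp_all add: lact lin_zero tsum_cmult[of _ _ _ 0, simplified])
    then show "\<zero>\<^bsub>H\<^esub> \<in> L" unfolding L_def by (intro image_eqI[of _ _ "\<lambda>x. 0"]) auto
    fix x c assume "x \<in> L"
    then obtain \<xi> where \<xi>: "lin H \<xi>" "\<forall>d\<in>D. \<xi> d = 0" "x = lact \<xi>" by (auto simp: L_def)
    have "lact (\<lambda>x. c * \<xi> x) = c \<odot>\<^bsub>H\<^esub> x" unfolding \<xi>
      by (rule vs_eqI[OF vs_H]) (simp_all add: lact lin_apply tsum_cmult[symmetric] mult.assoc)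
    then show "c \<odot>\<^bsub>H\<^esub> x \<in> L"
      unfolding L_def using \<xi> by (intro image_eqI[of _ _ "\<lambda>x. c * \<xi> x"]) auto
    fix y assume "y \<in> L"
    then obtain \<zeta> where \<zeta>: "lin H \<zeta>" "\<forall>d\<in>D. \<zeta> d = 0" "y = lact \<zeta>" by (auto simp: L_def)
    have "lact (\<lambda>x. \<xi> x + \<zeta> x) = x \<oplus>\<^bsub>H\<^esub> y" unfolding \<xi> \<zeta>
      by (rule vs_eqI[OF vs_H]) (simp_all add: lact lin_apply tsum_add[symmetric] algebra_simps)
    then show "x \<oplus>\<^bsub>H\<^esub> y \<in> L"
      unfolding L_def using \<xi> \<zeta> by (intro image_eqI[of _ _ "\<lambda>x. \<xi> x + \<zeta> x"]) auto
  qed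
  from subspace_projection[OF vs_H this] obtain \<pi>L where
    \<pi>L: "\<pi>L \<in> linear_maps H H" "\<And>x. x \<in> carrier H \<Longrightarrow> \<pi>L x \<in> L" "\<And>x. x \<in> L \<Longrightarrow> \<pi>L x = x" by blast
  have \<pi>Lc [simp]: "x \<in> carrier H \<Longrightarrow> \<pi>L x \<in> carrier H" for x using linear_maps_apply(1)[OF \<pi>L(1)] .
  define \<pi> where "\<pi> x = x \<oplus>\<^bsub>H\<^esub> (- 1) \<odot>\<^bsub>H\<^esub> \<pi>L x" for x
  have \<alpha>\<pi>: "\<alpha> (\<pi> x) = \<alpha> x - \<alpha> (\<pi>L x)" if "lin H \<alpha>" "x \<in> carrier H" for \<alpha> x
    using that by (simp add: \<pi>_def lin_apply)
  have \<pi>c [simp]: "x \<in> carrier H \<Longrightarrow> \<pi> x \<in> carrier H" for x by (simp add: \<pi>_def)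
  have l\<pi>L: "lin H (\<lambda>x. \<alpha> (\<pi>L x))" if "lin H \<alpha>" for \<alpha> by (rule lin_comp[OF that \<pi>L(1)])
  have \<pi> [simp]: "\<pi> \<in> linear_maps H H"
  proof (rule linear_maps_by_functionals)
    fix \<phi> assume \<phi>: "lin H \<phi>"
    have "lin H (\<lambda>x. \<phi> x + (- 1) * \<phi> (\<pi>L x))" using \<phi> l\<pi>L[OF \<phi>] by (intro lin_closure)
    then show "lin H (\<lambda>x. \<phi> (\<pi> x))" using \<phi> by (simp add: lin_def \<alpha>\<pi>)
  qed auto
  have \<pi>0: "\<pi> x = \<zero>\<^bsub>H\<^esub>" if "x \<in> L" for x
    using \<pi>L(3)[OF that] \<pi>L(2) that \<open>subspace H L\<close> by (auto simp: \<pi>_def vs_neg subspace_def)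
  have idem: "\<pi> (\<pi> x) = \<pi> x" if "x \<in> carrier H" for x
  proof (rule vs_eqI[OF vs_H])
    fix \<phi> assume \<phi>: "lin H \<phi>"
    have "\<phi> (\<pi> (\<pi> x)) = \<phi> (\<pi> x) - \<phi> (\<pi> (\<pi>L x))"
      using \<alpha>\<pi>[OF lin_comp[OF \<phi> \<pi>] that] that by simp
    then show "\<phi> (\<pi> (\<pi> x)) = \<phi> (\<pi> x)"
      using \<pi>0[OF \<pi>L(2)[OF that]] \<phi> by (simp add: lin_zero)
  qed (use that in auto)
  have coideal: "\<Delta> (\<pi> x) (\<lambda>a b. \<phi> a * \<psi> (\<pi> b)) = \<Delta> x (\<lambda>a b. \<phi> a * \<psi> (\<pi> b))"
    if x: "x \<in> carrier H" and l [simp]: "lin H \<phi>" "lin H \<psi>" for x \<phi> \<psi>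
  proof -
    note [simp] = lin_comp[OF l(2)]
    obtain \<xi> where \<xi> [simp]: "lin H \<xi>" and \<xi>D: "\<And>d. d \<in> D \<Longrightarrow> \<xi> d = 0" and x': "\<pi>L x = lact \<xi>"
      using \<pi>L(2)[OF x] by (auto simp: L_def)
    have "\<Delta> (\<pi>L x) (\<lambda>a b. \<phi> a * \<psi> (\<pi> b)) = \<Delta> h0 (\<lambda>a b. \<xi> a * \<Delta> b (\<lambda>c d. \<phi> c * \<psi> (\<pi> d)))"
      unfolding x' by (subst lact) auto
    also have "\<dots> = \<Delta> h0 (\<lambda>a b. \<Delta> a (\<lambda>c d. \<xi> c * \<phi> d * \<psi> (\<pi> b)))"
      by (simp add: comult_coassoc tsum_cmult[symmetric] mult.assoc)
    also have "\<dots> = \<psi> (\<pi> (lact (convolution \<xi> \<phi>)))"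
      by (subst lact) (auto simp: convolution_def tsum_multc)
    also have "\<dots> = 0"
    proof -
      have "convolution \<xi> \<phi> d = 0" if "d \<in> D" for d
        using \<xi>D[OF Dinv[OF that l(1)]] by (simp add: convolution_def lin_dual_H)
      then have "lact (convolution \<xi> \<phi>) \<in> L" unfolding L_def by auto
      then show ?thesis using \<pi>0 lin_zero[OF l(2)] by simp
    qed
    finally have "\<Delta> (\<pi>L x) (\<lambda>a b. \<phi> a * \<psi> (\<pi> b)) = 0" .
    then show ?thesis
      using x by (subst \<alpha>\<pi>[of "\<lambda>z. \<Delta> z (\<lambda>a b. \<phi> a * \<psi> (\<pi> b))"]) auto
  qed
  note QF = \<iota> \<pi> idem coideal
  define C where "C = quotient_comodule \<iota> \<pi>"
  define R where "R = regular \<iota>"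
  let ?\<kappa> = "inv_into (carrier H) \<iota>"
  let ?q = "\<lambda>x. \<iota> (\<pi> x)"
  have id: "(\<lambda>x. x) \<in> linear_maps H H" "\<And>x. x \<in> carrier H \<Longrightarrow> (\<lambda>x. x) ((\<lambda>x. x) x) = x"
    "\<And>x \<phi> \<psi>. x \<in> carrier H \<Longrightarrow> lin H \<phi> \<Longrightarrow> lin H \<psi> \<Longrightarrow>
      \<Delta> ((\<lambda>x. x) x) (\<lambda>a b. \<phi> a * \<psi> ((\<lambda>x. x) b)) = \<Delta> x (\<lambda>a b. \<phi> a * \<psi> ((\<lambda>x. x) b))"
    by auto
  note QR = \<iota> id
  have Cf: "vs C" "?q \<in> linear_maps H C" "?\<kappa> \<in> linear_maps C H" and Cc: "left_comodule H C"
    unfolding C_def by (rule quotient_vs[OF QF] proj_linear[OF QF] \<kappa>_linear[OF QF] quotient_left_comodule[OF QF]; assumption)+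
  have Rf: "vs R" "\<iota> \<in> linear_maps H R" "?\<kappa> \<in> linear_maps R H" and Rc: "left_comodule H R"
    unfolding R_def by (rule quotient_vs[OF QR] proj_linear[OF QR] \<kappa>_linear[OF QR] quotient_left_comodule[OF QR]; assumption)+
  note Cl = left_comodule_lcoaction[OF Cc] and Rl = left_comodule_lcoaction[OF Rc]
  note [simp] = Cf Rf linear_maps_apply(1)[OF Cf(2)] linear_maps_apply(1)[OF Rf(3)] lcoactionD[OF Cl] lcoactionD[OF Rl]
  define g where "g x = ?q (?\<kappa> x)" for x
  have g [simp]: "g \<in> linear_maps R C" unfolding g_def by (rule linear_maps_comp[OF Cf(2) Rf(3)])
  have gcol: "g \<in> comodule_maps H R C"
  proof -
    have "lcoact C (g v) = tensor_map H R H C id g (lcoact R v)" if v: "v \<in> carrier R" for v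
    proof (rule tensor_eqI[of H C])
      fix \<alpha> \<beta> assume l [simp]: "lin H \<alpha>" "lin C \<beta>"
      note [simp] = lin_comp[OF l(2)]
      have "tsum H C (lcoact C (g v)) (\<lambda>v w. \<alpha> v * \<beta> w) = \<Delta> (?\<kappa> v) (\<lambda>a b. \<alpha> a * \<beta> (?q b))"
        unfolding g_def C_def by (rule quotient_coact_sum[OF QF]) (use v l in \<open>simp_all add: C_def[symmetric]\<close>)
      also have "\<dots> = \<Delta> (?\<kappa> v) (\<lambda>a b. \<alpha> a * \<beta> (g (\<iota> b)))"
        using \<iota> by (simp add: g_def)
      also have "\<dots> = tsum H R (lcoact R v) (\<lambda>a b. \<alpha> a * \<beta> (g b))"
        unfolding R_def by (rule quotient_coact_\<kappa>[OF QR, symmetric]) (use v in \<open>simp_all add: R_def[symmetric]\<close>)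
      finally show "tsum H C (lcoact C (g v)) (\<lambda>v w. \<alpha> v * \<beta> w) =
          tsum H C (tensor_map H R H C id g (lcoact R v)) (\<lambda>v w. \<alpha> v * \<beta> w)"
        using v by (subst tsum_tensor_map) simp_all
    qed (use v linear_maps_apply(1)[OF g] in auto)
    then show ?thesis by (simp add: comodule_maps_def)
  qed
  have zcol: "(\<lambda>_. \<zero>\<^bsub>C\<^esub>) \<in> comodule_maps H C C"
  proof -
    have z: "(\<lambda>_. \<zero>\<^bsub>C\<^esub>) \<in> linear_maps C C" by (auto simp: linear_maps_iff vs_simps)
    have "lcoact C \<zero>\<^bsub>C\<^esub> = tensor_map H C H C id (\<lambda>_. \<zero>\<^bsub>C\<^esub>) (lcoact C v)" if v: "v \<in> carrier C" for v
    proof (rule tensor_eqI[of H C])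
      fix \<alpha> \<beta> assume l: "lin H \<alpha>" "lin C \<beta>"
      have "lin C (\<lambda>v. tsum H C (lcoact C v) (\<lambda>v w. \<alpha> v * \<beta> w))"
        using l by simp
      from lin_zero[OF this] show "tsum H C (lcoact C \<zero>\<^bsub>C\<^esub>) (\<lambda>v w. \<alpha> v * \<beta> w) =
        tsum H C (tensor_map H C H C id (\<lambda>_. \<zero>\<^bsub>C\<^esub>) (lcoact C v)) (\<lambda>v w. \<alpha> v * \<beta> w)"
        using v z l by (simp add: tsum_tensor_map lin_zero tsum_cmult[of _ _ _ 0, simplified])
    qed (use v z in auto)
    with z show ?thesis by (simp add: comodule_maps_def)
  qed
  have exact: "g ` carrier R = {v \<in> carrier C. \<zero>\<^bsub>C\<^esub> = \<zero>\<^bsub>C\<^esub>}"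
  proof -
    have "v \<in> g ` carrier R" if v: "v \<in> carrier C" for v
    proof -
      have "?\<kappa> v \<in> carrier H"
        by (rule quotient_elem(1)[OF QF]) (use v in \<open>auto simp: C_def\<close>)
      moreover have "?q (?\<kappa> v) = v"
        by (rule quotient_elem(3)[OF QF]) (use v in \<open>auto simp: C_def\<close>)
      ultimately have "v = g (\<iota> (?\<kappa> v))" "\<iota> (?\<kappa> v) \<in> carrier R"
        by (simp_all only: g_def inv_into_f_f[OF \<iota>] linear_maps_apply(1)[OF Rf(2)])
      then show ?thesis by (rule image_eqI)
    qed
    then show ?thesis using linear_maps_apply(1)[OF g] by auto
  qed
  \<comment> \<open>Precomposing \<open>f\<close> with a projection onto \<open>D\<close> makes \<open>z\<close> a tensor in \<open>P \<otimes> (H / L)\<close> without a choice of representatives.\<close>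
  define z where "z = tvec H H (P \<otimes>\<^sub>\<complex> C) (comult H h0) (\<lambda>a b. pure_tensor P C (fD a) (?q b))"
  have zc: "z \<in> carrier (P \<otimes>\<^sub>\<complex> C)" by (simp add: z_def)
  have zsum: "tsum P C z F = \<Delta> h0 (\<lambda>a b. F (fD a) (?q b))" if "bil P C F" for F
    unfolding z_def using that by (subst tsum_tvec) (auto simp: tsum_pure)
  have K: "\<Delta> h0 (\<lambda>x y. \<zeta> (\<pi>D x) * \<gamma> (?q y)) = \<Delta> h0 (\<lambda>x y. \<zeta> x * \<gamma> (?q y))"
    if l [simp]: "lin H \<zeta>" "lin C \<gamma>" for \<zeta> \<gamma>
  proof -
    note [simp] = lin_comp[OF l(1)] lin_comp[OF l(2)]
    define \<xi> where "\<xi> x = \<zeta> x + (- 1) * \<zeta> (\<pi>D x)" for x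
    have "lin H \<xi>" unfolding \<xi>_def by (intro lin_closure) auto
    moreover have "\<forall>d\<in>D. \<xi> d = 0" by (auto simp: \<xi>_def)
    ultimately have p0: "\<pi> (lact \<xi>) = \<zero>\<^bsub>H\<^esub>" by (intro \<pi>0) (auto simp: L_def)
    have \<gamma>q: "lin H (\<lambda>y. \<gamma> (?q y))" by (rule lin_comp[OF l(2) Cf(2)])
    have z0: "\<pi> \<zero>\<^bsub>H\<^esub> = \<zero>\<^bsub>H\<^esub>" using linear_maps_zero[OF \<pi>] by simp
    have "\<Delta> h0 (\<lambda>x y. \<xi> x * \<gamma> (?q y)) = 0"
      unfolding lact[OF \<gamma>q, symmetric] p0 using lin_zero[OF \<gamma>q vs_H] unfolding z0 .
    then show ?thesis
      by (simp add: \<xi>_def algebra_simps tsum_diff)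
  qed
  have "z \<in> carrier (cotensor H P C)"
  proof (rule cotensorI[OF Cl zc])
    fix \<alpha> \<beta> \<gamma> assume l [simp]: "lin P \<alpha>" "lin H \<beta>" "lin C \<gamma>"
    note [simp] = lin_comp[OF l(1)] lin_comp[OF l(2)] lin_comp[OF l(3)]
    have "tsum P C z (\<lambda>p v. \<rho> p (\<lambda>a b. \<alpha> a * (\<beta> b * \<gamma> v))) = \<Delta> h0 (\<lambda>x y. \<alpha> (dual_P \<beta> (fD x)) * \<gamma> (?q y))"
      by (simp add: zsum lin_dual_P tsum_multc[symmetric] mult.assoc)
    also have "\<dots> = \<Delta> h0 (\<lambda>x y. \<alpha> (fD (dual_H \<beta> (\<pi>D x))) * \<gamma> (?q y))"
      by (simp add: fD_def fcol Dinv)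
    also have "\<dots> = \<Delta> h0 (\<lambda>x y. \<alpha> (fD (dual_H \<beta> x)) * \<gamma> (?q y))"
      by (rule K[of "\<lambda>x. \<alpha> (fD (dual_H \<beta> x))"]) (auto intro!: lin_comp[OF l(1)] linear_maps_comp[OF fD])
    also have "\<dots> = \<Delta> h0 (\<lambda>x y. \<Delta> x (\<lambda>c d. \<alpha> (fD c) * (\<beta> d * \<gamma> (?q y))))"
      by (simp add: lin_dual_H[of "\<lambda>x. \<alpha> (fD x)"] tsum_multc[symmetric] mult.assoc)
    also have "\<dots> = \<Delta> h0 (\<lambda>x y. \<Delta> y (\<lambda>b w. \<alpha> (fD x) * (\<beta> b * \<gamma> (?q w))))"
      by (simp add: comult_coassoc)
    also have "\<dots> = \<Delta> h0 (\<lambda>x y. \<alpha> (fD x) * tsum H C (lcoact C (?q y)) (\<lambda>b w. \<beta> b * \<gamma> w))"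
      by (simp add: quotient_coact_sum[OF QF, folded C_def] tsum_cmult)
    also have "\<dots> = tsum P C z (\<lambda>p v. tsum H C (lcoact C v) (\<lambda>b w. \<alpha> p * (\<beta> b * \<gamma> w)))"
      by (simp add: zsum tsum_cmult)
    finally show "tsum P C z (\<lambda>p v. \<rho> p (\<lambda>a b. \<alpha> a * (\<beta> b * \<gamma> v))) =
      tsum P C z (\<lambda>p v. tsum H C (lcoact C v) (\<lambda>b w. \<alpha> p * (\<beta> b * \<gamma> w)))" .
  qed
  moreover have "tensor_map P C P C id (\<lambda>_. \<zero>\<^bsub>C\<^esub>) z = \<zero>\<^bsub>P \<otimes>\<^sub>\<complex> C\<^esub>"
  proof (rule tensor_eqI[of P C])
    have z0: "(\<lambda>_. \<zero>\<^bsub>C\<^esub>) \<in> linear_maps C C" using zcol by (simp add: comodule_maps_def)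
    show "tensor_map P C P C id (\<lambda>_. \<zero>\<^bsub>C\<^esub>) z \<in> carrier (P \<otimes>\<^sub>\<complex> C)" using z0 zc by simp
    fix \<alpha> \<beta> assume l: "lin P \<alpha>" "lin C \<beta>"
    have "lin (P \<otimes>\<^sub>\<complex> C) (\<lambda>t. tsum P C t (\<lambda>v w. \<alpha> v * \<beta> w))" using l by (intro lin_tsum) auto
    from lin_zero[OF this] show "tsum P C (tensor_map P C P C id (\<lambda>_. \<zero>\<^bsub>C\<^esub>) z) (\<lambda>v w. \<alpha> v * \<beta> w) =
        tsum P C \<zero>\<^bsub>P \<otimes>\<^sub>\<complex> C\<^esub> (\<lambda>v w. \<alpha> v * \<beta> w)"
      using z0 zc l by (simp add: tsum_tensor_map lin_zero tsum_cmult[of _ _ _ 0, simplified])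
  qed auto
  moreover have "tensor_map P R P C id g ` carrier (cotensor H P R) =
      {t \<in> carrier (cotensor H P C). tensor_map P C P C id (\<lambda>_. \<zero>\<^bsub>C\<^esub>) t = \<zero>\<^bsub>P \<otimes>\<^sub>\<complex> C\<^esub>}"
    by (rule flat[unfolded coflat_def, rule_format, OF Rc Cc Cc gcol zcol exact])
  ultimately have "z \<in> tensor_map P R P C id g ` carrier (cotensor H P R)"
    by (simp only: mem_Collect_eq)
  then obtain u where u: "u \<in> carrier (cotensor H P R)" and zu: "z = tensor_map P R P C id g u" by blast
  obtain q where q: "q \<in> carrier P"
    "\<And>F. bil P H F \<Longrightarrow> tsum P R u (\<lambda>p x. F p (?\<kappa> x)) = \<rho> q F"
  proof (rule cotensor_regular[OF \<iota> u[unfolded R_def], folded R_def])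
    fix q assume a: "q \<in> carrier P" "\<And>F. bil P H F \<Longrightarrow> tsum P R u (\<lambda>p x. F p (?\<kappa> x)) = \<rho> q F"
    show thesis by (rule that[OF a])
  qed
  have q\<gamma>: "\<rho> q (\<lambda>a b. \<alpha> a * \<gamma> (?q b)) = \<Delta> h0 (\<lambda>x y. \<alpha> (fD x) * \<gamma> (?q y))"
    if l [simp]: "lin P \<alpha>" "lin C \<gamma>" for \<alpha> \<gamma>
  proof -
    note [simp] = lin_comp[OF l(1)] lin_comp[OF l(2)]
    have "\<rho> q (\<lambda>a b. \<alpha> a * \<gamma> (?q b)) = tsum P R u (\<lambda>p x. \<alpha> p * \<gamma> (g x))"
      by (subst q(2)[symmetric]) (auto simp: g_def)
    also have "\<dots> = tsum P C z (\<lambda>p x. \<alpha> p * \<gamma> x)"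
      unfolding zu using cotensor_carrier[OF u] by (subst tsum_tensor_map) auto
    finally show ?thesis by (simp add: zsum)
  qed
  have "dual_P \<phi> q = f (dual_H \<phi> h0)" if \<phi> [simp]: "lin H \<phi>" and d: "dual_H \<phi> h0 \<in> D" for \<phi>
  proof (rule vs_eqI[OF vs_P])
    fix \<alpha> assume l [simp]: "lin P \<alpha>"
    note [simp] = lin_comp[OF \<phi>] lin_comp[OF l]
    have \<phi>L: "\<phi> x = 0" if xL: "x \<in> L" for x
    proof -
      obtain \<xi> where \<xi>: "lin H \<xi>" "\<forall>d\<in>D. \<xi> d = 0" "x = lact \<xi>" using xL by (auto simp: L_def)
      have "\<phi> x = \<xi> (dual_H \<phi> h0)" using \<xi> by (simp add: lact lin_dual_H)
      then show ?thesis using \<xi> d by simp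
    qed
    have \<phi>\<pi>: "\<phi> (?\<kappa> (?q x)) = \<phi> x" if "x \<in> carrier H" for x
      using \<phi>L[OF \<pi>L(2)[OF that]] that \<iota> by (simp add: \<alpha>\<pi>)
    have l\<kappa>: "lin C (\<lambda>x. \<phi> (?\<kappa> x))" by simp
    have "\<alpha> (dual_P \<phi> q) = \<rho> q (\<lambda>a b. \<alpha> a * \<phi> (?\<kappa> (?q b)))"
      using q(1) by (simp add: lin_dual_P \<phi>\<pi>)
    also have "\<dots> = \<Delta> h0 (\<lambda>x y. \<alpha> (fD x) * \<phi> y)"
      using q\<gamma>[OF l l\<kappa>] by (simp add: \<phi>\<pi>)
    also have "\<dots> = \<alpha> (fD (dual_H \<phi> h0))"
      by (simp add: lin_dual_H[of "\<lambda>x. \<alpha> (fD x)"])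
    finally show "\<alpha> (dual_P \<phi> q) = \<alpha> (f (dual_H \<phi> h0))" using d by (simp add: fD_def)
  qed auto
  then show thesis using q(1) that by blast
qed

text \<open>Start from \<open>c 1 \<mapsto> c 1\<close> and take a maximal partial map that commutes with the action of the dual. If its
  domain were not all of \<open>H\<close>, the preceding lemma would enlarge it.\<close>

lemma total_integral:
  fixes \<iota> :: "'h \<Rightarrow> 'u"
  assumes \<iota>: "inj_on \<iota> (carrier H)" and flat: "coflat TYPE('u) H P"
  obtains j where "j \<in> linear_maps H P" "j 1\<^sub>H = 1\<^sub>P"
    "\<And>h F. h \<in> carrier H \<Longrightarrow> bil P H F \<Longrightarrow> \<rho> (j h) F = \<Delta> h (\<lambda>a b. F (j a) b)"
proof -
  define \<Theta> where "\<Theta> = {\<theta>. \<exists>\<phi>. lin H \<phi> \<and> \<theta> = (\<lambda>(h, p). (dual_H \<phi> h, dual_P \<phi> p))}"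
  let ?G0 = "range (\<lambda>c. (c \<odot>\<^bsub>H\<^esub> 1\<^sub>H, c \<odot>\<^bsub>P\<^esub> 1\<^sub>P))"
  have \<epsilon>c: "\<epsilon> (c \<odot>\<^bsub>H\<^esub> 1\<^sub>H) = c" for c by (simp add: lin_apply)
  have G0: "linfun H P ?G0"
    unfolding linfun_def
  proof (intro conjI allI impI linrelI)
    show "(\<zero>\<^bsub>H\<^esub>, \<zero>\<^bsub>P\<^esub>) \<in> ?G0"
      by (rule image_eqI[of _ _ 0]) (simp_all add: vs_simps)
    fix w assume "(\<zero>\<^bsub>H\<^esub>, w) \<in> ?G0"
    then obtain c where c: "c \<odot>\<^bsub>H\<^esub> 1\<^sub>H = \<zero>\<^bsub>H\<^esub>" "w = c \<odot>\<^bsub>P\<^esub> 1\<^sub>P" by auto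
    then have "c = 0" using \<epsilon>c[of c] by (simp add: lin_zero)
    then show "w = \<zero>\<^bsub>P\<^esub>" using c by (simp add: vs_simps)
  qed (auto simp: vs_distrib(1)[symmetric] vs_simps)
  have \<Theta>0: "\<theta> ` ?G0 \<subseteq> ?G0" if "\<theta> \<in> \<Theta>" for \<theta>
    using that linear_maps_apply(3)[OF dual_linear(1)] linear_maps_apply(3)[OF dual_linear(2)]
    by (auto simp: \<Theta>_def dual_one vs_simps)
  obtain M where M: "linfun H P M" "?G0 \<subseteq> M" "\<And>\<theta>. \<theta> \<in> \<Theta> \<Longrightarrow> \<theta> ` M \<subseteq> M"
    and max: "\<And>G. linfun H P G \<Longrightarrow> M \<subseteq> G \<Longrightarrow> G \<subseteq> UNIV \<Longrightarrow> (\<And>\<theta>. \<theta> \<in> \<Theta> \<Longrightarrow> \<theta> ` G \<subseteq> G) \<Longrightarrow> G = M"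
  proof (rule maximal_linfun[OF G0 subset_UNIV \<Theta>0])
    fix M assume a: "linfun H P M" "?G0 \<subseteq> M" "\<And>\<theta>. \<theta> \<in> \<Theta> \<Longrightarrow> \<theta> ` M \<subseteq> M"
      "\<And>G. linfun H P G \<Longrightarrow> M \<subseteq> G \<Longrightarrow> G \<subseteq> UNIV \<Longrightarrow> (\<And>\<theta>. \<theta> \<in> \<Theta> \<Longrightarrow> \<theta> ` G \<subseteq> G) \<Longrightarrow> G = M"
    show thesis by (rule that[OF a])
  qed
  have M': "linrel H P M" using M(1) by (simp add: linfun_def)
  have dM: "(dual_H \<phi> h, dual_P \<phi> p) \<in> M" if "(h, p) \<in> M" "lin H \<phi>" for h p \<phi>
    using M(3)[of "\<lambda>(h, p). (dual_H \<phi> h, dual_P \<phi> p)"] that by (auto simp: \<Theta>_def)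
  define D where "D = fst ` M"
  have D: "subspace H D"
    unfolding subspace_def
  proof (intro conjI ballI allI)
    show "D \<subseteq> carrier H" using M' by (auto simp: linrel_def D_def)
    show "\<zero>\<^bsub>H\<^esub> \<in> D" unfolding D_def by (rule image_eqI[OF _ linrelD(3)[OF M']]) simp
    fix x c assume "x \<in> D"
    then obtain a where a: "(x, a) \<in> M" by (auto simp: D_def)
    show "c \<odot>\<^bsub>H\<^esub> x \<in> D" unfolding D_def by (rule image_eqI[OF _ linrelD(5)[OF M' a]]) simp
    fix y assume "y \<in> D"
    then obtain b where b: "(y, b) \<in> M" by (auto simp: D_def)
    show "x \<oplus>\<^bsub>H\<^esub> y \<in> D" unfolding D_def by (rule image_eqI[OF _ linrelD(4)[OF M' a b]]) simp
  qed
  obtain f where f: "f \<in> linear_maps H P" "\<And>h p. (h, p) \<in> M \<Longrightarrow> f h = p"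
  proof (rule linear_selection[of H P "carrier H \<times> carrier P" M])
    show "linrel H P (carrier H \<times> carrier P)" by (rule linrelI) auto
    show "M \<subseteq> carrier H \<times> carrier P" using M' by (simp add: linrel_def)
    show "h \<in> fst ` (carrier H \<times> carrier P)" if "h \<in> carrier H" for h
      by (rule image_eqI[of _ _ "(h, 1\<^sub>P)"]) (use that in auto)
  qed (use M(1) that in auto)
  have fD: "(d, f d) \<in> M" if "d \<in> D" for d using that f(2) by (force simp: D_def)
  have Dinv: "dual_H \<phi> d \<in> D" and fcol: "dual_P \<phi> (f d) = f (dual_H \<phi> d)" if "d \<in> D" "lin H \<phi>" for d \<phi>
    using dM[OF fD[OF that(1)] that(2)] f(2) by (force simp: D_def)+
  have "D = carrier H"
  proof (rule ccontr)
    assume "D \<noteq> carrier H"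
    then obtain h0 where h0: "h0 \<in> carrier H" "h0 \<notin> D" using D by (auto simp: subspace_def)
    obtain q where q: "q \<in> carrier P"
      "\<And>\<phi>. lin H \<phi> \<Longrightarrow> dual_H \<phi> h0 \<in> D \<Longrightarrow> dual_P \<phi> q = f (dual_H \<phi> h0)"
      using colinear_extension_step[OF \<iota> flat D Dinv f(1) fcol h0(1)] by blast
    let ?N = "(\<lambda>\<phi>. (dual_H \<phi> h0, dual_P \<phi> q)) ` {\<phi>. lin H \<phi>}"
    let ?S = "(\<lambda>((v, w), (v', w')). (v \<oplus>\<^bsub>H\<^esub> v', w \<oplus>\<^bsub>P\<^esub> w')) ` (M \<times> ?N)"
    have N: "linrel H P ?N"
    proof (rule linrelI)
      show "(\<zero>\<^bsub>H\<^esub>, \<zero>\<^bsub>P\<^esub>) \<in> ?N"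
        by (rule image_eqI[of _ _ "\<lambda>x. 0"]) (simp_all add: dual_linear_functional)
      fix v w v' w' c assume "(v, w) \<in> ?N"
      then obtain \<phi> where \<phi>: "lin H \<phi>" "v = dual_H \<phi> h0" "w = dual_P \<phi> q" by auto
      show "(c \<odot>\<^bsub>H\<^esub> v, c \<odot>\<^bsub>P\<^esub> w) \<in> ?N"
        by (rule image_eqI[of _ _ "\<lambda>x. c * \<phi> x"]) (simp_all add: dual_linear_functional \<phi>)
      assume "(v', w') \<in> ?N"
      then obtain \<psi> where \<psi>: "lin H \<psi>" "v' = dual_H \<psi> h0" "w' = dual_P \<psi> q" by auto
      show "(v \<oplus>\<^bsub>H\<^esub> v', w \<oplus>\<^bsub>P\<^esub> w') \<in> ?N"
        by (rule image_eqI[of _ _ "\<lambda>x. \<phi> x + \<psi> x"]) (simp_all add: dual_linear_functional \<phi> \<psi>)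
    qed auto
    have agree: "w = w'" if m: "(v, w) \<in> M" and n: "(v, w') \<in> ?N" for v w w'
    proof -
      obtain \<phi> where \<phi>: "lin H \<phi>" "v = dual_H \<phi> h0" "w' = dual_P \<phi> q" using n by auto
      have "v \<in> D" using m by (force simp: D_def)
      then show ?thesis using q(2)[OF \<phi>(1)] f(2)[OF m] \<phi> by simp
    qed
    have h0N: "(h0, q) \<in> ?N"
      by (rule image_eqI[of _ _ \<epsilon>]) (simp_all add: dual_counit h0 q(1))
    have "?S = M"
    proof (rule max)
      show "linfun H P ?S" by (rule linfun_extend[OF vs_H vs_P M(1) N agree])
      show "M \<subseteq> ?S"
      proof (clarify)
        fix x y assume xy: "(x, y) \<in> M"
        show "(x, y) \<in> ?S"
          by (rule image_eqI[of _ _ "((x, y), (\<zero>\<^bsub>H\<^esub>, \<zero>\<^bsub>P\<^esub>))"])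
            (use xy linrelD(1,2)[OF M' xy] linrelD(3)[OF N] in \<open>simp_all add: vs_simps\<close>)
      qed
      fix \<theta> assume "\<theta> \<in> \<Theta>"
      then obtain \<phi> where \<phi>: "lin H \<phi>" "\<theta> = (\<lambda>(h, p). (dual_H \<phi> h, dual_P \<phi> p))" by (auto simp: \<Theta>_def)
      show "\<theta> ` ?S \<subseteq> ?S"
      proof (clarsimp simp: \<phi>(2) simp del: image_iff)
        fix a b \<psi> assume ab: "(a, b) \<in> M" and \<psi>: "lin H \<psi>"
        have "(dual_H \<phi> a \<oplus>\<^bsub>H\<^esub> dual_H (convolution \<phi> \<psi>) h0, dual_P \<phi> b \<oplus>\<^bsub>P\<^esub> dual_P (convolution \<phi> \<psi>) q) \<in> ?S"
          using dM[OF ab \<phi>(1)] \<phi>(1) \<psi>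
          by (intro image_eqI[of _ _ "((dual_H \<phi> a, dual_P \<phi> b), (dual_H (convolution \<phi> \<psi>) h0, dual_P (convolution \<phi> \<psi>) q))"]) auto
        moreover have "dual_H \<phi> (a \<oplus>\<^bsub>H\<^esub> dual_H \<psi> h0) = dual_H \<phi> a \<oplus>\<^bsub>H\<^esub> dual_H (convolution \<phi> \<psi>) h0"
          "dual_P \<phi> (b \<oplus>\<^bsub>P\<^esub> dual_P \<psi> q) = dual_P \<phi> b \<oplus>\<^bsub>P\<^esub> dual_P (convolution \<phi> \<psi>) q"
          using linear_maps_apply(2)[OF dual_linear(1)[OF \<phi>(1)]] linear_maps_apply(2)[OF dual_linear(2)[OF \<phi>(1)]]
            linrelD(1,2)[OF M' ab] \<phi>(1) \<psi> h0(1) q(1) by (simp_all add: dual_dual)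
        ultimately show "(dual_H \<phi> (a \<oplus>\<^bsub>H\<^esub> dual_H \<psi> h0), dual_P \<phi> (b \<oplus>\<^bsub>P\<^esub> dual_P \<psi> q)) \<in> ?S"
          by (simp del: image_iff)
      qed
    qed simp
    moreover have "(h0, q) \<in> ?S"
      by (rule image_eqI[of _ _ "((\<zero>\<^bsub>H\<^esub>, \<zero>\<^bsub>P\<^esub>), (h0, q))"])
        (use h0N h0(1) q(1) linrelD(3)[OF M'] in \<open>simp_all add: vs_simps\<close>)
    ultimately have "(h0, q) \<in> M" by simp
    then show False using h0(2) by (force simp: D_def)
  qed
  note Dall = this
  have "(1 \<odot>\<^bsub>H\<^esub> 1\<^sub>H, 1 \<odot>\<^bsub>P\<^esub> 1\<^sub>P) \<in> M" using M(2) by blast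
  then have "f 1\<^sub>H = 1\<^sub>P" using f(2) by (simp add: vs_simps)
  moreover have "\<rho> (f h) F = \<Delta> h (\<lambda>a b. F (f a) b)" if h: "h \<in> carrier H" and F: "bil P H F" for h F
  proof -
    note [simp] = f(1) linear_maps_apply(1)[OF f(1)] h
    have "rcoact P (f h) = tensor_map H H P H f id (comult H h)"
    proof (rule tensor_eqI[of P H])
      fix \<alpha> \<beta> assume l [simp]: "lin P \<alpha>" "lin H \<beta>"
      have "\<rho> (f h) (\<lambda>v w. \<alpha> v * \<beta> w) = \<alpha> (f (dual_H \<beta> h))"
        using fcol[of h \<beta>] Dall by (simp flip: lin_dual_P)
      also have "\<dots> = \<Delta> h (\<lambda>v w. \<alpha> (f v) * \<beta> w)"
        using lin_dual_H[of "\<lambda>x. \<alpha> (f x)" \<beta> h] lin_comp[OF l(1) f(1)] by simp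
      finally show "\<rho> (f h) (\<lambda>v w. \<alpha> v * \<beta> w) = tsum P H (tensor_map H H P H f id (comult H h)) (\<lambda>v w. \<alpha> v * \<beta> w)"
        by (simp add: tsum_tensor_map)
    qed auto
    then show ?thesis using F by (simp add: tsum_tensor_map)
  qed
  ultimately show thesis using f(1) that by blast
qed

end

subsection \<open>Subspaces, changed actions and record extensions\<close>

lemma subspace_abelian_group:
  fixes V :: "(complex, 'a, 'm) module_scheme" and M :: "('r, 'a, 'n) module_scheme"
  assumes V: "vs V" and U: "subspace V (carrier M)"
    and ops: "\<And>x y. x \<oplus>\<^bsub>M\<^esub> y = x \<oplus>\<^bsub>V\<^esub> y" "\<zero>\<^bsub>M\<^esub> = \<zero>\<^bsub>V\<^esub>"
  shows "abelian_group M"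
proof (rule abelian_groupI)
  have sub: "x \<in> carrier V" if "x \<in> carrier M" for x using that U by (auto simp: subspace_def)
  fix x assume x: "x \<in> carrier M"
  show "\<exists>y\<in>carrier M. y \<oplus>\<^bsub>M\<^esub> x = \<zero>\<^bsub>M\<^esub>"
    using x U sub[OF x] V vs_neg[OF V sub[OF x]]
    by (intro bexI[of _ "(- 1) \<odot>\<^bsub>V\<^esub> x"]) (auto simp: ops subspace_def vs_ac)
qed (use U V in \<open>auto simp: ops subspace_def vs_ac vs_simps subset_iff\<close>)

lemma with_action_simps [simp]:
  "carrier (with_action M a) = carrier M" "x \<oplus>\<^bsub>with_action M a\<^esub> y = x \<oplus>\<^bsub>M\<^esub> y"
  "\<zero>\<^bsub>with_action M a\<^esub> = \<zero>\<^bsub>M\<^esub>" "c \<odot>\<^bsub>with_action M a\<^esub> x = a c x"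
  by (simp_all add: with_action_def)

text \<open>Comodules are records that extend vector spaces; constructions on vector spaces do not see the coaction.\<close>

lemma extend_simps [simp]:
  "carrier (module.extend M e) = carrier M" "x \<oplus>\<^bsub>module.extend M e\<^esub> y = x \<oplus>\<^bsub>M\<^esub> y"
  "\<zero>\<^bsub>module.extend M e\<^esub> = \<zero>\<^bsub>M\<^esub>" "c \<odot>\<^bsub>module.extend M e\<^esub> x = c \<odot>\<^bsub>M\<^esub> x"
  "monoid.mult (module.extend M e) = monoid.mult M" "\<one>\<^bsub>module.extend M e\<^esub> = \<one>\<^bsub>M\<^esub>"
  by (simp_all add: module.extend_def)

lemma extend_linear [simp]:
  "linear_maps U (module.extend M e) = linear_maps U M" "linear_maps (module.extend M e) U = linear_maps M U"
  "lin (module.extend M e) = lin M"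
  by (auto simp: linear_maps_iff lin_def fun_eq_iff)

lemma extend_vs [simp]:
  assumes M: "vs M" shows "vs (module.extend M e)"
proof (rule vsI)
  have "subspace M (carrier (module.extend M e))" using M by (auto simp: subspace_def)
  then show "abelian_group (module.extend M e)"
    by (rule subspace_abelian_group[OF M]) auto
qed (use M in \<open>auto simp: vs_simps vs_distrib\<close>)

lemma tensor_group_extend [simp]:
  "tensor_group UNIV A (module.extend M e) = tensor_group UNIV A M"
  "tensor_group UNIV (module.extend M e) A = tensor_group UNIV M A"
  "pure_tensor A (module.extend M e) = pure_tensor A M"
  "pure_tensor (module.extend M e) A = pure_tensor M A"
proof -
  have "tensor_rels UNIV A (module.extend M e) = tensor_rels UNIV A M"
    "tensor_rels UNIV (module.extend M e) A = tensor_rels UNIV M A"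
    by (simp_all add: tensor_rels_def)
  then have k: "tensor_kernel UNIV A (module.extend M e) = tensor_kernel UNIV A M"
    "tensor_kernel UNIV (module.extend M e) A = tensor_kernel UNIV M A"
    by (simp_all add: tensor_kernel_def)
  then show "tensor_group UNIV A (module.extend M e) = tensor_group UNIV A M"
    "tensor_group UNIV (module.extend M e) A = tensor_group UNIV M A"
    "pure_tensor A (module.extend M e) = pure_tensor A M"
    "pure_tensor (module.extend M e) A = pure_tensor M A"
    by (simp_all add: tensor_group_def tensor_elem_def fun_eq_iff)
qed

lemma tensor_extend [simp]:
  "A \<otimes>\<^sub>\<complex> module.extend M e = A \<otimes>\<^sub>\<complex> M" "module.extend M e \<otimes>\<^sub>\<complex> A = M \<otimes>\<^sub>\<complex> A"
  "bilinear_lift A (module.extend M e) = (bilinear_lift A M :: (complex, 'b, 'k) module_scheme \<Rightarrow> _)"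
  "bilinear_lift (module.extend M e) A = (bilinear_lift M A :: (complex, 'b, 'k) module_scheme \<Rightarrow> _)"
  "tsum A (module.extend M e) = tsum A M" "tsum (module.extend M e) A = tsum M A"
proof -
  show "bilinear_lift A (module.extend M e) = (bilinear_lift A M :: (complex, 'b, 'k) module_scheme \<Rightarrow> _)"
    "bilinear_lift (module.extend M e) A = (bilinear_lift M A :: (complex, 'b, 'k) module_scheme \<Rightarrow> _)"
    by (simp_all add: bilinear_lift_def tensor_lift_def fun_eq_iff)
  show t: "A \<otimes>\<^sub>\<complex> module.extend M e = A \<otimes>\<^sub>\<complex> M" "module.extend M e \<otimes>\<^sub>\<complex> A = M \<otimes>\<^sub>\<complex> A"
    by (simp_all add: tensor_def[of A "module.extend M e"] tensor_def[of "module.extend M e" A]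
        tensor_def[of A M] tensor_def[of M A] Let_def tensor_lift_def fun_eq_iff)
  show "tsum A (module.extend M e) = tsum A M" "tsum (module.extend M e) A = tsum M A"
    by (simp_all add: tsum_def presentation_def t fun_eq_iff)
qed

lemma tensor_map_extend [simp]:
  "tensor_map A (module.extend M e) C D = tensor_map A M C D"
  "tensor_map A C D (module.extend M e) = tensor_map A C D M"
  by (simp_all add: tensor_map_def fun_eq_iff)

context hopf_coaction
begin

subsection \<open>The canonical map\<close>

abbreviation "PB \<equiv> tensor_group B (right_regular P) (left_regular P)"
abbreviation "elemB \<equiv> tensor_elem B (right_regular P) (left_regular P)"

lemma balanced_PB: "balanced_tensor B (right_regular P) (left_regular P)"
proof (rule balanced_tensor.intro)
  have "subspace P (carrier P)" by (auto simp: subspace_def)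
  then show "abelian_group (right_regular P)" "abelian_group (left_regular P)"
    by (auto intro!: subspace_abelian_group[of P])
qed auto

abbreviation can_elem :: "'p \<Rightarrow> 'p \<Rightarrow> ('p, 'h) tens"
  where "can_elem p q \<equiv> pure_tensor P H p 1\<^sub>H \<otimes>\<^bsub>P \<otimes>\<^sub>\<complex> H\<^esub> rcoact P q"

lemma can_elem_closed [simp]: "p \<in> carrier P \<Longrightarrow> q \<in> carrier P \<Longrightarrow> can_elem p q \<in> carrier (P \<otimes>\<^sub>\<complex> H)"
  by (rule tensor_mult_closed[OF algebra_P algebra_H]) auto

lemma can_elem_sum:
  assumes "p \<in> carrier P" "q \<in> carrier P" and F: "bil P H F"
  shows "tsum P H (can_elem p q) F = \<rho> q (\<lambda>a b. F (p \<star> a) b)"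
proof -
  note [simp] = bil_comp[OF F]
  have "tsum P H (can_elem p q) F =
      tsum P H (pure_tensor P H p 1\<^sub>H) (\<lambda>v w. \<rho> q (\<lambda>a b. F (v \<star> a) (w \<cdot> b)))"
    by (rule tsum_tensor_mult[OF algebra_P algebra_H]) (use assms in auto)
  then show ?thesis using assms by (simp add: tsum_pure)
qed

lemma can_elem_linear [simp]:
  "p \<in> carrier P \<Longrightarrow> (\<lambda>q. can_elem p q) \<in> linear_maps P (P \<otimes>\<^sub>\<complex> H)"
  "q \<in> carrier P \<Longrightarrow> (\<lambda>p. can_elem p q) \<in> linear_maps P (P \<otimes>\<^sub>\<complex> H)"
  by (rule linear_maps_comp[OF tensor_mult_linear_right[OF algebra_P algebra_H, where t = "rcoact P 1\<^sub>P"] structure_linear(4)]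
      linear_maps_comp[OF tensor_mult_linear_left[OF algebra_P algebra_H, where s = "rcoact P 1\<^sub>P"] pure_linear_left[of P H]];
      simp)+

text \<open>The canonical map before the passage to \<open>P \<otimes>\<^sub>B P\<close>.\<close>

definition lcan :: "('p, 'p) tens \<Rightarrow> ('p, 'h) tens"
  where "lcan = bilinear_lift P P (P \<otimes>\<^sub>\<complex> H) can_elem"

lemma lcan_linear: "lcan \<in> linear_maps (P \<otimes>\<^sub>\<complex> P) (P \<otimes>\<^sub>\<complex> H)"
  and lcan_pure: "p \<in> carrier P \<Longrightarrow> q \<in> carrier P \<Longrightarrow> lcan (pure_tensor P P p q) = can_elem p q"
  unfolding lcan_def by (rule bilinear_lift_props; simp)+

lemma lcan_sum:
  assumes "t \<in> carrier (P \<otimes>\<^sub>\<complex> P)" "bil P H F"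
  shows "tsum P H (lcan t) F = tsum P P t (\<lambda>x y. \<rho> y (\<lambda>a b. F (x \<star> a) b))"
  unfolding lcan_def by (subst tsum_bilinear_lift) (use assms in \<open>auto simp: can_elem_sum\<close>)

lemma can_elem_balanced:
  assumes "b \<in> B" "p \<in> carrier P" "q \<in> carrier P"
  shows "can_elem (p \<star> b) q = can_elem p (b \<star> q)"
proof (rule tensor_eqI[of P H])
  fix \<alpha> \<beta> assume l [simp]: "lin P \<alpha>" "lin H \<beta>"
  note [simp] = lin_comp[OF l(1)] lin_comp[OF l(2)]
  show "tsum P H (can_elem (p \<star> b) q) (\<lambda>v w. \<alpha> v * \<beta> w) = tsum P H (can_elem p (b \<star> q)) (\<lambda>v w. \<alpha> v * \<beta> w)"
    using assms by (simp add: can_elem_sum coact_mult coinvariants_sum mult_assoc)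
qed (use assms in auto)

text \<open>The projection of \<open>P \<otimes> P\<close> onto \<open>P \<otimes>\<^sub>B P\<close>.\<close>

definition nat_PB :: "('p, 'p) tens \<Rightarrow> ('p, 'p) tens"
  where "nat_PB = tensor_lift UNIV P P PB elemB"

lemma PB_comm_group: "comm_group PB"
  by (rule balanced_tensor.tensor_comm_group[OF balanced_PB])

lemma scalar_in_B: "c \<odot>\<^bsub>P\<^esub> 1\<^sub>P \<in> B"
  using coinvariants_subspace by (simp add: subspace_def)

lemma scalar_mult:
  "p \<in> carrier P \<Longrightarrow> p \<star> (c \<odot>\<^bsub>P\<^esub> 1\<^sub>P) = c \<odot>\<^bsub>P\<^esub> p" "p \<in> carrier P \<Longrightarrow> (c \<odot>\<^bsub>P\<^esub> 1\<^sub>P) \<star> p = c \<odot>\<^bsub>P\<^esub> p"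
  by (simp_all add: complex_algebraD[OF algebra_P])

lemma elemB_balanced:
  "b \<in> B \<Longrightarrow> p \<in> carrier P \<Longrightarrow> q \<in> carrier P \<Longrightarrow> elemB (p \<star> b) q = elemB p (b \<star> q)"
  using balanced_tensor.te_balanced[OF balanced_PB, of b p q] by simp

lemma elemB_scalar:
  assumes "p \<in> carrier P" "q \<in> carrier P"
  shows "elemB (c \<odot>\<^bsub>P\<^esub> p) q = elemB p (c \<odot>\<^bsub>P\<^esub> q)"
  using elemB_balanced[OF scalar_in_B assms] assms by (simp add: scalar_mult)

lemma nat_PB_hom: "nat_PB \<in> hom (tensor_group UNIV P P) PB"
  and nat_PB_pure: "p \<in> carrier P \<Longrightarrow> q \<in> carrier P \<Longrightarrow> nat_PB (pure_tensor P P p q) = elemB p q"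
  unfolding nat_PB_def
  using balanced_tensor.te_add_left[OF balanced_PB] balanced_tensor.te_add_right[OF balanced_PB]
    balanced_tensor.te_closed[OF balanced_PB]
  by (intro balanced_tensor.tensor_lift[OF balanced_tensor_vs PB_comm_group]; simp add: elemB_scalar)+

lemma canonical_map_hom: "canonical_map H P \<in> hom PB (add_monoid (P \<otimes>\<^sub>\<complex> H))"
  and canonical_map_elem: "p \<in> carrier P \<Longrightarrow> q \<in> carrier P \<Longrightarrow> canonical_map H P (elemB p q) = can_elem p q"
  unfolding canonical_map_def
  using linear_maps_apply(2)[OF can_elem_linear(1)] linear_maps_apply(2)[OF can_elem_linear(2)]
  by (intro balanced_tensor.tensor_lift[OF balanced_PB comm_group_add_monoid[OF vs_abelian]];
      simp add: can_elem_balanced)+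

lemma tensor_hom_eq:
  fixes V :: "(complex, 'a, 'm) module_scheme" and W :: "(complex, 'b, 'n) module_scheme"
  assumes V: "vs V" and W: "vs W"
    and f: "f \<in> hom (tensor_group UNIV V W) G" and g: "g \<in> hom (tensor_group UNIV V W) G" and G: "group G"
    and eq: "\<And>v w. v \<in> carrier V \<Longrightarrow> w \<in> carrier W \<Longrightarrow> f (pure_tensor V W v w) = g (pure_tensor V W v w)"
    and t: "t \<in> carrier (V \<otimes>\<^sub>\<complex> W)"
  shows "f t = g t"
proof -
  note b = balanced_tensor_vs[OF V W]
  interpret T: comm_group "tensor_group UNIV V W" by (rule balanced_tensor.tensor_comm_group[OF b])
  interpret f: group_hom "tensor_group UNIV V W" G f
    using f G by (simp add: group_hom_def group_hom_axioms_def T.is_group)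
  interpret g: group_hom "tensor_group UNIV V W" G g
    using g G by (simp add: group_hom_def group_hom_axioms_def T.is_group)
  from t have "t \<in> carrier (tensor_group UNIV V W)" by (simp add: tensor_simps)
  then show ?thesis
  proof (induction rule: balanced_tensor.tensor_induct[OF b, consumes 1, case_names one mult])
    case one
    then show ?case by simp
  next
    case (mult m n s)
    then show ?case
      using balanced_tensor.te_closed[OF b] by (simp add: eq)
  qed
qed

lemma linear_map_hom: "f \<in> linear_maps (V \<otimes>\<^sub>\<complex> W) U \<Longrightarrow> f \<in> hom (tensor_group UNIV V W) (add_monoid U)"
  by (auto simp: linear_maps_iff hom_def tensor_simps)

lemma canonical_nat:
  assumes "t \<in> carrier (P \<otimes>\<^sub>\<complex> P)"
  shows "canonical_map H P (nat_PB t) = lcan t"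
proof (rule tensor_hom_eq[OF vs_P vs_P _ _ _ _ assms])
  show "(\<lambda>t. canonical_map H P (nat_PB t)) \<in> hom (tensor_group UNIV P P) (add_monoid (P \<otimes>\<^sub>\<complex> H))"
    using hom_compose[OF nat_PB_hom canonical_map_hom] by (simp add: comp_def)
  show "group (add_monoid (P \<otimes>\<^sub>\<complex> H))"
    using comm_group_add_monoid[OF vs_abelian[of "P \<otimes>\<^sub>\<complex> H"]] by (simp add: comm_group_def)
qed (auto simp: linear_map_hom[OF lcan_linear] nat_PB_pure canonical_map_elem lcan_pure)

lemma nat_PB_surj: "x \<in> carrier PB \<Longrightarrow> \<exists>t\<in>carrier (P \<otimes>\<^sub>\<complex> P). x = nat_PB t"
proof (induction rule: balanced_tensor.tensor_induct[OF balanced_PB, consumes 1, case_names one mult])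
  case one
  interpret n: group_hom "tensor_group UNIV P P" PB nat_PB
    using nat_PB_hom PB_comm_group balanced_tensor.tensor_comm_group[OF balanced_tensor_vs[OF vs_P vs_P]]
    by (simp add: group_hom_def group_hom_axioms_def comm_group_def)
  show ?case
    by (rule bexI[of _ "\<zero>\<^bsub>P \<otimes>\<^sub>\<complex> P\<^esub>"]) (use n.hom_one vs_closed(1)[of "P \<otimes>\<^sub>\<complex> P"] in \<open>auto simp: tensor_simps(3)\<close>)
next
  case (mult m n s)
  then obtain t where t: "t \<in> carrier (P \<otimes>\<^sub>\<complex> P)" "s = nat_PB t" by blast
  have mn: "m \<in> carrier P" "n \<in> carrier P" using mult by auto
  then have p: "pure_tensor P P m n \<in> carrier (P \<otimes>\<^sub>\<complex> P)" by simp
  have "nat_PB (pure_tensor P P m n \<oplus>\<^bsub>P \<otimes>\<^sub>\<complex> P\<^esub> t) = elemB m n \<otimes>\<^bsub>PB\<^esub> s"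
    using hom_mult[OF nat_PB_hom, of "pure_tensor P P m n" t] t p nat_PB_pure[OF mn]
    by (simp add: tensor_simps)
  then show ?case
    using p t by (intro bexI[of _ "pure_tensor P P m n \<oplus>\<^bsub>P \<otimes>\<^sub>\<complex> P\<^esub> t"]) auto
qed

subsection \<open>The map \<open>\<beta>\<close> on elements\<close>

abbreviation TC :: "('h, 'v) lcomod \<Rightarrow> ('h, 'w) lcomod \<Rightarrow> ('h, ('v, 'w) tens) lcomod"
  where "TC V W \<equiv> tensor_comodule H V W"

lemma TC_simps [simp]:
  fixes V :: "('h, 'v) lcomod" and W :: "('h, 'w) lcomod"
  shows "carrier (TC V W) = carrier (V \<otimes>\<^sub>\<complex> W)" "x \<oplus>\<^bsub>TC V W\<^esub> y = x \<oplus>\<^bsub>V \<otimes>\<^sub>\<complex> W\<^esub> y"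
    "\<zero>\<^bsub>TC V W\<^esub> = \<zero>\<^bsub>V \<otimes>\<^sub>\<complex> W\<^esub>" "c \<odot>\<^bsub>TC V W\<^esub> x = c \<odot>\<^bsub>V \<otimes>\<^sub>\<complex> W\<^esub> x"
    "linear_maps U (TC V W) = linear_maps U (V \<otimes>\<^sub>\<complex> W)" "linear_maps (TC V W) U = linear_maps (V \<otimes>\<^sub>\<complex> W) U"
    "lin (TC V W) = lin (V \<otimes>\<^sub>\<complex> W)" "vs V \<Longrightarrow> vs W \<Longrightarrow> vs (TC V W)"
  by (simp_all add: tensor_comodule_def)

context
  fixes V :: "('h, 'v) lcomod" and W :: "('h, 'w) lcomod"
  assumes V: "lcoaction V" and W: "lcoaction W"
begin

lemmas VW_facts [simp] = lcoactionD[OF V] lcoactionD[OF W]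

lemma TC_coact: "lcoact (TC V W) = bilinear_lift V W (H \<otimes>\<^sub>\<complex> (V \<otimes>\<^sub>\<complex> W)) (\<lambda>v w.
        bilinear_lift H V (H \<otimes>\<^sub>\<complex> (V \<otimes>\<^sub>\<complex> W)) (\<lambda>g v0.
          bilinear_lift H W (H \<otimes>\<^sub>\<complex> (V \<otimes>\<^sub>\<complex> W)) (\<lambda>h w0.
            pure_tensor H (V \<otimes>\<^sub>\<complex> W) (g \<cdot> h) (pure_tensor V W v0 w0))
          (lcoact W w))
        (lcoact V v))"
  by (simp add: tensor_comodule_def module.extend_def lcomod.fields_def)

lemma TC_coact_linear: "lcoact (TC V W) \<in> linear_maps (V \<otimes>\<^sub>\<complex> W) (H \<otimes>\<^sub>\<complex> (V \<otimes>\<^sub>\<complex> W))" (is ?lin)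
  and TC_coact_sum: "z \<in> carrier (V \<otimes>\<^sub>\<complex> W) \<Longrightarrow> bil H (V \<otimes>\<^sub>\<complex> W) F \<Longrightarrow>
    tsum H (V \<otimes>\<^sub>\<complex> W) (lcoact (TC V W) z) F = tsum V W z (\<lambda>v w. tsum H V (lcoact V v) (\<lambda>g v0.
      tsum H W (lcoact W w) (\<lambda>h w0. F (g \<cdot> h) (pure_tensor V W v0 w0))))" (is "_ \<Longrightarrow> _ \<Longrightarrow> ?sum")
proof -
  let ?T = "H \<otimes>\<^sub>\<complex> (V \<otimes>\<^sub>\<complex> W)"
  let ?p = "\<lambda>g v0 h w0. pure_tensor H (V \<otimes>\<^sub>\<complex> W) (g \<cdot> h) (pure_tensor V W v0 w0)"
  let ?a = "\<lambda>g v0. bilinear_lift H W ?T (?p g v0)"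
  have a0: "?a g v0 \<in> linear_maps (H \<otimes>\<^sub>\<complex> W) ?T" if "g \<in> carrier H" "v0 \<in> carrier V" for g v0
    by (rule bilinear_lift_props(1)) (use that in auto)
  have a1: "(\<lambda>g. ?a g v0 t) \<in> linear_maps H ?T" if "v0 \<in> carrier V" "t \<in> carrier (H \<otimes>\<^sub>\<complex> W)" for v0 t
    by (rule bilinear_lift_linear_left) (use that in auto)
  have a2: "(\<lambda>v0. ?a g v0 t) \<in> linear_maps V ?T" if "g \<in> carrier H" "t \<in> carrier (H \<otimes>\<^sub>\<complex> W)" for g t
    by (rule bilinear_lift_linear_left) (use that in auto)
  let ?b = "\<lambda>v w. bilinear_lift H V ?T (\<lambda>g v0. ?a g v0 (lcoact W w)) (lcoact V v)"
  have b1: "(\<lambda>v. ?b v w) \<in> linear_maps V ?T" if "w \<in> carrier W" for w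
    by (rule bilinear_lift_linear_arg) (use that a1 a2 in auto)
  have b2: "(\<lambda>w. ?b v w) \<in> linear_maps W ?T" if "v \<in> carrier V" for v
    by (rule bilinear_lift_linear_left) (use that a1 a2 linear_maps_comp[OF a0 VW_facts(6)] in auto)
  show ?lin
    unfolding TC_coact by (rule bilinear_lift_props(1)) (use b1 b2 in auto)
  assume z: "z \<in> carrier (V \<otimes>\<^sub>\<complex> W)" and F: "bil H (V \<otimes>\<^sub>\<complex> W) F"
  note [simp] = bil_comp[OF F]
  have "tsum H (V \<otimes>\<^sub>\<complex> W) (lcoact (TC V W) z) F = tsum V W z (\<lambda>v w. tsum H (V \<otimes>\<^sub>\<complex> W) (?b v w) F)"
    unfolding TC_coact by (rule tsum_bilinear_lift) (use z F b1 b2 in auto)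
  also have "\<dots> = tsum V W z (\<lambda>v w. tsum H V (lcoact V v) (\<lambda>g v0. tsum H (V \<otimes>\<^sub>\<complex> W) (?a g v0 (lcoact W w)) F))"
    by (rule tsum_body, rule tsum_bilinear_lift) (use F a1 a2 in auto)
  also have "\<dots> = tsum V W z (\<lambda>v w. tsum H V (lcoact V v) (\<lambda>g v0.
      tsum H W (lcoact W w) (\<lambda>h w0. tsum H (V \<otimes>\<^sub>\<complex> W) (?p g v0 h w0) F)))"
    by (rule tsum_body, rule tsum_body, rule tsum_bilinear_lift) (use F in auto)
  also have "\<dots> = tsum V W z (\<lambda>v w. tsum H V (lcoact V v) (\<lambda>g v0.
      tsum H W (lcoact W w) (\<lambda>h w0. F (g \<cdot> h) (pure_tensor V W v0 w0))))"
    using F by (simp add: tsum_pure)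
  finally show ?sum .
qed

end

lemma tensor_TC [simp]:
  fixes V :: "('h, 'v) lcomod" and W :: "('h, 'w) lcomod"
  shows "pure_tensor A (TC V W) = pure_tensor A (V \<otimes>\<^sub>\<complex> W)" "pure_tensor (TC V W) A = pure_tensor (V \<otimes>\<^sub>\<complex> W) A"
    "A \<otimes>\<^sub>\<complex> TC V W = A \<otimes>\<^sub>\<complex> (V \<otimes>\<^sub>\<complex> W)" "TC V W \<otimes>\<^sub>\<complex> A = (V \<otimes>\<^sub>\<complex> W) \<otimes>\<^sub>\<complex> A"
    "bilinear_lift A (TC V W) = (bilinear_lift A (V \<otimes>\<^sub>\<complex> W) :: (complex, 'b, 'k) module_scheme \<Rightarrow> _)"
    "bilinear_lift (TC V W) A = (bilinear_lift (V \<otimes>\<^sub>\<complex> W) A :: (complex, 'b, 'k) module_scheme \<Rightarrow> _)"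
    "tsum A (TC V W) = tsum A (V \<otimes>\<^sub>\<complex> W)" "tsum (TC V W) A = tsum (V \<otimes>\<^sub>\<complex> W) A"
    "tensor_map A (TC V W) C D = tensor_map A (V \<otimes>\<^sub>\<complex> W) C D" "tensor_map A C D (TC V W) = tensor_map A C D (V \<otimes>\<^sub>\<complex> W)"
  by (simp_all add: tensor_comodule_def)

text \<open>The value of \<open>\<beta>\<close> at \<open>x \<otimes> y\<close>.\<close>

definition bprod :: "('h, 'v) lcomod \<Rightarrow> ('h, 'w) lcomod \<Rightarrow> ('p, 'v) tens \<Rightarrow> ('p, 'w) tens \<Rightarrow> ('p, ('v, 'w) tens) tens"
  where "bprod V W x y = bilinear_lift P V (P \<otimes>\<^sub>\<complex> (V \<otimes>\<^sub>\<complex> W)) (\<lambda>a v.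
            bilinear_lift P W (P \<otimes>\<^sub>\<complex> (V \<otimes>\<^sub>\<complex> W)) (\<lambda>b w.
              pure_tensor P (V \<otimes>\<^sub>\<complex> W) (a \<star> b) (pure_tensor V W v w)) y) x"

lemma TC_lcoaction:
  fixes V :: "('h, 'v) lcomod" and W :: "('h, 'w) lcomod"
  assumes "lcoaction V" "lcoaction W"
  shows "lcoaction (TC V W)"
  unfolding lcoaction_def tensor_TC TC_simps
  using TC_coact_linear[OF assms] TC_simps(8)[OF lcoactionD(1)[OF assms(1)] lcoactionD(1)[OF assms(2)]] by (rule conjI[rotated])

lemma
  fixes V :: "('h, 'v) lcomod"
  assumes V: "lcoaction V" and b: "b \<in> carrier P"
  shows lact_linear: "cotensor_lact P V b \<in> linear_maps (P \<otimes>\<^sub>\<complex> V) (P \<otimes>\<^sub>\<complex> V)"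
    and ract_linear: "cotensor_ract P V b \<in> linear_maps (P \<otimes>\<^sub>\<complex> V) (P \<otimes>\<^sub>\<complex> V)"
    and lact_sum: "x \<in> carrier (P \<otimes>\<^sub>\<complex> V) \<Longrightarrow> bil P V F \<Longrightarrow>
      tsum P V (cotensor_lact P V b x) F = tsum P V x (\<lambda>a v. F (b \<star> a) v)"
    and ract_sum: "x \<in> carrier (P \<otimes>\<^sub>\<complex> V) \<Longrightarrow> bil P V F \<Longrightarrow>
      tsum P V (cotensor_ract P V b x) F = tsum P V x (\<lambda>a v. F (a \<star> b) v)"
proof -
  note [simp] = lcoactionD(1)[OF V] b
  show "cotensor_lact P V b \<in> linear_maps (P \<otimes>\<^sub>\<complex> V) (P \<otimes>\<^sub>\<complex> V)"
    "cotensor_ract P V b \<in> linear_maps (P \<otimes>\<^sub>\<complex> V) (P \<otimes>\<^sub>\<complex> V)"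
    unfolding cotensor_lact_def cotensor_ract_def by (rule tensor_map_linear; simp)+
  assume x: "x \<in> carrier (P \<otimes>\<^sub>\<complex> V)" and F: "bil P V F"
  show "tsum P V (cotensor_lact P V b x) F = tsum P V x (\<lambda>a v. F (b \<star> a) v)"
    "tsum P V (cotensor_ract P V b x) F = tsum P V x (\<lambda>a v. F (a \<star> b) v)"
    unfolding cotensor_lact_def cotensor_ract_def by (subst tsum_tensor_map; simp add: x F)+
qed

lemma
  fixes V :: "('h, 'v) lcomod"
  assumes V: "lcoaction V" and b: "b \<in> B" and x: "x \<in> carrier (cotensor H P V)"
  shows lact_cotensor: "cotensor_lact P V b x \<in> carrier (cotensor H P V)"
    and ract_cotensor: "cotensor_ract P V b x \<in> carrier (cotensor H P V)"
proof -
  note V' [simp] = lcoactionD[OF V]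
  note b' [simp] = coinvariants_carrier[OF b]
  have xc: "x \<in> carrier (P \<otimes>\<^sub>\<complex> V)" using x by (rule cotensor_carrier)
  show "cotensor_lact P V b x \<in> carrier (cotensor H P V)"
  proof (rule cotensorI[OF V])
    show "cotensor_lact P V b x \<in> carrier (P \<otimes>\<^sub>\<complex> V)" using linear_maps_apply(1)[OF lact_linear[OF V b'] xc] .
    fix \<alpha> \<beta> \<gamma> assume l [simp]: "lin P \<alpha>" "lin H \<beta>" "lin V \<gamma>"
    note [simp] = lin_comp[OF l(1)] lin_comp[OF l(2)]
    show "tsum P V (cotensor_lact P V b x) (\<lambda>p v. \<rho> p (\<lambda>a b. \<alpha> a * (\<beta> b * \<gamma> v))) =
      tsum P V (cotensor_lact P V b x) (\<lambda>p v. tsum H V (lcoact V v) (\<lambda>b w. \<alpha> p * (\<beta> b * \<gamma> w)))"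
      using cotensor_sum[OF V x, of "\<lambda>a c v. \<alpha> (b \<star> a) * (\<beta> c * \<gamma> v)"]
      by (simp add: lact_sum[OF V b' xc] coact_mult coinvariants_sum[OF b])
  qed
  show "cotensor_ract P V b x \<in> carrier (cotensor H P V)"
  proof (rule cotensorI[OF V])
    show "cotensor_ract P V b x \<in> carrier (P \<otimes>\<^sub>\<complex> V)" using linear_maps_apply(1)[OF ract_linear[OF V b'] xc] .
    fix \<alpha> \<beta> \<gamma> assume l [simp]: "lin P \<alpha>" "lin H \<beta>" "lin V \<gamma>"
    note [simp] = lin_comp[OF l(1)] lin_comp[OF l(2)]
    show "tsum P V (cotensor_ract P V b x) (\<lambda>p v. \<rho> p (\<lambda>a b. \<alpha> a * (\<beta> b * \<gamma> v))) =
      tsum P V (cotensor_ract P V b x) (\<lambda>p v. tsum H V (lcoact V v) (\<lambda>b w. \<alpha> p * (\<beta> b * \<gamma> w)))"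
      using cotensor_sum[OF V x, of "\<lambda>a c v. \<alpha> (a \<star> b) * (\<beta> c * \<gamma> v)"]
      by (simp add: ract_sum[OF V b' xc] coact_mult coinvariants_sum[OF b])
  qed
qed

context
  fixes V :: "('h, 'v) lcomod" and W :: "('h, 'w) lcomod"
  assumes V: "lcoaction V" and W: "lcoaction W"
begin

lemmas VWf [simp] = lcoactionD[OF V] lcoactionD[OF W]

lemma bprod_inner: "a \<in> carrier P \<Longrightarrow> v \<in> carrier V \<Longrightarrow>
    bilinear_lift P W (P \<otimes>\<^sub>\<complex> (V \<otimes>\<^sub>\<complex> W)) (\<lambda>b w. pure_tensor P (V \<otimes>\<^sub>\<complex> W) (a \<star> b) (pure_tensor V W v w))
      \<in> linear_maps (P \<otimes>\<^sub>\<complex> W) (P \<otimes>\<^sub>\<complex> (V \<otimes>\<^sub>\<complex> W))"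
  by (rule bilinear_lift_props(1)) auto

lemma bprod_outer: "y \<in> carrier (P \<otimes>\<^sub>\<complex> W) \<Longrightarrow> v \<in> carrier V \<Longrightarrow>
    (\<lambda>a. bilinear_lift P W (P \<otimes>\<^sub>\<complex> (V \<otimes>\<^sub>\<complex> W)) (\<lambda>b w. pure_tensor P (V \<otimes>\<^sub>\<complex> W) (a \<star> b) (pure_tensor V W v w)) y)
      \<in> linear_maps P (P \<otimes>\<^sub>\<complex> (V \<otimes>\<^sub>\<complex> W))"
  "y \<in> carrier (P \<otimes>\<^sub>\<complex> W) \<Longrightarrow> a \<in> carrier P \<Longrightarrow>
    (\<lambda>v. bilinear_lift P W (P \<otimes>\<^sub>\<complex> (V \<otimes>\<^sub>\<complex> W)) (\<lambda>b w. pure_tensor P (V \<otimes>\<^sub>\<complex> W) (a \<star> b) (pure_tensor V W v w)) y)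
      \<in> linear_maps V (P \<otimes>\<^sub>\<complex> (V \<otimes>\<^sub>\<complex> W))"
  by (rule bilinear_lift_linear_left; simp)+

lemma bprod_linear_left: "y \<in> carrier (P \<otimes>\<^sub>\<complex> W) \<Longrightarrow> (\<lambda>x. bprod V W x y) \<in> linear_maps (P \<otimes>\<^sub>\<complex> V) (P \<otimes>\<^sub>\<complex> (V \<otimes>\<^sub>\<complex> W))"
  unfolding bprod_def by (rule bilinear_lift_props(1)) (use bprod_outer in auto)

lemma bprod_linear_right: "x \<in> carrier (P \<otimes>\<^sub>\<complex> V) \<Longrightarrow> (\<lambda>y. bprod V W x y) \<in> linear_maps (P \<otimes>\<^sub>\<complex> W) (P \<otimes>\<^sub>\<complex> (V \<otimes>\<^sub>\<complex> W))"
  unfolding bprod_def by (rule bilinear_lift_linear_left) (use bprod_outer bprod_inner in auto)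

lemma bprod_closed [simp]:
  "x \<in> carrier (P \<otimes>\<^sub>\<complex> V) \<Longrightarrow> y \<in> carrier (P \<otimes>\<^sub>\<complex> W) \<Longrightarrow> bprod V W x y \<in> carrier (P \<otimes>\<^sub>\<complex> (V \<otimes>\<^sub>\<complex> W))"
  using linear_maps_apply(1)[OF bprod_linear_left] .

lemma bprod_sum:
  assumes x: "x \<in> carrier (P \<otimes>\<^sub>\<complex> V)" and y: "y \<in> carrier (P \<otimes>\<^sub>\<complex> W)" and F: "bil P (V \<otimes>\<^sub>\<complex> W) F"
  shows "tsum P (V \<otimes>\<^sub>\<complex> W) (bprod V W x y) F =
    tsum P V x (\<lambda>a v. tsum P W y (\<lambda>b w. F (a \<star> b) (pure_tensor V W v w)))"
proof -
  note [simp] = bil_comp[OF F]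
  have "tsum P (V \<otimes>\<^sub>\<complex> W) (bprod V W x y) F = tsum P V x (\<lambda>a v. tsum P (V \<otimes>\<^sub>\<complex> W)
      (bilinear_lift P W (P \<otimes>\<^sub>\<complex> (V \<otimes>\<^sub>\<complex> W)) (\<lambda>b w. pure_tensor P (V \<otimes>\<^sub>\<complex> W) (a \<star> b) (pure_tensor V W v w)) y) F)"
    unfolding bprod_def by (rule tsum_bilinear_lift) (use x F bprod_outer y in auto)
  also have "\<dots> = tsum P V x (\<lambda>a v. tsum P W y (\<lambda>b w.
      tsum P (V \<otimes>\<^sub>\<complex> W) (pure_tensor P (V \<otimes>\<^sub>\<complex> W) (a \<star> b) (pure_tensor V W v w)) F))"
    by (rule tsum_body, rule tsum_bilinear_lift) (use y F in auto)
  also have "\<dots> = tsum P V x (\<lambda>a v. tsum P W y (\<lambda>b w. F (a \<star> b) (pure_tensor V W v w)))"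
    using F by (simp add: tsum_pure)
  finally show ?thesis .
qed

text \<open>The coactions of \<open>P\<close> and of \<open>V \<otimes> W\<close> are both given by products in \<open>H\<close>, so that moving the coaction
  from \<open>P\<close> to \<open>V\<close> and from \<open>P\<close> to \<open>W\<close> is the same as moving it to \<open>V \<otimes> W\<close>.\<close>

lemma bprod_cotensor:
  assumes x: "x \<in> carrier (cotensor H P V)" and y: "y \<in> carrier (cotensor H P W)"
  shows "bprod V W x y \<in> carrier (cotensor H P (TC V W))"
proof (rule cotensorI[OF TC_lcoaction[OF V W]])
  have xc: "x \<in> carrier (P \<otimes>\<^sub>\<complex> V)" and yc: "y \<in> carrier (P \<otimes>\<^sub>\<complex> W)" using x y by (auto intro: cotensor_carrier)
  then show "bprod V W x y \<in> carrier (P \<otimes>\<^sub>\<complex> TC V W)" by simp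
  fix \<alpha> \<beta> \<gamma> assume l: "lin P \<alpha>" "lin H \<beta>" "lin (TC V W) \<gamma>"
  then have l' [simp]: "lin P \<alpha>" "lin H \<beta>" "lin (V \<otimes>\<^sub>\<complex> W) \<gamma>" by simp_all
  note [simp] = lin_comp[OF l(1)] lin_comp[OF l(2)] lin_comp[OF l'(3)] TC_coact_linear[OF V W]
    linear_maps_comp[OF TC_coact_linear[OF V W]]
  let ?g = "\<lambda>v w. \<gamma> (pure_tensor V W v w)"
  have "tsum P (TC V W) (bprod V W x y) (\<lambda>p v. \<rho> p (\<lambda>a b. \<alpha> a * (\<beta> b * \<gamma> v))) =
      tsum P V x (\<lambda>a v. tsum P W y (\<lambda>b w. \<rho> a (\<lambda>a0 a1. \<rho> b (\<lambda>b0 b1. \<alpha> (a0 \<star> b0) * (\<beta> (a1 \<cdot> b1) * ?g v w)))))"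
    by (simp add: bprod_sum xc yc coact_mult)
  also have "\<dots> = tsum P V x (\<lambda>a v. \<rho> a (\<lambda>a0 a1. tsum P W y (\<lambda>b w. \<rho> b (\<lambda>b0 b1. \<alpha> (a0 \<star> b0) * (\<beta> (a1 \<cdot> b1) * ?g v w)))))"
    by (intro tsum_body tsum_swap)
  also have "\<dots> = tsum P V x (\<lambda>a v. tsum H V (lcoact V v) (\<lambda>g v0.
      tsum P W y (\<lambda>b w. \<rho> b (\<lambda>b0 b1. \<alpha> (a \<star> b0) * (\<beta> (g \<cdot> b1) * ?g v0 w)))))"
    by (rule cotensor_sum[OF V x]) auto
  also have "\<dots> = tsum P V x (\<lambda>a v. tsum H V (lcoact V v) (\<lambda>g v0.
      tsum P W y (\<lambda>b w. tsum H W (lcoact W w) (\<lambda>h w0. \<alpha> (a \<star> b) * (\<beta> (g \<cdot> h) * ?g v0 w0)))))"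
    by (rule tsum_body, rule tsum_body, rule cotensor_sum[OF W y]) auto
  also have "\<dots> = tsum P V x (\<lambda>a v. tsum P W y (\<lambda>b w. tsum H V (lcoact V v) (\<lambda>g v0.
      tsum H W (lcoact W w) (\<lambda>h w0. \<alpha> (a \<star> b) * (\<beta> (g \<cdot> h) * ?g v0 w0)))))"
    by (intro tsum_body tsum_swap)
  also have "\<dots> = tsum P (TC V W) (bprod V W x y) (\<lambda>p v. tsum H (TC V W) (lcoact (TC V W) v) (\<lambda>b w. \<alpha> p * (\<beta> b * \<gamma> w)))"
    by (simp add: bprod_sum xc yc TC_coact_sum[OF V W] tsum_pure)
  finally show "tsum P (TC V W) (bprod V W x y) (\<lambda>p v. \<rho> p (\<lambda>a b. \<alpha> a * (\<beta> b * \<gamma> v))) =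
     tsum P (TC V W) (bprod V W x y) (\<lambda>p v. tsum H (TC V W) (lcoact (TC V W) v) (\<lambda>b w. \<alpha> p * (\<beta> b * \<gamma> w)))" .
qed

lemma bprod_balanced:
  assumes x: "x \<in> carrier (P \<otimes>\<^sub>\<complex> V)" and y: "y \<in> carrier (P \<otimes>\<^sub>\<complex> W)" and b: "b \<in> B"
  shows "bprod V W (cotensor_ract P V b x) y = bprod V W x (cotensor_lact P W b y)"
proof (rule vs_eqI[of "P \<otimes>\<^sub>\<complex> (V \<otimes>\<^sub>\<complex> W)"])
  note b' = coinvariants_carrier[OF b]
  note c [simp] = linear_maps_apply(1)[OF ract_linear[OF V b'] x] linear_maps_apply(1)[OF lact_linear[OF W b'] y]
  show "bprod V W (cotensor_ract P V b x) y \<in> carrier (P \<otimes>\<^sub>\<complex> (V \<otimes>\<^sub>\<complex> W))"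
    "bprod V W x (cotensor_lact P W b y) \<in> carrier (P \<otimes>\<^sub>\<complex> (V \<otimes>\<^sub>\<complex> W))" using x y by auto
  fix \<phi> assume \<phi>: "lin (P \<otimes>\<^sub>\<complex> (V \<otimes>\<^sub>\<complex> W)) \<phi>"
  note [simp] = lin_comp[OF \<phi>] coinvariants_carrier[OF b]
  have e: "\<phi> z = tsum P (V \<otimes>\<^sub>\<complex> W) z (\<lambda>p r. \<phi> (pure_tensor P (V \<otimes>\<^sub>\<complex> W) p r))"
    if "z \<in> carrier (P \<otimes>\<^sub>\<complex> (V \<otimes>\<^sub>\<complex> W))" for z
    by (rule lin_presentation[OF _ _ that \<phi>]) auto
  have "tsum P (V \<otimes>\<^sub>\<complex> W) (bprod V W (cotensor_ract P V b x) y) (\<lambda>p r. \<phi> (pure_tensor P (V \<otimes>\<^sub>\<complex> W) p r)) =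
      tsum P (V \<otimes>\<^sub>\<complex> W) (bprod V W x (cotensor_lact P W b y)) (\<lambda>p r. \<phi> (pure_tensor P (V \<otimes>\<^sub>\<complex> W) p r))"
    by (simp add: x y bprod_sum ract_sum[OF V b'] lact_sum[OF W b'] mult_assoc)
  then show "\<phi> (bprod V W (cotensor_ract P V b x) y) = \<phi> (bprod V W x (cotensor_lact P W b y))"
    using e[OF bprod_closed[OF c(1) y]] e[OF bprod_closed[OF x c(2)]] by simp
qed auto

lemma balanced_beta: "balanced_tensor B (cotensor_right H P V) (cotensor_left H P W)"
proof (rule balanced_tensor.intro)
  show "abelian_group (cotensor_right H P V)"
    by (rule subspace_abelian_group[of "P \<otimes>\<^sub>\<complex> V"]) (simp_all add: cotensor_subspace[OF V])
  show "abelian_group (cotensor_left H P W)"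
    by (rule subspace_abelian_group[of "P \<otimes>\<^sub>\<complex> W"]) (simp_all add: cotensor_subspace[OF W])
qed (auto intro: lact_cotensor[OF W] ract_cotensor[OF V])

lemma beta_hom: "beta H P V W \<in> hom (beta_dom H P V W) (add_monoid (P \<otimes>\<^sub>\<complex> (V \<otimes>\<^sub>\<complex> W)))"
  and beta_elem: "x \<in> carrier (cotensor H P V) \<Longrightarrow> y \<in> carrier (cotensor H P W) \<Longrightarrow>
    beta H P V W (beta_tensor H P V W x y) = bprod V W x y"
proof -
  note c = cotensor_carrier
  have e: "beta H P V W = tensor_lift B (cotensor_right H P V) (cotensor_left H P W)
      (add_monoid (P \<otimes>\<^sub>\<complex> (V \<otimes>\<^sub>\<complex> W))) (bprod V W)"
    unfolding beta_def Let_def bprod_def by simp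
  note L = balanced_tensor.tensor_lift[OF balanced_beta comm_group_add_monoid[OF vs_abelian[of "P \<otimes>\<^sub>\<complex> (V \<otimes>\<^sub>\<complex> W)"]],
      where h = "bprod V W"]
  note s = linear_maps_apply(2)[OF bprod_linear_left] linear_maps_apply(2)[OF bprod_linear_right]
  show "beta H P V W \<in> hom (beta_dom H P V W) (add_monoid (P \<otimes>\<^sub>\<complex> (V \<otimes>\<^sub>\<complex> W)))"
    unfolding e beta_dom_def by (rule L(1)) (simp_all add: c s bprod_balanced)
  show "beta H P V W (beta_tensor H P V W x y) = bprod V W x y"
    if "x \<in> carrier (cotensor H P V)" "y \<in> carrier (cotensor H P W)"
    unfolding e beta_tensor_def by (rule L(2)) (simp_all add: c s bprod_balanced that)
qed

end

subsection \<open>Strong connections\<close>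

text \<open>
  A strong connection sends \<open>h\<close> to \<open>\<omega>(h) = h\<^sup>1 \<otimes> h\<^sup>2\<close> in \<open>P \<otimes> P\<close>. Its first leg transforms by the antipode of
  \<open>h\<^sub>1\<close> under the coaction of \<open>P\<close>, its second leg is right colinear, and \<open>h\<^sup>1 h\<^sup>2 = \<epsilon>(h)\<close>. The last two
  properties imply that \<open>\<omega>\<close> lifts the translation map \<open>h \<mapsto> can\<^sup>-\<^sup>1(1 \<otimes> h)\<close> from \<open>P \<otimes>\<^sub>B P\<close> to \<open>P \<otimes> P\<close>.
\<close>

definition strong_connection :: "('h \<Rightarrow> ('p, 'p) tens) \<Rightarrow> bool"
  where "strong_connection \<omega> \<longleftrightarrow> \<omega> \<in> linear_maps H (P \<otimes>\<^sub>\<complex> P) \<and>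
    (\<forall>h\<in>carrier H. \<forall>F. tril P H P F \<longrightarrow>
      tsum P P (\<omega> h) (\<lambda>u v. \<rho> u (\<lambda>a b. F a b v)) = \<Delta> h (\<lambda>g k. tsum P P (\<omega> k) (\<lambda>u v. F u (S g) v))) \<and>
    (\<forall>h\<in>carrier H. \<forall>F. tril P P H F \<longrightarrow>
      tsum P P (\<omega> h) (\<lambda>u v. \<rho> v (F u)) = \<Delta> h (\<lambda>g k. tsum P P (\<omega> g) (\<lambda>u v. F u v k))) \<and>
    (\<forall>h\<in>carrier H. \<forall>\<alpha>. lin P \<alpha> \<longrightarrow> tsum P P (\<omega> h) (\<lambda>u v. \<alpha> (u \<star> v)) = \<epsilon> h * \<alpha> 1\<^sub>P)"

lemma strong_connectionD:
  assumes "strong_connection \<omega>"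
  shows "\<omega> \<in> linear_maps H (P \<otimes>\<^sub>\<complex> P)" "h \<in> carrier H \<Longrightarrow> \<omega> h \<in> carrier (P \<otimes>\<^sub>\<complex> P)"
    "f \<in> linear_maps V H \<Longrightarrow> (\<lambda>v. \<omega> (f v)) \<in> linear_maps V (P \<otimes>\<^sub>\<complex> P)"
    "h \<in> carrier H \<Longrightarrow> tril P H P F \<Longrightarrow> tsum P P (\<omega> h) (\<lambda>u v. \<rho> u (\<lambda>a b. F a b v)) =
      \<Delta> h (\<lambda>g k. tsum P P (\<omega> k) (\<lambda>u v. F u (S g) v))"
    "h \<in> carrier H \<Longrightarrow> tril P P H G \<Longrightarrow> tsum P P (\<omega> h) (\<lambda>u v. \<rho> v (G u)) =
      \<Delta> h (\<lambda>g k. tsum P P (\<omega> g) (\<lambda>u v. G u v k))"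
    "h \<in> carrier H \<Longrightarrow> lin P \<alpha> \<Longrightarrow> tsum P P (\<omega> h) (\<lambda>u v. \<alpha> (u \<star> v)) = \<epsilon> h * \<alpha> 1\<^sub>P"
  using assms linear_maps_apply(1)[of \<omega> H "P \<otimes>\<^sub>\<complex> P"] linear_maps_comp[of \<omega> H "P \<otimes>\<^sub>\<complex> P" f V]
  unfolding strong_connection_def by blast+

subsection \<open>The canonical map is onto if \<open>\<beta>\<close> is onto for \<open>V = W = H\<close>\<close>

lemma regular_facts:
  fixes \<iota> :: "'h \<Rightarrow> 'u"
  assumes \<iota>: "inj_on \<iota> (carrier H)"
  shows "vs (regular \<iota>)" "\<iota> \<in> linear_maps H (regular \<iota>)" "inv_into (carrier H) \<iota> \<in> linear_maps (regular \<iota>) H"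
    "left_comodule H (regular \<iota>)" "x \<in> carrier H \<Longrightarrow> inv_into (carrier H) \<iota> (\<iota> x) = x"
    "x \<in> carrier H \<Longrightarrow> bil H (regular \<iota>) F \<Longrightarrow>
      tsum H (regular \<iota>) (lcoact (regular \<iota>) (\<iota> x)) F = \<Delta> x (\<lambda>a b. F a (\<iota> b))"
proof -
  have id: "(\<lambda>x. x) \<in> linear_maps H H" "\<And>x. x \<in> carrier H \<Longrightarrow> (\<lambda>x. x) ((\<lambda>x. x) x) = x"
    "\<And>x \<phi> \<psi>. x \<in> carrier H \<Longrightarrow> lin H \<phi> \<Longrightarrow> lin H \<psi> \<Longrightarrow>
      \<Delta> ((\<lambda>x. x) x) (\<lambda>a b. \<phi> a * \<psi> ((\<lambda>x. x) b)) = \<Delta> x (\<lambda>a b. \<phi> a * \<psi> ((\<lambda>x. x) b))"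
    by auto
  note QR = \<iota> id
  show 1: "vs (regular \<iota>)" "\<iota> \<in> linear_maps H (regular \<iota>)" "inv_into (carrier H) \<iota> \<in> linear_maps (regular \<iota>) H"
    "left_comodule H (regular \<iota>)"
    by (rule quotient_vs[OF QR] proj_linear[OF QR] \<kappa>_linear[OF QR] quotient_left_comodule[OF QR]; assumption)+
  show "inv_into (carrier H) \<iota> (\<iota> x) = x" if "x \<in> carrier H" for x
    using that \<iota> by (rule inv_into_f_f[rotated])
  assume x: "x \<in> carrier H" and F: "bil H (regular \<iota>) F"
  have "lcoact (regular \<iota>) (\<iota> x) = tensor_map H H H (regular \<iota>) id (\<lambda>h. \<iota> h) (comult H (inv_into (carrier H) \<iota> (\<iota> x)))"
    by (rule quotient_coact[OF QR]; assumption)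
  then show "tsum H (regular \<iota>) (lcoact (regular \<iota>) (\<iota> x)) F = \<Delta> x (\<lambda>a b. F a (\<iota> b))"
    using inv_into_f_f[OF \<iota> x] tsum_tensor_map[OF vs_H vs_H vs_H 1(1) linear_maps_id(2) 1(2) structure_closed(1)[OF x] F]
    by simp
qed

lemma linear_onto_tensor:
  fixes V :: "(complex, 'a, 'm) module_scheme" and W :: "(complex, 'b, 'n) module_scheme" and U :: "(complex, 'c, 'k) module_scheme"
  assumes V: "vs V" and W: "vs W" and U: "vs U" and f: "f \<in> linear_maps U (V \<otimes>\<^sub>\<complex> W)"
    and pure: "\<And>v w. v \<in> carrier V \<Longrightarrow> w \<in> carrier W \<Longrightarrow> pure_tensor V W v w \<in> f ` carrier U"
  shows "carrier (V \<otimes>\<^sub>\<complex> W) \<subseteq> f ` carrier U"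
proof
  fix t assume "t \<in> carrier (V \<otimes>\<^sub>\<complex> W)"
  then have "t \<in> carrier (tensor_group UNIV V W)" by (simp add: tensor_simps)
  then show "t \<in> f ` carrier U"
  proof (induction rule: balanced_tensor.tensor_induct[OF balanced_tensor_vs[OF V W], consumes 1, case_names one mult])
    case one
    show ?case
      by (rule image_eqI[of _ _ "\<zero>\<^bsub>U\<^esub>"]) (use linear_maps_zero[OF f U] V W U in \<open>simp_all add: tensor_simps(3)\<close>)
  next
    case (mult m n s)
    then obtain x y where "x \<in> carrier U" "y \<in> carrier U" "pure_tensor V W m n = f x" "s = f y"
      using pure by blast
    then show ?case
      using linear_maps_apply(2)[OF f, of x y] U by (intro image_eqI[of _ _ "x \<oplus>\<^bsub>U\<^esub> y"]) (simp_all add: tensor_simps(2))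
  qed
qed

text \<open>Both factors of \<open>P \<box> H\<close> are copies of \<open>P\<close>, and \<open>P \<box> (H \<otimes> H)\<close> is a copy of \<open>P \<otimes> H\<close>: the counit on the
  first tensor factor \<open>H\<close> is one direction, and \<open>p \<otimes> h \<mapsto> p\<^sub>0 \<otimes> (p\<^sub>1 S(h\<^sub>1) \<otimes> h\<^sub>2)\<close> is the other. Under these
  identifications \<open>\<beta>\<close> becomes the canonical map.\<close>

lemma lcan_onto:
  fixes \<iota> :: "'h \<Rightarrow> 'u"
  assumes \<iota>: "inj_on \<iota> (carrier H)"
    and beta: "carrier (cotensor H P (TC (regular \<iota>) (regular \<iota>))) \<subseteq>
      beta H P (regular \<iota>) (regular \<iota>) ` carrier (beta_dom H P (regular \<iota>) (regular \<iota>))"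
  shows "carrier (P \<otimes>\<^sub>\<complex> H) \<subseteq> lcan ` carrier (P \<otimes>\<^sub>\<complex> P)"
proof (rule linear_onto_tensor)
  define R where "R = regular \<iota>"
  let ?\<kappa> = "inv_into (carrier H) \<iota>"
  note Rf [simp] = regular_facts(1-3)[OF \<iota>, folded R_def]
  note Rcoact = regular_facts(6)[OF \<iota>, folded R_def]
  note \<kappa>\<iota> [simp] = regular_facts(5)[OF \<iota>]
  have Rl: "lcoaction R" using left_comodule_lcoaction[OF regular_facts(4)[OF \<iota>]] by (simp add: R_def)
  note [simp] = linear_maps_apply(1)[OF Rf(2)] linear_maps_apply(1)[OF Rf(3)] linear_maps_comp[OF Rf(2)] linear_maps_comp[OF Rf(3)]
    lcoactionD[OF Rl]
  note bal = balanced_beta[OF Rl Rl]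
  \<comment> \<open>\<open>K\<close> identifies \<open>P \<box> (H \<otimes> H)\<close> with \<open>P \<otimes> H\<close>.\<close>
  let ?k0 = "\<lambda>x y. \<epsilon> (?\<kappa> x) \<odot>\<^bsub>H\<^esub> ?\<kappa> y"
  define k where "k = bilinear_lift R R H ?k0"
  have k: "k \<in> linear_maps (R \<otimes>\<^sub>\<complex> R) H" "\<And>x y. x \<in> carrier R \<Longrightarrow> y \<in> carrier R \<Longrightarrow> k (pure_tensor R R x y) = ?k0 x y"
    unfolding k_def by (rule bilinear_lift_props; simp)+
  define K where "K = tensor_map P (R \<otimes>\<^sub>\<complex> R) P H id k"
  have K: "K \<in> linear_maps (P \<otimes>\<^sub>\<complex> (R \<otimes>\<^sub>\<complex> R)) (P \<otimes>\<^sub>\<complex> H)"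
    unfolding K_def by (rule tensor_map_linear) (simp_all add: k)
  have Ksum: "tsum P H (K t) F = tsum P (R \<otimes>\<^sub>\<complex> R) t (\<lambda>p z. F p (k z))"
    if "t \<in> carrier (P \<otimes>\<^sub>\<complex> (R \<otimes>\<^sub>\<complex> R))" "bil P H F" for t F
    unfolding K_def using that k by (subst tsum_tensor_map) simp_all
  have prod: "K (bprod R R x y) \<in> lcan ` carrier (P \<otimes>\<^sub>\<complex> P)"
    if x: "x \<in> carrier (cotensor H P R)" and y: "y \<in> carrier (cotensor H P R)" for x y
  proof -
    have xc: "x \<in> carrier (P \<otimes>\<^sub>\<complex> R)" and yc: "y \<in> carrier (P \<otimes>\<^sub>\<complex> R)" using x y by (auto intro: cotensor_carrier)
    obtain p where p: "p \<in> carrier P" "\<And>\<alpha>. lin P \<alpha> \<Longrightarrow> \<alpha> p = tsum P R x (\<lambda>p x. \<alpha> p * \<epsilon> (?\<kappa> x))"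
    proof (rule cotensor_regular[OF \<iota> x[unfolded R_def], folded R_def])
      fix p assume a: "p \<in> carrier P" "\<And>\<alpha>. lin P \<alpha> \<Longrightarrow> \<alpha> p = tsum P R x (\<lambda>p x. \<alpha> p * \<epsilon> (?\<kappa> x))"
      show thesis by (rule that[OF a])
    qed
    obtain q where q: "q \<in> carrier P" "\<And>F. bil P H F \<Longrightarrow> tsum P R y (\<lambda>p x. F p (?\<kappa> x)) = \<rho> q F"
    proof (rule cotensor_regular[OF \<iota> y[unfolded R_def], folded R_def])
      fix q assume a: "q \<in> carrier P" "\<And>F. bil P H F \<Longrightarrow> tsum P R y (\<lambda>p x. F p (?\<kappa> x)) = \<rho> q F"
      show thesis by (rule that[OF a])
    qed
    have "K (bprod R R x y) = can_elem p q"
    proof (rule tensor_eqI[of P H])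
      fix \<alpha> \<beta> assume l [simp]: "lin P \<alpha>" "lin H \<beta>"
      note [simp] = lin_comp[OF l(1)] lin_comp[OF l(2)] linear_maps_comp[OF k(1)]
      have "tsum P H (K (bprod R R x y)) (\<lambda>v w. \<alpha> v * \<beta> w) =
          tsum P R x (\<lambda>a v. tsum P R y (\<lambda>b w. \<alpha> (a \<star> b) * (\<epsilon> (?\<kappa> v) * \<beta> (?\<kappa> w))))"
        using xc yc by (simp add: Ksum bprod_closed[OF Rl Rl] bprod_sum[OF Rl Rl] k lin_apply(2)[OF l(2)])
      also have "\<dots> = tsum P R x (\<lambda>a v. \<epsilon> (?\<kappa> v) * tsum P R y (\<lambda>b w. \<alpha> (a \<star> b) * \<beta> (?\<kappa> w)))"
        unfolding tsum_cmult[symmetric] by (simp add: mult_ac)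
      also have "\<dots> = tsum P R x (\<lambda>a v. \<rho> q (\<lambda>b w. \<alpha> (a \<star> b) * \<beta> w) * \<epsilon> (?\<kappa> v))"
        by (simp add: q(2)[of "\<lambda>b w. \<alpha> (a \<star> b) * \<beta> w" for a] mult.commute)
      also have "\<dots> = \<rho> q (\<lambda>b w. \<alpha> (p \<star> b) * \<beta> w)"
        by (rule p(2)[symmetric]) simp
      also have "\<dots> = tsum P H (can_elem p q) (\<lambda>v w. \<alpha> v * \<beta> w)"
        using p(1) q(1) by (simp add: can_elem_sum)
      finally show "tsum P H (K (bprod R R x y)) (\<lambda>v w. \<alpha> v * \<beta> w) = tsum P H (can_elem p q) (\<lambda>v w. \<alpha> v * \<beta> w)" .
    qed (use p(1) q(1) bprod_closed[OF Rl Rl xc yc] linear_maps_apply(1)[OF K] in auto)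
    then show ?thesis
      using lcan_pure[OF p(1) q(1)] p(1) q(1) by (intro image_eqI[of _ _ "pure_tensor P P p q"]) auto
  qed
  interpret bh: group_hom "beta_dom H P R R" "add_monoid (P \<otimes>\<^sub>\<complex> (R \<otimes>\<^sub>\<complex> R))" "beta H P R R"
    using beta_hom[OF Rl Rl] balanced_tensor.tensor_comm_group[OF bal, folded beta_dom_def]
      comm_group_add_monoid[OF vs_abelian[of "P \<otimes>\<^sub>\<complex> (R \<otimes>\<^sub>\<complex> R)"]]
    by (simp add: group_hom_def group_hom_axioms_def comm_group_def)
  have range: "K (beta H P R R \<xi>) \<in> lcan ` carrier (P \<otimes>\<^sub>\<complex> P)" if "\<xi> \<in> carrier (beta_dom H P R R)" for \<xi>
    using that[unfolded beta_dom_def]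
  proof (induction rule: balanced_tensor.tensor_induct[OF bal, consumes 1, case_names one mult])
    case one
    show ?case
      by (rule image_eqI[of _ _ "\<zero>\<^bsub>P \<otimes>\<^sub>\<complex> P\<^esub>"])
        (use bh.hom_one linear_maps_zero[OF K] linear_maps_zero[OF lcan_linear] in \<open>simp_all add: beta_dom_def\<close>)
  next
    case (mult m n s)
    then have mn: "m \<in> carrier (cotensor H P R)" "n \<in> carrier (cotensor H P R)" by simp_all
    have te: "beta_tensor H P R R m n \<in> carrier (beta_dom H P R R)"
      unfolding beta_tensor_def beta_dom_def using mult(1,2) by (rule balanced_tensor.te_closed[OF bal])
    have s: "s \<in> carrier (beta_dom H P R R)" using mult(3) by (simp add: beta_dom_def)
    have "beta H P R R (beta_tensor H P R R m n \<otimes>\<^bsub>beta_dom H P R R\<^esub> s) = bprod R R m n \<oplus>\<^bsub>P \<otimes>\<^sub>\<complex> (R \<otimes>\<^sub>\<complex> R)\<^esub> beta H P R R s"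
      using bh.hom_mult[OF te s] beta_elem[OF Rl Rl mn] by simp
    then have e: "K (beta H P R R (beta_tensor H P R R m n \<otimes>\<^bsub>beta_dom H P R R\<^esub> s)) =
        K (bprod R R m n) \<oplus>\<^bsub>P \<otimes>\<^sub>\<complex> H\<^esub> K (beta H P R R s)"
      using linear_maps_apply(2)[OF K] bprod_closed[OF Rl Rl] cotensor_carrier[OF mn(1)] cotensor_carrier[OF mn(2)] bh.hom_closed[OF s]
      by simp
    obtain t1 t2 where "t1 \<in> carrier (P \<otimes>\<^sub>\<complex> P)" "t2 \<in> carrier (P \<otimes>\<^sub>\<complex> P)"
      "K (bprod R R m n) = lcan t1" "K (beta H P R R s) = lcan t2"
      using prod[OF mn] mult(4) by blast
    then show ?case
      using e linear_maps_apply(2)[OF lcan_linear, of t1 t2]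
      by (intro image_eqI[of _ _ "t1 \<oplus>\<^bsub>P \<otimes>\<^sub>\<complex> P\<^esub> t2"]) (simp_all add: beta_tensor_def beta_dom_def)
  qed
  show "pure_tensor P H p h \<in> lcan ` carrier (P \<otimes>\<^sub>\<complex> P)" if p [simp]: "p \<in> carrier P" and h [simp]: "h \<in> carrier H" for p h
  proof -
    define t where "t = tvec P H (P \<otimes>\<^sub>\<complex> (R \<otimes>\<^sub>\<complex> R)) (rcoact P p) (\<lambda>a b.
      tvec H H (P \<otimes>\<^sub>\<complex> (R \<otimes>\<^sub>\<complex> R)) (comult H h) (\<lambda>c d.
        pure_tensor P (R \<otimes>\<^sub>\<complex> R) a (pure_tensor R R (\<iota> (b \<cdot> S c)) (\<iota> d))))"
    have tc: "t \<in> carrier (P \<otimes>\<^sub>\<complex> (R \<otimes>\<^sub>\<complex> R))" by (simp add: t_def)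
    have tsum: "tsum P (R \<otimes>\<^sub>\<complex> R) t F = \<rho> p (\<lambda>a b. \<Delta> h (\<lambda>c d. F a (pure_tensor R R (\<iota> (b \<cdot> S c)) (\<iota> d))))"
      if "bil P (R \<otimes>\<^sub>\<complex> R) F" for F
      using that by (simp add: t_def tsum_tvec tsum_pure)
    have "t \<in> carrier (cotensor H P (TC R R))"
    proof (rule cotensorI[OF TC_lcoaction[OF Rl Rl]])
      show "t \<in> carrier (P \<otimes>\<^sub>\<complex> TC R R)" using tc by simp
      fix \<alpha> \<beta> \<gamma> assume l: "lin P \<alpha>" "lin H \<beta>" "lin (TC R R) \<gamma>"
      then have l' [simp]: "lin P \<alpha>" "lin H \<beta>" "lin (R \<otimes>\<^sub>\<complex> R) \<gamma>" by simp_all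
      note [simp] = lin_comp[OF l(1)] lin_comp[OF l(2)] lin_comp[OF l'(3)] TC_coact_linear[OF Rl Rl]
        linear_maps_comp[OF TC_coact_linear[OF Rl Rl]]
      let ?g = "\<lambda>x y. \<gamma> (pure_tensor R R (\<iota> x) (\<iota> y))"
      have "tsum P (R \<otimes>\<^sub>\<complex> R) t (\<lambda>p v. \<rho> p (\<lambda>a b. \<alpha> a * (\<beta> b * \<gamma> v))) =
          \<rho> p (\<lambda>a b. \<Delta> h (\<lambda>c d. \<rho> a (\<lambda>a0 a1. \<alpha> a0 * (\<beta> a1 * ?g (b \<cdot> S c) d))))"
        by (simp add: tsum)
      also have "\<dots> = \<rho> p (\<lambda>a b. \<rho> a (\<lambda>a0 a1. \<Delta> h (\<lambda>c d. \<alpha> a0 * (\<beta> a1 * ?g (b \<cdot> S c) d))))"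
        by (intro tsum_body tsum_swap)
      also have "\<dots> = \<rho> p (\<lambda>a b. \<Delta> b (\<lambda>b1 b2. \<Delta> h (\<lambda>c w. \<alpha> a * (\<beta> b1 * ?g (b2 \<cdot> S c) w))))"
        by (rule coact_coassoc) auto
      finally have L: "tsum P (R \<otimes>\<^sub>\<complex> R) t (\<lambda>p v. \<rho> p (\<lambda>a b. \<alpha> a * (\<beta> b * \<gamma> v))) =
          \<rho> p (\<lambda>a b. \<Delta> b (\<lambda>b1 b2. \<Delta> h (\<lambda>c w. \<alpha> a * (\<beta> b1 * ?g (b2 \<cdot> S c) w))))" .
      have "tsum P (R \<otimes>\<^sub>\<complex> R) t (\<lambda>p v. tsum H (R \<otimes>\<^sub>\<complex> R) (lcoact (TC R R) v) (\<lambda>b w. \<alpha> p * (\<beta> b * \<gamma> w))) =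
          \<rho> p (\<lambda>a b. \<Delta> h (\<lambda>c d. \<Delta> (b \<cdot> S c) (\<lambda>g v. \<Delta> d (\<lambda>k w. \<alpha> a * (\<beta> (g \<cdot> k) * ?g v w)))))"
        by (simp add: tsum TC_coact_sum[OF Rl Rl] tsum_pure Rcoact)
      also have "\<dots> = \<rho> p (\<lambda>a b. \<Delta> h (\<lambda>c d. \<Delta> b (\<lambda>b1 b2. \<Delta> c (\<lambda>c1 c2. \<Delta> d (\<lambda>k w.
          \<alpha> a * (\<beta> (b1 \<cdot> (S c2 \<cdot> k)) * ?g (b2 \<cdot> S c1) w))))))"
        by (simp add: comult_mult comult_antipode mult_assoc)
      also have "\<dots> = \<rho> p (\<lambda>a b. \<Delta> b (\<lambda>b1 b2. \<Delta> h (\<lambda>c d. \<Delta> c (\<lambda>c1 c2. \<Delta> d (\<lambda>k w.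
          \<alpha> a * (\<beta> (b1 \<cdot> (S c2 \<cdot> k)) * ?g (b2 \<cdot> S c1) w))))))"
        by (intro tsum_body tsum_swap)
      also have "\<dots> = \<rho> p (\<lambda>a b. \<Delta> b (\<lambda>b1 b2. \<Delta> h (\<lambda>c r. \<Delta> r (\<lambda>z w. \<Delta> z (\<lambda>c2 k.
          \<alpha> a * (\<beta> (b1 \<cdot> (S c2 \<cdot> k)) * ?g (b2 \<cdot> S c) w))))))"
        by (simp add: comult_coassoc)
      also have "\<dots> = \<rho> p (\<lambda>a b. \<Delta> b (\<lambda>b1 b2. \<Delta> h (\<lambda>c r. \<Delta> r (\<lambda>z w. \<epsilon> z *
          (\<alpha> a * (\<beta> b1 * ?g (b2 \<cdot> S c) w))))))"
      proof (intro tsum_body)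
        fix a b1 b2 c z w
        assume c: "a \<in> carrier P" "b1 \<in> carrier H" "b2 \<in> carrier H" "c \<in> carrier H" "z \<in> carrier H" "w \<in> carrier H"
        show "\<Delta> z (\<lambda>c2 k. \<alpha> a * (\<beta> (b1 \<cdot> (S c2 \<cdot> k)) * ?g (b2 \<cdot> S c) w)) = \<epsilon> z * (\<alpha> a * (\<beta> b1 * ?g (b2 \<cdot> S c) w))"
          by (subst antipode_sum(1)[where \<alpha> = "\<lambda>r. \<alpha> a * (\<beta> (b1 \<cdot> r) * ?g (b2 \<cdot> S c) w)"]) (use c in auto)
      qed
      also have "\<dots> = \<rho> p (\<lambda>a b. \<Delta> b (\<lambda>b1 b2. \<Delta> h (\<lambda>c w. \<alpha> a * (\<beta> b1 * ?g (b2 \<cdot> S c) w))))"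
        by (intro tsum_body comult_counit(1)) auto
      finally show "tsum P (TC R R) t (\<lambda>p v. \<rho> p (\<lambda>a b. \<alpha> a * (\<beta> b * \<gamma> v))) =
          tsum P (TC R R) t (\<lambda>p v. tsum H (TC R R) (lcoact (TC R R) v) (\<lambda>b w. \<alpha> p * (\<beta> b * \<gamma> w)))"
        using L by simp
    qed
    then obtain \<xi> where "\<xi> \<in> carrier (beta_dom H P R R)" "t = beta H P R R \<xi>"
      using beta unfolding R_def by blast
    then have "K t \<in> lcan ` carrier (P \<otimes>\<^sub>\<complex> P)" using range by simp
    moreover have "K t = pure_tensor P H p h"
    proof (rule tensor_eqI[of P H])
      fix \<alpha> \<beta> assume l [simp]: "lin P \<alpha>" "lin H \<beta>"
      note [simp] = lin_comp[OF l(1)] lin_comp[OF l(2)] linear_maps_comp[OF k(1)]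
      have "tsum P H (K t) (\<lambda>v w. \<alpha> v * \<beta> w) = \<rho> p (\<lambda>a b. \<Delta> h (\<lambda>c d. \<alpha> a * (\<epsilon> b * (\<epsilon> c * \<beta> d))))"
        using tc by (simp add: Ksum tsum k lin_apply(2)[OF l(2)] mult.assoc)
      also have "\<dots> = \<rho> p (\<lambda>a b. \<alpha> a * \<epsilon> b * \<beta> h)"
        by (simp add: tsum_cmult comult_counit mult.assoc)
      also have "\<dots> = \<alpha> p * \<beta> h"
        unfolding tsum_multc by (simp add: coact_counit)
      finally show "tsum P H (K t) (\<lambda>v w. \<alpha> v * \<beta> w) = tsum P H (pure_tensor P H p h) (\<lambda>v w. \<alpha> v * \<beta> w)"
        by (simp add: tsum_pure)
    qed (use tc linear_maps_apply(1)[OF K] in auto)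
    ultimately show ?thesis by simp
  qed
qed (auto simp: lcan_linear)

subsection \<open>The inverse of the antipode\<close>

context
  assumes bij: "bij_betw S (carrier H) (carrier H)"
begin

abbreviation "Si \<equiv> inv_into (carrier H) S"

lemma Si_closed [simp]: "x \<in> carrier H \<Longrightarrow> Si x \<in> carrier H"
  and Si_left [simp]: "x \<in> carrier H \<Longrightarrow> Si (S x) = x"
  and Si_right [simp]: "x \<in> carrier H \<Longrightarrow> S (Si x) = x"
  using bij by (auto simp: bij_betw_def inv_into_into f_inv_into_f)

lemma Si_linear [simp]: "Si \<in> linear_maps H H"
proof (rule linear_mapsI)
  note S = linear_maps_apply[OF structure_linear(2)]
  show "Si (x \<oplus>\<^bsub>H\<^esub> y) = Si x \<oplus>\<^bsub>H\<^esub> Si y" if "x \<in> carrier H" "y \<in> carrier H" for x y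
    using S(2)[of "Si x" "Si y"] Si_left[of "Si x \<oplus>\<^bsub>H\<^esub> Si y"] that by simp
  show "Si (c \<odot>\<^bsub>H\<^esub> x) = c \<odot>\<^bsub>H\<^esub> Si x" if "x \<in> carrier H" for x c
    using S(3)[of "Si x" c] Si_left[of "c \<odot>\<^bsub>H\<^esub> Si x"] that by simp
qed simp

lemma Si_linear_comp [simp]: "f \<in> linear_maps V H \<Longrightarrow> (\<lambda>v. Si (f v)) \<in> linear_maps V H"
  by (rule linear_maps_comp[OF Si_linear])

lemma comult_Si:
  assumes x: "x \<in> carrier H" and F: "bil H H F"
  shows "\<Delta> (Si x) F = \<Delta> x (\<lambda>a b. F (Si b) (Si a))"
proof -
  note [simp] = bil_comp[OF F]
  have "\<Delta> (S (Si x)) (\<lambda>a b. F (Si b) (Si a)) = \<Delta> (Si x) F"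
    using x by (subst comult_antipode) simp_all
  then show ?thesis using x by simp
qed

text \<open>\<open>S\<^sup>-\<^sup>1(x\<^sub>2) x\<^sub>1 = \<epsilon>(x)\<close>: the inverse is an antipode for the opposite comultiplication.\<close>

lemma Si_sum:
  assumes x: "x \<in> carrier H" and \<alpha>: "lin H \<alpha>"
  shows "\<Delta> x (\<lambda>a b. \<alpha> (Si b \<cdot> a)) = \<epsilon> x * \<alpha> 1\<^sub>H"
proof -
  note [simp] = lin_comp[OF \<alpha>]
  have "\<Delta> (S (Si x)) (\<lambda>a b. \<alpha> (Si b \<cdot> a)) = \<Delta> (Si x) (\<lambda>a b. \<alpha> (a \<cdot> S b))"
    using x by (subst comult_antipode) simp_all
  then show ?thesis using x counit_antipode[of "Si x"] by (simp add: antipode_sum \<alpha>)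
qed

subsection \<open>A total integral and surjectivity of the canonical map give a strong connection\<close>

context
  fixes j :: "'h \<Rightarrow> 'p"
  assumes j: "j \<in> linear_maps H P" and j1: "j 1\<^sub>H = 1\<^sub>P"
    and jcol: "\<And>h F. h \<in> carrier H \<Longrightarrow> bil P H F \<Longrightarrow> \<rho> (j h) F = \<Delta> h (\<lambda>a b. F (j a) b)"
    and onto: "carrier (P \<otimes>\<^sub>\<complex> H) \<subseteq> lcan ` carrier (P \<otimes>\<^sub>\<complex> P)"
begin

lemmas j_facts = j linear_maps_apply(1)[OF j] linear_maps_comp[OF j]

text \<open>Surjectivity of the canonical map gives a linear \<open>f\<close> with \<open>can(f(h)) = 1 \<otimes> h\<close>. For \<open>f(h\<^sub>2) = x \<otimes> y\<close> put
  \<open>\<omega>(h) = j(S(h\<^sub>1) S\<^sup>-\<^sup>1(x\<^sub>1)) x\<^sub>0 \<otimes> y\<^sub>0 j(S(y\<^sub>1) h\<^sub>3)\<close>. Whatever the coactions of \<open>x\<close> and \<open>y\<close> are, they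
  cancel against those of \<open>j\<close>, which leaves \<open>S(h\<^sub>1)\<close> on the left and \<open>h\<^sub>3\<close> on the right. The product of the legs
  is computed from \<open>x\<^sub>0 y\<^sub>0 \<otimes> x\<^sub>1 \<otimes> y\<^sub>1 = 1 \<otimes> S(h\<^sub>1) \<otimes> h\<^sub>2\<close> for \<open>f(h) = x \<otimes> y\<close>, which is another form of
  \<open>can(f(h)) = 1 \<otimes> h\<close> and is established first.\<close>

lemma strong_connection_exists: "\<exists>\<omega>. strong_connection \<omega>"
proof -
  note [simp] = j_facts
  obtain \<sigma> where \<sigma>: "\<sigma> \<in> linear_maps (P \<otimes>\<^sub>\<complex> H) (P \<otimes>\<^sub>\<complex> P)" "\<And>w. w \<in> carrier (P \<otimes>\<^sub>\<complex> H) \<Longrightarrow> lcan (\<sigma> w) = id w"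
  proof (rule linear_lift[OF _ _ _ lcan_linear linear_maps_id(2)[of "P \<otimes>\<^sub>\<complex> H"]])
    show "id w \<in> lcan ` carrier (P \<otimes>\<^sub>\<complex> P)" if "w \<in> carrier (P \<otimes>\<^sub>\<complex> H)" for w
      using that onto by auto
  qed (simp_all add: that)
  define f where "f h = \<sigma> (pure_tensor P H 1\<^sub>P h)" for h
  have f: "f \<in> linear_maps H (P \<otimes>\<^sub>\<complex> P)"
    unfolding f_def by (rule linear_maps_comp[OF \<sigma>(1)]) simp
  note [simp] = f linear_maps_apply(1)[OF f] linear_maps_comp[OF f]
  have lcanf: "lcan (f h) = pure_tensor P H 1\<^sub>P h" if "h \<in> carrier H" for h
    using that \<sigma>(2) by (simp add: f_def)
  have key: "tsum P P (f h) (\<lambda>x y. \<rho> x (\<lambda>x0 x1. \<rho> y (\<lambda>y0 y1. G x1 (x0 \<star> y0) y1))) = \<Delta> h (\<lambda>a b. G (S a) 1\<^sub>P b)"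
    if h [simp]: "h \<in> carrier H" and G: "tril H P H G" for h G
  proof -
    note [simp] = tril_comp[OF G]
    let ?F = "\<lambda>a b. \<rho> a (\<lambda>a0 a1. \<Delta> b (\<lambda>b1 b2. G (a1 \<cdot> S b1) a0 b2))"
    have "\<Delta> h (\<lambda>a b. G (S a) 1\<^sub>P b) = tsum P H (lcan (f h)) ?F"
      by (simp add: lcanf tsum_pure coact_one)
    also have "\<dots> = tsum P P (f h) (\<lambda>x y. \<rho> y (\<lambda>a b. \<rho> x (\<lambda>x0 x1. \<rho> a (\<lambda>a0 a1. \<Delta> b (\<lambda>b1 b2.
        G (x1 \<cdot> (a1 \<cdot> S b1)) (x0 \<star> a0) b2)))))"
      by (simp add: lcan_sum coact_mult mult_assoc)
    also have "\<dots> = tsum P P (f h) (\<lambda>x y. \<rho> x (\<lambda>x0 x1. \<rho> y (\<lambda>a b. \<rho> a (\<lambda>a0 a1. \<Delta> b (\<lambda>b1 b2.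
        G (x1 \<cdot> (a1 \<cdot> S b1)) (x0 \<star> a0) b2)))))"
      by (intro tsum_body tsum_swap)
    also have "\<dots> = tsum P P (f h) (\<lambda>x y. \<rho> x (\<lambda>x0 x1. \<rho> y (\<lambda>a r. \<Delta> r (\<lambda>z b2. \<Delta> z (\<lambda>a1 b1.
        G (x1 \<cdot> (a1 \<cdot> S b1)) (x0 \<star> a) b2)))))"
      by (simp add: coact_coassoc comult_coassoc)
    also have "\<dots> = tsum P P (f h) (\<lambda>x y. \<rho> x (\<lambda>x0 x1. \<rho> y (\<lambda>a r. \<Delta> r (\<lambda>z b2. \<epsilon> z * G x1 (x0 \<star> a) b2))))"
    proof (intro tsum_body)
      fix x0 x1 a z b2 assume c: "x0 \<in> carrier P" "x1 \<in> carrier H" "a \<in> carrier P" "z \<in> carrier H" "b2 \<in> carrier H"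
      show "\<Delta> z (\<lambda>a1 b1. G (x1 \<cdot> (a1 \<cdot> S b1)) (x0 \<star> a) b2) = \<epsilon> z * G x1 (x0 \<star> a) b2"
        by (subst antipode_sum(2)[where \<alpha> = "\<lambda>r. G (x1 \<cdot> r) (x0 \<star> a) b2"]) (use c in auto)
    qed
    also have "\<dots> = tsum P P (f h) (\<lambda>x y. \<rho> x (\<lambda>x0 x1. \<rho> y (\<lambda>y0 y1. G x1 (x0 \<star> y0) y1)))"
      by (intro tsum_body comult_counit(1)) auto
    finally show ?thesis ..
  qed
  define W where "W h1 h2 h3 F = tsum P P (f h2) (\<lambda>x y. \<rho> x (\<lambda>x0 x1. \<rho> y (\<lambda>y0 y1.
      F (j (S h1 \<cdot> Si x1) \<star> x0) (y0 \<star> j (S y1 \<cdot> h3)))))" for h1 h2 h3 and F :: "'p \<Rightarrow> 'p \<Rightarrow> complex"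
  define \<omega> where "\<omega> h = tvec H H (P \<otimes>\<^sub>\<complex> P) (comult H h) (\<lambda>h1 h'. tvec H H (P \<otimes>\<^sub>\<complex> P) (comult H h') (\<lambda>h2 h3.
      tvec P P (P \<otimes>\<^sub>\<complex> P) (f h2) (\<lambda>x y. tvec P H (P \<otimes>\<^sub>\<complex> P) (rcoact P x) (\<lambda>x0 x1. tvec P H (P \<otimes>\<^sub>\<complex> P) (rcoact P y) (\<lambda>y0 y1.
        pure_tensor P P (j (S h1 \<cdot> Si x1) \<star> x0) (y0 \<star> j (S y1 \<cdot> h3)))))))" for h
  have \<omega>c [simp]: "\<omega> h \<in> carrier (P \<otimes>\<^sub>\<complex> P)" for h by (simp add: \<omega>_def)
  have \<omega>sum: "tsum P P (\<omega> h) F = \<Delta> h (\<lambda>h1 h'. \<Delta> h' (\<lambda>h2 h3. W h1 h2 h3 F))" if "bil P P F" for h F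
    using that by (simp add: \<omega>_def W_def tsum_tvec tsum_pure)
  have Wlin: "g \<in> linear_maps V H \<Longrightarrow> h2 \<in> carrier H \<Longrightarrow> h3 \<in> carrier H \<Longrightarrow> lin V (\<lambda>v. W (g v) h2 h3 F)"
    "g \<in> linear_maps V H \<Longrightarrow> h1 \<in> carrier H \<Longrightarrow> h3 \<in> carrier H \<Longrightarrow> lin V (\<lambda>v. W h1 (g v) h3 F)"
    "g \<in> linear_maps V H \<Longrightarrow> h1 \<in> carrier H \<Longrightarrow> h2 \<in> carrier H \<Longrightarrow> lin V (\<lambda>v. W h1 h2 (g v) F)"
    if "bil P P F" for V :: "(complex, 'z, 'w) module_scheme" and g h1 h2 h3 F
  proof -
    note [simp] = bil_comp[OF that]
    show "g \<in> linear_maps V H \<Longrightarrow> h2 \<in> carrier H \<Longrightarrow> h3 \<in> carrier H \<Longrightarrow> lin V (\<lambda>v. W (g v) h2 h3 F)"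
      "g \<in> linear_maps V H \<Longrightarrow> h1 \<in> carrier H \<Longrightarrow> h3 \<in> carrier H \<Longrightarrow> lin V (\<lambda>v. W h1 (g v) h3 F)"
      "g \<in> linear_maps V H \<Longrightarrow> h1 \<in> carrier H \<Longrightarrow> h2 \<in> carrier H \<Longrightarrow> lin V (\<lambda>v. W h1 h2 (g v) F)"
      unfolding W_def by simp_all
  qed
  have Wleft: "W h1 h2 h3 (\<lambda>u v. \<rho> u (\<lambda>a b. F a b v)) = \<Delta> h1 (\<lambda>g k. W k h2 h3 (\<lambda>u v. F u (S g) v))"
    if h [simp]: "h1 \<in> carrier H" "h2 \<in> carrier H" "h3 \<in> carrier H" and F: "tril P H P F" for h1 h2 h3 F
  proof -
    note [simp] = tril_comp[OF F]
    let ?v = "\<lambda>y0 y1. y0 \<star> j (S y1 \<cdot> h3)"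
    have inner: "\<rho> x (\<lambda>x0 x1. \<rho> (j (S h1 \<cdot> Si x1) \<star> x0) (\<lambda>a b. F a b v)) =
        \<Delta> h1 (\<lambda>g k. \<rho> x (\<lambda>x0 x1. F (j (S k \<cdot> Si x1) \<star> x0) (S g) v))"
      if [simp]: "x \<in> carrier P" "v \<in> carrier P" for x v
    proof -
      have "\<rho> x (\<lambda>x0 x1. \<rho> (j (S h1 \<cdot> Si x1) \<star> x0) (\<lambda>a b. F a b v)) =
        \<rho> x (\<lambda>x0 x1. \<Delta> h1 (\<lambda>g k. \<Delta> x1 (\<lambda>m l. \<rho> x0 (\<lambda>c d. F (j (S k \<cdot> Si l) \<star> c) (S g \<cdot> (Si m \<cdot> d)) v))))"
        by (simp add: coact_mult jcol comult_mult comult_antipode comult_Si mult_assoc)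
      also have "\<dots> = \<Delta> h1 (\<lambda>g k. \<rho> x (\<lambda>x0 x1. \<rho> x0 (\<lambda>c d. \<Delta> x1 (\<lambda>m l. F (j (S k \<cdot> Si l) \<star> c) (S g \<cdot> (Si m \<cdot> d)) v))))"
        by (subst tsum_swap) (intro tsum_body tsum_swap)
      also have "\<dots> = \<Delta> h1 (\<lambda>g k. \<rho> x (\<lambda>c r. \<Delta> r (\<lambda>z l. \<Delta> z (\<lambda>d m. F (j (S k \<cdot> Si l) \<star> c) (S g \<cdot> (Si m \<cdot> d)) v))))"
        by (simp add: coact_coassoc comult_coassoc)
      also have "\<dots> = \<Delta> h1 (\<lambda>g k. \<rho> x (\<lambda>c r. \<Delta> r (\<lambda>z l. \<epsilon> z * F (j (S k \<cdot> Si l) \<star> c) (S g) v)))"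
      proof (intro tsum_body)
        fix g k c z l assume c: "g \<in> carrier H" "k \<in> carrier H" "c \<in> carrier P" "z \<in> carrier H" "l \<in> carrier H"
        show "\<Delta> z (\<lambda>d m. F (j (S k \<cdot> Si l) \<star> c) (S g \<cdot> (Si m \<cdot> d)) v) = \<epsilon> z * F (j (S k \<cdot> Si l) \<star> c) (S g) v"
          by (subst Si_sum[where \<alpha> = "\<lambda>r. F (j (S k \<cdot> Si l) \<star> c) (S g \<cdot> r) v"]) (use c in auto)
      qed
      also have "\<dots> = \<Delta> h1 (\<lambda>g k. \<rho> x (\<lambda>c l. F (j (S k \<cdot> Si l) \<star> c) (S g) v))"
        by (intro tsum_body comult_counit(1)) auto
      finally show ?thesis .
    qed
    have "W h1 h2 h3 (\<lambda>u v. \<rho> u (\<lambda>a b. F a b v)) = tsum P P (f h2) (\<lambda>x y. \<rho> y (\<lambda>y0 y1. \<rho> x (\<lambda>x0 x1.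
        \<rho> (j (S h1 \<cdot> Si x1) \<star> x0) (\<lambda>a b. F a b (?v y0 y1)))))"
      unfolding W_def by (intro tsum_body tsum_swap)
    also have "\<dots> = tsum P P (f h2) (\<lambda>x y. \<rho> y (\<lambda>y0 y1. \<Delta> h1 (\<lambda>g k. \<rho> x (\<lambda>x0 x1. F (j (S k \<cdot> Si x1) \<star> x0) (S g) (?v y0 y1)))))"
      by (simp add: inner)
    also have "\<dots> = tsum P P (f h2) (\<lambda>x y. \<Delta> h1 (\<lambda>g k. \<rho> x (\<lambda>x0 x1. \<rho> y (\<lambda>y0 y1. F (j (S k \<cdot> Si x1) \<star> x0) (S g) (?v y0 y1)))))"
      by (rule tsum_body, subst tsum_swap, intro tsum_body tsum_swap)
    also have "\<dots> = \<Delta> h1 (\<lambda>g k. W k h2 h3 (\<lambda>u v. F u (S g) v))"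
      unfolding W_def by (rule tsum_swap)
    finally show ?thesis .
  qed
  have Wright: "W h1 h2 h3 (\<lambda>u v. \<rho> v (F u)) = \<Delta> h3 (\<lambda>m n. W h1 h2 m (\<lambda>u v. F u v n))"
    if h [simp]: "h1 \<in> carrier H" "h2 \<in> carrier H" "h3 \<in> carrier H" and F: "tril P P H F" for h1 h2 h3 F
  proof -
    note [simp] = tril_comp[OF F]
    have inner: "\<rho> y (\<lambda>y0 y1. \<rho> (y0 \<star> j (S y1 \<cdot> h3)) (F u)) = \<Delta> h3 (\<lambda>m n. \<rho> y (\<lambda>y0 y1. F u (y0 \<star> j (S y1 \<cdot> m)) n))"
      if [simp]: "y \<in> carrier P" "u \<in> carrier P" for y u
    proof -
      have "\<rho> y (\<lambda>y0 y1. \<rho> (y0 \<star> j (S y1 \<cdot> h3)) (F u)) =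
        \<rho> y (\<lambda>y0 y1. \<rho> y0 (\<lambda>c d. \<Delta> y1 (\<lambda>k l. \<Delta> h3 (\<lambda>m n. F u (c \<star> j (S l \<cdot> m)) (d \<cdot> S k \<cdot> n)))))"
        by (simp add: coact_mult jcol comult_mult comult_antipode mult_assoc)
      also have "\<dots> = \<rho> y (\<lambda>c r. \<Delta> r (\<lambda>z l. \<Delta> z (\<lambda>d k. \<Delta> h3 (\<lambda>m n. F u (c \<star> j (S l \<cdot> m)) (d \<cdot> S k \<cdot> n)))))"
        by (simp add: coact_coassoc comult_coassoc)
      also have "\<dots> = \<rho> y (\<lambda>c r. \<Delta> r (\<lambda>z l. \<epsilon> z * \<Delta> h3 (\<lambda>m n. F u (c \<star> j (S l \<cdot> m)) n)))"
      proof (intro tsum_body)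
        fix c z l assume c: "c \<in> carrier P" "z \<in> carrier H" "l \<in> carrier H"
        show "\<Delta> z (\<lambda>d k. \<Delta> h3 (\<lambda>m n. F u (c \<star> j (S l \<cdot> m)) (d \<cdot> S k \<cdot> n))) = \<epsilon> z * \<Delta> h3 (\<lambda>m n. F u (c \<star> j (S l \<cdot> m)) n)"
          by (subst antipode_sum(2)[where \<alpha> = "\<lambda>r. \<Delta> h3 (\<lambda>m n. F u (c \<star> j (S l \<cdot> m)) (r \<cdot> n))"]) (use c in auto)
      qed
      also have "\<dots> = \<rho> y (\<lambda>c l. \<Delta> h3 (\<lambda>m n. F u (c \<star> j (S l \<cdot> m)) n))"
        by (intro tsum_body comult_counit(1)) auto
      also have "\<dots> = \<Delta> h3 (\<lambda>m n. \<rho> y (\<lambda>y0 y1. F u (y0 \<star> j (S y1 \<cdot> m)) n))"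
        by (rule tsum_swap)
      finally show ?thesis .
    qed
    have "W h1 h2 h3 (\<lambda>u v. \<rho> v (F u)) = tsum P P (f h2) (\<lambda>x y. \<rho> x (\<lambda>x0 x1. \<Delta> h3 (\<lambda>m n. \<rho> y (\<lambda>y0 y1.
        F (j (S h1 \<cdot> Si x1) \<star> x0) (y0 \<star> j (S y1 \<cdot> m)) n))))"
      unfolding W_def by (simp add: inner)
    also have "\<dots> = tsum P P (f h2) (\<lambda>x y. \<Delta> h3 (\<lambda>m n. \<rho> x (\<lambda>x0 x1. \<rho> y (\<lambda>y0 y1.
        F (j (S h1 \<cdot> Si x1) \<star> x0) (y0 \<star> j (S y1 \<cdot> m)) n))))"
      by (intro tsum_body tsum_swap)
    also have "\<dots> = \<Delta> h3 (\<lambda>m n. W h1 h2 m (\<lambda>u v. F u v n))"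
      unfolding W_def by (rule tsum_swap)
    finally show ?thesis .
  qed
  have "strong_connection \<omega>"
    unfolding strong_connection_def
  proof (intro conjI ballI allI impI)
    show "\<omega> \<in> linear_maps H (P \<otimes>\<^sub>\<complex> P)"
    proof (rule linear_maps_by_functionals)
      fix \<phi> assume \<phi>: "lin (P \<otimes>\<^sub>\<complex> P) \<phi>"
      have b: "bil P P (\<lambda>v w. \<phi> (pure_tensor P P v w))" by (simp add: lin_comp[OF \<phi>])
      have "\<phi> (\<omega> h) = \<Delta> h (\<lambda>h1 h'. \<Delta> h' (\<lambda>h2 h3. W h1 h2 h3 (\<lambda>v w. \<phi> (pure_tensor P P v w))))" for h
        using lin_presentation[OF vs_P vs_P \<omega>c \<phi>] \<omega>sum[OF b] by simp
      then show "lin H (\<lambda>h. \<phi> (\<omega> h))" by (simp add: Wlin[OF b])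
    qed auto
    fix h assume h [simp]: "h \<in> carrier H"
    show "tsum P P (\<omega> h) (\<lambda>u v. \<rho> u (\<lambda>a b. F a b v)) = \<Delta> h (\<lambda>g k. tsum P P (\<omega> k) (\<lambda>u v. F u (S g) v))"
      if F: "tril P H P F" for F
    proof -
      note [simp] = tril_comp[OF F]
      have b [simp]: "bil P P (\<lambda>u v. F u (S g) v)" if "g \<in> carrier H" for g using that by simp
      have [simp]: "lin V (\<lambda>v. W k h2 h3 (\<lambda>u w. F u (S (g v)) w))"
        if "g \<in> linear_maps V H" "k \<in> carrier H" "h2 \<in> carrier H" "h3 \<in> carrier H"
        for V :: "('h hopf)" and g k h2 h3
        using that unfolding W_def by simp
      note [simp] = Wlin[OF b]
      have "tsum P P (\<omega> h) (\<lambda>u v. \<rho> u (\<lambda>a b. F a b v)) =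
          \<Delta> h (\<lambda>h1 h'. \<Delta> h' (\<lambda>h2 h3. \<Delta> h1 (\<lambda>g k. W k h2 h3 (\<lambda>u v. F u (S g) v))))"
        by (simp add: \<omega>sum Wleft F)
      also have "\<dots> = \<Delta> h (\<lambda>h1 h'. \<Delta> h1 (\<lambda>g k. \<Delta> h' (\<lambda>h2 h3. W k h2 h3 (\<lambda>u v. F u (S g) v))))"
        by (intro tsum_body tsum_swap)
      also have "\<dots> = \<Delta> h (\<lambda>g k. \<Delta> k (\<lambda>h1 h'. \<Delta> h' (\<lambda>h2 h3. W h1 h2 h3 (\<lambda>u v. F u (S g) v))))"
        by (simp add: comult_coassoc)
      finally show ?thesis by (simp add: \<omega>sum)
    qed
    show "tsum P P (\<omega> h) (\<lambda>u v. \<rho> v (F u)) = \<Delta> h (\<lambda>g k. tsum P P (\<omega> g) (\<lambda>u v. F u v k))"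
      if F: "tril P P H F" for F
    proof -
      note [simp] = tril_comp[OF F]
      have b [simp]: "bil P P (\<lambda>u v. F u v n)" if "n \<in> carrier H" for n using that by simp
      have [simp]: "lin V (\<lambda>v. W k h2 h3 (\<lambda>u w. F u w (g v)))"
        if "g \<in> linear_maps V H" "k \<in> carrier H" "h2 \<in> carrier H" "h3 \<in> carrier H"
        for V :: "('h hopf)" and g k h2 h3
        using that unfolding W_def by simp
      note [simp] = Wlin[OF b]
      have "tsum P P (\<omega> h) (\<lambda>u v. \<rho> v (F u)) =
          \<Delta> h (\<lambda>h1 h'. \<Delta> h' (\<lambda>h2 h3. \<Delta> h3 (\<lambda>m n. W h1 h2 m (\<lambda>u v. F u v n))))"
        by (simp add: \<omega>sum Wright F)
      also have "\<dots> = \<Delta> h (\<lambda>g n. \<Delta> g (\<lambda>h1 h'. \<Delta> h' (\<lambda>h2 m. W h1 h2 m (\<lambda>u v. F u v n))))"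
        by (simp add: comult_coassoc)
      finally show ?thesis by (simp add: \<omega>sum)
    qed
    show "tsum P P (\<omega> h) (\<lambda>u v. \<alpha> (u \<star> v)) = \<epsilon> h * \<alpha> 1\<^sub>P" if \<alpha> [simp]: "lin P \<alpha>" for \<alpha>
    proof -
      note [simp] = lin_comp[OF \<alpha>]
      have W: "W h1 h2 h3 (\<lambda>u v. \<alpha> (u \<star> v)) = \<Delta> h2 (\<lambda>a b. \<alpha> (j (S h1 \<cdot> a) \<star> j (S b \<cdot> h3)))"
        if [simp]: "h1 \<in> carrier H" "h2 \<in> carrier H" "h3 \<in> carrier H" for h1 h2 h3
        using key[of h2 "\<lambda>x1 z y1. \<alpha> (j (S h1 \<cdot> Si x1) \<star> (z \<star> j (S y1 \<cdot> h3)))"]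
        by (simp add: W_def mult_assoc)
      have "tsum P P (\<omega> h) (\<lambda>u v. \<alpha> (u \<star> v)) =
          \<Delta> h (\<lambda>h1 h'. \<Delta> h' (\<lambda>h2 h3. \<Delta> h2 (\<lambda>a b. \<alpha> (j (S h1 \<cdot> a) \<star> j (S b \<cdot> h3)))))"
        by (simp add: \<omega>sum W)
      also have "\<dots> = \<Delta> h (\<lambda>h1 h'. \<Delta> h' (\<lambda>a r. \<Delta> r (\<lambda>b h3. \<alpha> (j (S h1 \<cdot> a) \<star> j (S b \<cdot> h3)))))"
        by (simp add: comult_coassoc)
      also have "\<dots> = \<Delta> h (\<lambda>h1 h'. \<Delta> h' (\<lambda>a r. \<epsilon> r * \<alpha> (j (S h1 \<cdot> a))))"
      proof (intro tsum_body)
        fix h1 a r assume c: "h1 \<in> carrier H" "a \<in> carrier H" "r \<in> carrier H"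
        show "\<Delta> r (\<lambda>b h3. \<alpha> (j (S h1 \<cdot> a) \<star> j (S b \<cdot> h3))) = \<epsilon> r * \<alpha> (j (S h1 \<cdot> a))"
          by (subst antipode_sum(1)[where \<alpha> = "\<lambda>r. \<alpha> (j (S h1 \<cdot> a) \<star> j r)"]) (use c in \<open>auto simp: j1\<close>)
      qed
      also have "\<dots> = \<Delta> h (\<lambda>h1 a. \<alpha> (j (S h1 \<cdot> a)))"
        by (intro tsum_body comult_counit(2)) auto
      also have "\<dots> = \<epsilon> h * \<alpha> 1\<^sub>P"
        by (subst antipode_sum(1)[where \<alpha> = "\<lambda>r. \<alpha> (j r)"]) (auto simp: j1)
      finally show ?thesis .
    qed
  qed
  then show ?thesis by blast
qed

end

end

subsection \<open>A strong connection makes the comodule algebra principal\<close>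

text \<open>The algebra \<open>B\<close>, as a submodule of \<open>P\<close>.\<close>

abbreviation "Bm \<equiv> P\<lparr>carrier := B\<rparr>"

lemma vs_Bm [simp]: "vs Bm"
proof (rule vsI)
  show "abelian_group Bm"
    by (rule subspace_abelian_group[of P]) (simp_all add: coinvariants_subspace)
qed (use coinvariants_subspace in \<open>auto simp: subspace_def vs_distrib vs_simps\<close>)

lemma Bm_linear [simp]:
  "f \<in> linear_maps U Bm \<Longrightarrow> f \<in> linear_maps U P" "g \<in> linear_maps P V \<Longrightarrow> g \<in> linear_maps Bm V"
  "(\<lambda>x. x) \<in> linear_maps Bm P" "id \<in> linear_maps Bm P" "lin P \<alpha> \<Longrightarrow> lin Bm \<alpha>"
  by (auto simp: linear_maps_iff lin_def)

context
  fixes \<omega> :: "'h \<Rightarrow> ('p, 'p) tens"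
  assumes \<omega>: "strong_connection \<omega>"
begin

lemmas \<omega>D = strong_connectionD(1-3)[OF \<omega>]
lemmas \<omega>_left = strong_connectionD(4)[OF \<omega>]
lemmas \<omega>_right = strong_connectionD(5)[OF \<omega>]
lemmas \<omega>_mult = strong_connectionD(6)[OF \<omega>]

text \<open>\<open>p \<mapsto> p\<^sub>0 \<omega>(p\<^sub>1)\<close>, the splitting of the multiplication \<open>B \<otimes> P \<rightarrow> P\<close>, with values in \<open>P \<otimes> P\<close>.\<close>

definition split :: "'p \<Rightarrow> ('p, 'p) tens"
  where "split p = tvec P H (P \<otimes>\<^sub>\<complex> P) (rcoact P p) (\<lambda>p0 p1.
    tvec P P (P \<otimes>\<^sub>\<complex> P) (\<omega> p1) (\<lambda>u v. pure_tensor P P (p0 \<star> u) v))"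

lemma split_closed [simp]: "split p \<in> carrier (P \<otimes>\<^sub>\<complex> P)"
  by (simp add: split_def \<omega>D)

lemma split_sum:
  assumes F: "bil P P F"
  shows "tsum P P (split p) F = \<rho> p (\<lambda>p0 p1. tsum P P (\<omega> p1) (\<lambda>u v. F (p0 \<star> u) v))"
  using F by (simp add: split_def tsum_tvec tsum_pure \<omega>D)

lemma split_linear [simp]: "split \<in> linear_maps P (P \<otimes>\<^sub>\<complex> P)"
proof (rule linear_maps_by_functionals)
  note [simp] = \<omega>D
  fix \<phi> assume \<phi>: "lin (P \<otimes>\<^sub>\<complex> P) \<phi>"
  have b: "bil P P (\<lambda>v w. \<phi> (pure_tensor P P v w))" by (simp add: lin_comp[OF \<phi>])
  have "\<phi> (split p) = \<rho> p (\<lambda>p0 p1. tsum P P (\<omega> p1) (\<lambda>u v. \<phi> (pure_tensor P P (p0 \<star> u) v)))" for p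
    using lin_presentation[OF vs_P vs_P split_closed \<phi>] split_sum[OF b] by simp
  then show "lin P (\<lambda>p. \<phi> (split p))" by (simp add: lin_comp[OF \<phi>])
qed auto

text \<open>The left leg is coinvariant since \<open>S\<close> cancels: \<open>p\<^sub>1 S(p\<^sub>2) = \<epsilon>(p\<^sub>1)\<close>.\<close>

lemma split_left:
  assumes p [simp]: "p \<in> carrier P" and F: "tril P H P F"
  shows "tsum P P (split p) (\<lambda>u v. \<rho> u (\<lambda>a b. F a b v)) = tsum P P (split p) (\<lambda>u v. F u 1\<^sub>H v)"
proof -
  note [simp] = \<omega>D
  note [simp] = tril_comp[OF F]
  have "tsum P P (split p) (\<lambda>u v. \<rho> u (\<lambda>a b. F a b v)) =
      \<rho> p (\<lambda>p0 p1. tsum P P (\<omega> p1) (\<lambda>u v. \<rho> p0 (\<lambda>a b. \<rho> u (\<lambda>c d. F (a \<star> c) (b \<cdot> d) v))))"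
    by (simp add: split_sum coact_mult)
  also have "\<dots> = \<rho> p (\<lambda>p0 p1. \<rho> p0 (\<lambda>a b. tsum P P (\<omega> p1) (\<lambda>u v. \<rho> u (\<lambda>c d. F (a \<star> c) (b \<cdot> d) v))))"
    by (intro tsum_body tsum_swap)
  also have "\<dots> = \<rho> p (\<lambda>p0 p1. \<rho> p0 (\<lambda>a b. \<Delta> p1 (\<lambda>g k. tsum P P (\<omega> k) (\<lambda>u v. F (a \<star> u) (b \<cdot> S g) v))))"
    by (rule tsum_body, rule tsum_body, rule \<omega>_left) auto
  also have "\<dots> = \<rho> p (\<lambda>a r. \<Delta> r (\<lambda>z k. \<Delta> z (\<lambda>b g. tsum P P (\<omega> k) (\<lambda>u v. F (a \<star> u) (b \<cdot> S g) v))))"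
    by (simp add: coact_coassoc comult_coassoc)
  also have "\<dots> = \<rho> p (\<lambda>a r. \<Delta> r (\<lambda>z k. \<epsilon> z * tsum P P (\<omega> k) (\<lambda>u v. F (a \<star> u) 1\<^sub>H v)))"
  proof (intro tsum_body)
    fix a z k assume c: "a \<in> carrier P" "z \<in> carrier H" "k \<in> carrier H"
    show "\<Delta> z (\<lambda>b g. tsum P P (\<omega> k) (\<lambda>u v. F (a \<star> u) (b \<cdot> S g) v)) = \<epsilon> z * tsum P P (\<omega> k) (\<lambda>u v. F (a \<star> u) 1\<^sub>H v)"
      by (subst antipode_sum(2)[where \<alpha> = "\<lambda>r. tsum P P (\<omega> k) (\<lambda>u v. F (a \<star> u) r v)"]) (use c in auto)
  qed
  also have "\<dots> = \<rho> p (\<lambda>a k. tsum P P (\<omega> k) (\<lambda>u v. F (a \<star> u) 1\<^sub>H v))"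
    by (rule tsum_body, rule comult_counit(1)) auto
  finally show ?thesis by (simp add: split_sum)
qed

lemma split_right:
  assumes p [simp]: "p \<in> carrier P" and F: "tril P P H F"
  shows "tsum P P (split p) (\<lambda>u v. \<rho> v (F u)) = \<rho> p (\<lambda>p0 p1. tsum P P (split p0) (\<lambda>u v. F u v p1))"
proof -
  note [simp] = \<omega>D
  note [simp] = tril_comp[OF F]
  have "tsum P P (split p) (\<lambda>u v. \<rho> v (F u)) = \<rho> p (\<lambda>p0 p1. tsum P P (\<omega> p1) (\<lambda>u v. \<rho> v (F (p0 \<star> u))))"
    by (simp add: split_sum)
  also have "\<dots> = \<rho> p (\<lambda>p0 p1. \<Delta> p1 (\<lambda>g k. tsum P P (\<omega> g) (\<lambda>u v. F (p0 \<star> u) v k)))"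
    by (rule tsum_body, rule \<omega>_right) auto
  also have "\<dots> = \<rho> p (\<lambda>p0 p1. tsum P P (split p0) (\<lambda>u v. F u v p1))"
    by (simp add: split_sum coact_coassoc)
  finally show ?thesis .
qed

lemma split_mult:
  assumes p [simp]: "p \<in> carrier P" and \<alpha> [simp]: "lin P \<alpha>"
  shows "tsum P P (split p) (\<lambda>u v. \<alpha> (u \<star> v)) = \<alpha> p"
proof -
  note [simp] = \<omega>D
  note [simp] = lin_comp[OF \<alpha>]
  have "tsum P P (split p) (\<lambda>u v. \<alpha> (u \<star> v)) = \<rho> p (\<lambda>p0 p1. tsum P P (\<omega> p1) (\<lambda>u v. \<alpha> (p0 \<star> (u \<star> v))))"
    by (simp add: split_sum mult_assoc)
  also have "\<dots> = \<rho> p (\<lambda>p0 p1. \<epsilon> p1 * \<alpha> p0)"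
    by (simp add: \<omega>_mult[where \<alpha> = "\<lambda>r. \<alpha> (p0 \<star> r)" for p0])
  finally show ?thesis by (simp add: coact_counit)
qed

lemma split_B_linear:
  assumes "b \<in> B" "p \<in> carrier P" and F: "bil P P F"
  shows "tsum P P (split (b \<star> p)) F = tsum P P (split p) (\<lambda>u v. F (b \<star> u) v)"
proof -
  note [simp] = bil_comp[OF F]
  show ?thesis using assms by (simp add: split_sum coact_mult coinvariants_sum mult_assoc \<omega>D)
qed

context
  fixes E :: "'p \<Rightarrow> 'p"
  assumes E: "E \<in> linear_maps P P" "\<And>p. p \<in> carrier P \<Longrightarrow> E p \<in> B" "\<And>b. b \<in> B \<Longrightarrow> E b = b"
begin

lemmas E_facts = E linear_maps_comp[OF E(1)]

text \<open>\<open>E\<close> is a linear projection of \<open>P\<close> onto \<open>B\<close>. It expresses that the left leg of the splitting lies in \<open>B\<close>.\<close>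

lemma split_E:
  assumes p [simp]: "p \<in> carrier P"
  shows "bil P P F \<Longrightarrow> tsum P P (split p) (\<lambda>u v. F (E u) v) = tsum P P (split p) F"
proof -
  note [simp] = E_facts
  have leg: "tvec P P P (split p) (\<lambda>u v. \<psi> v \<odot>\<^bsub>P\<^esub> u) \<in> B" (is "?x \<in> B") if \<psi> [simp]: "lin P \<psi>" for \<psi>
  proof -
    have x: "\<alpha> ?x = tsum P P (split p) (\<lambda>u v. \<psi> v * \<alpha> u)" if "lin P \<alpha>" for \<alpha>
      using that by (subst lin_tvec[OF vs_P vs_P vs_P _ that]) (simp_all add: lin_apply)
    have "\<rho> ?x (\<lambda>x h. \<alpha> x * \<beta> h) = \<alpha> ?x * \<beta> 1\<^sub>H" if [simp]: "lin P \<alpha>" "lin H \<beta>" for \<alpha> \<beta>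
    proof -
      have "\<rho> ?x (\<lambda>x h. \<alpha> x * \<beta> h) = tsum P P (split p) (\<lambda>u v. \<rho> u (\<lambda>x h. \<psi> v * (\<alpha> x * \<beta> h)))"
        by (subst x) (simp_all add: tsum_cmult)
      also have "\<dots> = tsum P P (split p) (\<lambda>u v. \<psi> v * (\<alpha> u * \<beta> 1\<^sub>H))"
        by (rule split_left) simp_all
      also have "\<dots> = \<alpha> ?x * \<beta> 1\<^sub>H"
        by (simp add: x tsum_multc[symmetric] mult.assoc)
      finally show ?thesis .
    qed
    then show ?thesis by (simp add: coinvariants_iff)
  qed
  show "bil P P F \<Longrightarrow> tsum P P (split p) (\<lambda>u v. F (E u) v) = tsum P P (split p) F"
    by (rule left_leg_projection(2)[OF vs_P vs_P split_closed leg E(1) E(3)])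
qed

lemma lcan_onto_strong: "carrier (P \<otimes>\<^sub>\<complex> H) \<subseteq> lcan ` carrier (P \<otimes>\<^sub>\<complex> P)"
proof (rule linear_onto_tensor[OF vs_P vs_H _ lcan_linear])
  note [simp] = \<omega>D
  fix p h assume [simp]: "p \<in> carrier P" "h \<in> carrier H"
  define t where "t = tvec P P (P \<otimes>\<^sub>\<complex> P) (\<omega> h) (\<lambda>u v. pure_tensor P P (p \<star> u) v)"
  have t [simp]: "t \<in> carrier (P \<otimes>\<^sub>\<complex> P)" by (simp add: t_def)
  have "lcan t = pure_tensor P H p h"
  proof (rule tensor_eqI[of P H])
    fix \<alpha> \<beta> assume l [simp]: "lin P \<alpha>" "lin H \<beta>"
    note [simp] = lin_comp[OF l(1)] lin_comp[OF l(2)]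
    have "tsum P H (lcan t) (\<lambda>v w. \<alpha> v * \<beta> w) = tsum P P (\<omega> h) (\<lambda>u v. \<rho> v (\<lambda>a b. \<alpha> (p \<star> (u \<star> a)) * \<beta> b))"
      by (simp add: lcan_sum) (simp add: t_def tsum_tvec tsum_pure mult_assoc)
    also have "\<dots> = \<Delta> h (\<lambda>g k. tsum P P (\<omega> g) (\<lambda>u v. \<alpha> (p \<star> (u \<star> v)) * \<beta> k))"
      by (rule \<omega>_right) simp_all
    also have "\<dots> = \<Delta> h (\<lambda>g k. \<epsilon> g * (\<alpha> p * \<beta> k))"
      by (simp add: tsum_multc \<omega>_mult[where \<alpha> = "\<lambda>r. \<alpha> (p \<star> r)"] mult.assoc)
    also have "\<dots> = \<alpha> p * \<beta> h"
      by (rule comult_counit(1)) simp_all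
    finally show "tsum P H (lcan t) (\<lambda>v w. \<alpha> v * \<beta> w) = tsum P H (pure_tensor P H p h) (\<lambda>v w. \<alpha> v * \<beta> w)"
      by (simp add: tsum_pure)
  qed (use linear_maps_apply(1)[OF lcan_linear] in auto)
  then show "pure_tensor P H p h \<in> lcan ` carrier (P \<otimes>\<^sub>\<complex> P)" using t by (metis image_eqI)
qed simp

text \<open>The map \<open>\<Lambda>(p \<otimes> h) = p \<omega>(h)\<close> is a left inverse of the canonical map modulo \<open>B\<close>: for \<open>y\<^sub>0 \<omega>(y\<^sub>1) = u \<otimes> v\<close> the leg
  \<open>u\<close> lies in \<open>B\<close>, so \<open>\<Lambda>(can(x \<otimes> y)) = x u \<otimes> v\<close> equals \<open>x \<otimes> u v = x \<otimes> y\<close> in \<open>P \<otimes>\<^sub>B P\<close>.\<close>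

lemma canonical_map_injective:
  assumes t: "t \<in> carrier (P \<otimes>\<^sub>\<complex> P)" and zero: "lcan t = \<zero>\<^bsub>P \<otimes>\<^sub>\<complex> H\<^esub>"
  shows "nat_PB t = \<one>\<^bsub>PB\<^esub>"
proof -
  note [simp] = \<omega>D E_facts
  interpret T: comm_group "tensor_group UNIV P P"
    by (rule balanced_tensor.tensor_comm_group[OF balanced_tensor_vs[OF vs_P vs_P]])
  interpret Q: comm_group PB by (rule PB_comm_group)
  interpret n: group_hom "tensor_group UNIV P P" PB nat_PB
    using nat_PB_hom by (simp add: group_hom_def group_hom_axioms_def T.is_group Q.is_group)
  \<comment> \<open>The candidate \<open>p \<otimes> h \<mapsto> p \<omega>(h)\<close> for the inverse of the canonical map.\<close>
  let ?h = "\<lambda>p h. tensor_map P P P P (\<lambda>u. p \<star> u) id (\<omega> h)"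
  define \<Lambda> where "\<Lambda> = bilinear_lift P H (P \<otimes>\<^sub>\<complex> P) ?h"
  have h1: "?h p \<in> linear_maps H (P \<otimes>\<^sub>\<complex> P)" if "p \<in> carrier P" for p
    by (rule linear_maps_comp[OF tensor_map_linear]) (use that in auto)
  have h2: "(\<lambda>p. ?h p h) \<in> linear_maps P (P \<otimes>\<^sub>\<complex> P)" if "h \<in> carrier H" for h
    unfolding tensor_map_def by (rule bilinear_lift_linear_left) (use that in auto)
  have \<Lambda>: "\<Lambda> \<in> linear_maps (P \<otimes>\<^sub>\<complex> H) (P \<otimes>\<^sub>\<complex> P)"
    unfolding \<Lambda>_def by (rule bilinear_lift_props(1)) (use h1 h2 in auto)
  have \<Lambda>sum: "tsum P P (\<Lambda> z) F = tsum P H z (\<lambda>p h. tsum P P (\<omega> h) (\<lambda>u v. F (p \<star> u) v))"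
    if "z \<in> carrier (P \<otimes>\<^sub>\<complex> H)" and F: "bil P P F" for z F
    unfolding \<Lambda>_def by (subst tsum_bilinear_lift) (use that h1 h2 in \<open>simp_all add: tsum_tensor_map\<close>)
  define mE where "mE = bilinear_lift P P P (\<lambda>u v. E u \<star> v)"
  have mE: "mE \<in> linear_maps (P \<otimes>\<^sub>\<complex> P) P" "\<And>u v. u \<in> carrier P \<Longrightarrow> v \<in> carrier P \<Longrightarrow> mE (pure_tensor P P u v) = E u \<star> v"
    unfolding mE_def by (rule bilinear_lift_props; simp)+
  have mEs: "mE (split y) = y" if y [simp]: "y \<in> carrier P" for y
  proof (rule vs_eqI[OF vs_P])
    fix \<phi> assume \<phi>: "lin P \<phi>"
    note [simp] = lin_comp[OF \<phi>] \<phi>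
    have "\<phi> (mE (split y)) = tsum P P (split y) (\<lambda>u v. \<phi> (E u \<star> v))"
      unfolding mE_def by (rule lin_bilinear_lift) simp_all
    also have "\<dots> = tsum P P (split y) (\<lambda>u v. \<phi> (u \<star> v))"
      by (rule split_E[where F = "\<lambda>u v. \<phi> (u \<star> v)"]) simp_all
    also have "\<dots> = \<phi> y" by (rule split_mult) simp_all
    finally show "\<phi> (mE (split y)) = \<phi> y" .
  qed (use linear_maps_apply(1)[OF mE(1)] in auto)
  have pureL: "nat_PB (\<Lambda> (can_elem x y)) = elemB x y" if [simp]: "x \<in> carrier P" "y \<in> carrier P" for x y
  proof -
    let ?m = "tensor_map P P P P (\<lambda>u. x \<star> E u) id"
    have m: "?m \<in> linear_maps (P \<otimes>\<^sub>\<complex> P) (P \<otimes>\<^sub>\<complex> P)" by (rule tensor_map_linear) auto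
    have "\<Lambda> (can_elem x y) = ?m (split y)"
    proof (rule tensor_eqI[of P P])
      fix \<alpha> \<beta> assume l [simp]: "lin P \<alpha>" "lin P \<beta>"
      note [simp] = lin_comp[OF l(1)] lin_comp[OF l(2)]
      have "tsum P P (\<Lambda> (can_elem x y)) (\<lambda>u v. \<alpha> u * \<beta> v) = tsum P P (split y) (\<lambda>u v. \<alpha> (x \<star> u) * \<beta> v)"
        by (simp add: \<Lambda>sum can_elem_sum split_sum mult_assoc)
      also have "\<dots> = tsum P P (split y) (\<lambda>u v. \<alpha> (x \<star> E u) * \<beta> v)"
        by (rule split_E[where F = "\<lambda>u v. \<alpha> (x \<star> u) * \<beta> v", symmetric]) simp_all
      finally show "tsum P P (\<Lambda> (can_elem x y)) (\<lambda>u v. \<alpha> u * \<beta> v) = tsum P P (?m (split y)) (\<lambda>u v. \<alpha> u * \<beta> v)"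
        by (simp add: tsum_tensor_map)
    qed (use linear_maps_apply(1)[OF \<Lambda>] in auto)
    also have "nat_PB (?m (split y)) = elemB x (mE (split y))"
    proof (rule tensor_hom_eq[OF vs_P vs_P _ _ Q.is_group _ split_closed])
      show "(\<lambda>t. nat_PB (?m t)) \<in> hom (tensor_group UNIV P P) PB"
        using m hom_mult[OF nat_PB_hom] hom_in_carrier[OF nat_PB_hom] by (auto simp: linear_maps_iff hom_def tensor_simps)
      show "(\<lambda>t. elemB x (mE t)) \<in> hom (tensor_group UNIV P P) PB"
        using mE(1) balanced_tensor.te_add_right[OF balanced_PB] balanced_tensor.te_closed[OF balanced_PB]
        by (auto simp: linear_maps_iff hom_def tensor_simps)
      fix v w assume [simp]: "v \<in> carrier P" "w \<in> carrier P"
      show "nat_PB (?m (pure_tensor P P v w)) = elemB x (mE (pure_tensor P P v w))"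
        by (simp add: tensor_map_pure nat_PB_pure mE(2) elemB_balanced)
    qed
    finally show ?thesis by (simp add: mEs)
  qed
  have "nat_PB (\<Lambda> (lcan t)) = nat_PB t"
  proof (rule tensor_hom_eq[OF vs_P vs_P _ nat_PB_hom Q.is_group _ t])
    have "(\<lambda>t. \<Lambda> (lcan t)) \<in> linear_maps (P \<otimes>\<^sub>\<complex> P) (P \<otimes>\<^sub>\<complex> P)"
      by (rule linear_maps_comp[OF \<Lambda> lcan_linear])
    then show "(\<lambda>t. nat_PB (\<Lambda> (lcan t))) \<in> hom (tensor_group UNIV P P) PB"
      using hom_mult[OF nat_PB_hom] hom_in_carrier[OF nat_PB_hom] by (auto simp: linear_maps_iff hom_def tensor_simps)
    show "nat_PB (\<Lambda> (lcan (pure_tensor P P v w))) = nat_PB (pure_tensor P P v w)"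
      if "v \<in> carrier P" "w \<in> carrier P" for v w
      using that by (simp add: lcan_pure pureL nat_PB_pure)
  qed
  moreover have "\<Lambda> (lcan t) = \<one>\<^bsub>tensor_group UNIV P P\<^esub>"
    using zero linear_maps_zero[OF \<Lambda>] by (simp add: tensor_simps(3))
  ultimately show ?thesis using n.hom_one by simp
qed

lemma canonical_map_bijective: "bij_betw (canonical_map H P) (carrier PB) (carrier (P \<otimes>\<^sub>\<complex> H))"
proof -
  interpret c: group_hom PB "add_monoid (P \<otimes>\<^sub>\<complex> H)" "canonical_map H P"
    using canonical_map_hom PB_comm_group comm_group_add_monoid[OF vs_abelian[of "P \<otimes>\<^sub>\<complex> H"]]
    by (simp add: group_hom_def group_hom_axioms_def comm_group_def)
  have "inj_on (canonical_map H P) (carrier PB)"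
    unfolding c.inj_on_one_iff
  proof (intro allI impI)
    fix x assume x: "x \<in> carrier PB" and z: "canonical_map H P x = \<one>\<^bsub>add_monoid (P \<otimes>\<^sub>\<complex> H)\<^esub>"
    obtain t where t: "t \<in> carrier (P \<otimes>\<^sub>\<complex> P)" "x = nat_PB t" using nat_PB_surj[OF x] by blast
    then show "x = \<one>\<^bsub>PB\<^esub>"
      using canonical_map_injective[OF t(1)] canonical_nat[OF t(1)] z by simp
  qed
  moreover have "canonical_map H P ` carrier PB = carrier (P \<otimes>\<^sub>\<complex> H)"
  proof
    show "canonical_map H P ` carrier PB \<subseteq> carrier (P \<otimes>\<^sub>\<complex> H)" using c.hom_closed by auto
    show "carrier (P \<otimes>\<^sub>\<complex> H) \<subseteq> canonical_map H P ` carrier PB"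
    proof
      fix z assume "z \<in> carrier (P \<otimes>\<^sub>\<complex> H)"
      then obtain t where t: "t \<in> carrier (P \<otimes>\<^sub>\<complex> P)" "z = lcan t" using lcan_onto_strong by blast
      have "nat_PB t \<in> carrier PB"
        using hom_in_carrier[OF nat_PB_hom] t(1) by (simp add: tensor_simps)
      then show "z \<in> canonical_map H P ` carrier PB"
        using canonical_nat[OF t(1)] t(2) by (intro image_eqI[of _ _ "nat_PB t"]) simp_all
    qed
  qed
  ultimately show ?thesis by (simp add: bij_betw_def)
qed

end

theorem strong_connection_principal: "principal_comodule_algebra H P"
proof -
  obtain E where E: "E \<in> linear_maps P P" "\<And>p. p \<in> carrier P \<Longrightarrow> E p \<in> B" "\<And>b. b \<in> B \<Longrightarrow> E b = b"
    using subspace_projection[OF vs_P coinvariants_subspace] by blast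
  have EB: "E \<in> linear_maps P Bm"
    by (rule linear_mapsI) (simp_all add: E(2) linear_maps_apply(2,3)[OF E(1)])
  note [simp] = E linear_maps_comp[OF E(1)]
  note [simp] = EB linear_maps_comp[OF EB]
  define s where "s p = tensor_map P P Bm P E id (split p)" for p
  have s: "s \<in> linear_maps P (Bm \<otimes>\<^sub>\<complex> P)"
    unfolding s_def by (rule linear_maps_comp[OF tensor_map_linear split_linear]) simp_all
  have ssum: "tsum Bm P (s p) F = tsum P P (split p) (\<lambda>u v. F (E u) v)" if "bil Bm P F" for p F
    unfolding s_def using that by (subst tsum_tensor_map) simp_all
  note sE = split_E[OF E]
  note sc [simp] = linear_maps_apply(1)[OF s]
  have a1: "s (b \<star> p) = tensor_map Bm P Bm P (\<lambda>a. b \<star> a) id (s p)" if b: "b \<in> B" and p [simp]: "p \<in> carrier P" for b p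
  proof (rule tensor_eqI[of Bm P])
    have bl: "(\<lambda>a. b \<star> a) \<in> linear_maps Bm Bm"
      using linear_mult(4)[OF linear_maps_id(1), of b] b by (auto simp: linear_maps_iff)
    note [simp] = coinvariants_carrier[OF b] bl
    show "s (b \<star> p) \<in> carrier (Bm \<otimes>\<^sub>\<complex> P)" "tensor_map Bm P Bm P (\<lambda>a. b \<star> a) id (s p) \<in> carrier (Bm \<otimes>\<^sub>\<complex> P)" by simp_all
    fix \<alpha> \<beta> assume l [simp]: "lin Bm \<alpha>" "lin P \<beta>"
    note [simp] = lin_comp[OF l(1)] lin_comp[OF l(2)]
    have "tsum Bm P (s (b \<star> p)) (\<lambda>v w. \<alpha> v * \<beta> w) = tsum P P (split p) (\<lambda>u v. \<alpha> (E (b \<star> u)) * \<beta> v)"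
      by (simp add: ssum split_B_linear[OF b])
    also have "\<dots> = tsum P P (split p) (\<lambda>u v. \<alpha> (E (b \<star> E u)) * \<beta> v)"
      by (rule sE[where F = "\<lambda>u v. \<alpha> (E (b \<star> u)) * \<beta> v", symmetric]) simp_all
    also have "\<dots> = tsum P P (split p) (\<lambda>u v. \<alpha> (b \<star> E u) * \<beta> v)"
      using b by simp
    finally show "tsum Bm P (s (b \<star> p)) (\<lambda>v w. \<alpha> v * \<beta> w) =
        tsum Bm P (tensor_map Bm P Bm P (\<lambda>a. b \<star> a) id (s p)) (\<lambda>v w. \<alpha> v * \<beta> w)"
      using lin_comp[OF l(1) bl] by (simp add: tsum_tensor_map ssum)
  qed simp_all
  have a2: "tensor_assoc Bm P H (tensor_map P H (Bm \<otimes>\<^sub>\<complex> P) H s id (rcoact P p))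
      = tensor_map Bm P Bm (P \<otimes>\<^sub>\<complex> H) id (rcoact P) (s p)" if p [simp]: "p \<in> carrier P" for p
  proof (rule coassocI)
    fix \<alpha> \<beta> \<gamma> assume l [simp]: "lin Bm \<alpha>" "lin P \<beta>" "lin H \<gamma>"
    note [simp] = lin_comp[OF l(1)] lin_comp[OF l(2)] lin_comp[OF l(3)]
    show "\<rho> p (\<lambda>x a. tsum Bm P (s x) (\<lambda>m c. \<alpha> m * (\<beta> c * \<gamma> a))) =
         tsum Bm P (s p) (\<lambda>m y. \<rho> y (\<lambda>c a. \<alpha> m * (\<beta> c * \<gamma> a)))"
      by (simp add: ssum split_right[of p "\<lambda>u v w. \<alpha> (E u) * (\<beta> v * \<gamma> w)"])
  qed (use s in simp_all)
  have a3: "bilinear_lift Bm P P (\<lambda>b q. b \<star> q) (s p) = p" if p [simp]: "p \<in> carrier P" for p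
  proof (rule vs_eqI[OF vs_P])
    have ml: "(\<lambda>b. b \<star> q) \<in> linear_maps Bm P" if "q \<in> carrier P" for q
      using linear_mult(3)[OF linear_maps_id(1) that] by simp
    have mr: "(\<lambda>q. b \<star> q) \<in> linear_maps P P" if "b \<in> B" for b using that by simp
    show "bilinear_lift Bm P P (\<lambda>b q. b \<star> q) (s p) \<in> carrier P"
      by (rule linear_maps_apply(1)[OF bilinear_lift_props(1)]) (simp_all add: ml mr)
    fix \<phi> assume \<phi>: "lin P \<phi>"
    note [simp] = \<phi> lin_comp[OF \<phi>]
    have "\<phi> (bilinear_lift Bm P P (\<lambda>b q. b \<star> q) (s p)) = tsum Bm P (s p) (\<lambda>b q. \<phi> (b \<star> q))"
      by (rule lin_bilinear_lift) (simp_all add: ml mr)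
    also have "\<dots> = tsum P P (split p) (\<lambda>u v. \<phi> (E u \<star> v))"
      by (rule ssum, rule bilI) (simp_all add: ml mr)
    also have "\<dots> = \<phi> p"
      by (simp add: sE[where F = "\<lambda>u v. \<phi> (u \<star> v)"] split_mult)
    finally show "\<phi> (bilinear_lift Bm P P (\<lambda>b q. b \<star> q) (s p)) = \<phi> p" .
  qed simp
  have carrier: "carrier Bm = B" by simp
  show ?thesis
    unfolding principal_comodule_algebra_def Let_def carrier
    by (intro conjI bexI[OF _ s] ballI canonical_map_bijective[OF E] a1 a2 a3)
qed

end

subsection \<open>A principal comodule algebra has a strong connection\<close>

text \<open>If the canonical map is onto, identities on \<open>P \<otimes> H\<close> need only be checked at \<open>x y\<^sub>0 \<otimes> y\<^sub>1\<close>.\<close>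

lemma can_elem_functional_eq:
  assumes onto: "carrier (P \<otimes>\<^sub>\<complex> H) \<subseteq> lcan ` carrier (P \<otimes>\<^sub>\<complex> P)"
    and \<Phi>: "lin (P \<otimes>\<^sub>\<complex> H) \<Phi>" and \<Psi>: "lin (P \<otimes>\<^sub>\<complex> H) \<Psi>"
    and eq: "\<And>x y. x \<in> carrier P \<Longrightarrow> y \<in> carrier P \<Longrightarrow> \<Phi> (can_elem x y) = \<Psi> (can_elem x y)"
    and z: "z \<in> carrier (P \<otimes>\<^sub>\<complex> H)"
  shows "\<Phi> z = \<Psi> z"
proof -
  obtain t where t: "t \<in> carrier (P \<otimes>\<^sub>\<complex> P)" "z = lcan t" using onto z by blast
  have "\<Phi> (lcan t) = tsum P P t (\<lambda>x y. \<Phi> (can_elem x y))" "\<Psi> (lcan t) = tsum P P t (\<lambda>x y. \<Psi> (can_elem x y))"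
    using lin_presentation[OF vs_P vs_P t(1) lin_comp[OF \<Phi> lcan_linear]]
      lin_presentation[OF vs_P vs_P t(1) lin_comp[OF \<Psi> lcan_linear]] by (simp_all add: lcan_pure)
  then show ?thesis using t(2) eq by simp
qed

text \<open>The map \<open>\<Lambda>(can(x \<otimes> y)) = x s(y)\<close>, with \<open>s\<close> the given splitting, is well defined on \<open>P \<otimes> H\<close> since the
  canonical map is injective on \<open>P \<otimes>\<^sub>B P\<close> and \<open>s\<close> is \<open>B\<close>-linear. The strong connection is \<open>h \<mapsto> \<Lambda>(1 \<otimes> h)\<close>. Each of
  its properties is the case \<open>p = 1\<close> of an identity for \<open>\<Lambda>(p \<otimes> h)\<close>, which is checked on the image of the
  canonical map.\<close>

theorem principal_strong_connection:
  assumes "principal_comodule_algebra H P"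
  shows "\<exists>\<omega>. strong_connection \<omega>"
proof -
  have can: "bij_betw (canonical_map H P) (carrier PB) (carrier (P \<otimes>\<^sub>\<complex> H))"
    using assms by (simp add: principal_comodule_algebra_def)
  obtain s where s: "s \<in> linear_maps P (Bm \<otimes>\<^sub>\<complex> P)"
    and sB: "\<And>b p. b \<in> B \<Longrightarrow> p \<in> carrier P \<Longrightarrow> s (b \<star> p) = tensor_map Bm P Bm P (\<lambda>a. b \<star> a) id (s p)"
    and sH: "\<And>p. p \<in> carrier P \<Longrightarrow> tensor_assoc Bm P H (tensor_map P H (Bm \<otimes>\<^sub>\<complex> P) H s id (rcoact P p))
            = tensor_map Bm P Bm (P \<otimes>\<^sub>\<complex> H) id (rcoact P) (s p)"
    and sm: "\<And>p. p \<in> carrier P \<Longrightarrow> bilinear_lift Bm P P (\<lambda>b q. b \<star> q) (s p) = p"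
    using assms unfolding principal_comodule_algebra_def Let_def by auto
  note sc [simp] = linear_maps_apply(1)[OF s]
  define s' where "s' p = tensor_map Bm P P P id id (s p)" for p
  have s' [simp]: "s' \<in> linear_maps P (P \<otimes>\<^sub>\<complex> P)"
    unfolding s'_def by (rule linear_maps_comp[OF tensor_map_linear s]) simp_all
  note [simp] = linear_maps_comp[OF s'] linear_maps_apply(1)[OF s']
  have s'sum: "tsum P P (s' p) F = tsum Bm P (s p) F" if "bil P P F" "p \<in> carrier P" for p F
    unfolding s'_def using that by (subst tsum_tensor_map) simp_all
  have s'_B: "tsum P P (s' (b \<star> p)) F = tsum P P (s' p) (\<lambda>u v. F (b \<star> u) v)"
    if b: "b \<in> B" and [simp]: "p \<in> carrier P" and F: "bil P P F" for b p F
  proof -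
    have bl: "(\<lambda>a. b \<star> a) \<in> linear_maps Bm Bm"
      using linear_mult(4)[OF linear_maps_id(1), of b] b by (auto simp: linear_maps_iff)
    have "bil Bm P F" using F by (auto simp: bil_def)
    note [simp] = bil_comp[OF F] coinvariants_carrier[OF b] this
    show ?thesis
      using F b by (simp add: s'sum sB[OF b] tsum_tensor_map bl)
  qed
  have s'_left: "tsum P P (s' p) (\<lambda>u v. \<rho> u (\<lambda>a b. F a b v)) = tsum P P (s' p) (\<lambda>u v. F u 1\<^sub>H v)"
    if [simp]: "p \<in> carrier P" and F: "tril P H P F" for p F
  proof -
    note [simp] = tril_comp[OF F]
    have "tsum Bm P (s p) (\<lambda>u v. \<rho> u (\<lambda>a b. F a b v)) = tsum Bm P (s p) (\<lambda>u v. F u 1\<^sub>H v)"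
      by (rule tsum_body, rule coinvariants_sum) simp_all
    then show ?thesis by (simp add: s'sum)
  qed
  have s'_right: "tsum P P (s' p) (\<lambda>u v. \<rho> v (F u)) = \<rho> p (\<lambda>p0 p1. tsum P P (s' p0) (\<lambda>u v. F u v p1))"
    if [simp]: "p \<in> carrier P" and F: "tril P P H F" for p F
  proof -
    note [simp] = tril_comp[OF F]
    have FB: "tril Bm P H F" using F by (auto simp: tril_def)
    have "\<rho> p (\<lambda>p0 p1. tsum Bm P (s p0) (\<lambda>u v. F u v p1)) = tsum Bm P (s p) (\<lambda>u v. \<rho> v (F u))"
      by (rule coassocD[OF _ _ _ _ _ _ _ _ _ sH]) (use s FB in simp_all)
    then show ?thesis by (simp add: s'sum)
  qed
  have s'_mult: "tsum P P (s' p) (\<lambda>u v. \<alpha> (u \<star> v)) = \<alpha> p" if [simp]: "p \<in> carrier P" and \<alpha>: "lin P \<alpha>" for p \<alpha>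
  proof -
    note [simp] = \<alpha> lin_comp[OF \<alpha>]
    have ml: "(\<lambda>b. b \<star> q) \<in> linear_maps Bm P" if "q \<in> carrier P" for q
      using linear_mult(3)[OF linear_maps_id(1) that] by simp
    have "\<alpha> (bilinear_lift Bm P P (\<lambda>b q. b \<star> q) (s p)) = tsum Bm P (s p) (\<lambda>b q. \<alpha> (b \<star> q))"
      by (rule lin_bilinear_lift) (simp_all add: ml)
    then show ?thesis by (simp add: s'sum sm)
  qed
  \<comment> \<open>The map \<open>x \<otimes> y \<mapsto> x s(y)\<close> is balanced over \<open>B\<close>, hence factors through the canonical map.\<close>
  let ?h = "\<lambda>x y. tensor_map P P P P (\<lambda>u. x \<star> u) id (s' y)"
  have h1: "?h x \<in> linear_maps P (P \<otimes>\<^sub>\<complex> P)" if "x \<in> carrier P" for x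
    by (rule linear_maps_comp[OF tensor_map_linear]) (use that in auto)
  have h2: "(\<lambda>x. ?h x y) \<in> linear_maps P (P \<otimes>\<^sub>\<complex> P)" if "y \<in> carrier P" for y
    unfolding tensor_map_def by (rule bilinear_lift_linear_left) (use that in auto)
  have hsum: "tsum P P (?h x y) F = tsum P P (s' y) (\<lambda>u v. F (x \<star> u) v)"
    if "x \<in> carrier P" "y \<in> carrier P" "bil P P F" for x y F
    using that by (subst tsum_tensor_map) simp_all
  have hB: "?h (x \<star> b) y = ?h x (b \<star> y)" if "b \<in> B" and [simp]: "x \<in> carrier P" "y \<in> carrier P" for b x y
  proof (rule tensor_eqI[of P P])
    note [simp] = coinvariants_carrier[OF that(1)]
    fix \<alpha> \<beta> assume l [simp]: "lin P \<alpha>" "lin P \<beta>"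
    note [simp] = lin_comp[OF l(1)] lin_comp[OF l(2)]
    show "tsum P P (?h (x \<star> b) y) (\<lambda>v w. \<alpha> v * \<beta> w) = tsum P P (?h x (b \<star> y)) (\<lambda>v w. \<alpha> v * \<beta> w)"
      by (simp add: tsum_tensor_map s'_B[OF that(1)] mult_assoc)
  qed (use that in auto)
  define L where "L = bilinear_lift P P (P \<otimes>\<^sub>\<complex> P) ?h"
  have L: "L \<in> linear_maps (P \<otimes>\<^sub>\<complex> P) (P \<otimes>\<^sub>\<complex> P)"
    and Lpure: "\<And>x y. x \<in> carrier P \<Longrightarrow> y \<in> carrier P \<Longrightarrow> L (pure_tensor P P x y) = ?h x y"
    unfolding L_def using h1 h2 by (intro bilinear_lift_props; simp)+
  note G = comm_group_add_monoid[OF vs_abelian[of "P \<otimes>\<^sub>\<complex> P"]]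
  define L' where "L' = tensor_lift B (right_regular P) (left_regular P) (add_monoid (P \<otimes>\<^sub>\<complex> P)) ?h"
  have L': "L' \<in> hom PB (add_monoid (P \<otimes>\<^sub>\<complex> P))"
    and L'elem: "\<And>x y. x \<in> carrier P \<Longrightarrow> y \<in> carrier P \<Longrightarrow> L' (elemB x y) = ?h x y"
    unfolding L'_def
    using linear_maps_apply[OF h1] linear_maps_apply[OF h2] hB
    by (intro balanced_tensor.tensor_lift[OF balanced_PB G]; simp)+
  have LL': "L' (nat_PB t) = L t" if t: "t \<in> carrier (P \<otimes>\<^sub>\<complex> P)" for t
  proof (rule tensor_hom_eq[OF vs_P vs_P _ _ _ _ t])
    show "(\<lambda>t. L' (nat_PB t)) \<in> hom (tensor_group UNIV P P) (add_monoid (P \<otimes>\<^sub>\<complex> P))"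
      using hom_compose[OF nat_PB_hom L'] by (simp add: comp_def)
    show "group (add_monoid (P \<otimes>\<^sub>\<complex> P))" using G by (simp add: comm_group_def)
  qed (simp_all add: linear_map_hom[OF L] nat_PB_pure L'elem Lpure)
  have nat_closed: "nat_PB t \<in> carrier PB" if "t \<in> carrier (P \<otimes>\<^sub>\<complex> P)" for t
    using hom_in_carrier[OF nat_PB_hom] that by (simp add: tensor_simps)
  have Lker: "L t = L t'" if "t \<in> carrier (P \<otimes>\<^sub>\<complex> P)" "t' \<in> carrier (P \<otimes>\<^sub>\<complex> P)" "lcan t = lcan t'" for t t'
  proof -
    have "nat_PB t = nat_PB t'"
      using can nat_closed[OF that(1)] nat_closed[OF that(2)] canonical_nat[OF that(1)] canonical_nat[OF that(2)] that(3)
      by (metis bij_betw_def inj_onD)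
    then show ?thesis using LL'[OF that(1)] LL'[OF that(2)] by simp
  qed
  have onto: "carrier (P \<otimes>\<^sub>\<complex> H) \<subseteq> lcan ` carrier (P \<otimes>\<^sub>\<complex> P)"
  proof
    fix z assume "z \<in> carrier (P \<otimes>\<^sub>\<complex> H)"
    then have "z \<in> canonical_map H P ` carrier PB" using can by (simp add: bij_betw_def)
    then obtain x where x: "x \<in> carrier PB" "canonical_map H P x = z" by (rule imageE) (rule that, simp_all)
    obtain t where "t \<in> carrier (P \<otimes>\<^sub>\<complex> P)" "x = nat_PB t" using nat_PB_surj[OF x(1)] by blast
    then show "z \<in> lcan ` carrier (P \<otimes>\<^sub>\<complex> P)" using canonical_nat x(2) by blast
  qed
  obtain \<sigma> where \<sigma>: "\<sigma> \<in> linear_maps (P \<otimes>\<^sub>\<complex> H) (P \<otimes>\<^sub>\<complex> P)" "\<And>w. w \<in> carrier (P \<otimes>\<^sub>\<complex> H) \<Longrightarrow> lcan (\<sigma> w) = id w"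
  proof (rule linear_lift[OF _ _ _ lcan_linear linear_maps_id(2)[of "P \<otimes>\<^sub>\<complex> H"]])
    show "id w \<in> lcan ` carrier (P \<otimes>\<^sub>\<complex> P)" if "w \<in> carrier (P \<otimes>\<^sub>\<complex> H)" for w
      using that onto by auto
  qed (simp_all add: that)
  define \<Lambda> where "\<Lambda> z = L (\<sigma> z)" for z
  have \<Lambda> [simp]: "\<Lambda> \<in> linear_maps (P \<otimes>\<^sub>\<complex> H) (P \<otimes>\<^sub>\<complex> P)"
    unfolding \<Lambda>_def by (rule linear_maps_comp[OF L \<sigma>(1)])
  note [simp] = linear_maps_apply(1)[OF \<Lambda>] linear_maps_comp[OF \<Lambda>]
  have \<Lambda>can: "\<Lambda> (can_elem x y) = ?h x y" if [simp]: "x \<in> carrier P" "y \<in> carrier P" for x y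
    unfolding \<Lambda>_def Lpure[OF that, symmetric]
    by (rule Lker) (simp_all add: linear_maps_apply(1)[OF \<sigma>(1)] \<sigma>(2) lcan_pure)
  have \<Lambda>sum: "tsum P P (\<Lambda> (can_elem x y)) F = tsum P P (s' y) (\<lambda>u v. F (x \<star> u) v)"
    if "x \<in> carrier P" "y \<in> carrier P" "bil P P F" for x y F
    using hsum[OF that] \<Lambda>can[OF that(1,2)] by simp
  have \<Lambda>\<rho>: "\<rho> y (\<lambda>a b. tsum P P (\<Lambda> (pure_tensor P H (x \<star> a) b)) F) = tsum P P (s' y) (\<lambda>u v. F (x \<star> u) v)"
    if [simp]: "x \<in> carrier P" "y \<in> carrier P" "bil P P F" for x y F
  proof -
    have "tsum P P (\<Lambda> (can_elem x y)) F = tsum P H (can_elem x y) (\<lambda>a b. tsum P P (\<Lambda> (pure_tensor P H a b)) F)"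
      by (rule lin_presentation) simp_all
    also have "\<dots> = \<rho> y (\<lambda>a b. tsum P P (\<Lambda> (pure_tensor P H (x \<star> a) b)) F)"
      by (rule can_elem_sum) simp_all
    finally show ?thesis using \<Lambda>sum[OF that] by simp
  qed
  have left: "tsum P P (\<Lambda> z) (\<lambda>u v. \<rho> u (\<lambda>a b. F a b v)) =
      tsum P H z (\<lambda>p h. \<rho> p (\<lambda>p0 p1. \<Delta> h (\<lambda>g k. tsum P P (\<Lambda> (pure_tensor P H p0 k)) (\<lambda>u v. F u (p1 \<cdot> S g) v))))"
    if z: "z \<in> carrier (P \<otimes>\<^sub>\<complex> H)" and F: "tril P H P F" for z F
  proof (rule can_elem_functional_eq[OF onto _ _ _ z])
    note [simp] = tril_comp[OF F]
    fix x y assume [simp]: "x \<in> carrier P" "y \<in> carrier P"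
    have "tsum P P (\<Lambda> (can_elem x y)) (\<lambda>u v. \<rho> u (\<lambda>a b. F a b v)) =
        tsum P P (s' y) (\<lambda>u v. \<rho> x (\<lambda>x0 x1. \<rho> u (\<lambda>c d. F (x0 \<star> c) (x1 \<cdot> d) v)))"
      by (simp add: \<Lambda>sum coact_mult)
    also have "\<dots> = \<rho> x (\<lambda>x0 x1. tsum P P (s' y) (\<lambda>u v. \<rho> u (\<lambda>c d. F (x0 \<star> c) (x1 \<cdot> d) v)))"
      by (rule tsum_swap)
    also have "\<dots> = \<rho> x (\<lambda>x0 x1. tsum P P (s' y) (\<lambda>u v. F (x0 \<star> u) x1 v))"
      by (simp add: s'_left[of y "\<lambda>c d v. F (x0 \<star> c) (x1 \<cdot> d) v" for x0 x1])
    finally have 1: "tsum P P (\<Lambda> (can_elem x y)) (\<lambda>u v. \<rho> u (\<lambda>a b. F a b v)) =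
        \<rho> x (\<lambda>x0 x1. tsum P P (s' y) (\<lambda>u v. F (x0 \<star> u) x1 v))" .
    let ?K = "\<lambda>a k r. tsum P P (\<Lambda> (pure_tensor P H a k)) (\<lambda>u v. F u r v)"
    have "tsum P H (can_elem x y) (\<lambda>p h. \<rho> p (\<lambda>p0 p1. \<Delta> h (\<lambda>g k. ?K p0 k (p1 \<cdot> S g)))) =
        \<rho> y (\<lambda>y0 y1. \<rho> x (\<lambda>x0 x1. \<rho> y0 (\<lambda>c d. \<Delta> y1 (\<lambda>g k. ?K (x0 \<star> c) k (x1 \<cdot> (d \<cdot> S g))))))"
      by (simp add: can_elem_sum coact_mult mult_assoc)
    also have "\<dots> = \<rho> x (\<lambda>x0 x1. \<rho> y (\<lambda>y0 y1. \<rho> y0 (\<lambda>c d. \<Delta> y1 (\<lambda>g k. ?K (x0 \<star> c) k (x1 \<cdot> (d \<cdot> S g))))))"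
      by (rule tsum_swap)
    also have "\<dots> = \<rho> x (\<lambda>x0 x1. \<rho> y (\<lambda>c r. \<Delta> r (\<lambda>z k. \<Delta> z (\<lambda>d g. ?K (x0 \<star> c) k (x1 \<cdot> (d \<cdot> S g))))))"
      by (simp add: coact_coassoc comult_coassoc)
    also have "\<dots> = \<rho> x (\<lambda>x0 x1. \<rho> y (\<lambda>c r. \<Delta> r (\<lambda>z k. \<epsilon> z * ?K (x0 \<star> c) k x1)))"
    proof (intro tsum_body)
      fix x0 x1 c z k assume c: "x0 \<in> carrier P" "x1 \<in> carrier H" "c \<in> carrier P" "z \<in> carrier H" "k \<in> carrier H"
      show "\<Delta> z (\<lambda>d g. ?K (x0 \<star> c) k (x1 \<cdot> (d \<cdot> S g))) = \<epsilon> z * ?K (x0 \<star> c) k x1"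
        by (subst antipode_sum(2)[where \<alpha> = "\<lambda>r. ?K (x0 \<star> c) k (x1 \<cdot> r)"]) (use c in auto)
    qed
    also have "\<dots> = \<rho> x (\<lambda>x0 x1. \<rho> y (\<lambda>c k. ?K (x0 \<star> c) k x1))"
      by (rule tsum_body, rule tsum_body, rule comult_counit(1)) auto
    also have "\<dots> = \<rho> x (\<lambda>x0 x1. tsum P P (s' y) (\<lambda>u v. F (x0 \<star> u) x1 v))"
      by (rule tsum_body, rule \<Lambda>\<rho>) auto
    finally show "tsum P P (\<Lambda> (can_elem x y)) (\<lambda>u v. \<rho> u (\<lambda>a b. F a b v)) =
        tsum P H (can_elem x y) (\<lambda>p h. \<rho> p (\<lambda>p0 p1. \<Delta> h (\<lambda>g k. ?K p0 k (p1 \<cdot> S g))))"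
      using 1 by simp
  qed (simp_all add: tril_comp[OF F])
  have right: "tsum P P (\<Lambda> z) (\<lambda>u v. \<rho> v (F u)) =
      tsum P H z (\<lambda>p h. \<Delta> h (\<lambda>g k. tsum P P (\<Lambda> (pure_tensor P H p g)) (\<lambda>u v. F u v k)))"
    if z: "z \<in> carrier (P \<otimes>\<^sub>\<complex> H)" and F: "tril P P H F" for z F
  proof (rule can_elem_functional_eq[OF onto _ _ _ z])
    note [simp] = tril_comp[OF F]
    fix x y assume [simp]: "x \<in> carrier P" "y \<in> carrier P"
    have "tsum P P (\<Lambda> (can_elem x y)) (\<lambda>u v. \<rho> v (F u)) = \<rho> y (\<lambda>y0 y1. tsum P P (s' y0) (\<lambda>u v. F (x \<star> u) v y1))"
      by (simp add: \<Lambda>sum s'_right[of y "\<lambda>u. F (x \<star> u)"])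
    also have "\<dots> = \<rho> y (\<lambda>y0 k. \<rho> y0 (\<lambda>a g. tsum P P (\<Lambda> (pure_tensor P H (x \<star> a) g)) (\<lambda>u v. F u v k)))"
      by (simp add: \<Lambda>\<rho>)
    also have "\<dots> = tsum P H (can_elem x y) (\<lambda>p h. \<Delta> h (\<lambda>g k. tsum P P (\<Lambda> (pure_tensor P H p g)) (\<lambda>u v. F u v k)))"
      by (simp add: coact_coassoc can_elem_sum)
    finally show "tsum P P (\<Lambda> (can_elem x y)) (\<lambda>u v. \<rho> v (F u)) =
      tsum P H (can_elem x y) (\<lambda>p h. \<Delta> h (\<lambda>g k. tsum P P (\<Lambda> (pure_tensor P H p g)) (\<lambda>u v. F u v k)))" .
  qed (simp_all add: tril_comp[OF F])
  have mult: "tsum P P (\<Lambda> z) (\<lambda>u v. \<alpha> (u \<star> v)) = tsum P H z (\<lambda>p h. \<epsilon> h * \<alpha> p)"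
    if z: "z \<in> carrier (P \<otimes>\<^sub>\<complex> H)" and \<alpha> [simp]: "lin P \<alpha>" for z \<alpha>
  proof (rule can_elem_functional_eq[OF onto _ _ _ z])
    note [simp] = lin_comp[OF \<alpha>]
    fix x y assume [simp]: "x \<in> carrier P" "y \<in> carrier P"
    show "tsum P P (\<Lambda> (can_elem x y)) (\<lambda>u v. \<alpha> (u \<star> v)) = tsum P H (can_elem x y) (\<lambda>p h. \<epsilon> h * \<alpha> p)"
      using s'_mult[of y "\<lambda>r. \<alpha> (x \<star> r)"] coact_counit(1)[of y "\<lambda>r. \<alpha> (x \<star> r)"]
      by (simp add: \<Lambda>sum can_elem_sum mult_assoc)
  qed (simp_all add: lin_comp[OF \<alpha>])
  define \<omega> where "\<omega> h = \<Lambda> (pure_tensor P H 1\<^sub>P h)" for h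
  have "strong_connection \<omega>"
    unfolding strong_connection_def
  proof (intro conjI ballI allI impI)
    show "\<omega> \<in> linear_maps H (P \<otimes>\<^sub>\<complex> P)" unfolding \<omega>_def by simp
    fix h assume [simp]: "h \<in> carrier H"
    show "tsum P P (\<omega> h) (\<lambda>u v. \<rho> u (\<lambda>a b. F a b v)) = \<Delta> h (\<lambda>g k. tsum P P (\<omega> k) (\<lambda>u v. F u (S g) v))"
      if F: "tril P H P F" for F
    proof -
      note [simp] = tril_comp[OF F]
      show ?thesis using F by (simp add: \<omega>_def left tsum_pure coact_one)
    qed
    show "tsum P P (\<omega> h) (\<lambda>u v. \<rho> v (F u)) = \<Delta> h (\<lambda>g k. tsum P P (\<omega> g) (\<lambda>u v. F u v k))"
      if F: "tril P P H F" for F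
    proof -
      note [simp] = tril_comp[OF F]
      show ?thesis using F by (simp add: \<omega>_def right tsum_pure)
    qed
    show "tsum P P (\<omega> h) (\<lambda>u v. \<alpha> (u \<star> v)) = \<epsilon> h * \<alpha> 1\<^sub>P" if "lin P \<alpha>" for \<alpha>
      using that by (simp add: \<omega>_def mult tsum_pure)
  qed
  then show ?thesis by blast
qed

subsection \<open>A strong connection makes the cotensor functor exact\<close>

lemma comodule_mapsD:
  fixes U :: "('h, 'u) lcomod" and V :: "('h, 'v) lcomod"
  assumes U: "lcoaction U" and V: "lcoaction V" and f: "f \<in> comodule_maps H U V"
  shows "f \<in> linear_maps U V"
    and "v \<in> carrier U \<Longrightarrow> bil H V F \<Longrightarrow>
      tsum H V (lcoact V (f v)) F = tsum H U (lcoact U v) (\<lambda>h w. F h (f w))"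
proof -
  show l: "f \<in> linear_maps U V" using f by (simp add: comodule_maps_def)
  assume v: "v \<in> carrier U" and F: "bil H V F"
  have "lcoact V (f v) = tensor_map H U H V id f (lcoact U v)"
    using f v by (simp add: comodule_maps_def)
  then show "tsum H V (lcoact V (f v)) F = tsum H U (lcoact U v) (\<lambda>h w. F h (f w))"
    using F v l lcoactionD(1,3)[OF U] lcoactionD(1)[OF V] by (simp add: tsum_tensor_map)
qed

lemma cotensor_map:
  fixes U :: "('h, 'u) lcomod" and V :: "('h, 'v) lcomod"
  assumes U: "lcoaction U" and V: "lcoaction V" and f: "f \<in> comodule_maps H U V"
    and x: "x \<in> carrier (cotensor H P U)"
  shows "tensor_map P U P V id f x \<in> carrier (cotensor H P V)"
proof (rule cotensorI[OF V])
  note [simp] = lcoactionD[OF U] lcoactionD[OF V] cotensor_carrier[OF x] comodule_mapsD(1)[OF U V f]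
    linear_maps_apply(1)[OF comodule_mapsD(1)[OF U V f]] linear_maps_comp[OF comodule_mapsD(1)[OF U V f]]
  show "tensor_map P U P V id f x \<in> carrier (P \<otimes>\<^sub>\<complex> V)" by simp
  fix \<alpha> \<beta> \<gamma> assume l [simp]: "lin P \<alpha>" "lin H \<beta>" "lin V \<gamma>"
  note [simp] = lin_comp[OF l(3)]
  have "tsum P U x (\<lambda>p v. \<rho> p (\<lambda>a b. \<alpha> a * (\<beta> b * \<gamma> (f v)))) =
      tsum P U x (\<lambda>p v. tsum H U (lcoact U v) (\<lambda>b w. \<alpha> p * (\<beta> b * \<gamma> (f w))))"
    by (rule cotensor_sum[OF U x]) simp
  then show "tsum P V (tensor_map P U P V id f x) (\<lambda>p v. \<rho> p (\<lambda>a b. \<alpha> a * (\<beta> b * \<gamma> v))) =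
      tsum P V (tensor_map P U P V id f x) (\<lambda>p v. tsum H V (lcoact V v) (\<lambda>b w. \<alpha> p * (\<beta> b * \<gamma> w)))"
    by (simp add: tsum_tensor_map comodule_mapsD(2)[OF U V f])
qed

context
  fixes \<omega> :: "'h \<Rightarrow> ('p, 'p) tens" and E :: "'p \<Rightarrow> 'p"
  assumes \<omega>: "strong_connection \<omega>"
    and E: "E \<in> linear_maps P P" "\<And>p. p \<in> carrier P \<Longrightarrow> E p \<in> B" "\<And>b. b \<in> B \<Longrightarrow> E b = b"
begin

lemmas \<omega>E = strong_connectionD(1-3)[OF \<omega>] E linear_maps_comp[OF E(1)]
  split_closed[OF \<omega>] split_linear[OF \<omega>] linear_maps_comp[OF split_linear[OF \<omega>]]

text \<open>\<open>p \<otimes> v \<mapsto> E(p v\<^sub>1\<^sup>1) v\<^sub>1\<^sup>2 \<otimes> v\<^sub>0\<close>, a natural projection of \<open>P \<otimes> V\<close> onto \<open>P \<box> V\<close>.\<close>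

definition retract :: "('h, 'v) lcomod \<Rightarrow> ('p, 'v) tens \<Rightarrow> ('p, 'v) tens"
  where "retract V t = tvec P V (P \<otimes>\<^sub>\<complex> V) t (\<lambda>p v. tvec H V (P \<otimes>\<^sub>\<complex> V) (lcoact V v) (\<lambda>h w.
    tvec P P (P \<otimes>\<^sub>\<complex> V) (\<omega> h) (\<lambda>u x. pure_tensor P V (E (p \<star> u) \<star> x) w)))"

lemma retract_closed: "lcoaction V \<Longrightarrow> retract V t \<in> carrier (P \<otimes>\<^sub>\<complex> V)"
  for V :: "('h, 'v) lcomod"
proof -
  assume V: "lcoaction V"
  note [simp] = \<omega>E lcoactionD(1,3)[OF V]
  show ?thesis by (simp add: retract_def)
qed

lemma retract_sum:
  fixes V :: "('h, 'v) lcomod"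
  assumes V: "lcoaction V" and F: "bil P V F"
  shows "tsum P V (retract V t) F =
    tsum P V t (\<lambda>p v. tsum H V (lcoact V v) (\<lambda>h w. tsum P P (\<omega> h) (\<lambda>u x. F (E (p \<star> u) \<star> x) w)))"
proof -
  note [simp] = \<omega>E lcoactionD(1,3)[OF V]
  show ?thesis using F by (simp add: retract_def tsum_tvec tsum_pure)
qed

lemma retract_cotensor:
  fixes V :: "('h, 'v) lcomod"
  assumes V: "left_comodule H V" and t: "t \<in> carrier (P \<otimes>\<^sub>\<complex> V)"
  shows "retract V t \<in> carrier (cotensor H P V)"
proof (rule cotensorI[OF left_comodule_lcoaction[OF V]])
  note Vl = left_comodule_lcoaction[OF V]
  note [simp] = lcoactionD[OF Vl]
  show "retract V t \<in> carrier (P \<otimes>\<^sub>\<complex> V)" by (rule retract_closed[OF Vl])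
  fix \<alpha> \<beta> \<gamma> assume l [simp]: "lin P \<alpha>" "lin H \<beta>" "lin V \<gamma>"
  note [simp] = lin_comp[OF l(1)] lin_comp[OF l(2)] \<omega>E
  have "tsum P V (retract V t) (\<lambda>p v. \<rho> p (\<lambda>a b. \<alpha> a * (\<beta> b * \<gamma> v))) =
    tsum P V t (\<lambda>p v. tsum H V (lcoact V v) (\<lambda>h w. tsum P P (\<omega> h) (\<lambda>u x. \<rho> x (\<lambda>c d. \<alpha> (E (p \<star> u) \<star> c) * (\<beta> d * \<gamma> w)))))"
    by (simp add: retract_sum[OF Vl] coact_mult coinvariants_sum)
  also have "\<dots> = tsum P V t (\<lambda>p v. tsum H V (lcoact V v) (\<lambda>h w. \<Delta> h (\<lambda>g k. tsum P P (\<omega> g) (\<lambda>u x. \<alpha> (E (p \<star> u) \<star> x) * (\<beta> k * \<gamma> w)))))"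
    by (rule tsum_body, rule tsum_body, rule strong_connectionD(5)[OF \<omega>]) simp_all
  also have "\<dots> = tsum P V t (\<lambda>p v. tsum H V (lcoact V v) (\<lambda>g w. tsum H V (lcoact V w) (\<lambda>k y.
      tsum P P (\<omega> g) (\<lambda>u x. \<alpha> (E (p \<star> u) \<star> x) * (\<beta> k * \<gamma> y)))))"
    by (rule tsum_body, rule lcoact_coassoc_sum[OF V]) simp_all
  also have "\<dots> = tsum P V t (\<lambda>p v. tsum H V (lcoact V v) (\<lambda>g w. tsum P P (\<omega> g) (\<lambda>u x. tsum H V (lcoact V w) (\<lambda>k y.
      \<alpha> (E (p \<star> u) \<star> x) * (\<beta> k * \<gamma> y)))))"
    by (intro tsum_body tsum_swap)
  also have "\<dots> = tsum P V (retract V t) (\<lambda>p v. tsum H V (lcoact V v) (\<lambda>b w. \<alpha> p * (\<beta> b * \<gamma> w)))"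
    by (simp add: retract_sum[OF Vl])
  finally show "tsum P V (retract V t) (\<lambda>p v. \<rho> p (\<lambda>a b. \<alpha> a * (\<beta> b * \<gamma> v))) =
    tsum P V (retract V t) (\<lambda>p v. tsum H V (lcoact V v) (\<lambda>b w. \<alpha> p * (\<beta> b * \<gamma> w)))" .
qed

lemma retract_id:
  fixes V :: "('h, 'v) lcomod"
  assumes V: "lcoaction V" and t: "t \<in> carrier (cotensor H P V)"
  shows "retract V t = t"
proof (rule tensor_eqI[of P V])
  note [simp] = lcoactionD[OF V] \<omega>E
  fix \<alpha> \<beta> assume l [simp]: "lin P \<alpha>" "lin V \<beta>"
  note [simp] = lin_comp[OF l(1)]
  have "tsum P V (retract V t) (\<lambda>v w. \<alpha> v * \<beta> w) =
      tsum P V t (\<lambda>p v. tsum H V (lcoact V v) (\<lambda>h w. tsum P P (\<omega> h) (\<lambda>u x. \<alpha> (E (p \<star> u) \<star> x) * \<beta> w)))"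
    by (simp add: retract_sum[OF V])
  also have "\<dots> = tsum P V t (\<lambda>p v. \<rho> p (\<lambda>a b. tsum P P (\<omega> b) (\<lambda>u x. \<alpha> (E (a \<star> u) \<star> x) * \<beta> v)))"
    by (rule cotensor_sum[OF V t, symmetric]) simp
  also have "\<dots> = tsum P V t (\<lambda>p v. tsum P P (split \<omega> p) (\<lambda>u x. \<alpha> (E u \<star> x)) * \<beta> v)"
    by (simp add: split_sum[OF \<omega>] tsum_multc)
  also have "\<dots> = tsum P V t (\<lambda>p v. tsum P P (split \<omega> p) (\<lambda>u x. \<alpha> (u \<star> x)) * \<beta> v)"
    by (intro tsum_body arg_cong[of _ _ "\<lambda>x. x * _"] split_E[OF \<omega> E, where F = "\<lambda>u x. \<alpha> (u \<star> x)"]) simp_all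
  also have "\<dots> = tsum P V t (\<lambda>v w. \<alpha> v * \<beta> w)"
    by (simp add: split_mult[OF \<omega>])
  finally show "tsum P V (retract V t) (\<lambda>v w. \<alpha> v * \<beta> w) = tsum P V t (\<lambda>v w. \<alpha> v * \<beta> w)" .
qed (use lcoactionD(1)[OF V] retract_closed[OF V] cotensor_carrier[OF t] in auto)

lemma retract_natural:
  fixes U :: "('h, 'u) lcomod" and V :: "('h, 'v) lcomod"
  assumes U: "lcoaction U" and V: "lcoaction V" and f: "f \<in> comodule_maps H U V" and t: "t \<in> carrier (P \<otimes>\<^sub>\<complex> U)"
  shows "tensor_map P U P V id f (retract U t) = retract V (tensor_map P U P V id f t)"
proof (rule tensor_eqI[of P V])
  note [simp] = lcoactionD[OF U] lcoactionD[OF V] t comodule_mapsD(1)[OF U V f] retract_closed[OF U] retract_closed[OF V]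
    linear_maps_apply(1)[OF comodule_mapsD(1)[OF U V f]] linear_maps_comp[OF comodule_mapsD(1)[OF U V f]] \<omega>E
  show "tensor_map P U P V id f (retract U t) \<in> carrier (P \<otimes>\<^sub>\<complex> V)" "retract V (tensor_map P U P V id f t) \<in> carrier (P \<otimes>\<^sub>\<complex> V)"
    by simp_all
  fix \<alpha> \<beta> assume l [simp]: "lin P \<alpha>" "lin V \<beta>"
  note [simp] = lin_comp[OF l(1)] lin_comp[OF l(2)]
  show "tsum P V (tensor_map P U P V id f (retract U t)) (\<lambda>v w. \<alpha> v * \<beta> w) =
      tsum P V (retract V (tensor_map P U P V id f t)) (\<lambda>v w. \<alpha> v * \<beta> w)"
    by (simp add: tsum_tensor_map retract_sum[OF U] retract_sum[OF V] comodule_mapsD(2)[OF U V f])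
qed (use lcoactionD(1)[OF V] in simp_all)

text \<open>By the retraction, \<open>P \<box> V\<close> is a natural direct summand of \<open>P \<otimes> V\<close>, and tensoring over a field is exact.\<close>

lemma strong_connection_coflat: "coflat TYPE('u) H P"
  unfolding coflat_def
proof (intro allI impI ballI)
  fix U V W :: "('h, 'u) lcomod" and f g
  assume U: "left_comodule H U" and V: "left_comodule H V" and W: "left_comodule H W"
    and f: "f \<in> comodule_maps H U V" and g: "g \<in> comodule_maps H V W"
    and exact: "f ` carrier U = {v \<in> carrier V. g v = \<zero>\<^bsub>W\<^esub>}"
  note l = left_comodule_lcoaction[OF U] left_comodule_lcoaction[OF V] left_comodule_lcoaction[OF W]
  note fl = comodule_mapsD(1)[OF l(1,2) f] and gl = comodule_mapsD(1)[OF l(2,3) g]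
  note [simp] = lcoactionD(1)[OF l(1)] lcoactionD(1)[OF l(2)] lcoactionD(1)[OF l(3)] fl gl
    linear_maps_apply(1)[OF fl] linear_maps_apply(1)[OF gl] linear_maps_comp[OF fl] linear_maps_comp[OF gl]
  have gf: "g (f u) = \<zero>\<^bsub>W\<^esub>" if "u \<in> carrier U" for u using exact that by blast
  show "tensor_map P U P V id f ` carrier (cotensor H P U) =
      {t \<in> carrier (cotensor H P V). tensor_map P V P W id g t = \<zero>\<^bsub>P \<otimes>\<^sub>\<complex> W\<^esub>}" (is "?L = ?R")
  proof
    show "?L \<subseteq> ?R"
    proof
      fix t assume "t \<in> ?L"
      then obtain x where x: "x \<in> carrier (cotensor H P U)" "t = tensor_map P U P V id f x" by blast
      note [simp] = cotensor_carrier[OF x(1)]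
      have "tensor_map P V P W id g t = \<zero>\<^bsub>P \<otimes>\<^sub>\<complex> W\<^esub>"
      proof (rule tensor_eqI[of P W])
        fix \<alpha> \<beta> assume ab [simp]: "lin P \<alpha>" "lin W \<beta>"
        note [simp] = lin_comp[OF ab(2)]
        have "lin (P \<otimes>\<^sub>\<complex> W) (\<lambda>t. tsum P W t (\<lambda>v w. \<alpha> v * \<beta> w))" by (rule lin_tsum) simp_all
        from lin_zero[OF this] show "tsum P W (tensor_map P V P W id g t) (\<lambda>v w. \<alpha> v * \<beta> w) = tsum P W \<zero>\<^bsub>P \<otimes>\<^sub>\<complex> W\<^esub> (\<lambda>v w. \<alpha> v * \<beta> w)"
          by (simp add: x(2) tsum_tensor_map gf lin_zero[OF ab(2)] tsum_cmult[of _ _ _ 0, simplified])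
      qed (simp_all add: x(2))
      then show "t \<in> ?R" using cotensor_map[OF l(1,2) f x(1)] x(2) by simp
    qed
    show "?R \<subseteq> ?L"
    proof
      fix t assume t: "t \<in> ?R"
      then have tc: "t \<in> carrier (cotensor H P V)" and tz: "tensor_map P V P W id g t = \<zero>\<^bsub>P \<otimes>\<^sub>\<complex> W\<^esub>" by auto
      note [simp] = cotensor_carrier[OF tc]
      have K: "subspace V (f ` carrier U)"
        unfolding exact subspace_def
        by (auto simp: linear_maps_apply[OF gl] linear_maps_zero[OF gl] vs_simps)
      obtain \<kappa> where \<kappa>: "\<kappa> \<in> linear_maps V V" "\<And>v. v \<in> carrier V \<Longrightarrow> \<kappa> v \<in> f ` carrier U" "\<And>v. v \<in> f ` carrier U \<Longrightarrow> \<kappa> v = v"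
        using subspace_projection[OF _ K] by auto
      have \<kappa>t: "tensor_map P V P V id \<kappa> t = t"
      proof (rule right_leg_projection(1)[of P V])
        fix \<phi> assume [simp]: "lin P \<phi>"
        let ?y = "tvec P V V t (\<lambda>u v. \<phi> u \<odot>\<^bsub>V\<^esub> v)"
        have "g ?y = \<zero>\<^bsub>W\<^esub>"
        proof (rule vs_eqI[of W])
          fix \<gamma> assume \<gamma> [simp]: "lin W \<gamma>"
          note [simp] = lin_comp[OF \<gamma>]
          have "\<gamma> (g ?y) = tsum P V t (\<lambda>u v. \<gamma> (g (\<phi> u \<odot>\<^bsub>V\<^esub> v)))"
            by (rule lin_tvec[of P V V]) simp_all
          also have "\<dots> = tsum P W (tensor_map P V P W id g t) (\<lambda>u v. \<phi> u * \<gamma> v)"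
            by (simp add: tsum_tensor_map linear_maps_apply(3)[OF gl] lin_apply(2)[OF \<gamma>])
          also have "\<dots> = 0"
            unfolding tz by (rule lin_zero[of "P \<otimes>\<^sub>\<complex> W" "\<lambda>z. tsum P W z (\<lambda>u v. \<phi> u * \<gamma> v)"], rule lin_tsum) simp_all
          finally show "\<gamma> (g ?y) = \<gamma> \<zero>\<^bsub>W\<^esub>" by (simp add: lin_zero)
        qed simp_all
        then show "?y \<in> f ` carrier U" unfolding exact by simp
      qed (use \<kappa> in simp_all)
      obtain \<kappa>' where \<kappa>': "\<kappa>' \<in> linear_maps V U" "\<And>v. v \<in> carrier V \<Longrightarrow> f (\<kappa>' v) = \<kappa> v"
        using linear_lift[OF _ _ _ fl \<kappa>(1) \<kappa>(2)] by auto
      note [simp] = \<kappa>(1) \<kappa>'(1) linear_maps_apply(1)[OF \<kappa>(1)] linear_maps_apply(1)[OF \<kappa>'(1)]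
      define u where "u = tensor_map P V P U id \<kappa>' t"
      have uc [simp]: "u \<in> carrier (P \<otimes>\<^sub>\<complex> U)" by (simp add: u_def)
      have fu: "tensor_map P U P V id f u = t"
      proof (rule tensor_eqI[of P V])
        fix \<alpha> \<beta> assume ab [simp]: "lin P \<alpha>" "lin V \<beta>"
        note [simp] = lin_comp[OF ab(2)]
        have "tsum P V (tensor_map P U P V id f u) (\<lambda>v w. \<alpha> v * \<beta> w) = tsum P V (tensor_map P V P V id \<kappa> t) (\<lambda>v w. \<alpha> v * \<beta> w)"
          by (simp add: u_def tsum_tensor_map \<kappa>'(2))
        then show "tsum P V (tensor_map P U P V id f u) (\<lambda>v w. \<alpha> v * \<beta> w) = tsum P V t (\<lambda>v w. \<alpha> v * \<beta> w)"
          by (simp add: \<kappa>t)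
      qed simp_all
      have "tensor_map P U P V id f (retract U u) = t"
        using retract_natural[OF l(1,2) f uc] retract_id[OF l(2) tc] fu by simp
      then show "t \<in> ?L" using retract_cotensor[OF U uc] by (metis image_eqI)
    qed
  qed
qed

end

subsection \<open>A strong connection makes \<open>\<beta>\<close> bijective\<close>

lemma tsum_smult:
  fixes V :: "(complex, 'a, 'm) module_scheme" and W :: "(complex, 'b, 'n) module_scheme"
  assumes "vs V" "vs W" "bil V W F" "t \<in> carrier (V \<otimes>\<^sub>\<complex> W)"
  shows "tsum V W (c \<odot>\<^bsub>V \<otimes>\<^sub>\<complex> W\<^esub> t) F = c * tsum V W t F"
  using lin_apply(2)[OF lin_tsum[OF assms(1-3)] assms(4)] .

lemma
  fixes V :: "('h, 'v) lcomod"
  assumes V: "lcoaction V" and x: "x \<in> carrier (P \<otimes>\<^sub>\<complex> V)"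
  shows lact_linear_arg: "(\<lambda>b. cotensor_lact P V b x) \<in> linear_maps P (P \<otimes>\<^sub>\<complex> V)"
    and ract_linear_arg: "(\<lambda>b. cotensor_ract P V b x) \<in> linear_maps P (P \<otimes>\<^sub>\<complex> V)"
  unfolding cotensor_lact_def cotensor_ract_def tensor_map_def
  by (rule bilinear_lift_linear_left; simp add: lcoactionD(1)[OF V] x)+

lemma
  fixes V :: "('h, 'v) lcomod"
  assumes V: "lcoaction V" and x: "x \<in> carrier (P \<otimes>\<^sub>\<complex> V)"
  shows lact_scalar: "cotensor_lact P V (c \<odot>\<^bsub>P\<^esub> 1\<^sub>P) x = c \<odot>\<^bsub>P \<otimes>\<^sub>\<complex> V\<^esub> x"
    and ract_scalar: "cotensor_ract P V (c \<odot>\<^bsub>P\<^esub> 1\<^sub>P) x = c \<odot>\<^bsub>P \<otimes>\<^sub>\<complex> V\<^esub> x"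
proof -
  note [simp] = lcoactionD(1)[OF V] x
  have b [simp]: "c \<odot>\<^bsub>P\<^esub> 1\<^sub>P \<in> carrier P" by simp
  note [simp] = linear_maps_apply(1)[OF lact_linear[OF V b]] linear_maps_apply(1)[OF ract_linear[OF V b]]
  show "cotensor_lact P V (c \<odot>\<^bsub>P\<^esub> 1\<^sub>P) x = c \<odot>\<^bsub>P \<otimes>\<^sub>\<complex> V\<^esub> x"
    by (rule tensor_eqI[of P V]) (simp_all add: lact_sum[OF V b] scalar_mult tsum_smult lin_apply mult.assoc tsum_cmult)
  show "cotensor_ract P V (c \<odot>\<^bsub>P\<^esub> 1\<^sub>P) x = c \<odot>\<^bsub>P \<otimes>\<^sub>\<complex> V\<^esub> x"
    by (rule tensor_eqI[of P V]) (simp_all add: ract_sum[OF V b] scalar_mult tsum_smult lin_apply mult.assoc tsum_cmult)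
qed

lemma bprod_pure:
  fixes V :: "('h, 'v) lcomod" and W :: "('h, 'w) lcomod"
  assumes V: "lcoaction V" and W: "lcoaction W"
    and [simp]: "a \<in> carrier P" "v \<in> carrier V" "b \<in> carrier P" "w \<in> carrier W"
  shows "bprod V W (pure_tensor P V a v) (pure_tensor P W b w) = pure_tensor P (V \<otimes>\<^sub>\<complex> W) (a \<star> b) (pure_tensor V W v w)"
proof (rule tensor_eqI[of P "V \<otimes>\<^sub>\<complex> W"])
  note [simp] = lcoactionD(1)[OF V] lcoactionD(1)[OF W] bprod_closed[OF V W]
  show "bprod V W (pure_tensor P V a v) (pure_tensor P W b w) \<in> carrier (P \<otimes>\<^sub>\<complex> (V \<otimes>\<^sub>\<complex> W))" by simp
  fix \<alpha> \<beta> assume l [simp]: "lin P \<alpha>" "lin (V \<otimes>\<^sub>\<complex> W) \<beta>"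
  note [simp] = lin_comp[OF l(1)] lin_comp[OF l(2)]
  show "tsum P (V \<otimes>\<^sub>\<complex> W) (bprod V W (pure_tensor P V a v) (pure_tensor P W b w)) (\<lambda>v w. \<alpha> v * \<beta> w) =
    tsum P (V \<otimes>\<^sub>\<complex> W) (pure_tensor P (V \<otimes>\<^sub>\<complex> W) (a \<star> b) (pure_tensor V W v w)) (\<lambda>v w. \<alpha> v * \<beta> w)"
    by (simp add: bprod_sum[OF V W] tsum_pure)
qed (use lcoactionD(1)[OF V] lcoactionD(1)[OF W] in simp_all)

context
  fixes \<omega> :: "'h \<Rightarrow> ('p, 'p) tens" and V :: "('h, 'v) lcomod" and W :: "('h, 'w) lcomod"
  assumes \<omega>: "strong_connection \<omega>" and V: "left_comodule H V" and W: "left_comodule H W"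
begin

lemmas Vl = left_comodule_lcoaction[OF V]
lemmas Wl = left_comodule_lcoaction[OF W]
lemmas basic_facts = lcoactionD[OF left_comodule_lcoaction[OF V]] lcoactionD[OF left_comodule_lcoaction[OF W]]
  strong_connectionD(1-3)[OF \<omega>]

text \<open>
  \<open>p \<otimes> (v \<otimes> w) \<mapsto> (p w\<^sub>1\<^sup>1 \<otimes> v) \<otimes> (w\<^sub>1\<^sup>2 \<otimes> w\<^sub>0)\<close>, where \<open>\<omega>\<close> is applied to the \<open>H\<close>-leg \<open>w\<^sub>1\<close> of the coaction of
  \<open>w\<close>. On \<open>P \<box> (V \<otimes> W)\<close> its legs lie in \<open>P \<box> V\<close> and \<open>P \<box> W\<close>, and it induces the inverse of \<open>\<beta>\<close>.
\<close>

definition unmerge :: "('p, ('v, 'w) tens) tens \<Rightarrow> (('p, 'v) tens, ('p, 'w) tens) tens"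
  where "unmerge t = (let TV = P \<otimes>\<^sub>\<complex> V; TW = P \<otimes>\<^sub>\<complex> W; X' = TV \<otimes>\<^sub>\<complex> TW in
    tvec P (V \<otimes>\<^sub>\<complex> W) X' t (\<lambda>p z. tvec V W X' z (\<lambda>v w. tvec H W X' (lcoact W w) (\<lambda>h w0.
      tvec P P X' (\<omega> h) (\<lambda>a b. pure_tensor TV TW (pure_tensor P V (p \<star> a) v) (pure_tensor P W b w0))))))"

lemma unmerge_closed: "unmerge t \<in> carrier ((P \<otimes>\<^sub>\<complex> V) \<otimes>\<^sub>\<complex> (P \<otimes>\<^sub>\<complex> W))"
  unfolding unmerge_def Let_def by (simp add: basic_facts)

lemma unmerge_sum:
  assumes G: "bil (P \<otimes>\<^sub>\<complex> V) (P \<otimes>\<^sub>\<complex> W) G"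
  shows "tsum (P \<otimes>\<^sub>\<complex> V) (P \<otimes>\<^sub>\<complex> W) (unmerge t) G =
    tsum P (V \<otimes>\<^sub>\<complex> W) t (\<lambda>p z. tsum V W z (\<lambda>v w. tsum H W (lcoact W w) (\<lambda>h w0.
      tsum P P (\<omega> h) (\<lambda>a b. G (pure_tensor P V (p \<star> a) v) (pure_tensor P W b w0)))))"
  using G unfolding unmerge_def Let_def by (simp add: basic_facts tsum_tvec tsum_pure)

lemma unmerge_linear: "unmerge \<in> linear_maps (P \<otimes>\<^sub>\<complex> (V \<otimes>\<^sub>\<complex> W)) ((P \<otimes>\<^sub>\<complex> V) \<otimes>\<^sub>\<complex> (P \<otimes>\<^sub>\<complex> W))"
proof (rule linear_maps_by_functionals)
  note [simp] = basic_facts unmerge_closed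
  show "vs (P \<otimes>\<^sub>\<complex> (V \<otimes>\<^sub>\<complex> W))" "vs ((P \<otimes>\<^sub>\<complex> V) \<otimes>\<^sub>\<complex> (P \<otimes>\<^sub>\<complex> W))" by simp_all
  show "unmerge v \<in> carrier ((P \<otimes>\<^sub>\<complex> V) \<otimes>\<^sub>\<complex> (P \<otimes>\<^sub>\<complex> W))" for v by simp
  fix \<phi> assume \<phi>: "lin ((P \<otimes>\<^sub>\<complex> V) \<otimes>\<^sub>\<complex> (P \<otimes>\<^sub>\<complex> W)) \<phi>"
  let ?G = "\<lambda>x y. \<phi> (pure_tensor (P \<otimes>\<^sub>\<complex> V) (P \<otimes>\<^sub>\<complex> W) x y)"
  note [simp] = lin_comp[OF \<phi>]
  have b: "bil (P \<otimes>\<^sub>\<complex> V) (P \<otimes>\<^sub>\<complex> W) ?G" by simp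
  have "\<phi> (unmerge t) = tsum P (V \<otimes>\<^sub>\<complex> W) t (\<lambda>p z. tsum V W z (\<lambda>v w. tsum H W (lcoact W w) (\<lambda>h w0.
      tsum P P (\<omega> h) (\<lambda>a b. ?G (pure_tensor P V (p \<star> a) v) (pure_tensor P W b w0)))))" for t
    using lin_presentation[OF _ _ unmerge_closed \<phi>] unmerge_sum[OF b] by simp
  moreover have "lin (P \<otimes>\<^sub>\<complex> (V \<otimes>\<^sub>\<complex> W)) (\<lambda>t. tsum P (V \<otimes>\<^sub>\<complex> W) t (\<lambda>p z. tsum V W z (\<lambda>v w. tsum H W (lcoact W w) (\<lambda>h w0.
      tsum P P (\<omega> h) (\<lambda>a b. ?G (pure_tensor P V (p \<star> a) v) (pure_tensor P W b w0))))))"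
    by (rule lin_tsum_arg) simp_all
  ultimately show "lin (P \<otimes>\<^sub>\<complex> (V \<otimes>\<^sub>\<complex> W)) (\<lambda>t. \<phi> (unmerge t))" by simp
qed

lemma leg_sum:
  fixes U :: "(complex, 'a, 'm) module_scheme" and A :: "('h, 'd) lcomod"
  assumes "vs U" "lcoaction A" and F: "bil P A F"
  shows "s \<in> carrier ((P \<otimes>\<^sub>\<complex> A) \<otimes>\<^sub>\<complex> U) \<Longrightarrow> lin U \<psi> \<Longrightarrow>
      tsum P A (tvec (P \<otimes>\<^sub>\<complex> A) U (P \<otimes>\<^sub>\<complex> A) s (\<lambda>u v. \<psi> v \<odot>\<^bsub>P \<otimes>\<^sub>\<complex> A\<^esub> u)) F =
        tsum (P \<otimes>\<^sub>\<complex> A) U s (\<lambda>u v. \<psi> v * tsum P A u F)"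
    and "s' \<in> carrier (U \<otimes>\<^sub>\<complex> (P \<otimes>\<^sub>\<complex> A)) \<Longrightarrow> lin U \<psi> \<Longrightarrow>
      tsum P A (tvec U (P \<otimes>\<^sub>\<complex> A) (P \<otimes>\<^sub>\<complex> A) s' (\<lambda>v u. \<psi> v \<odot>\<^bsub>P \<otimes>\<^sub>\<complex> A\<^esub> u)) F =
        tsum U (P \<otimes>\<^sub>\<complex> A) s' (\<lambda>v u. \<psi> v * tsum P A u F)"
  using assms lcoactionD(1)[OF assms(2)] by (simp_all add: tsum_tvec tsum_smult)

text \<open>Moving the coaction from \<open>P\<close> to \<open>V \<otimes> W\<close> produces \<open>v\<^sub>1 w\<^sub>1\<close>, and the left leg of \<open>\<omega>\<close> contributes
  \<open>S(w\<^sub>2)\<close>. The factors that come from \<open>w\<close> cancel, so only \<open>v\<^sub>1\<close> is left.\<close>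

lemma unmerge_left_leg:
  assumes t: "t \<in> carrier (cotensor H P (TC V W))" and \<psi>: "lin (P \<otimes>\<^sub>\<complex> W) \<psi>"
  shows "tvec (P \<otimes>\<^sub>\<complex> V) (P \<otimes>\<^sub>\<complex> W) (P \<otimes>\<^sub>\<complex> V) (unmerge t) (\<lambda>u v. \<psi> v \<odot>\<^bsub>P \<otimes>\<^sub>\<complex> V\<^esub> u) \<in> carrier (cotensor H P V)"
    (is "?y \<in> _")
proof (rule cotensorI[OF Vl])
  note [simp] = basic_facts \<psi> lin_comp[OF \<psi>] unmerge_closed TC_coact_linear[OF Vl Wl]
    linear_maps_comp[OF TC_coact_linear[OF Vl Wl]]
  show "?y \<in> carrier (P \<otimes>\<^sub>\<complex> V)" by simp
  have tc [simp]: "t \<in> carrier (P \<otimes>\<^sub>\<complex> (V \<otimes>\<^sub>\<complex> W))" using cotensor_carrier[OF t] by simp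
  let ?\<psi> = "\<lambda>b w. \<psi> (pure_tensor P W b w)"
  have ev: "tsum P V ?y F = tsum P (V \<otimes>\<^sub>\<complex> W) t (\<lambda>p z. tsum V W z (\<lambda>v w. tsum H W (lcoact W w) (\<lambda>h w0.
      tsum P P (\<omega> h) (\<lambda>a b. ?\<psi> b w0 * F (p \<star> a) v))))" if F: "bil P V F" for F
    using F by (simp add: leg_sum[OF _ Vl F] unmerge_sum tsum_pure)
  have main: "tsum P V ?y (\<lambda>p v. \<rho> p (\<lambda>a b. F a b v)) = tsum P V ?y (\<lambda>p v. tsum H V (lcoact V v) (F p))"
    if F: "tril P H V F" for F
  proof -
    note [simp] = tril_comp[OF F]
    define M where "M = (\<lambda>p r z. tsum V W z (\<lambda>v w. tsum H W (lcoact W w) (\<lambda>h w0. \<Delta> h (\<lambda>g k.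
      tsum P P (\<omega> k) (\<lambda>a b. ?\<psi> b w0 * F (p \<star> a) (r \<cdot> S g) v)))))"
    have M: "tril P H (TC V W) M" unfolding M_def by (intro trilI) simp_all
    have "tsum P V ?y (\<lambda>p v. \<rho> p (\<lambda>a b. F a b v)) =
      tsum P (V \<otimes>\<^sub>\<complex> W) t (\<lambda>p z. tsum V W z (\<lambda>v w. tsum H W (lcoact W w) (\<lambda>h w0.
      tsum P P (\<omega> h) (\<lambda>a b. \<rho> p (\<lambda>p0 p1. \<rho> a (\<lambda>a0 a1. ?\<psi> b w0 * F (p0 \<star> a0) (p1 \<cdot> a1) v))))))"
      by (simp add: ev coact_mult tsum_cmult)
    also have "\<dots> = tsum P (V \<otimes>\<^sub>\<complex> W) t (\<lambda>p z. tsum V W z (\<lambda>v w. tsum H W (lcoact W w) (\<lambda>h w0.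
      \<rho> p (\<lambda>p0 p1. tsum P P (\<omega> h) (\<lambda>a b. \<rho> a (\<lambda>a0 a1. ?\<psi> b w0 * F (p0 \<star> a0) (p1 \<cdot> a1) v))))))"
      by (intro tsum_body tsum_swap)
    also have "\<dots> = tsum P (V \<otimes>\<^sub>\<complex> W) t (\<lambda>p z. tsum V W z (\<lambda>v w. tsum H W (lcoact W w) (\<lambda>h w0.
      \<rho> p (\<lambda>p0 p1. \<Delta> h (\<lambda>g k. tsum P P (\<omega> k) (\<lambda>a b. ?\<psi> b w0 * F (p0 \<star> a) (p1 \<cdot> S g) v))))))"
      by (rule tsum_body, rule tsum_body, rule tsum_body,
          rule tsum_body, rule strong_connectionD(4)[OF \<omega>]) simp_all
    also have "\<dots> = tsum P (V \<otimes>\<^sub>\<complex> W) t (\<lambda>p z. tsum V W z (\<lambda>v w. \<rho> p (\<lambda>p0 p1. tsum H W (lcoact W w) (\<lambda>h w0.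
      \<Delta> h (\<lambda>g k. tsum P P (\<omega> k) (\<lambda>a b. ?\<psi> b w0 * F (p0 \<star> a) (p1 \<cdot> S g) v))))))"
      by (intro tsum_body tsum_swap)
    also have "\<dots> = tsum P (V \<otimes>\<^sub>\<complex> W) t (\<lambda>p z. \<rho> p (\<lambda>p0 p1. M p0 p1 z))"
      unfolding M_def by (intro tsum_body tsum_swap)
    also have "\<dots> = tsum P (V \<otimes>\<^sub>\<complex> W) t (\<lambda>p z. tsum H (V \<otimes>\<^sub>\<complex> W) (lcoact (TC V W) z) (M p))"
      using cotensor_sum[OF TC_lcoaction[OF Vl Wl] t M] by simp
    also have "\<dots> = tsum P (V \<otimes>\<^sub>\<complex> W) t (\<lambda>p z. tsum V W z (\<lambda>v w. tsum H V (lcoact V v) (\<lambda>g' v0.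
      tsum H W (lcoact W w) (\<lambda>h' w1. tsum H W (lcoact W w1) (\<lambda>h w0. \<Delta> h (\<lambda>g k.
      tsum P P (\<omega> k) (\<lambda>a b. ?\<psi> b w0 * F (p \<star> a) (g' \<cdot> (h' \<cdot> S g)) v0)))))))"
      by (simp add: M_def TC_coact_sum[OF Vl Wl] tsum_pure mult_assoc)
    also have "\<dots> = tsum P (V \<otimes>\<^sub>\<complex> W) t (\<lambda>p z. tsum V W z (\<lambda>v w. tsum H V (lcoact V v) (\<lambda>g' v0.
      tsum H W (lcoact W w) (\<lambda>e w0. \<Delta> e (\<lambda>h' h. \<Delta> h (\<lambda>g k.
      tsum P P (\<omega> k) (\<lambda>a b. ?\<psi> b w0 * F (p \<star> a) (g' \<cdot> (h' \<cdot> S g)) v0)))))))"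
      by (rule tsum_body, rule tsum_body, rule tsum_body,
          rule lcoact_coassoc_sum[OF W, symmetric]) simp_all
    also have "\<dots> = tsum P (V \<otimes>\<^sub>\<complex> W) t (\<lambda>p z. tsum V W z (\<lambda>v w. tsum H V (lcoact V v) (\<lambda>g' v0.
      tsum H W (lcoact W w) (\<lambda>e w0. \<Delta> e (\<lambda>x k. \<Delta> x (\<lambda>h' g.
      tsum P P (\<omega> k) (\<lambda>a b. ?\<psi> b w0 * F (p \<star> a) (g' \<cdot> (h' \<cdot> S g)) v0)))))))"
      by (simp add: comult_coassoc)
    also have "\<dots> = tsum P (V \<otimes>\<^sub>\<complex> W) t (\<lambda>p z. tsum V W z (\<lambda>v w. tsum H V (lcoact V v) (\<lambda>g' v0.
      tsum H W (lcoact W w) (\<lambda>e w0. \<Delta> e (\<lambda>x k. \<epsilon> x *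
      tsum P P (\<omega> k) (\<lambda>a b. ?\<psi> b w0 * F (p \<star> a) g' v0))))))"
    proof (intro tsum_body)
      fix p v g' v0 e w0 x k assume c: "p \<in> carrier P" "g' \<in> carrier H" "v0 \<in> carrier V" "w0 \<in> carrier W" "x \<in> carrier H" "k \<in> carrier H"
      show "\<Delta> x (\<lambda>h' g. tsum P P (\<omega> k) (\<lambda>a b. ?\<psi> b w0 * F (p \<star> a) (g' \<cdot> (h' \<cdot> S g)) v0)) =
        \<epsilon> x * tsum P P (\<omega> k) (\<lambda>a b. ?\<psi> b w0 * F (p \<star> a) g' v0)"
        by (subst antipode_sum(2)[where \<alpha> = "\<lambda>r. tsum P P (\<omega> k) (\<lambda>a b. ?\<psi> b w0 * F (p \<star> a) (g' \<cdot> r) v0)"])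
          (simp_all add: c)
    qed
    also have "\<dots> = tsum P (V \<otimes>\<^sub>\<complex> W) t (\<lambda>p z. tsum V W z (\<lambda>v w. tsum H V (lcoact V v) (\<lambda>g' v0.
      tsum H W (lcoact W w) (\<lambda>h w0. tsum P P (\<omega> h) (\<lambda>a b. ?\<psi> b w0 * F (p \<star> a) g' v0)))))"
      by (rule tsum_body, rule tsum_body, rule tsum_body,
          rule tsum_body, rule comult_counit(1)) simp_all
    also have "\<dots> = tsum P (V \<otimes>\<^sub>\<complex> W) t (\<lambda>p z. tsum V W z (\<lambda>v w.
      tsum H W (lcoact W w) (\<lambda>h w0. tsum H V (lcoact V v) (\<lambda>g' v0. tsum P P (\<omega> h) (\<lambda>a b. ?\<psi> b w0 * F (p \<star> a) g' v0)))))"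
      by (rule tsum_body, rule tsum_body, rule tsum_swap)
    also have "\<dots> = tsum P (V \<otimes>\<^sub>\<complex> W) t (\<lambda>p z. tsum V W z (\<lambda>v w.
      tsum H W (lcoact W w) (\<lambda>h w0. tsum P P (\<omega> h) (\<lambda>a b. tsum H V (lcoact V v) (\<lambda>g' v0. ?\<psi> b w0 * F (p \<star> a) g' v0)))))"
      by (intro tsum_body tsum_swap)
    also have "\<dots> = tsum P V ?y (\<lambda>p v. tsum H V (lcoact V v) (F p))"
      by (simp add: ev tsum_cmult)
    finally show ?thesis .
  qed
  fix \<alpha> \<beta> \<gamma> assume l [simp]: "lin P \<alpha>" "lin H \<beta>" "lin V \<gamma>"
  show "tsum P V ?y (\<lambda>p v. \<rho> p (\<lambda>a b. \<alpha> a * (\<beta> b * \<gamma> v))) =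
      tsum P V ?y (\<lambda>p v. tsum H V (lcoact V v) (\<lambda>b w. \<alpha> p * (\<beta> b * \<gamma> w)))"
    by (rule main) simp
qed

lemma unmerge_right_leg:
  assumes t: "t \<in> carrier (P \<otimes>\<^sub>\<complex> (V \<otimes>\<^sub>\<complex> W))" and \<phi>: "lin (P \<otimes>\<^sub>\<complex> V) \<phi>"
  shows "tvec (P \<otimes>\<^sub>\<complex> V) (P \<otimes>\<^sub>\<complex> W) (P \<otimes>\<^sub>\<complex> W) (unmerge t) (\<lambda>u v. \<phi> u \<odot>\<^bsub>P \<otimes>\<^sub>\<complex> W\<^esub> v) \<in> carrier (cotensor H P W)"
    (is "?y \<in> _")
proof (rule cotensorI[OF Wl])
  note [simp] = basic_facts \<phi> lin_comp[OF \<phi>] unmerge_closed t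
  show "?y \<in> carrier (P \<otimes>\<^sub>\<complex> W)" by simp
  let ?\<phi> = "\<lambda>a v. \<phi> (pure_tensor P V a v)"
  have ev: "tsum P W ?y F = tsum P (V \<otimes>\<^sub>\<complex> W) t (\<lambda>p z. tsum V W z (\<lambda>v w. tsum H W (lcoact W w) (\<lambda>h w0.
      tsum P P (\<omega> h) (\<lambda>a b. ?\<phi> (p \<star> a) v * F b w0))))" if F: "bil P W F" for F
    using F by (simp add: leg_sum[OF _ Wl F] unmerge_sum tsum_pure)
  fix \<alpha> \<beta> \<gamma> assume l [simp]: "lin P \<alpha>" "lin H \<beta>" "lin W \<gamma>"
  note [simp] = lin_comp[OF l(1)] lin_comp[OF l(2)] lin_comp[OF l(3)]
  have "tsum P W ?y (\<lambda>p v. \<rho> p (\<lambda>a b. \<alpha> a * (\<beta> b * \<gamma> v))) =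
    tsum P (V \<otimes>\<^sub>\<complex> W) t (\<lambda>p z. tsum V W z (\<lambda>v w. tsum H W (lcoact W w) (\<lambda>h w0.
      tsum P P (\<omega> h) (\<lambda>a b. \<rho> b (\<lambda>c d. ?\<phi> (p \<star> a) v * (\<alpha> c * (\<beta> d * \<gamma> w0)))))))"
    by (simp add: ev tsum_cmult)
  also have "\<dots> = tsum P (V \<otimes>\<^sub>\<complex> W) t (\<lambda>p z. tsum V W z (\<lambda>v w. tsum H W (lcoact W w) (\<lambda>h w0.
      \<Delta> h (\<lambda>g k. tsum P P (\<omega> g) (\<lambda>a b. ?\<phi> (p \<star> a) v * (\<alpha> b * (\<beta> k * \<gamma> w0)))))))"
    by (rule tsum_body, rule tsum_body, rule tsum_body,
        rule strong_connectionD(5)[OF \<omega>]) simp_all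
  also have "\<dots> = tsum P (V \<otimes>\<^sub>\<complex> W) t (\<lambda>p z. tsum V W z (\<lambda>v w. tsum H W (lcoact W w) (\<lambda>g w1.
      tsum H W (lcoact W w1) (\<lambda>k w0. tsum P P (\<omega> g) (\<lambda>a b. ?\<phi> (p \<star> a) v * (\<alpha> b * (\<beta> k * \<gamma> w0)))))))"
    by (rule tsum_body, rule tsum_body,
        rule lcoact_coassoc_sum[OF W]) simp_all
  also have "\<dots> = tsum P (V \<otimes>\<^sub>\<complex> W) t (\<lambda>p z. tsum V W z (\<lambda>v w. tsum H W (lcoact W w) (\<lambda>g w1.
      tsum P P (\<omega> g) (\<lambda>a b. tsum H W (lcoact W w1) (\<lambda>k w0. ?\<phi> (p \<star> a) v * (\<alpha> b * (\<beta> k * \<gamma> w0)))))))"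
    by (rule tsum_body, rule tsum_body, rule tsum_body, rule tsum_swap)
  also have "\<dots> = tsum P W ?y (\<lambda>p v. tsum H W (lcoact W v) (\<lambda>b w. \<alpha> p * (\<beta> b * \<gamma> w)))"
    by (simp add: ev tsum_cmult)
  finally show "tsum P W ?y (\<lambda>p v. \<rho> p (\<lambda>a b. \<alpha> a * (\<beta> b * \<gamma> v))) =
      tsum P W ?y (\<lambda>p v. tsum H W (lcoact W v) (\<lambda>b w. \<alpha> p * (\<beta> b * \<gamma> w)))" .
qed

text \<open>Multiplying the legs back together gives \<open>w\<^sub>1\<^sup>1 w\<^sub>1\<^sup>2 = \<epsilon>(w\<^sub>1)\<close>.\<close>

lemma merge_unmerge:
  assumes t: "t \<in> carrier (P \<otimes>\<^sub>\<complex> (V \<otimes>\<^sub>\<complex> W))"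
  shows "bilinear_lift (P \<otimes>\<^sub>\<complex> V) (P \<otimes>\<^sub>\<complex> W) (P \<otimes>\<^sub>\<complex> (V \<otimes>\<^sub>\<complex> W)) (bprod V W) (unmerge t) = t"
    (is "?m = t")
proof (rule vs_eqI[of "P \<otimes>\<^sub>\<complex> (V \<otimes>\<^sub>\<complex> W)"])
  note [simp] = basic_facts unmerge_closed t bprod_linear_left[OF Vl Wl] bprod_linear_right[OF Vl Wl]
  show "vs (P \<otimes>\<^sub>\<complex> (V \<otimes>\<^sub>\<complex> W))" by simp
  show "?m \<in> carrier (P \<otimes>\<^sub>\<complex> (V \<otimes>\<^sub>\<complex> W))"
    by (rule linear_maps_apply(1)[OF bilinear_lift_props(1)]) simp_all
  fix \<phi> assume \<phi>: "lin (P \<otimes>\<^sub>\<complex> (V \<otimes>\<^sub>\<complex> W)) \<phi>"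
  note [simp] = lin_comp[OF \<phi>]
  have "\<phi> ?m = tsum (P \<otimes>\<^sub>\<complex> V) (P \<otimes>\<^sub>\<complex> W) (unmerge t) (\<lambda>x y. \<phi> (bprod V W x y))"
    by (rule lin_bilinear_lift) (simp_all add: \<phi>)
  also have "\<dots> = tsum P (V \<otimes>\<^sub>\<complex> W) t (\<lambda>p z. tsum V W z (\<lambda>v w. tsum H W (lcoact W w) (\<lambda>h w0.
      tsum P P (\<omega> h) (\<lambda>a b. \<phi> (pure_tensor P (V \<otimes>\<^sub>\<complex> W) (p \<star> (a \<star> b)) (pure_tensor V W v w0))))))"
    by (simp add: unmerge_sum bprod_pure[OF Vl Wl] mult_assoc)
  also have "\<dots> = tsum P (V \<otimes>\<^sub>\<complex> W) t (\<lambda>p z. tsum V W z (\<lambda>v w. tsum H W (lcoact W w) (\<lambda>h w0.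
      \<epsilon> h * \<phi> (pure_tensor P (V \<otimes>\<^sub>\<complex> W) p (pure_tensor V W v w0)))))"
    by (simp add: strong_connectionD(6)[OF \<omega>, where \<alpha> = "\<lambda>r. \<phi> (pure_tensor P (V \<otimes>\<^sub>\<complex> W) (p \<star> r) z)" for p z])
  also have "\<dots> = tsum P (V \<otimes>\<^sub>\<complex> W) t (\<lambda>p z. tsum V W z (\<lambda>v w. \<phi> (pure_tensor P (V \<otimes>\<^sub>\<complex> W) p (pure_tensor V W v w))))"
    by (rule tsum_body, rule tsum_body, rule lcoact_counit_sum[OF W]) simp_all
  also have "\<dots> = tsum P (V \<otimes>\<^sub>\<complex> W) t (\<lambda>p z. \<phi> (pure_tensor P (V \<otimes>\<^sub>\<complex> W) p z))"
    by (rule tsum_body, rule lin_presentation[symmetric]) simp_all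
  also have "\<dots> = \<phi> t"
    by (rule lin_presentation[symmetric]) (simp_all add: \<phi>)
  finally show "\<phi> ?m = \<phi> t" .
qed (use t in simp)

end

end

text \<open>The additive group of \<open>V \<otimes> W\<close> and the group \<^term>\<open>tensor_group UNIV V W\<close> have the same homomorphisms, since
  they share carrier and operation.\<close>

lemma hom_add_tensor:
  "hom (add_monoid (V \<otimes>\<^sub>\<complex> W)) G = hom (tensor_group UNIV V W) G"
  "hom G (add_monoid (V \<otimes>\<^sub>\<complex> W)) = hom G (tensor_group UNIV V W)"
  by (auto simp: hom_def tensor_simps)

lemma hom_linear: "f \<in> linear_maps U U' \<Longrightarrow> g \<in> hom (add_monoid U') G \<Longrightarrow> (\<lambda>u. g (f u)) \<in> hom (add_monoid U) G"
  by (auto simp: linear_maps_iff hom_def)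

context hopf_coaction
begin

lemma
  fixes V :: "('h, 'v) lcomod" and W :: "('h, 'w) lcomod"
  assumes V: "lcoaction V" and W: "lcoaction W"
  shows beta_dom_group: "comm_group (beta_dom H P V W)"
    and beta_tensor_closed: "x \<in> carrier (cotensor H P V) \<Longrightarrow> y \<in> carrier (cotensor H P W) \<Longrightarrow>
      beta_tensor H P V W x y \<in> carrier (beta_dom H P V W)"
    and beta_tensor_add_left: "x \<in> carrier (cotensor H P V) \<Longrightarrow> x' \<in> carrier (cotensor H P V) \<Longrightarrow> y \<in> carrier (cotensor H P W) \<Longrightarrow>
      beta_tensor H P V W (x \<oplus>\<^bsub>P \<otimes>\<^sub>\<complex> V\<^esub> x') y = beta_tensor H P V W x y \<otimes>\<^bsub>beta_dom H P V W\<^esub> beta_tensor H P V W x' y"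
    and beta_tensor_add_right: "x \<in> carrier (cotensor H P V) \<Longrightarrow> y \<in> carrier (cotensor H P W) \<Longrightarrow> y' \<in> carrier (cotensor H P W) \<Longrightarrow>
      beta_tensor H P V W x (y \<oplus>\<^bsub>P \<otimes>\<^sub>\<complex> W\<^esub> y') = beta_tensor H P V W x y \<otimes>\<^bsub>beta_dom H P V W\<^esub> beta_tensor H P V W x y'"
    and beta_tensor_balanced: "b \<in> B \<Longrightarrow> x \<in> carrier (cotensor H P V) \<Longrightarrow> y \<in> carrier (cotensor H P W) \<Longrightarrow>
      beta_tensor H P V W (cotensor_ract P V b x) y = beta_tensor H P V W x (cotensor_lact P W b y)"
proof -
  note bal = balanced_beta[OF V W]
  show "comm_group (beta_dom H P V W)"
    unfolding beta_dom_def by (rule balanced_tensor.tensor_comm_group[OF bal])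
  show "beta_tensor H P V W x y \<in> carrier (beta_dom H P V W)"
    if "x \<in> carrier (cotensor H P V)" "y \<in> carrier (cotensor H P W)"
    using that balanced_tensor.te_closed[OF bal, of x y] by (simp add: beta_dom_def beta_tensor_def)
  show "beta_tensor H P V W (x \<oplus>\<^bsub>P \<otimes>\<^sub>\<complex> V\<^esub> x') y = beta_tensor H P V W x y \<otimes>\<^bsub>beta_dom H P V W\<^esub> beta_tensor H P V W x' y"
    if "x \<in> carrier (cotensor H P V)" "x' \<in> carrier (cotensor H P V)" "y \<in> carrier (cotensor H P W)"
    using that balanced_tensor.te_add_left[OF bal, of x x' y] by (simp add: beta_dom_def beta_tensor_def)
  show "beta_tensor H P V W x (y \<oplus>\<^bsub>P \<otimes>\<^sub>\<complex> W\<^esub> y') = beta_tensor H P V W x y \<otimes>\<^bsub>beta_dom H P V W\<^esub> beta_tensor H P V W x y'"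
    if "x \<in> carrier (cotensor H P V)" "y \<in> carrier (cotensor H P W)" "y' \<in> carrier (cotensor H P W)"
    using that balanced_tensor.te_add_right[OF bal, of x y' y] by (simp add: beta_dom_def beta_tensor_def)
  show "beta_tensor H P V W (cotensor_ract P V b x) y = beta_tensor H P V W x (cotensor_lact P W b y)"
    if "b \<in> B" "x \<in> carrier (cotensor H P V)" "y \<in> carrier (cotensor H P W)"
    using that balanced_tensor.te_balanced[OF bal, of b x y] by (simp add: beta_tensor_def)
qed

lemma beta_dom_induct [consumes 3, case_names one mult]:
  fixes V :: "('h, 'v) lcomod" and W :: "('h, 'w) lcomod"
  assumes V: "lcoaction V" and W: "lcoaction W" and q: "q \<in> carrier (beta_dom H P V W)"
    and "K \<one>\<^bsub>beta_dom H P V W\<^esub>"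
    and "\<And>x y s. x \<in> carrier (cotensor H P V) \<Longrightarrow> y \<in> carrier (cotensor H P W) \<Longrightarrow> s \<in> carrier (beta_dom H P V W) \<Longrightarrow> K s \<Longrightarrow>
      K (beta_tensor H P V W x y \<otimes>\<^bsub>beta_dom H P V W\<^esub> s)"
  shows "K q"
proof (rule balanced_tensor.tensor_induct[OF balanced_beta[OF V W], of q K])
  show "q \<in> carrier (tensor_group B (cotensor_right H P V) (cotensor_left H P W))" using q by (simp add: beta_dom_def)
qed (use assms(4,5) in \<open>simp_all add: beta_dom_def beta_tensor_def\<close>)

lemma beta_cotensor:
  fixes V :: "('h, 'v) lcomod" and W :: "('h, 'w) lcomod"
  assumes V: "lcoaction V" and W: "lcoaction W" and q: "q \<in> carrier (beta_dom H P V W)"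
  shows "beta H P V W q \<in> carrier (cotensor H P (TC V W))"
proof -
  note [simp] = lcoactionD(1)[OF V] lcoactionD(1)[OF W]
  interpret D: comm_group "beta_dom H P V W" by (rule beta_dom_group[OF V W])
  interpret A: comm_group "add_monoid (P \<otimes>\<^sub>\<complex> (V \<otimes>\<^sub>\<complex> W))" by (rule comm_group_add_monoid) (simp add: vs_abelian)
  interpret b: group_hom "beta_dom H P V W" "add_monoid (P \<otimes>\<^sub>\<complex> (V \<otimes>\<^sub>\<complex> W))" "beta H P V W"
    using beta_hom[OF V W] by unfold_locales
  have sub: "subspace (P \<otimes>\<^sub>\<complex> (V \<otimes>\<^sub>\<complex> W)) (carrier (cotensor H P (TC V W)))"
    using cotensor_subspace[OF TC_lcoaction[OF V W]] by simp
  from V W q show ?thesis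
  proof (induction rule: beta_dom_induct)
    case one
    then show ?case using sub b.hom_one by (simp add: subspace_def)
  next
    case (mult x y s)
    then show ?case
      using sub b.hom_mult[OF beta_tensor_closed[OF V W mult(1,2)] mult(3)] bprod_cotensor[OF V W mult(1,2)]
      by (simp add: subspace_def beta_elem[OF V W])
  qed
qed

context
  fixes \<omega> :: "'h \<Rightarrow> ('p, 'p) tens" and E :: "'p \<Rightarrow> 'p" and W :: "('h, 'w) lcomod"
  assumes \<omega>: "strong_connection \<omega>"
    and E: "E \<in> linear_maps P P" "\<And>p. p \<in> carrier P \<Longrightarrow> E p \<in> B" "\<And>b. b \<in> B \<Longrightarrow> E b = b"
    and W: "lcoaction W"
begin

text \<open>For \<open>y\<close> in \<open>P \<box> W\<close>, the splitting of the multiplication applied to its \<open>P\<close>-leg lies in \<open>B \<otimes> (P \<box> W)\<close>.\<close>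

definition split_leg :: "('p, 'w) tens \<Rightarrow> ('p, ('p, 'w) tens) tens"
  where "split_leg y = tvec P W (P \<otimes>\<^sub>\<complex> (P \<otimes>\<^sub>\<complex> W)) y (\<lambda>b w. tvec P P (P \<otimes>\<^sub>\<complex> (P \<otimes>\<^sub>\<complex> W)) (split \<omega> b) (\<lambda>c d.
    pure_tensor P (P \<otimes>\<^sub>\<complex> W) c (pure_tensor P W d w)))"

lemmas split_facts = lcoactionD[OF W] split_closed[OF \<omega>] split_linear[OF \<omega>] linear_maps_comp[OF split_linear[OF \<omega>]]

lemma split_leg_closed: "split_leg y \<in> carrier (P \<otimes>\<^sub>\<complex> (P \<otimes>\<^sub>\<complex> W))"
  by (simp add: split_leg_def split_facts)

lemma split_leg_sum:
  assumes F: "bil P (P \<otimes>\<^sub>\<complex> W) F"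
  shows "tsum P (P \<otimes>\<^sub>\<complex> W) (split_leg y) F = tsum P W y (\<lambda>b w. tsum P P (split \<omega> b) (\<lambda>c d. F c (pure_tensor P W d w)))"
  using F by (simp add: split_leg_def split_facts tsum_tvec tsum_pure)

lemma split_leg_E:
  assumes F: "bil P (P \<otimes>\<^sub>\<complex> W) F"
  shows "tsum P (P \<otimes>\<^sub>\<complex> W) (split_leg y) (\<lambda>c z. F (E c) z) = tsum P (P \<otimes>\<^sub>\<complex> W) (split_leg y) F"
proof -
  note [simp] = split_facts bil_comp[OF F] linear_maps_comp[OF E(1)] linear_maps_apply(1)[OF E(1)] E(1)
  have "tsum P (P \<otimes>\<^sub>\<complex> W) (split_leg y) (\<lambda>c z. F (E c) z) =
      tsum P W y (\<lambda>b w. tsum P P (split \<omega> b) (\<lambda>c d. F (E c) (pure_tensor P W d w)))"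
    by (rule split_leg_sum) simp
  also have "\<dots> = tsum P W y (\<lambda>b w. tsum P P (split \<omega> b) (\<lambda>c d. F c (pure_tensor P W d w)))"
    by (rule tsum_body, rule split_E[OF \<omega> E, where F = "\<lambda>c d. F c (pure_tensor P W d w)" for w]) simp_all
  also have "\<dots> = tsum P (P \<otimes>\<^sub>\<complex> W) (split_leg y) F"
    by (rule split_leg_sum[OF F, symmetric])
  finally show ?thesis .
qed

lemma split_leg_cotensor:
  fixes \<kappa> :: "('p, 'w) tens \<Rightarrow> ('p, 'w) tens"
  assumes y: "y \<in> carrier (cotensor H P W)" and \<kappa>: "\<kappa> \<in> linear_maps (P \<otimes>\<^sub>\<complex> W) (P \<otimes>\<^sub>\<complex> W)"
      "\<And>x. x \<in> carrier (cotensor H P W) \<Longrightarrow> \<kappa> x = x"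
    and F: "bil P (P \<otimes>\<^sub>\<complex> W) F"
  shows "tsum P (P \<otimes>\<^sub>\<complex> W) (split_leg y) (\<lambda>c z. F c (\<kappa> z)) = tsum P (P \<otimes>\<^sub>\<complex> W) (split_leg y) F"
proof (rule right_leg_projection(2)[OF _ _ split_leg_closed _ \<kappa> F])
  note [simp] = split_facts split_leg_closed
  show "vs (P \<otimes>\<^sub>\<complex> W)" by simp
  fix \<phi> assume \<phi> [simp]: "lin P \<phi>"
  let ?u = "tvec P (P \<otimes>\<^sub>\<complex> W) (P \<otimes>\<^sub>\<complex> W) (split_leg y) (\<lambda>u v. \<phi> u \<odot>\<^bsub>P \<otimes>\<^sub>\<complex> W\<^esub> v)"
  have ev: "tsum P W ?u F = tsum P W y (\<lambda>b w. tsum P P (split \<omega> b) (\<lambda>c d. \<phi> c * F d w))" if F: "bil P W F" for F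
    using F by (simp add: tsum_tvec tsum_smult split_leg_sum tsum_pure)
  show "?u \<in> carrier (cotensor H P W)"
  proof (rule cotensorI[OF W])
    show "?u \<in> carrier (P \<otimes>\<^sub>\<complex> W)" by simp
    fix \<alpha> \<beta> \<gamma> assume l [simp]: "lin P \<alpha>" "lin H \<beta>" "lin W \<gamma>"
    note [simp] = lin_comp[OF l(1)] lin_comp[OF l(2)] lin_comp[OF l(3)]
    have "tsum P W ?u (\<lambda>p v. \<rho> p (\<lambda>a b. \<alpha> a * (\<beta> b * \<gamma> v))) =
      tsum P W y (\<lambda>b w. tsum P P (split \<omega> b) (\<lambda>c d. \<rho> d (\<lambda>d0 d1. \<phi> c * (\<alpha> d0 * (\<beta> d1 * \<gamma> w)))))"
      by (simp add: ev tsum_cmult)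
    also have "\<dots> = tsum P W y (\<lambda>b w. \<rho> b (\<lambda>b0 b1. tsum P P (split \<omega> b0) (\<lambda>c d. \<phi> c * (\<alpha> d * (\<beta> b1 * \<gamma> w)))))"
      by (rule tsum_body, rule split_right[OF \<omega>]) simp_all
    also have "\<dots> = tsum P W y (\<lambda>b w. tsum H W (lcoact W w) (\<lambda>h w0. tsum P P (split \<omega> b) (\<lambda>c d. \<phi> c * (\<alpha> d * (\<beta> h * \<gamma> w0)))))"
      by (rule cotensor_sum[OF W y]) simp
    also have "\<dots> = tsum P W y (\<lambda>b w. tsum P P (split \<omega> b) (\<lambda>c d. tsum H W (lcoact W w) (\<lambda>h w0. \<phi> c * (\<alpha> d * (\<beta> h * \<gamma> w0)))))"
      by (rule tsum_body, rule tsum_swap)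
    also have "\<dots> = tsum P W ?u (\<lambda>p v. tsum H W (lcoact W v) (\<lambda>b w. \<alpha> p * (\<beta> b * \<gamma> w)))"
      by (simp add: ev tsum_cmult)
    finally show "tsum P W ?u (\<lambda>p v. \<rho> p (\<lambda>a b. \<alpha> a * (\<beta> b * \<gamma> v))) =
      tsum P W ?u (\<lambda>p v. tsum H W (lcoact W v) (\<lambda>b w. \<alpha> p * (\<beta> b * \<gamma> w)))" .
  qed
qed simp

text \<open>For \<open>y\<close> in \<open>P \<box> W\<close> the coaction of \<open>w\<close> can be traded for that of the \<open>P\<close>-leg \<open>b\<close> of \<open>y\<close>, and
  \<open>b\<^sub>0 \<omega>(b\<^sub>1)\<close> is the splitting at \<open>b\<close>.\<close>

lemma unmerge_bprod_sum:
  fixes V :: "('h, 'v) lcomod"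
  assumes V: "left_comodule H V" and W': "left_comodule H W"
    and x: "x \<in> carrier (P \<otimes>\<^sub>\<complex> V)" and y: "y \<in> carrier (cotensor H P W)" and G: "bil (P \<otimes>\<^sub>\<complex> V) (P \<otimes>\<^sub>\<complex> W) G"
  shows "tsum (P \<otimes>\<^sub>\<complex> V) (P \<otimes>\<^sub>\<complex> W) (unmerge \<omega> V W (bprod V W x y)) G =
    tsum P (P \<otimes>\<^sub>\<complex> W) (split_leg y) (\<lambda>c z. G (cotensor_ract P V c x) z)"
proof -
  note Vl = left_comodule_lcoaction[OF V]
  note [simp] = split_facts lcoactionD[OF Vl] strong_connectionD(1-3)[OF \<omega>] x cotensor_carrier[OF y] bil_comp[OF G]
    ract_linear_arg[OF Vl]
  have "tsum (P \<otimes>\<^sub>\<complex> V) (P \<otimes>\<^sub>\<complex> W) (unmerge \<omega> V W (bprod V W x y)) G =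
    tsum P V x (\<lambda>a v. tsum P W y (\<lambda>b w. tsum H W (lcoact W w) (\<lambda>h w0.
      tsum P P (\<omega> h) (\<lambda>c d. G (pure_tensor P V (a \<star> (b \<star> c)) v) (pure_tensor P W d w0)))))"
    by (simp add: unmerge_sum[OF \<omega> V W' G] bprod_sum[OF Vl W] tsum_pure mult_assoc)
  also have "\<dots> = tsum P V x (\<lambda>a v. tsum P W y (\<lambda>b w. \<rho> b (\<lambda>b0 b1.
      tsum P P (\<omega> b1) (\<lambda>c d. G (pure_tensor P V (a \<star> (b0 \<star> c)) v) (pure_tensor P W d w)))))"
    by (rule tsum_body, rule cotensor_sum[OF W y, symmetric]) simp
  also have "\<dots> = tsum P V x (\<lambda>a v. tsum P (P \<otimes>\<^sub>\<complex> W) (split_leg y) (\<lambda>c z. G (pure_tensor P V (a \<star> c) v) z))"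
    by (simp add: split_leg_sum split_sum[OF \<omega>])
  also have "\<dots> = tsum P (P \<otimes>\<^sub>\<complex> W) (split_leg y) (\<lambda>c z. tsum P V x (\<lambda>a v. G (pure_tensor P V (a \<star> c) v) z))"
    by (rule tsum_swap)
  also have "\<dots> = tsum P (P \<otimes>\<^sub>\<complex> W) (split_leg y) (\<lambda>c z. G (cotensor_ract P V c x) z)"
  proof (rule tsum_body)
    fix c z assume c [simp]: "c \<in> carrier P" and z: "z \<in> carrier (P \<otimes>\<^sub>\<complex> W)"
    have l: "lin (P \<otimes>\<^sub>\<complex> V) (\<lambda>x. G x z)" using G z by (simp add: bil_def)
    have "G (cotensor_ract P V c x) z = tsum P V (cotensor_ract P V c x) (\<lambda>a v. G (pure_tensor P V a v) z)"
      by (rule lin_presentation[OF _ _ _ l]) (simp_all add: linear_maps_apply(1)[OF ract_linear[OF Vl c]])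
    also have "\<dots> = tsum P V x (\<lambda>a v. G (pure_tensor P V (a \<star> c) v) z)"
      by (rule ract_sum[OF Vl c x]) (simp add: z)
    finally show "tsum P V x (\<lambda>a v. G (pure_tensor P V (a \<star> c) v) z) = G (cotensor_ract P V c x) z" ..
  qed
  finally show ?thesis .
qed

text \<open>The inverse \<open>\<Psi>\<close> of \<open>\<beta>\<close> is \<open>unmerge\<close> followed by the projection \<open>\<theta>\<close> to the tensor product over \<open>B\<close>. That
  \<open>\<beta> \<Psi>\<close> is the identity follows from \<open>merge_unmerge\<close>. For \<open>\<Psi> \<beta>\<close>, the element \<open>\<beta>(x \<otimes> y)\<close> goes to
  \<open>x c \<otimes> z\<close> with \<open>c \<otimes> z = split_leg y\<close>. Here \<open>c\<close> lies in \<open>B\<close>, so it may be moved across to \<open>z\<close>, and \<open>c z = y\<close>.\<close>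

theorem strong_connection_beta_bijective:
  fixes V :: "('h, 'v) lcomod"
  assumes V: "left_comodule H V" and W': "left_comodule H W"
  shows "beta_bijective H P V W"
proof -
  note Vl = left_comodule_lcoaction[OF V]
  let ?TV = "P \<otimes>\<^sub>\<complex> V" and ?TW = "P \<otimes>\<^sub>\<complex> W" and ?T = "P \<otimes>\<^sub>\<complex> (V \<otimes>\<^sub>\<complex> W)" and ?X = "(P \<otimes>\<^sub>\<complex> V) \<otimes>\<^sub>\<complex> (P \<otimes>\<^sub>\<complex> W)"
  let ?Q = "beta_dom H P V W" and ?bt = "beta_tensor H P V W"
  note [simp] = split_facts lcoactionD[OF Vl] linear_maps_comp[OF E(1)] linear_maps_apply(1)[OF E(1)] E(1)
  note bt = beta_tensor_closed[OF Vl W] beta_tensor_add_left[OF Vl W] beta_tensor_add_right[OF Vl W] beta_tensor_balanced[OF Vl W]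
  interpret Q: comm_group ?Q by (rule beta_dom_group[OF Vl W])
  note cc = cotensor_carrier
  have bt_scalar: "?bt (c \<odot>\<^bsub>?TV\<^esub> x) y = ?bt x (c \<odot>\<^bsub>?TW\<^esub> y)"
    if "x \<in> carrier (cotensor H P V)" "y \<in> carrier (cotensor H P W)" for c x y
    using bt(4)[OF scalar_in_B[of c] that] by (simp add: ract_scalar[OF Vl cc[OF that(1)]] lact_scalar[OF W cc[OF that(2)]])
  obtain \<pi> where \<pi>: "\<pi> \<in> linear_maps ?TV ?TV" "\<And>x. x \<in> carrier ?TV \<Longrightarrow> \<pi> x \<in> carrier (cotensor H P V)"
      "\<And>x. x \<in> carrier (cotensor H P V) \<Longrightarrow> \<pi> x = x"
    using subspace_projection[OF _ cotensor_subspace[OF Vl]] by auto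
  obtain \<kappa> where \<kappa>: "\<kappa> \<in> linear_maps ?TW ?TW" "\<And>x. x \<in> carrier ?TW \<Longrightarrow> \<kappa> x \<in> carrier (cotensor H P W)"
      "\<And>x. x \<in> carrier (cotensor H P W) \<Longrightarrow> \<kappa> x = x"
    using subspace_projection[OF _ cotensor_subspace[OF W]] by auto
  note [simp] = \<pi>(1,2) \<kappa>(1,2) linear_maps_comp[OF \<pi>(1)] linear_maps_comp[OF \<kappa>(1)]
  note pk_add = linear_maps_apply(2,3)[OF \<pi>(1)] linear_maps_apply(2,3)[OF \<kappa>(1)]
  \<comment> \<open>\<open>\<theta>\<close> is defined on all of \<open>(P \<otimes> V) \<otimes> (P \<otimes> W)\<close> by projecting both legs to the cotensor products.\<close>
  define \<theta> where "\<theta> = tensor_lift UNIV ?TV ?TW ?Q (\<lambda>x y. ?bt (\<pi> x) (\<kappa> y))"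
  have \<theta>: "\<theta> \<in> hom (tensor_group UNIV ?TV ?TW) ?Q"
    and \<theta>_pure: "\<And>x y. x \<in> carrier ?TV \<Longrightarrow> y \<in> carrier ?TW \<Longrightarrow> \<theta> (pure_tensor ?TV ?TW x y) = ?bt (\<pi> x) (\<kappa> y)"
    unfolding \<theta>_def
    by (rule balanced_tensor.tensor_lift[OF balanced_tensor_vs Q.comm_group_axioms]; simp add: bt pk_add bt_scalar)+
  let ?u = "unmerge \<omega> V W"
  define \<Psi> where "\<Psi> t = \<theta> (?u t)" for t
  have \<Psi>: "\<Psi> \<in> hom (add_monoid ?T) ?Q"
    unfolding \<Psi>_def using hom_linear[OF unmerge_linear[OF \<omega> V W']] \<theta> by (simp add: hom_add_tensor)
  have right_inverse: "beta H P V W (\<Psi> t) = t" if t: "t \<in> carrier (cotensor H P (TC V W))" for t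
  proof -
    have tc [simp]: "t \<in> carrier ?T" using cc[OF t] by simp
    let ?m = "bilinear_lift ?TV ?TW ?T (bprod V W)" and ?pk = "tensor_map ?TV ?TW ?TV ?TW \<pi> \<kappa>"
    note bl [simp] = bprod_linear_left[OF Vl W] bprod_linear_right[OF Vl W]
    have m: "?m \<in> linear_maps ?X ?T"
      and m_pure: "\<And>x y. x \<in> carrier ?TV \<Longrightarrow> y \<in> carrier ?TW \<Longrightarrow> ?m (pure_tensor ?TV ?TW x y) = bprod V W x y"
      by (rule bilinear_lift_props; simp)+
    have uc: "?u t \<in> carrier ?X" by (rule unmerge_closed[OF \<omega> V W'])
    have "beta H P V W (\<theta> (?u t)) = ?m (?pk (?u t))"
    proof (rule tensor_hom_eq[OF _ _ _ _ _ _ uc])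
      show "(\<lambda>s. beta H P V W (\<theta> s)) \<in> hom (tensor_group UNIV ?TV ?TW) (add_monoid ?T)"
        using hom_compose[OF \<theta> beta_hom[OF Vl W]] by (simp add: comp_def)
      show "(\<lambda>s. ?m (?pk s)) \<in> hom (tensor_group UNIV ?TV ?TW) (add_monoid ?T)"
        by (rule linear_map_hom, rule linear_maps_comp[OF m], rule tensor_map_linear) simp_all
      show "group (add_monoid ?T)"
        using comm_group_add_monoid[OF vs_abelian[of ?T]] by (simp add: comm_group_def)
      fix x y assume [simp]: "x \<in> carrier ?TV" "y \<in> carrier ?TW"
      show "beta H P V W (\<theta> (pure_tensor ?TV ?TW x y)) = ?m (?pk (pure_tensor ?TV ?TW x y))"
        by (simp add: \<theta>_pure beta_elem[OF Vl W] tensor_map_pure m_pure cc)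
    qed simp_all
    also have "?pk (?u t) = ?u t"
    proof (rule tensor_eqI[OF _ _ _ uc])
      fix \<alpha> \<beta> assume l [simp]: "lin ?TV \<alpha>" "lin ?TW \<beta>"
      note [simp] = lin_comp[OF l(1)] lin_comp[OF l(2)]
      have "tsum ?TV ?TW (?pk (?u t)) (\<lambda>v w. \<alpha> v * \<beta> w) = tsum ?TV ?TW (?u t) (\<lambda>v w. \<alpha> (\<pi> v) * \<beta> (\<kappa> w))"
        by (rule tsum_tensor_map) (simp_all add: uc)
      also have "\<dots> = tsum ?TV ?TW (?u t) (\<lambda>v w. \<alpha> (\<pi> v) * \<beta> w)"
        by (rule right_leg_projection(2)[OF _ _ uc unmerge_right_leg[OF \<omega> V W' tc] \<kappa>(1,3)]) simp_all
      also have "\<dots> = tsum ?TV ?TW (?u t) (\<lambda>v w. \<alpha> v * \<beta> w)"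
        by (rule left_leg_projection(2)[OF _ _ uc unmerge_left_leg[OF \<omega> V W' t] \<pi>(1,3), where F = "\<lambda>v w. \<alpha> v * \<beta> w"]) simp_all
      finally show "tsum ?TV ?TW (?pk (?u t)) (\<lambda>v w. \<alpha> v * \<beta> w) = tsum ?TV ?TW (?u t) (\<lambda>v w. \<alpha> v * \<beta> w)" .
    qed (simp_all add: uc)
    also have "?m (?u t) = t" by (rule merge_unmerge[OF \<omega> V W' tc])
    finally show ?thesis by (simp add: \<Psi>_def)
  qed
  have generators: "\<Psi> (bprod V W x y) = ?bt x y"
    if x: "x \<in> carrier (cotensor H P V)" and y: "y \<in> carrier (cotensor H P W)" for x y
  proof -
    note xc [simp] = cc[OF x] and yc [simp] = cc[OF y]
    note ract = ract_linear_arg[OF Vl xc]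
    have ract' [simp]: "cotensor_ract P V c x \<in> carrier ?TV" if "c \<in> carrier P" for c
      using linear_maps_apply(1)[OF ract that] .
    note [simp] = linear_maps_comp[OF ract] ract
    have lact' [simp]: "cotensor_lact P W c z \<in> carrier ?TW" if "c \<in> carrier P" "z \<in> carrier ?TW" for c z
      using linear_maps_apply(1)[OF lact_linear[OF W that(1)] that(2)] .
    note lact = lact_linear_arg[OF W] lact_linear[OF W] linear_maps_comp[OF lact_linear_arg[OF W]] linear_maps_comp[OF lact_linear[OF W]]
    \<comment> \<open>\<open>N\<close> moves the left leg of \<open>split_leg y\<close> over to \<open>x\<close>, and \<open>L\<close> multiplies it back to \<open>y\<close>.\<close>
    define N where "N = bilinear_lift P ?TW ?X (\<lambda>c z. pure_tensor ?TV ?TW (cotensor_ract P V c x) z)"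
    have N: "N \<in> linear_maps (P \<otimes>\<^sub>\<complex> ?TW) ?X"
      and N_pure: "\<And>c z. c \<in> carrier P \<Longrightarrow> z \<in> carrier ?TW \<Longrightarrow> N (pure_tensor P ?TW c z) = pure_tensor ?TV ?TW (cotensor_ract P V c x) z"
      unfolding N_def by (rule bilinear_lift_props; simp)+
    define L where "L = bilinear_lift P ?TW ?TW (\<lambda>c z. cotensor_lact P W (E c) (\<kappa> z))"
    have L: "L \<in> linear_maps (P \<otimes>\<^sub>\<complex> ?TW) ?TW"
      and L_pure: "\<And>c z. c \<in> carrier P \<Longrightarrow> z \<in> carrier ?TW \<Longrightarrow> L (pure_tensor P ?TW c z) = cotensor_lact P W (E c) (\<kappa> z)"
      unfolding L_def by (rule bilinear_lift_props; simp add: lact cc)+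
    let ?y = "split_leg y" and ?E = "tensor_map P ?TW P ?TW E \<kappa>"
    note yc' [simp] = split_leg_closed
    have E\<kappa>: "tsum P ?TW ?y (\<lambda>c z. F (E c) (\<kappa> z)) = tsum P ?TW ?y F" if F: "bil P ?TW F" for F
    proof -
      note [simp] = bil_comp[OF F]
      have "tsum P ?TW ?y (\<lambda>c z. F (E c) (\<kappa> z)) = tsum P ?TW ?y (\<lambda>c z. F (E c) z)"
        by (rule split_leg_cotensor[OF y \<kappa>(1,3), where F = "\<lambda>c z. F (E c) z"]) simp_all
      then show ?thesis by (simp add: split_leg_E[OF F])
    qed
    have Ey: "?E ?y = ?y"
    proof (rule tensor_eqI[of P ?TW])
      fix \<alpha> \<beta> assume l [simp]: "lin P \<alpha>" "lin ?TW \<beta>"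
      note [simp] = lin_comp[OF l(1)] lin_comp[OF l(2)]
      show "tsum P ?TW (?E ?y) (\<lambda>v w. \<alpha> v * \<beta> w) = tsum P ?TW ?y (\<lambda>v w. \<alpha> v * \<beta> w)"
        using E\<kappa>[of "\<lambda>v w. \<alpha> v * \<beta> w"] by (simp add: tsum_tensor_map)
    qed simp_all
    have "?u (bprod V W x y) = N ?y"
    proof (rule tensor_eqI[of ?TV ?TW])
      fix \<alpha> \<beta> assume l [simp]: "lin ?TV \<alpha>" "lin ?TW \<beta>"
      note [simp] = lin_comp[OF l(1)] lin_comp[OF l(2)]
      have "tsum ?TV ?TW (?u (bprod V W x y)) (\<lambda>v w. \<alpha> v * \<beta> w) = tsum P ?TW ?y (\<lambda>c z. \<alpha> (cotensor_ract P V c x) * \<beta> z)"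
        by (rule unmerge_bprod_sum[OF V W' xc y]) simp
      also have "\<dots> = tsum ?TV ?TW (N ?y) (\<lambda>v w. \<alpha> v * \<beta> w)"
        unfolding N_def by (subst tsum_bilinear_lift) (simp_all add: tsum_pure)
      finally show "tsum ?TV ?TW (?u (bprod V W x y)) (\<lambda>v w. \<alpha> v * \<beta> w) = tsum ?TV ?TW (N ?y) (\<lambda>v w. \<alpha> v * \<beta> w)" .
    qed (simp_all add: linear_maps_apply(1)[OF N] unmerge_closed[OF \<omega> V W'])
    then have "\<Psi> (bprod V W x y) = \<theta> (N (?E ?y))" by (simp add: \<Psi>_def Ey)
    also have "\<dots> = ?bt x (\<kappa> (L ?y))"
    proof (rule tensor_hom_eq[of P ?TW _ ?Q])
      have EN: "(\<lambda>s. N (?E s)) \<in> linear_maps (P \<otimes>\<^sub>\<complex> ?TW) ?X"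
        by (rule linear_maps_comp[OF N], rule tensor_map_linear) simp_all
      show "(\<lambda>s. \<theta> (N (?E s))) \<in> hom (tensor_group UNIV P ?TW) ?Q"
        using hom_linear[OF EN] \<theta> by (simp add: hom_add_tensor)
      have "(\<lambda>z. ?bt x (\<kappa> z)) \<in> hom (add_monoid ?TW) ?Q"
        by (rule homI) (simp_all add: bt x pk_add)
      from hom_linear[OF L this] show "(\<lambda>s. ?bt x (\<kappa> (L s))) \<in> hom (tensor_group UNIV P ?TW) ?Q"
        by (simp add: hom_add_tensor)
      fix c z assume [simp]: "c \<in> carrier P" "z \<in> carrier ?TW"
      have b: "E c \<in> B" by (rule E(2)) simp
      have "\<theta> (N (?E (pure_tensor P ?TW c z))) = ?bt (cotensor_ract P V (E c) x) (\<kappa> z)"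
        by (simp add: tensor_map_pure N_pure \<theta>_pure \<pi>(3) ract_cotensor[OF Vl b x] \<kappa>(3) cc)
      also have "\<dots> = ?bt x (\<kappa> (L (pure_tensor P ?TW c z)))"
        by (simp add: bt(4)[OF b x] L_pure \<kappa>(3) lact_cotensor[OF W b])
      finally show "\<theta> (N (?E (pure_tensor P ?TW c z))) = ?bt x (\<kappa> (L (pure_tensor P ?TW c z)))" .
    qed (simp_all add: Q.is_group)
    also have "L ?y = y"
    proof (rule vs_eqI[of ?TW])
      fix \<phi> assume \<phi>: "lin ?TW \<phi>"
      note [simp] = lin_comp[OF \<phi>] lact
      have lact_pure: "cotensor_lact P W c (pure_tensor P W d w) = pure_tensor P W (c \<star> d) w"
        if "c \<in> carrier P" "d \<in> carrier P" "w \<in> carrier W" for c d w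
        unfolding cotensor_lact_def using that by (subst tensor_map_pure) simp_all
      have "\<phi> (L ?y) = tsum P ?TW ?y (\<lambda>c z. \<phi> (cotensor_lact P W (E c) (\<kappa> z)))"
        unfolding L_def by (rule lin_bilinear_lift) (simp_all add: \<phi> cc)
      also have "\<dots> = tsum P ?TW ?y (\<lambda>c z. \<phi> (cotensor_lact P W c z))"
        by (rule E\<kappa>) simp
      also have "\<dots> = tsum P W y (\<lambda>b w. tsum P P (split \<omega> b) (\<lambda>c d. \<phi> (pure_tensor P W (c \<star> d) w)))"
        by (simp add: split_leg_sum lact_pure)
      also have "\<dots> = tsum P W y (\<lambda>b w. \<phi> (pure_tensor P W b w))"
        by (rule tsum_body, rule split_mult[OF \<omega>, where \<alpha> = "\<lambda>r. \<phi> (pure_tensor P W r w)" for w]) simp_all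
      also have "\<dots> = \<phi> y" by (rule lin_presentation[symmetric]) (simp_all add: \<phi>)
      finally show "\<phi> (L ?y) = \<phi> y" .
    qed (simp_all add: linear_maps_apply(1)[OF L])
    finally show ?thesis by (simp add: \<kappa>(3)[OF y])
  qed
  interpret A: comm_group "add_monoid ?T" by (rule comm_group_add_monoid) (simp add: vs_abelian)
  interpret b: group_hom ?Q "add_monoid ?T" "beta H P V W"
    using beta_hom[OF Vl W] by unfold_locales
  interpret p: group_hom "add_monoid ?T" ?Q \<Psi>
    using \<Psi> by unfold_locales
  have left_inverse: "\<Psi> (beta H P V W q) = q" if "q \<in> carrier ?Q" for q
    using Vl W that
  proof (induction rule: beta_dom_induct)
    case one
    show ?case using b.hom_one p.hom_one by simp
  next
    case (mult x y s)
    have "beta H P V W (?bt x y \<otimes>\<^bsub>?Q\<^esub> s) = bprod V W x y \<otimes>\<^bsub>add_monoid ?T\<^esub> beta H P V W s"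
      by (simp only: b.hom_mult[OF bt(1)[OF mult(1,2)] mult(3)] beta_elem[OF Vl W mult(1,2)])
    moreover have "bprod V W x y \<in> carrier (add_monoid ?T)"
      using bprod_closed[OF Vl W cc[OF mult(1)] cc[OF mult(2)]] by simp
    ultimately show ?case
      using p.hom_mult[OF _ b.hom_closed[OF mult(3)]] mult(4) generators[OF mult(1,2)] by simp
  qed
  show ?thesis
    unfolding beta_bijective_def
  proof (rule bij_betw_byWitness[where f' = \<Psi>])
    show "\<forall>q\<in>carrier ?Q. \<Psi> (beta H P V W q) = q" using left_inverse by blast
    show "\<forall>t\<in>carrier (cotensor H P (TC V W)). beta H P V W (\<Psi> t) = t" using right_inverse by blast
    show "beta H P V W ` carrier ?Q \<subseteq> carrier (cotensor H P (TC V W))" using beta_cotensor[OF Vl W] by blast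
    show "\<Psi> ` carrier (cotensor H P (TC V W)) \<subseteq> carrier ?Q"
    proof
      fix q assume "q \<in> \<Psi> ` carrier (cotensor H P (TC V W))"
      then obtain t where t: "t \<in> carrier (cotensor H P (TC V W))" "q = \<Psi> t" by blast
      then show "q \<in> carrier ?Q" using p.hom_closed[of t] cc[OF t(1)] by simp
    qed
  qed
qed

end

subsection \<open>The monoidal identities\<close>

text \<open>On representatives both sides of each identity are the same sum, by associativity and unitality in \<open>P\<close>.\<close>

lemma beta_bilinear:
  fixes V :: "('h, 'v) lcomod" and W :: "('h, 'w) lcomod"
  assumes V: "lcoaction V" and W: "lcoaction W" and b: "b \<in> B"
    and x: "x \<in> carrier (cotensor H P V)" and y: "y \<in> carrier (cotensor H P W)"
  shows "beta H P V W (beta_tensor H P V W (cotensor_lact P V b x) y)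
          = cotensor_lact P (TC V W) b (beta H P V W (beta_tensor H P V W x y))" (is "?l = ?l'")
    and "beta H P V W (beta_tensor H P V W x (cotensor_ract P W b y))
          = cotensor_ract P (TC V W) b (beta H P V W (beta_tensor H P V W x y))" (is "?r = ?r'")
proof -
  note T = TC_lcoaction[OF V W]
  note b' [simp] = coinvariants_carrier[OF b]
  note [simp] = lcoactionD(1)[OF V] lcoactionD(1)[OF W] cotensor_carrier[OF x] cotensor_carrier[OF y]
    cotensor_carrier[OF lact_cotensor[OF V b x]] cotensor_carrier[OF ract_cotensor[OF W b y]]
    beta_elem[OF V W x y] beta_elem[OF V W lact_cotensor[OF V b x] y] beta_elem[OF V W x ract_cotensor[OF W b y]]
    bprod_closed[OF V W]
    linear_maps_apply(1)[OF lact_linear[OF T b', simplified]] linear_maps_apply(1)[OF ract_linear[OF T b', simplified]]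
    lact_sum[OF T b', simplified] ract_sum[OF T b', simplified] lact_sum[OF V b'] ract_sum[OF W b'] bprod_sum[OF V W] mult_assoc
  show "?l = ?l'"
  proof (rule tensor_eqI[of P "V \<otimes>\<^sub>\<complex> W"])
    fix \<alpha> \<beta> assume l [simp]: "lin P \<alpha>" "lin (V \<otimes>\<^sub>\<complex> W) \<beta>"
    note [simp] = lin_comp[OF l(1)] lin_comp[OF l(2)]
    show "tsum P (V \<otimes>\<^sub>\<complex> W) ?l (\<lambda>v w. \<alpha> v * \<beta> w) = tsum P (V \<otimes>\<^sub>\<complex> W) ?l' (\<lambda>v w. \<alpha> v * \<beta> w)" by simp
  qed simp_all
  show "?r = ?r'"
  proof (rule tensor_eqI[of P "V \<otimes>\<^sub>\<complex> W"])
    fix \<alpha> \<beta> assume l [simp]: "lin P \<alpha>" "lin (V \<otimes>\<^sub>\<complex> W) \<beta>"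
    note [simp] = lin_comp[OF l(1)] lin_comp[OF l(2)]
    show "tsum P (V \<otimes>\<^sub>\<complex> W) ?r (\<lambda>v w. \<alpha> v * \<beta> w) = tsum P (V \<otimes>\<^sub>\<complex> W) ?r' (\<lambda>v w. \<alpha> v * \<beta> w)" by simp
  qed simp_all
qed

lemma beta_natural:
  fixes V :: "('h, 'v) lcomod" and W :: "('h, 'w) lcomod" and V' :: "('h, 'v2) lcomod" and W' :: "('h, 'w2) lcomod"
  assumes V: "lcoaction V" and W: "lcoaction W" and V': "lcoaction V'" and W': "lcoaction W'"
    and f: "f \<in> comodule_maps H V V'" and g: "g \<in> comodule_maps H W W'"
    and x: "x \<in> carrier (cotensor H P V)" and y: "y \<in> carrier (cotensor H P W)"
  shows "tensor_map P (TC V W) P (TC V' W') id (tensor_map V W V' W' f g) (beta H P V W (beta_tensor H P V W x y))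
    = beta H P V' W' (beta_tensor H P V' W' (tensor_map P V P V' id f x) (tensor_map P W P W' id g y))" (is "?l = ?r")
proof (rule tensor_eqI[of P "V' \<otimes>\<^sub>\<complex> W'"])
  note fl = comodule_mapsD(1)[OF V V' f] and gl = comodule_mapsD(1)[OF W W' g]
  note fc = cotensor_map[OF V V' f x] and gc = cotensor_map[OF W W' g y]
  have fg: "tensor_map V W V' W' f g \<in> linear_maps (V \<otimes>\<^sub>\<complex> W) (V' \<otimes>\<^sub>\<complex> W')"
    by (rule tensor_map_linear) (simp_all add: lcoactionD(1)[OF V] lcoactionD(1)[OF W] lcoactionD(1)[OF V'] lcoactionD(1)[OF W'] fl gl)
  note [simp] = lcoactionD(1)[OF V] lcoactionD(1)[OF W] lcoactionD(1)[OF V'] lcoactionD(1)[OF W'] fl gl fg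
    linear_maps_apply(1)[OF fl] linear_maps_apply(1)[OF gl] linear_maps_comp[OF fl] linear_maps_comp[OF gl] linear_maps_comp[OF fg]
    cotensor_carrier[OF x] cotensor_carrier[OF y] cotensor_carrier[OF fc] cotensor_carrier[OF gc]
    beta_elem[OF V W x y] beta_elem[OF V' W' fc gc] bprod_closed[OF V W] bprod_closed[OF V' W']
  show "?l \<in> carrier (P \<otimes>\<^sub>\<complex> (V' \<otimes>\<^sub>\<complex> W'))" "?r \<in> carrier (P \<otimes>\<^sub>\<complex> (V' \<otimes>\<^sub>\<complex> W'))" by simp_all
  fix \<alpha> \<beta> assume l [simp]: "lin P \<alpha>" "lin (V' \<otimes>\<^sub>\<complex> W') \<beta>"
  note [simp] = lin_comp[OF l(1)] lin_comp[OF l(2)]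
  show "tsum P (V' \<otimes>\<^sub>\<complex> W') ?l (\<lambda>v w. \<alpha> v * \<beta> w) = tsum P (V' \<otimes>\<^sub>\<complex> W') ?r (\<lambda>v w. \<alpha> v * \<beta> w)"
    by (simp add: tsum_tensor_map bprod_sum[OF V W] bprod_sum[OF V' W'] tensor_map_pure)
qed (use lcoactionD(1)[OF V'] lcoactionD(1)[OF W'] in simp_all)

lemma tensor_assoc_pure:
  fixes U :: "(complex, 'a, 'm) module_scheme" and V :: "(complex, 'b, 'n) module_scheme" and W :: "(complex, 'c, 'k) module_scheme"
  assumes [simp]: "vs U" "vs V" "vs W" "u \<in> carrier U" "v \<in> carrier V" "w \<in> carrier W"
  shows "tensor_assoc U V W (pure_tensor (U \<otimes>\<^sub>\<complex> V) W (pure_tensor U V u v) w) = pure_tensor U (V \<otimes>\<^sub>\<complex> W) u (pure_tensor V W v w)"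
proof -
  have "tensor_assoc U V W (pure_tensor (U \<otimes>\<^sub>\<complex> V) W (pure_tensor U V u v) w) =
      bilinear_lift U V (U \<otimes>\<^sub>\<complex> (V \<otimes>\<^sub>\<complex> W)) (\<lambda>u v. pure_tensor U (V \<otimes>\<^sub>\<complex> W) u (pure_tensor V W v w)) (pure_tensor U V u v)"
    unfolding tensor_assoc_def
    by (rule bilinear_lift_props(2)) (simp_all add: tensor_assoc_inner tensor_assoc_outer)
  also have "\<dots> = pure_tensor U (V \<otimes>\<^sub>\<complex> W) u (pure_tensor V W v w)"
    by (rule bilinear_lift_props(2)) simp_all
  finally show ?thesis .
qed

lemma beta_associative:
  fixes U :: "('h, 'x) lcomod" and V :: "('h, 'v) lcomod" and W :: "('h, 'w) lcomod"
  assumes U: "lcoaction U" and V: "lcoaction V" and W: "lcoaction W"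
    and x: "x \<in> carrier (cotensor H P U)" and y: "y \<in> carrier (cotensor H P V)" and z: "z \<in> carrier (cotensor H P W)"
  shows "tensor_map P (TC (TC U V) W) P (TC U (TC V W)) id (tensor_assoc U V W)
      (beta H P (TC U V) W (beta_tensor H P (TC U V) W (beta H P U V (beta_tensor H P U V x y)) z))
    = beta H P U (TC V W) (beta_tensor H P U (TC V W) x (beta H P V W (beta_tensor H P V W y z)))" (is "?l = ?r")
proof (rule tensor_eqI[of P "U \<otimes>\<^sub>\<complex> (V \<otimes>\<^sub>\<complex> W)"])
  note UV = TC_lcoaction[OF U V] and VW = TC_lcoaction[OF V W]
  note xy = bprod_cotensor[OF U V x y] and yz = bprod_cotensor[OF V W y z]
  note vs [simp] = lcoactionD(1)[OF U] lcoactionD(1)[OF V] lcoactionD(1)[OF W]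
  note al = tensor_assoc_linear[OF vs]
  note [simp] = al linear_maps_comp[OF al] tensor_assoc_closed[OF vs]
    cotensor_carrier[OF x] cotensor_carrier[OF y] cotensor_carrier[OF z]
    beta_elem[OF U V x y] beta_elem[OF V W y z] beta_elem[OF UV W xy z] beta_elem[OF U VW x yz]
    bprod_closed[OF U V] bprod_closed[OF V W] bprod_closed[OF UV W, simplified] bprod_closed[OF U VW, simplified]
  show "?l \<in> carrier (P \<otimes>\<^sub>\<complex> (U \<otimes>\<^sub>\<complex> (V \<otimes>\<^sub>\<complex> W)))" "?r \<in> carrier (P \<otimes>\<^sub>\<complex> (U \<otimes>\<^sub>\<complex> (V \<otimes>\<^sub>\<complex> W)))" by simp_all
  fix \<alpha> \<beta> assume l [simp]: "lin P \<alpha>" "lin (U \<otimes>\<^sub>\<complex> (V \<otimes>\<^sub>\<complex> W)) \<beta>"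
  note [simp] = lin_comp[OF l(1)] lin_comp[OF l(2)]
  show "tsum P (U \<otimes>\<^sub>\<complex> (V \<otimes>\<^sub>\<complex> W)) ?l (\<lambda>v w. \<alpha> v * \<beta> w) = tsum P (U \<otimes>\<^sub>\<complex> (V \<otimes>\<^sub>\<complex> W)) ?r (\<lambda>v w. \<alpha> v * \<beta> w)"
    by (simp add: tsum_tensor_map bprod_sum[OF U V] bprod_sum[OF V W] bprod_sum[OF UV W, simplified] bprod_sum[OF U VW, simplified]
        tensor_assoc_pure mult_assoc)
qed (use lcoactionD(1)[OF U] lcoactionD(1)[OF V] lcoactionD(1)[OF W] in simp_all)

abbreviation "I \<equiv> trivial_comodule H"

lemma trivial_simps [simp]:
  "carrier I = UNIV" "a \<oplus>\<^bsub>I\<^esub> b = a + b" "c \<odot>\<^bsub>I\<^esub> a = c * a" "vs I"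
  "linear_maps U I = linear_maps U complex_space" "linear_maps I U = linear_maps complex_space U" "lin I = lin complex_space"
  "lcoact I = (\<lambda>c. pure_tensor H complex_space 1\<^sub>H c)"
  by (simp_all add: trivial_comodule_def) (simp_all add: module.extend_def lcomod.fields_def)

lemma tensor_trivial [simp]:
  "pure_tensor A I = pure_tensor A complex_space" "pure_tensor I A = pure_tensor complex_space A"
  "A \<otimes>\<^sub>\<complex> I = A \<otimes>\<^sub>\<complex> complex_space" "I \<otimes>\<^sub>\<complex> A = complex_space \<otimes>\<^sub>\<complex> A"
  "bilinear_lift A I = (bilinear_lift A complex_space :: (complex, 'b, 'k) module_scheme \<Rightarrow> _)"
  "bilinear_lift I A = (bilinear_lift complex_space A :: (complex, 'b, 'k) module_scheme \<Rightarrow> _)"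
  "tsum A I = tsum A complex_space" "tsum I A = tsum complex_space A"
  by (simp_all add: trivial_comodule_def)

lemma trivial_lcoaction: "lcoaction I"
  by (simp add: lcoaction_def)

lemma unit_cotensor:
  assumes b: "b \<in> B" shows "pure_tensor P I b 1 \<in> carrier (cotensor H P I)"
proof (rule cotensorI[OF trivial_lcoaction])
  fix \<alpha> \<beta> \<gamma> assume l: "lin P \<alpha>" "lin H \<beta>" "lin I \<gamma>"
  then have [simp]: "lin P \<alpha>" "lin H \<beta>" "lin complex_space \<gamma>" by simp_all
  show "tsum P I (pure_tensor P I b 1) (\<lambda>p v. \<rho> p (\<lambda>a b. \<alpha> a * (\<beta> b * \<gamma> v))) =
      tsum P I (pure_tensor P I b 1) (\<lambda>p v. tsum H I (lcoact I v) (\<lambda>b w. \<alpha> p * (\<beta> b * \<gamma> w)))"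
    using b by (simp add: tsum_pure coinvariants_sum[OF b])
qed (use b in simp)

lemma beta_unit:
  fixes V :: "('h, 'v) lcomod"
  assumes V: "lcoaction V" and b: "b \<in> B" and x: "x \<in> carrier (cotensor H P V)"
  shows "tensor_map P (TC I V) P V id (bilinear_lift I V V (\<lambda>c v. c \<odot>\<^bsub>V\<^esub> v))
      (beta H P I V (beta_tensor H P I V (pure_tensor P I b 1) x)) = cotensor_lact P V b x" (is "?l = ?l'")
    and "tensor_map P (TC V I) P V id (bilinear_lift V I V (\<lambda>v c. c \<odot>\<^bsub>V\<^esub> v))
      (beta H P V I (beta_tensor H P V I x (pure_tensor P I b 1))) = cotensor_ract P V b x" (is "?r = ?r'")
proof -
  note \<eta> = unit_cotensor[OF b]
  have [simp]: "lin complex_space (\<lambda>c. c)" by (simp add: lin_def)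
  note b' [simp] = coinvariants_carrier[OF b]
  note [simp] = lcoactionD(1)[OF V] cotensor_carrier[OF x]
  have i [simp]: "(\<lambda>c. c \<odot>\<^bsub>V\<^esub> v) \<in> linear_maps complex_space V" if "v \<in> carrier V" for v
    by (rule linear_mapsI) (simp_all add: that vs_distrib vs_simps)
  have m: "bilinear_lift complex_space V V (\<lambda>c v. c \<odot>\<^bsub>V\<^esub> v) \<in> linear_maps (complex_space \<otimes>\<^sub>\<complex> V) V"
      "bilinear_lift V complex_space V (\<lambda>v c. c \<odot>\<^bsub>V\<^esub> v) \<in> linear_maps (V \<otimes>\<^sub>\<complex> complex_space) V"
    by (rule bilinear_lift_props(1); simp)+
  have mp: "bilinear_lift complex_space V V (\<lambda>c v. c \<odot>\<^bsub>V\<^esub> v) (pure_tensor complex_space V c v) = c \<odot>\<^bsub>V\<^esub> v"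
      "bilinear_lift V complex_space V (\<lambda>v c. c \<odot>\<^bsub>V\<^esub> v) (pure_tensor V complex_space v c) = c \<odot>\<^bsub>V\<^esub> v" if "v \<in> carrier V" for c v
    by (rule bilinear_lift_props(2); simp add: that)+
  note [simp] = m linear_maps_comp[OF m(1)] linear_maps_comp[OF m(2)]
    beta_elem[OF trivial_lcoaction V \<eta> x, simplified] beta_elem[OF V trivial_lcoaction x \<eta>, simplified]
    bprod_closed[OF trivial_lcoaction V, simplified] bprod_closed[OF V trivial_lcoaction, simplified]
    linear_maps_apply(1)[OF lact_linear[OF V b']] linear_maps_apply(1)[OF ract_linear[OF V b']]
  show "?l = ?l'"
  proof (rule tensor_eqI[of P V])
    fix \<alpha> \<beta> assume l [simp]: "lin P \<alpha>" "lin V \<beta>"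
    note [simp] = lin_comp[OF l(1)] lin_comp[OF l(2)]
    show "tsum P V ?l (\<lambda>v w. \<alpha> v * \<beta> w) = tsum P V ?l' (\<lambda>v w. \<alpha> v * \<beta> w)"
      by (simp add: tsum_tensor_map bprod_sum[OF trivial_lcoaction V, simplified] tsum_pure mp lact_sum[OF V b'] lin_apply)
  qed simp_all
  show "?r = ?r'"
  proof (rule tensor_eqI[of P V])
    fix \<alpha> \<beta> assume l [simp]: "lin P \<alpha>" "lin V \<beta>"
    note [simp] = lin_comp[OF l(1)] lin_comp[OF l(2)]
    show "tsum P V ?r (\<lambda>v w. \<alpha> v * \<beta> w) = tsum P V ?r' (\<lambda>v w. \<alpha> v * \<beta> w)"
      by (simp add: tsum_tensor_map bprod_sum[OF V trivial_lcoaction, simplified] tsum_pure mp ract_sum[OF V b'] lin_apply)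
  qed simp_all
qed

text \<open>The inverse sends \<open>\<Sum> p \<otimes> c\<close> to \<open>\<Sum> c p\<close>; the equation of the cotensor product says that this is coinvariant.\<close>

lemma unit_bijective: "bij_betw (\<lambda>b. pure_tensor P I b 1) B (carrier (cotensor H P I))"
proof (rule bij_betw_byWitness[where f' = "\<lambda>t. tvec P complex_space P t (\<lambda>p c. c \<odot>\<^bsub>P\<^esub> p)"])
  let ?g = "\<lambda>t. tvec P complex_space P t (\<lambda>p c. c \<odot>\<^bsub>P\<^esub> p)"
  have ev: "\<alpha> (?g t) = tsum P complex_space t (\<lambda>p c. c * \<alpha> p)" if \<alpha>: "lin P \<alpha>" for \<alpha> t
    by (subst lin_tvec[of P complex_space P, OF _ _ _ _ \<alpha>]) (simp_all add: lin_apply[OF \<alpha>])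
  have id [simp]: "lin complex_space (\<lambda>c. c)" by (simp add: lin_def)
  show "\<forall>b\<in>B. ?g (pure_tensor P I b 1) = b"
  proof
    fix b assume b: "b \<in> B"
    show "?g (pure_tensor P I b 1) = b"
      by (rule vs_eqI[OF vs_P]) (use b in \<open>simp_all add: ev tsum_pure\<close>)
  qed
  show "\<forall>t\<in>carrier (cotensor H P I). pure_tensor P I (?g t) 1 = t"
  proof
    fix t assume t: "t \<in> carrier (cotensor H P I)"
    have [simp]: "t \<in> carrier (P \<otimes>\<^sub>\<complex> complex_space)" using cotensor_carrier[OF t] by simp
    show "pure_tensor P I (?g t) 1 = t"
    proof (rule tensor_eqI[of P complex_space])
      fix \<alpha> \<beta> assume l [simp]: "lin P \<alpha>" "lin complex_space \<beta>"
      have \<beta>: "\<beta> c = c * \<beta> 1" for c using lin_apply(2)[OF l(2), of 1 c] by simp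
      have "tsum P complex_space (pure_tensor P I (?g t) 1) (\<lambda>v w. \<alpha> v * \<beta> w) = tsum P complex_space t (\<lambda>p c. c * \<alpha> p) * \<beta> 1"
        by (simp add: tsum_pure ev)
      also have "\<dots> = tsum P complex_space t (\<lambda>p c. \<alpha> p * (c * \<beta> 1))"
        unfolding tsum_multc[symmetric] by (simp add: mult_ac)
      finally show "tsum P complex_space (pure_tensor P I (?g t) 1) (\<lambda>v w. \<alpha> v * \<beta> w) = tsum P complex_space t (\<lambda>v w. \<alpha> v * \<beta> w)"
        by (simp only: \<beta>[symmetric])
    qed simp_all
  qed
  show "(\<lambda>b. pure_tensor P I b 1) ` B \<subseteq> carrier (cotensor H P I)"
    using unit_cotensor by blast
  show "?g ` carrier (cotensor H P I) \<subseteq> B"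
  proof (rule image_subsetI)
    fix t assume t: "t \<in> carrier (cotensor H P I)"
    have [simp]: "t \<in> carrier (P \<otimes>\<^sub>\<complex> complex_space)" using cotensor_carrier[OF t] by simp
    have "\<rho> (?g t) (\<lambda>x h. \<alpha> x * \<beta> h) = \<alpha> (?g t) * \<beta> 1\<^sub>H" if l [simp]: "lin P \<alpha>" "lin H \<beta>" for \<alpha> \<beta>
    proof -
      note [simp] = lin_comp[OF l(1)] lin_comp[OF l(2)]
      have "\<rho> (?g t) (\<lambda>x h. \<alpha> x * \<beta> h) = tsum P complex_space t (\<lambda>p c. \<rho> p (\<lambda>x h. \<alpha> x * (\<beta> h * c)))"
        by (subst ev) (simp_all add: tsum_cmult[symmetric] mult_ac)
      also have "\<dots> = tsum P complex_space t (\<lambda>p c. \<alpha> p * (\<beta> 1\<^sub>H * c))"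
        using cotensor_sum[OF trivial_lcoaction t, of "\<lambda>x h c. \<alpha> x * (\<beta> h * c)"] by (simp add: tsum_pure)
      also have "\<dots> = \<alpha> (?g t) * \<beta> 1\<^sub>H"
        unfolding ev[OF l(1)] tsum_multc[symmetric] by (simp add: mult_ac)
      finally show ?thesis .
    qed
    then show "?g t \<in> B" by (simp add: coinvariants_iff)
  qed
qed

theorem strongly_monoidalI:
  assumes beta: "\<And>(V :: ('h, 'u) lcomod) (W :: ('h, 'u) lcomod). left_comodule H V \<Longrightarrow> left_comodule H W \<Longrightarrow> beta_bijective H P V W"
  shows "strongly_monoidal TYPE('u) H P"
  unfolding strongly_monoidal_def Let_def
proof (intro conjI allI impI ballI, goal_cases)
  case (1 V W) then show ?case by (rule beta)
next
  case (2 V W b x y) then show ?case by (rule beta_bilinear(1)[OF left_comodule_lcoaction left_comodule_lcoaction])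
next
  case (3 V W b x y) then show ?case by (rule beta_bilinear(2)[OF left_comodule_lcoaction left_comodule_lcoaction])
next
  case (4 V V' W W' f g x y)
  note c = 4(1-4)[THEN left_comodule_lcoaction]
  show ?case by (rule beta_natural[OF c(1,3,2,4) 4(5-8)])
next
  case (5 U V W x y z)
  note c = 5(1-3)[THEN left_comodule_lcoaction]
  show ?case by (rule beta_associative[OF c 5(4-6)])
next
  case (6 V b x) then show ?case by (rule beta_unit(1)[OF left_comodule_lcoaction])
next
  case (7 V b x) then show ?case by (rule beta_unit(2)[OF left_comodule_lcoaction])
next
  case 8 show ?case by (rule unit_bijective)
qed

lemma strongly_monoidal_bijective:
  fixes V :: "('h, 'u) lcomod" and W :: "('h, 'u) lcomod"
  assumes mon: "strongly_monoidal TYPE('u) H P" and V: "left_comodule H V" and W: "left_comodule H W"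
  shows "beta_bijective H P V W"
  using mon[unfolded strongly_monoidal_def, THEN conjunct1, THEN spec[of _ V], THEN spec[of _ W], THEN mp, OF V, THEN mp, OF W]
  by (rule conjunct1)

end

section \<open>The characterisation of principality\<close>

theorem theorem2p3:
  fixes H :: "'h hopf" and P :: "('h, 'p) rcomod"
  assumes "hopf_algebra H"
    and "bij_betw (antipode H) (carrier H) (carrier H)"
    and "comodule_algebra H P"
    and "\<exists>\<iota> :: 'h \<Rightarrow> 'u. inj_on \<iota> (carrier H)"
  shows "(principal_comodule_algebra H P \<longleftrightarrow>
      coflat TYPE('u) H P \<and>
      (\<forall>(V :: ('h, 'u) lcomod) (W :: ('h, 'u) lcomod).
        left_comodule H V \<longrightarrow> left_comodule H W \<longrightarrow> beta_bijective H P V W)) \<and>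
    (principal_comodule_algebra H P \<longleftrightarrow> coflat TYPE('u) H P \<and> strongly_monoidal TYPE('u) H P)"
proof -
  interpret hopf_coaction H P
    using assms(1,3) by (rule hopf_coaction.intro)
  obtain \<iota> :: "'h \<Rightarrow> 'u" where \<iota>: "inj_on \<iota> (carrier H)" using assms(4) by blast
  have forward: "coflat TYPE('u) H P"
    and bijective: "\<And>(V :: ('h, 'u) lcomod) (W :: ('h, 'u) lcomod).
      left_comodule H V \<Longrightarrow> left_comodule H W \<Longrightarrow> beta_bijective H P V W"
    if "principal_comodule_algebra H P"
  proof -
    obtain \<omega> where \<omega>: "strong_connection \<omega>" using principal_strong_connection[OF \<open>principal_comodule_algebra H P\<close>] by blast
    obtain E where E: "E \<in> linear_maps P P" "\<And>p. p \<in> carrier P \<Longrightarrow> E p \<in> B" "\<And>b. b \<in> B \<Longrightarrow> E b = b"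
      using subspace_projection[OF vs_P coinvariants_subspace] by auto
    show "coflat TYPE('u) H P" by (rule strong_connection_coflat[OF \<omega> E])
    show "beta_bijective H P V W" if "left_comodule H V" "left_comodule H W" for V W :: "('h, 'u) lcomod"
      by (rule strong_connection_beta_bijective[OF \<omega> E left_comodule_lcoaction[OF that(2)] that])
  qed
  have backward: "principal_comodule_algebra H P"
    if coflat: "coflat TYPE('u) H P"
      and beta: "\<And>(V :: ('h, 'u) lcomod) (W :: ('h, 'u) lcomod).
        left_comodule H V \<Longrightarrow> left_comodule H W \<Longrightarrow> beta_bijective H P V W"
  proof -
    obtain j where j: "j \<in> linear_maps H P" "j 1\<^sub>H = 1\<^sub>P"
        "\<And>h F. h \<in> carrier H \<Longrightarrow> bil P H F \<Longrightarrow> \<rho> (j h) F = \<Delta> h (\<lambda>a b. F (j a) b)"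
      using total_integral[OF \<iota> coflat] by auto
    have "beta_bijective H P (regular \<iota>) (regular \<iota>)"
      using beta regular_facts(4)[OF \<iota>] by simp
    then have "carrier (P \<otimes>\<^sub>\<complex> H) \<subseteq> lcan ` carrier (P \<otimes>\<^sub>\<complex> P)"
      by (intro lcan_onto[OF \<iota>]) (simp add: beta_bijective_def bij_betw_def)
    then obtain \<omega> where "strong_connection \<omega>"
      using strong_connection_exists[OF assms(2) j] by blast
    then show ?thesis by (rule strong_connection_principal)
  qed
  have first: "principal_comodule_algebra H P \<longleftrightarrow> coflat TYPE('u) H P \<and>
      (\<forall>(V :: ('h, 'u) lcomod) (W :: ('h, 'u) lcomod).
        left_comodule H V \<longrightarrow> left_comodule H W \<longrightarrow> beta_bijective H P V W)"
    using forward bijective backward by blast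
  moreover have "strongly_monoidal TYPE('u) H P \<longleftrightarrow> (\<forall>(V :: ('h, 'u) lcomod) (W :: ('h, 'u) lcomod).
        left_comodule H V \<longrightarrow> left_comodule H W \<longrightarrow> beta_bijective H P V W)"
    using strongly_monoidalI strongly_monoidal_bijective by blast
  ultimately show ?thesis by blast
qed

end
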